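(* Let $n=\dim\ker(N)$ and assume the crossing $(\lambda_0,s_0)=(0,1)$ is non-regular in the $\lambda$ direction with first order crossing form $\mathfrak m_{\lambda_0}$ identically zero. If $n\le2$ and $\mathfrak M^{(2)}_{\lambda_0}$ is nondegenerate, then $$\mathfrak c=n_-(D_+)-n_-(D_-),$$ where $\mathfrak c=\operatorname{Mas}(\Lambda(0,s),\mathcal D;s\in[1-\varepsilon,1])+\operatorname{Mas}(\Lambda(\lambda,1),\mathcal D;\lambda\in[0,\varepsilon])$ for $0<\varepsilon\ll1$.
   Context: Operators. $\ell>0$, $g,h\in C^2([0,\ell],\mathbb R)$. For $s\in(0,1]$, $L_+^s=-\partial_{xx}-s^2g(sx)$, $L_-^s=-\partial_{xx}-s^2h(sx)$ in $L^2(0,\ell)$ with domain $H^2(0,\ell)\cap H^1_0(0,\ell)$; $N_s=\begin{pmatrix}0&-L_-^s\\ L_+^s&0\end{pmatrix}$ with domain $(H^2(0,\ell)\cap H^1_0(0,\ell))^2$; $L_\pm=L_\pm^1$, $N=N_1$. $S=\begin{pmatrix}0&1\\ 1&0\end{pmatrix}$; $\langle\cdot,\cdot\rangle$ is the $L^2$ inner product; functions are real-valued. Matrices. Let $z_\pm=\dim\ker L_\pm\in\{0,1\}$, so $n=z_++z_-$, and let $\{\mathbf u_1,\dots,\mathbf u_n\}$ be a basis of $\ker N$ with $\mathbf u_i=(u_i,0)^\top$, $u_i\in\ker L_+$, for $i\le z_+$, and $\mathbf u_i=(0,v_i)^\top$, $v_i\in\ker L_-$, for $z_+<i\le n$. The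 first order crossing form is $\mathfrak m_{\lambda_0}(q)=-\langle\mathbf u,S\mathbf u\rangle$ for $q=\operatorname{Tr}_1\mathbf u$, $\mathbf u\in\ker N$ ($\operatorname{Tr}_1$ as below). When it vanishes identically there are generalised eigenvectors $\widehat{\mathbf v}_i\in\operatorname{dom}(N)$ with $N\widehat{\mathbf v}_i=\mathbf u_i$, of the form $\widehat{\mathbf v}_i=(0,\widehat v_i)^\top$, $-L_-\widehat v_i=u_i$, for $i\le z_+$, and $\widehat{\mathbf v}_i=(\widehat u_i,0)^\top$, $L_+\widehat u_i=v_i$, for $z_+<i\le n$. The matrix of the second order crossing form is the $n\times n$ matrix $[\mathfrak M^{(2)}_{\lambda_0}]_{ij}=-2\langle\widehat{\mathbf v}_i,S\mathbf u_j\rangle$. Define $$[D_-]_{ij}=\langle\widehat v_i,L_-\widehat v_j\rangle=-\langle\widehat v_i,u_j\rangle,\ \ i,j=1,\dots,z_+;\qquad [D_+]_{ij}=\langle\widehat u_{z_++i},L_+\widehat u_{z_++j}\rangle=\langle\widehat u_{z_++i},v_{z_++j}\rangle,\ \ i,j=1,\dots,z_- .$$ $n_-(A)$ is the number of negative eigenvalues of a symmetric matrix $A$ ($0$ for an empty matrix). Lagrangian path. For $\mathbf u=(u,v)^\top\in H^2(0,\ell)$ put $\operatorname{Tr}_s\mathbf u=(u(0),v(0),u(\ell),v(\ell),-\frac1su'(0),\frac1sv'(0),\frac1su'(\ell),-\frac1sv'(\ell))^\top\in\mathbb R^8$. For $\lambda\in\mathbb R$ let $\mathcal K_{\lambda,s}$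 be the space of $\mathbf u\in H^2(0,\ell)$ with $N_s\mathbf u=s^2\lambda\mathbf u$ (no boundary conditions), $\Lambda(\lambda,s)=\operatorname{Tr}_s(\mathcal K_{\lambda,s})$ (a Lagrangian subspace of $\mathbb R^8$), and $\mathcal D=\{0\}\times\mathbb R^4$. A crossing is $(\lambda_0,s_0)$ with $\Lambda(\lambda_0,s_0)\cap\mathcal D\neq\{0\}$. Maslov index. On $\mathbb R^{2m}$ let $\omega(x,y)=Jx\cdot y$, $J=\begin{pmatrix}0_m&-I_m\\ I_m&0_m\end{pmatrix}$; $\mathcal L(m)$ is the set of $m$-dimensional subspaces on which $\omega$ vanishes. Fix $\Lambda_0\in\mathcal L(m)$. For a $C^1$ path $\Lambda:[a,b]\to\mathcal L(m)$, a crossing is $t_0$ with $\Lambda(t_0)\cap\Lambda_0\ne\{0\}$. Choosing a complement $W$ of $\Lambda(t_0)$, for $t$ near $t_0$, $\Lambda(t)=\{q+R_tq:q\in\Lambda(t_0)\}$ with $R_t:\Lambda(t_0)\to W$ linear, $C^1$ in $t$, $R_{t_0}=0$; the crossing form is $\mathfrak m_{t_0}(q)=\frac d{dt}\omega(q,R_tq)|_{t=t_0}$ on $\Lambda(t_0)\cap\Lambda_0$, and the crossing is regular if this is nondegenerate. With $n_\pm$ the numbers of positive/negative squares and $\operatorname{sign}=n_+-n_-$, for a path with only regular crossings $\operatorname{Mas}(\Lambda(t),\Lambda_0;[a,b])=-n_-(\mathfrak m_a)+\sum_{a<t_0<b}\operatorname{sign}(\mathfrak m_{t_0})+n_+(\mathfrak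 m_b)$ (endpoint terms are $0$ if not crossings). For an arbitrary continuous path the index is that of any path with only regular crossings homotopic to it with fixed endpoints (well defined). *)

theory Defs
  imports
    "HOL-Analysis.Analysis"
    "HOL-Library.Function_Algebras"
    "Jordan_Normal_Form.Char_Poly"
begin

section \<open>Function spaces on a compact interval\<close>

type_synonym rfun = "real \<Rightarrow> real"

text \<open>
  Functions on \<open>[0,l]\<close> are represented by functions on the line; elements of \<open>H2 l\<close> below
  vanish outside \<open>[0,l]\<close>, so that they form an honest vector space without a quotient.
\<close>

definition rscale :: "real \<Rightarrow> rfun \<Rightarrow> rfun" where
  "rscale c u = (\<lambda>x. c * u x)"

definition pscale :: "real \<Rightarrow> rfun \<times> rfun \<Rightarrow> rfun \<times> rfun" where
  "pscale c F = (rscale c (fst F), rscale c (snd F))"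

global_interpretation rfun_vs: vector_space rscale
  by unfold_locales (auto simp: rscale_def fun_eq_iff algebra_simps)

global_interpretation pair_vs: vector_space pscale
  by unfold_locales (auto simp: pscale_def rscale_def fun_eq_iff algebra_simps prod_eq_iff)

text \<open>Derivative on \<open>[0,l]\<close>, one-sided at the endpoints.\<close>

definition Dx :: "real \<Rightarrow> rfun \<Rightarrow> rfun" where
  "Dx l u x = vector_derivative u (at x within {0..l})"

definition C2_on :: "real \<Rightarrow> rfun \<Rightarrow> bool" where
  "C2_on l f \<longleftrightarrow> (\<exists>f1 f2.
     (\<forall>x\<in>{0..l}. (f has_real_derivative f1 x) (at x within {0..l})) \<and>
     (\<forall>x\<in>{0..l}. (f1 has_real_derivative f2 x) (at x within {0..l})) \<and>
     continuous_on {0..l} f2)"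

text \<open>
  The Sobolev space \<open>H\<^sup>2(0,l)\<close>, given by the \<open>C\<^sup>1\<close> representatives: \<open>u\<close> is the primitive of \<open>p\<close>,
  which is the primitive of a square integrable function.
\<close>

definition H2 :: "real \<Rightarrow> rfun set" where
  "H2 l = {u. (\<forall>x. x \<notin> {0..l} \<longrightarrow> u x = 0) \<and>
     (\<exists>p w. w \<in> borel_measurable (lebesgue_on {0..l}) \<and>
            integrable (lebesgue_on {0..l}) (\<lambda>x. (w x)\<^sup>2) \<and>
            (\<forall>x\<in>{0..l}. p x = p 0 + (LINT t|lebesgue_on {0..x}. w t)) \<and>
            (\<forall>x\<in>{0..l}. u x = u 0 + (LINT t|lebesgue_on {0..x}. p t)))}"

text \<open>\<open>H\<^sup>2(0,l) \<inter> H\<^sup>1\<^sub>0(0,l)\<close>\<close>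

definition H2_0 :: "real \<Rightarrow> rfun set" where
  "H2_0 l = {u \<in> H2 l. u 0 = 0 \<and> u l = 0}"

definition L2_eq :: "real \<Rightarrow> rfun \<Rightarrow> rfun \<Rightarrow> bool" where
  "L2_eq l u v \<longleftrightarrow> (AE x in lebesgue_on {0..l}. u x = v x)"

definition L2_eq2 :: "real \<Rightarrow> rfun \<times> rfun \<Rightarrow> rfun \<times> rfun \<Rightarrow> bool" where
  "L2_eq2 l F G \<longleftrightarrow> L2_eq l (fst F) (fst G) \<and> L2_eq l (snd F) (snd G)"

definition L2_inner :: "real \<Rightarrow> rfun \<Rightarrow> rfun \<Rightarrow> real" where
  "L2_inner l u v = (LINT x|lebesgue_on {0..l}. u x * v x)"

definition L2_inner2 :: "real \<Rightarrow> rfun \<times> rfun \<Rightarrow> rfun \<times> rfun \<Rightarrow> real" where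
  "L2_inner2 l F G = L2_inner l (fst F) (fst G) + L2_inner l (snd F) (snd G)"


section \<open>The operators\<close>

text \<open>
  \<open>L_op l g s\<close> is the differential expression of \<open>L\<^sub>+\<^sup>s\<close> and \<open>L_op l h s\<close> that of \<open>L\<^sub>-\<^sup>s\<close>.
  For \<open>u \<in> H2 l\<close> the pointwise second derivative exists almost everywhere and coincides with
  the weak one, hence equations between such expressions are read with \<open>L2_eq\<close>.
\<close>

definition L_op :: "real \<Rightarrow> rfun \<Rightarrow> real \<Rightarrow> rfun \<Rightarrow> rfun" where
  "L_op l V s u = (\<lambda>x. - Dx l (Dx l u) x - s\<^sup>2 * V (s * x) * u x)"

definition N_op :: "real \<Rightarrow> rfun \<Rightarrow> rfun \<Rightarrow> real \<Rightarrow> rfun \<times> rfun \<Rightarrow> rfun \<times> rfun" where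
  "N_op l g h s F = (- L_op l h s (snd F), L_op l g s (fst F))"

definition S_op :: "rfun \<times> rfun \<Rightarrow> rfun \<times> rfun" where
  "S_op F = (snd F, fst F)"

definition dom_N :: "real \<Rightarrow> (rfun \<times> rfun) set" where
  "dom_N l = H2_0 l \<times> H2_0 l"

text \<open>\<open>ker L\<^sub>+ = ker_L l g\<close> and \<open>ker L\<^sub>- = ker_L l h\<close>\<close>

definition ker_L :: "real \<Rightarrow> rfun \<Rightarrow> rfun set" where
  "ker_L l V = {u \<in> H2_0 l. L2_eq l (L_op l V 1 u) 0}"

definition ker_N :: "real \<Rightarrow> rfun \<Rightarrow> rfun \<Rightarrow> (rfun \<times> rfun) set" where
  "ker_N l g h = {F \<in> dom_N l. L2_eq2 l (N_op l g h 1 F) 0}"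


section \<open>Lagrangian subspaces and the Maslov index\<close>

text \<open>\<open>\<real>\<^sup>2\<^sup>m\<close> is written as \<open>\<real>\<^sup>m \<times> \<real>\<^sup>m\<close>.\<close>

type_synonym 'm symp = "(real^'m) \<times> (real^'m)"

definition symp_J :: "'m::finite symp \<Rightarrow> 'm symp" where
  "symp_J x = (- snd x, fst x)"

definition symp_form :: "'m::finite symp \<Rightarrow> 'm symp \<Rightarrow> real" where
  "symp_form x y = symp_J x \<bullet> y"

definition Lagr :: "'m::finite symp set set" where
  "Lagr = {V. subspace V \<and> dim V = CARD('m) \<and> (\<forall>x\<in>V. \<forall>y\<in>V. symp_form x y = 0)}"

text \<open>
  \<open>Lagr\<close> carries the topology and the smooth structure of the Grassmannian, in which a subspace is
  identified with the orthogonal projection onto it; \<open>closest_point V\<close> is this projection.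
\<close>

definition cont_family :: "'t::topological_space set \<Rightarrow> ('t \<Rightarrow> 'm::finite symp set) \<Rightarrow> bool" where
  "cont_family A H \<longleftrightarrow>
     (\<forall>t\<in>A. H t \<in> Lagr) \<and> (\<forall>x. continuous_on A (\<lambda>t. closest_point (H t) x))"

definition C1_path :: "(real \<Rightarrow> 'm::finite symp set) \<Rightarrow> real \<Rightarrow> real \<Rightarrow> bool" where
  "C1_path \<Lambda> a b \<longleftrightarrow> (\<forall>t\<in>{a..b}. \<Lambda> t \<in> Lagr) \<and>
     (\<forall>x. \<exists>d. (\<forall>t\<in>{a..b}. ((\<lambda>t. closest_point (\<Lambda> t) x) has_vector_derivative d t)
                                (at t within {a..b})) \<and>
              continuous_on {a..b} d)"

definition is_crossing :: "(real \<Rightarrow> 'm::finite symp set) \<Rightarrow> 'm symp set \<Rightarrow> real \<Rightarrow> bool" where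
  "is_crossing \<Lambda> \<Lambda>0 t \<longleftrightarrow> \<Lambda> t \<inter> \<Lambda>0 \<noteq> {0}"

definition is_complement :: "'a::real_vector set \<Rightarrow> 'a set \<Rightarrow> bool" where
  "is_complement V W \<longleftrightarrow>
     subspace W \<and> V \<inter> W = {0} \<and> (\<forall>x. \<exists>v\<in>V. \<exists>w\<in>W. x = v + w)"

text \<open>
  \<open>graph_map \<Lambda> W t q\<close> is \<open>R\<^sub>t q\<close>. The crossing form does not depend on the complement chosen;
  \<open>I\<close> is the parameter interval, so that derivatives at its endpoints are one-sided.
\<close>

definition graph_map ::
  "(real \<Rightarrow> 'm::finite symp set) \<Rightarrow> 'm symp set \<Rightarrow> real \<Rightarrow> 'm symp \<Rightarrow> 'm symp" where
  "graph_map \<Lambda> W t q = (THE w. w \<in> W \<and> q + w \<in> \<Lambda> t)"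

definition crossing_form ::
  "(real \<Rightarrow> 'm::finite symp set) \<Rightarrow> real set \<Rightarrow> real \<Rightarrow> 'm symp \<Rightarrow> real" where
  "crossing_form \<Lambda> I t0 q = (let W = (SOME W. is_complement (\<Lambda> t0) W) in
     vector_derivative (\<lambda>t. symp_form q (graph_map \<Lambda> W t q)) (at t0 within I))"

text \<open>Quadratic forms \<open>Q\<close> on a subspace \<open>V\<close>: bases in which \<open>Q\<close> is a sum of signed squares.\<close>

definition diagonalises :: "'a::real_vector set \<Rightarrow> 'a set \<Rightarrow> ('a \<Rightarrow> real) \<Rightarrow> bool" where
  "diagonalises B V Q \<longleftrightarrow> finite B \<and> independent B \<and> span B = V \<and>
     (\<forall>c. Q (\<Sum>b\<in>B. c b *\<^sub>R b) = (\<Sum>b\<in>B. (c b)\<^sup>2 * Q b))"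

definition pos_squares :: "'a::real_vector set \<Rightarrow> ('a \<Rightarrow> real) \<Rightarrow> nat" where
  "pos_squares V Q = (THE k. \<exists>B. diagonalises B V Q \<and> k = card {b\<in>B. Q b > 0})"

definition neg_squares :: "'a::real_vector set \<Rightarrow> ('a \<Rightarrow> real) \<Rightarrow> nat" where
  "neg_squares V Q = (THE k. \<exists>B. diagonalises B V Q \<and> k = card {b\<in>B. Q b < 0})"

definition nondegenerate :: "'a::real_vector set \<Rightarrow> ('a \<Rightarrow> real) \<Rightarrow> bool" where
  "nondegenerate V Q \<longleftrightarrow> (\<forall>q\<in>V. (\<forall>p\<in>V. Q (q + p) - Q q - Q p = 0) \<longrightarrow> q = 0)"

definition regular_crossing ::
  "(real \<Rightarrow> 'm::finite symp set) \<Rightarrow> 'm symp set \<Rightarrow> real set \<Rightarrow> real \<Rightarrow> bool" where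
  "regular_crossing \<Lambda> \<Lambda>0 I t \<longleftrightarrow>
     is_crossing \<Lambda> \<Lambda>0 t \<and> nondegenerate (\<Lambda> t \<inter> \<Lambda>0) (crossing_form \<Lambda> I t)"

definition regular_path ::
  "(real \<Rightarrow> 'm::finite symp set) \<Rightarrow> 'm symp set \<Rightarrow> real \<Rightarrow> real \<Rightarrow> bool" where
  "regular_path \<Lambda> \<Lambda>0 a b \<longleftrightarrow> C1_path \<Lambda> a b \<and>
     (\<forall>t\<in>{a..b}. is_crossing \<Lambda> \<Lambda>0 t \<longrightarrow> regular_crossing \<Lambda> \<Lambda>0 {a..b} t)"

definition crossing_pos ::
  "(real \<Rightarrow> 'm::finite symp set) \<Rightarrow> 'm symp set \<Rightarrow> real set \<Rightarrow> real \<Rightarrow> int" where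
  "crossing_pos \<Lambda> \<Lambda>0 I t = (if is_crossing \<Lambda> \<Lambda>0 t
     then int (pos_squares (\<Lambda> t \<inter> \<Lambda>0) (crossing_form \<Lambda> I t)) else 0)"

definition crossing_neg ::
  "(real \<Rightarrow> 'm::finite symp set) \<Rightarrow> 'm symp set \<Rightarrow> real set \<Rightarrow> real \<Rightarrow> int" where
  "crossing_neg \<Lambda> \<Lambda>0 I t = (if is_crossing \<Lambda> \<Lambda>0 t
     then int (neg_squares (\<Lambda> t \<inter> \<Lambda>0) (crossing_form \<Lambda> I t)) else 0)"

definition Mas_regular ::
  "(real \<Rightarrow> 'm::finite symp set) \<Rightarrow> 'm symp set \<Rightarrow> real \<Rightarrow> real \<Rightarrow> int" where
  "Mas_regular \<Lambda> \<Lambda>0 a b =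
     - crossing_neg \<Lambda> \<Lambda>0 {a..b} a
     + (\<Sum>t\<in>{t\<in>{a<..<b}. is_crossing \<Lambda> \<Lambda>0 t}.
          crossing_pos \<Lambda> \<Lambda>0 {a..b} t - crossing_neg \<Lambda> \<Lambda>0 {a..b} t)
     + crossing_pos \<Lambda> \<Lambda>0 {a..b} b"

definition homotopic_fixed_ends ::
  "real \<Rightarrow> real \<Rightarrow> (real \<Rightarrow> 'm::finite symp set) \<Rightarrow> (real \<Rightarrow> 'm symp set) \<Rightarrow> bool" where
  "homotopic_fixed_ends a b \<Lambda> \<Gamma> \<longleftrightarrow> (\<exists>H :: real \<times> real \<Rightarrow> 'm symp set.
     cont_family ({0..1} \<times> {a..b}) H \<and>
     (\<forall>t\<in>{a..b}. H (0, t) = \<Lambda> t \<and> H (1, t) = \<Gamma> t) \<and>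
     (\<forall>\<sigma>\<in>{0..1}. H (\<sigma>, a) = \<Lambda> a \<and> H (\<sigma>, b) = \<Lambda> b))"

definition Mas ::
  "(real \<Rightarrow> 'm::finite symp set) \<Rightarrow> 'm symp set \<Rightarrow> real \<Rightarrow> real \<Rightarrow> int" where
  "Mas \<Lambda> \<Lambda>0 a b = (THE k. \<exists>\<Gamma>. regular_path \<Gamma> \<Lambda>0 a b \<and>
     homotopic_fixed_ends a b \<Lambda> \<Gamma> \<and> k = Mas_regular \<Gamma> \<Lambda>0 a b)"


section \<open>The Lagrangian path\<close>

definition Tr :: "real \<Rightarrow> real \<Rightarrow> rfun \<times> rfun \<Rightarrow> 4 symp" where
  "Tr l s F = (let u = fst F; v = snd F in
     (vector [u 0, v 0, u l, v l],
      vector [- (1/s) * Dx l u 0, (1/s) * Dx l v 0, (1/s) * Dx l u l, - (1/s) * Dx l v l]))"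

definition K_space :: "real \<Rightarrow> rfun \<Rightarrow> rfun \<Rightarrow> real \<Rightarrow> real \<Rightarrow> (rfun \<times> rfun) set" where
  "K_space l g h \<mu> s = {F \<in> H2 l \<times> H2 l. L2_eq2 l (N_op l g h s F) (pscale (s\<^sup>2 * \<mu>) F)}"

definition Lam :: "real \<Rightarrow> rfun \<Rightarrow> rfun \<Rightarrow> real \<Rightarrow> real \<Rightarrow> 4 symp set" where
  "Lam l g h \<mu> s = Tr l s ` K_space l g h \<mu> s"

definition Dirichlet :: "4 symp set" where
  "Dirichlet = {0} \<times> UNIV"


section \<open>First and second order crossing forms at \<open>(0,1)\<close>\<close>

definition first_form :: "real \<Rightarrow> rfun \<Rightarrow> rfun \<Rightarrow> 4 symp \<Rightarrow> real" where
  "first_form l g h q = (let F = (THE F. F \<in> ker_N l g h \<and> Tr l 1 F = q) in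
     - L2_inner2 l F (S_op F))"

text \<open>
  Indices run from \<open>0\<close>: the members of the basis of \<open>ker N\<close> with index \<open>i < zp\<close> are \<open>(u i, 0)\<close>,
  those with \<open>zp \<le> i < n\<close> are \<open>(0, v i)\<close>. The functions \<open>vh i\<close> (\<open>i < zp\<close>) and \<open>uh i\<close> (\<open>zp \<le> i < n\<close>)
  are the components of the generalised eigenvectors.
\<close>

definition ker_vec :: "nat \<Rightarrow> (nat \<Rightarrow> rfun) \<Rightarrow> (nat \<Rightarrow> rfun) \<Rightarrow> nat \<Rightarrow> rfun \<times> rfun" where
  "ker_vec zp u v i = (if i < zp then (u i, 0) else (0, v i))"

definition gen_vec :: "nat \<Rightarrow> (nat \<Rightarrow> rfun) \<Rightarrow> (nat \<Rightarrow> rfun) \<Rightarrow> nat \<Rightarrow> rfun \<times> rfun" where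
  "gen_vec zp uh vh i = (if i < zp then (0, vh i) else (uh i, 0))"

definition adapted_basis ::
  "real \<Rightarrow> rfun \<Rightarrow> rfun \<Rightarrow> nat \<Rightarrow> nat \<Rightarrow> (nat \<Rightarrow> rfun) \<Rightarrow> (nat \<Rightarrow> rfun) \<Rightarrow> bool" where
  "adapted_basis l g h zp n u v \<longleftrightarrow>
     (\<forall>i<zp. u i \<in> ker_L l g) \<and> (\<forall>i\<in>{zp..<n}. v i \<in> ker_L l h) \<and>
     inj_on (ker_vec zp u v) {..<n} \<and>
     pair_vs.independent (ker_vec zp u v ` {..<n}) \<and>
     pair_vs.span (ker_vec zp u v ` {..<n}) = ker_N l g h"

definition generalised_eigenvectors ::
  "real \<Rightarrow> rfun \<Rightarrow> rfun \<Rightarrow> nat \<Rightarrow> nat \<Rightarrow> (nat \<Rightarrow> rfun) \<Rightarrow> (nat \<Rightarrow> rfun) \<Rightarrow>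
     (nat \<Rightarrow> rfun) \<Rightarrow> (nat \<Rightarrow> rfun) \<Rightarrow> bool" where
  "generalised_eigenvectors l g h zp n u v uh vh \<longleftrightarrow>
     (\<forall>i<n. gen_vec zp uh vh i \<in> dom_N l \<and>
            L2_eq2 l (N_op l g h 1 (gen_vec zp uh vh i)) (ker_vec zp u v i))"

definition M2_mat ::
  "real \<Rightarrow> nat \<Rightarrow> nat \<Rightarrow> (nat \<Rightarrow> rfun) \<Rightarrow> (nat \<Rightarrow> rfun) \<Rightarrow>
     (nat \<Rightarrow> rfun) \<Rightarrow> (nat \<Rightarrow> rfun) \<Rightarrow> real Matrix.mat" where
  "M2_mat l zp n u v uh vh = Matrix.mat n n
     (\<lambda>(i, j). - 2 * L2_inner2 l (gen_vec zp uh vh i) (S_op (ker_vec zp u v j)))"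

definition Dminus_mat :: "real \<Rightarrow> rfun \<Rightarrow> nat \<Rightarrow> (nat \<Rightarrow> rfun) \<Rightarrow> real Matrix.mat" where
  "Dminus_mat l h zp vh = Matrix.mat zp zp
     (\<lambda>(i, j). L2_inner l (vh i) (L_op l h 1 (vh j)))"

definition Dplus_mat :: "real \<Rightarrow> rfun \<Rightarrow> nat \<Rightarrow> nat \<Rightarrow> (nat \<Rightarrow> rfun) \<Rightarrow> real Matrix.mat" where
  "Dplus_mat l g zp zm uh = Matrix.mat zm zm
     (\<lambda>(i, j). L2_inner l (uh (zp + i)) (L_op l g 1 (uh (zp + j))))"

text \<open>Negative eigenvalues, counted with multiplicity.\<close>

definition n_neg :: "real Matrix.mat \<Rightarrow> nat" where
  "n_neg A = size {# x \<in># proots (char_poly A). x < 0 #}"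

end

theory Submission
  imports Defs
begin

text \<open>
  On each of the two short paths the Maslov index is a difference of Morse indices. A Lagrangian
  plane \<open>L\<close> transverse to \<open>{(x, - \<tau> x)}\<close> (\<open>chart \<tau> L\<close>) is \<open>{(A w, - w - \<tau> A w)}\<close> for one
  symmetric matrix \<open>A\<close>, and \<open>robin_index \<tau> L\<close> is the number of negative eigenvalues of \<open>A\<close>.
  Crossings of \<open>{0} \<times> UNIV\<close> are the points where \<open>A\<close> is singular, and the crossing form is the
  derivative of \<open>A\<close> on its kernel; so a path that stays in one chart has Maslov index
  \<open>robin_index \<tau> (\<Lambda> a) - robin_index \<tau> (\<Lambda> b)\<close>, however degenerate its crossings are
  (\<open>Mas_chart_path\<close>).

  Two things have to be shown for this. Regular representatives exist: between two symmetric
  matrices the curve \<open>(1 - u) A + u B + c u (1 - u)\<close> with \<open>c\<close> large has only regular crossings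
  (\<open>regular_path_between\<close>), and it is homotopic to the given path by convex combination inside the
  chart. And all regular representatives, also those whose homotopies leave the chart, have the same
  index: although \<open>robin_index \<tau>\<close> jumps when \<open>L\<close> leaves the chart, its mean over \<open>\<tau> \<in> [0,1]\<close> is
  continuous modulo integers, hence lifts continuously along a homotopy (\<open>robin_mean_lift\<close>), and the
  integer by which the lift differs from the mean drops by the Maslov index along every regular path
  (\<open>Mas_regular_angle\<close>).

  It remains to compare \<open>robin_index \<tau>\<close> at the corner \<open>(0,1)\<close> with its values close to the corner.
  Solutions of the eigenvalue equation are written as a first order system with flow \<open>sol\<close>, and
  \<open>\<Lambda>(\<mu>,s)\<close> is the set of pairs (initial data, data at \<open>s l\<close>) of this flow (\<open>Lam_eq\<close>). The
  perturbation result \<open>robin_index_perturb\<close> needs, for every kernel element, a curve of vectors in the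
  perturbed planes on which the Robin form, suitably scaled, converges to a nondegenerate diagonal
  matrix. Along \<open>s \<up> 1\<close> these are the kernel functions themselves, cut off at \<open>s l\<close>; the form is of
  first order in \<open>1 - s\<close>, positive on \<open>ker L\<^sub>+\<close> and negative on \<open>ker L\<^sub>-\<close>. So the
  first path contributes \<open>dim (ker L\<^sub>-)\<close>. Along \<open>\<mu> \<down> 0\<close> one corrects the kernel element \<open>k\<close> to
  \<open>k + \<mu> K\<close> with the generalised eigenvector \<open>K\<close>; by Green's formula the form is then of second
  order in \<open>\<mu>\<close>, with coefficients \<open>D\<^sub>-\<close> on \<open>ker L\<^sub>+\<close> and \<open>- D\<^sub>+\<close> on \<open>ker L\<^sub>-\<close>.
  So the second path contributes \<open>- n\<^sub>-(D\<^sub>-) - (dim (ker L\<^sub>-) - n\<^sub>-(D\<^sub>+))\<close>, and the sum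
  is \<open>n\<^sub>-(D\<^sub>+) - n\<^sub>-(D\<^sub>-)\<close>. Here each kernel is at most one-dimensional, so that all forms
  involved are diagonal in the given basis, and nondegeneracy of the second order form says that the
  diagonal entries do not vanish.
\<close>

section \<open>Negative index of a quadratic form\<close>

definition neg_def_on :: "('a::real_vector \<Rightarrow> real) \<Rightarrow> 'a set \<Rightarrow> bool" where
  "neg_def_on Q W \<longleftrightarrow> (\<forall>z\<in>W. z \<noteq> 0 \<longrightarrow> Q z < 0)"

definition neg_index :: "'a::euclidean_space set \<Rightarrow> ('a \<Rightarrow> real) \<Rightarrow> nat" where
  "neg_index V Q = Max {dim W | W. subspace W \<and> W \<subseteq> V \<and> neg_def_on Q W}"

definition pos_index :: "'a::euclidean_space set \<Rightarrow> ('a \<Rightarrow> real) \<Rightarrow> nat" where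
  "pos_index V Q = neg_index V (\<lambda>z. - Q z)"

lemma finite_neg_dims: "finite {dim W | W. subspace W \<and> W \<subseteq> (V::'a::euclidean_space set) \<and> neg_def_on Q W}"
  by (rule finite_subset[of _ "{..dim V}"]) (auto intro: dim_subset)

lemma neg_index_ge:
  fixes V :: "'a::euclidean_space set"
  assumes "subspace W" "W \<subseteq> V" "neg_def_on Q W"
  shows "dim W \<le> neg_index V Q"
  unfolding neg_index_def by (rule Max_ge[OF finite_neg_dims]) (use assms in blast)

lemma neg_index_attained:
  fixes V :: "'a::euclidean_space set"
  assumes "subspace V"
  obtains W where "subspace W" "W \<subseteq> V" "neg_def_on Q W" "dim W = neg_index V Q"
proof -
  have "{dim W | W. subspace W \<and> W \<subseteq> V \<and> neg_def_on Q W} \<noteq> {}"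
    using subspace_0[OF assms] subspace_single_0
    by (auto intro!: exI[of _ "{0}"] simp: neg_def_on_def)
  from Max_in[OF finite_neg_dims this] that show ?thesis
    unfolding neg_index_def by auto
qed

lemma dim_add_le_of_disjoint:
  fixes V :: "'a::euclidean_space set"
  assumes "subspace A" "subspace B" "A \<subseteq> V" "B \<subseteq> V" "A \<inter> B = {0}" "subspace V"
  shows "dim A + dim B \<le> dim V"
proof -
  have "dim {x + y |x y. x \<in> A \<and> y \<in> B} + dim (A \<inter> B) = dim A + dim B"
    by (rule dim_sums_Int) (use assms in auto)
  moreover have "dim {x + y |x y. x \<in> A \<and> y \<in> B} \<le> dim V"
    by (rule dim_subset) (use assms in \<open>auto intro: subspace_add\<close>)
  ultimately show ?thesis using assms by simp
qed

text \<open>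
  A negative definite subspace and a subspace where the form is nonnegative meet only in \<open>0\<close>.
\<close>

lemma neg_index_add_nonneg_le:
  fixes V :: "'a::euclidean_space set"
  assumes "subspace V" "subspace P" "P \<subseteq> V" "\<And>z. z \<in> P \<Longrightarrow> Q z \<ge> 0"
  shows "neg_index V Q + dim P \<le> dim V"
proof -
  obtain W where W: "subspace W" "W \<subseteq> V" "neg_def_on Q W" "dim W = neg_index V Q"
    using neg_index_attained[OF assms(1)] .
  have "W \<inter> P = {0}"
    using W assms subspace_0[of W] subspace_0[of P] by (force simp: neg_def_on_def)
  with dim_add_le_of_disjoint[OF W(1) assms(2) W(2) assms(3) _ assms(1)] W show ?thesis by simp
qed

text \<open>
  The radical may be added to a maximal positive subspace; the sum is still nonnegative.
\<close>

lemma neg_index_add_pos_index_le: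
  fixes V :: "'a::euclidean_space set"
  assumes V: "subspace V" and B: "bilinear B" and sym: "\<And>z w. z \<in> V \<Longrightarrow> w \<in> V \<Longrightarrow> B z w = B w z"
    and R: "subspace R" "R \<subseteq> V" and rad: "\<And>r w. r \<in> R \<Longrightarrow> w \<in> V \<Longrightarrow> B r w = 0"
  shows "neg_index V (\<lambda>z. B z z) + pos_index V (\<lambda>z. B z z) + dim R \<le> dim V"
proof -
  obtain W where W: "subspace W" "W \<subseteq> V" "neg_def_on (\<lambda>z. - B z z) W"
      "dim W = pos_index V (\<lambda>z. B z z)"
    unfolding pos_index_def using neg_index_attained[OF V] .
  let ?P = "{x + y |x y. x \<in> W \<and> y \<in> R}"
  have "W \<inter> R \<subseteq> {0}"
  proof
    fix z assume z: "z \<in> W \<inter> R"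
    then have "B z z = 0" using rad W by blast
    then show "z \<in> {0}" using z W(3) by (auto simp: neg_def_on_def)
  qed
  then have WR: "W \<inter> R = {0}" using subspace_0[OF W(1)] subspace_0[OF R(1)] by auto
  have "dim ?P + dim (W \<inter> R) = dim W + dim R" by (rule dim_sums_Int[OF W(1) R(1)])
  then have d: "dim ?P = dim W + dim R" using WR by simp
  have "neg_index V (\<lambda>z. B z z) + dim ?P \<le> dim V"
  proof (rule neg_index_add_nonneg_le[OF V])
    show "subspace ?P" by (rule subspace_sums[OF W(1) R(1)])
    show "?P \<subseteq> V" using W R V by (auto intro: subspace_add)
    fix z assume "z \<in> ?P"
    then obtain x y where xy: "z = x + y" "x \<in> W" "y \<in> R" by auto
    have "B z z = B x x + B x y + B y x + B y y"
      unfolding xy by (simp add: bilinear_ladd[OF B] bilinear_radd[OF B])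
    also have "\<dots> = B x x" using rad[of y x] rad[of y y] sym[of x y] xy W R by (simp add: subset_iff)
    also have "\<dots> \<ge> 0" using W(3) xy bilinear_lzero[OF B] by (cases "x = 0") (force simp: neg_def_on_def)+
    finally show "B z z \<ge> 0" .
  qed
  then show ?thesis using d W by simp
qed

lemma neg_index_add_pos_index_le_dim:
  fixes V :: "'a::euclidean_space set"
  assumes V: "subspace V" and Q0: "Q 0 = 0"
  shows "neg_index V Q + pos_index V Q \<le> dim V"
proof -
  obtain W where W: "subspace W" "W \<subseteq> V" "neg_def_on (\<lambda>z. - Q z) W"
      "dim W = pos_index V Q"
    unfolding pos_index_def using neg_index_attained[OF V] .
  have "neg_index V Q + dim W \<le> dim V"
    by (rule neg_index_add_nonneg_le[OF V W(1,2)])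
      (use W(3) Q0 in \<open>force simp: neg_def_on_def\<close>)
  then show ?thesis using W by simp
qed

lemma neg_index_ge_family:
  fixes V :: "'a::euclidean_space set" and e :: "'i \<Rightarrow> 'a"
  assumes I: "finite I" and V: "subspace V" and e: "\<And>i. i \<in> I \<Longrightarrow> e i \<in> V"
    and Q0: "Q 0 = 0"
    and neg: "\<And>c. \<exists>i\<in>I. c i \<noteq> 0 \<Longrightarrow> Q (\<Sum>i\<in>I. c i *\<^sub>R e i) < 0"
  shows "card I \<le> neg_index V Q"
proof -
  have nz: "(\<Sum>i\<in>I. c i *\<^sub>R e i) \<noteq> 0" if "\<exists>i\<in>I. c i \<noteq> 0" for c
    using neg[OF that] Q0 by auto
  have inj: "inj_on e I"
  proof (rule inj_onI, rule ccontr)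
    fix i j assume ij: "i \<in> I" "j \<in> I" "e i = e j" "i \<noteq> j"
    (* e i = e j would give a vanishing nontrivial combination *)
    let ?c = "\<lambda>k. if k = i then 1 else if k = j then -1 else (0::real)"
    have "(\<Sum>k\<in>I. ?c k *\<^sub>R e k) = (\<Sum>k\<in>{i,j}. ?c k *\<^sub>R e k)"
      by (rule sum.mono_neutral_right) (use I ij in auto)
    also have "\<dots> = 0" using ij by simp
    finally show False using nz[of ?c] ij by fastforce
  qed
  have ind: "independent (e ` I)"
  proof
    assume "dependent (e ` I)"
    then obtain u where u: "\<exists>v\<in>e ` I. u v \<noteq> 0" "(\<Sum>v\<in>e ` I. u v *\<^sub>R v) = 0"
      using dependent_finite[of "e ` I"] I by auto
    then have "(\<Sum>i\<in>I. u (e i) *\<^sub>R e i) = 0" by (simp add: sum.reindex[OF inj])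
    with nz[of "u \<circ> e"] u(1) show False by auto
  qed
  have "dim (span (e ` I)) \<le> neg_index V Q"
  proof (rule neg_index_ge)
    show "span (e ` I) \<subseteq> V" by (rule span_minimal) (use e V in auto)
    show "neg_def_on Q (span (e ` I))"
      unfolding neg_def_on_def
    proof (intro ballI impI)
      fix z assume z: "z \<in> span (e ` I)" "z \<noteq> 0"
      then obtain u where "z = (\<Sum>v\<in>e ` I. u v *\<^sub>R v)" using span_finite[of "e ` I"] I by auto
      then have u: "z = (\<Sum>i\<in>I. (u \<circ> e) i *\<^sub>R e i)" by (simp add: sum.reindex[OF inj])
      have "\<exists>i\<in>I. (u \<circ> e) i \<noteq> 0"
      proof (rule ccontr)
        assume "\<not> ?thesis"
        then have "z = 0" unfolding u by (intro sum.neutral) auto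
        with z show False by simp
      qed
      with neg u show "Q z < 0" by metis
    qed
  qed auto
  then show ?thesis using ind by (simp add: dim_eq_card_independent card_image[OF inj])
qed

lemma bilinear_quadratic_sum:
  fixes B :: "'a::real_vector \<Rightarrow> 'a \<Rightarrow> real"
  assumes B: "bilinear B"
  shows "B (\<Sum>i\<in>I. c i *\<^sub>R e i) (\<Sum>i\<in>I. c i *\<^sub>R e i) = (\<Sum>i\<in>I. \<Sum>j\<in>I. c i * c j * B (e i) (e j))"
proof -
  have l: "linear (\<lambda>x. B x y)" "linear (B x)" for x y using B by (auto simp: bilinear_def)
  show ?thesis
    by (subst sum.swap)
      (simp add: linear_sum[OF l(1)] linear_sum[OF l(2)] linear_cmul[OF l(1)] linear_cmul[OF l(2)]
        sum_distrib_left mult_ac)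
qed

text \<open>
  Diagonal dominance: by Cauchy-Schwarz the off-diagonal part is at most \<open>\<delta> * card I\<close> times \<open>\<Sum>i. (c i)\<^sup>2\<close>.
\<close>

lemma gram_near_diagonal_neg:
  fixes G :: "'i \<Rightarrow> 'i \<Rightarrow> real"
  assumes I: "finite I" and d: "\<And>i. i \<in> I \<Longrightarrow> d i \<le> - a"
    and G: "\<And>i j. i \<in> I \<Longrightarrow> j \<in> I \<Longrightarrow> \<bar>G i j - (if i = j then d i else 0)\<bar> \<le> \<delta>"
    and \<delta>: "\<delta> * card I < a" "0 \<le> \<delta>" and c: "\<exists>i\<in>I. c i \<noteq> 0"
  shows "(\<Sum>i\<in>I. \<Sum>j\<in>I. c i * c j * G i j) < 0"
proof -
  have pos: "(\<Sum>i\<in>I. (c i)\<^sup>2) > 0"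
  proof -
    obtain i where "i \<in> I" "c i \<noteq> 0" using c by blast
    then show ?thesis by (intro sum_pos2[OF I, of i]) auto
  qed
  have "(\<Sum>i\<in>I. \<Sum>j\<in>I. c i * c j * G i j)
      \<le> (\<Sum>i\<in>I. \<Sum>j\<in>I. (if i = j then (c i)\<^sup>2 * d i else 0) + \<delta> * (\<bar>c i\<bar> * \<bar>c j\<bar>))"
  proof (intro sum_mono)
    fix i j assume ij: "i \<in> I" "j \<in> I"
    have "c i * c j * G i j = c i * c j * (if i = j then d i else 0) + c i * c j * (G i j - (if i = j then d i else 0))"
      by (simp add: algebra_simps)
    also have "c i * c j * (G i j - (if i = j then d i else 0)) \<le> \<bar>c i * c j\<bar> * \<bar>G i j - (if i = j then d i else 0)\<bar>"
      by (metis abs_ge_self abs_mult)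
    also have "\<dots> \<le> \<bar>c i * c j\<bar> * \<delta>" by (intro mult_left_mono G ij) auto
    finally show "c i * c j * G i j \<le> (if i = j then (c i)\<^sup>2 * d i else 0) + \<delta> * (\<bar>c i\<bar> * \<bar>c j\<bar>)"
      by (auto simp: abs_mult power2_eq_square algebra_simps)
  qed
  also have "\<dots> = (\<Sum>i\<in>I. (c i)\<^sup>2 * d i) + \<delta> * (\<Sum>i\<in>I. \<bar>c i\<bar>)\<^sup>2"
    using I by (simp add: sum.distrib power2_eq_square sum_product flip: sum_distrib_left)
  also have "\<dots> \<le> (\<Sum>i\<in>I. (c i)\<^sup>2 * (-a)) + \<delta> * ((\<Sum>i\<in>I. (c i)\<^sup>2) * card I)"
  proof (intro add_mono sum_mono mult_left_mono d \<delta>)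
    show "(\<Sum>i\<in>I. \<bar>c i\<bar>)\<^sup>2 \<le> (\<Sum>i\<in>I. (c i)\<^sup>2) * card I"
      using sum_squared_le_sum_of_squares[of "\<lambda>i. \<bar>c i\<bar>" I] by simp
  qed auto
  also have "\<dots> = (\<Sum>i\<in>I. (c i)\<^sup>2) * (\<delta> * card I - a)"
    by (simp add: sum_distrib_right[symmetric] sum_distrib_left[symmetric] sum_negf algebra_simps)
  also have "\<dots> < 0" using pos \<delta> by (simp add: mult_less_0_iff)
  finally show ?thesis .
qed

lemma eventually_neg_index_ge:
  fixes B :: "'h \<Rightarrow> 'a::euclidean_space \<Rightarrow> 'a \<Rightarrow> real" and e :: "'h \<Rightarrow> 'i \<Rightarrow> 'a"
  assumes I: "finite I" and B: "\<And>h. bilinear (B h)"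
    and V: "\<forall>\<^sub>F h in F. subspace (V h) \<and> (\<forall>i\<in>I. e h i \<in> V h)"
    and lim: "\<And>i j. i \<in> I \<Longrightarrow> j \<in> I \<Longrightarrow> ((\<lambda>h. B h (e h i) (e h j)) \<longlongrightarrow> (if i = j then d i else 0)) F"
    and d: "\<And>i. i \<in> I \<Longrightarrow> d i < 0"
  shows "\<forall>\<^sub>F h in F. card I \<le> neg_index (V h) (\<lambda>z. B h z z)"
proof -
  obtain a where a: "a > 0" "\<And>i. i \<in> I \<Longrightarrow> d i \<le> - a"
  proof (cases "I = {}")
    case False
    show ?thesis
    proof (rule that[of "- Max (d ` I)"])
      show "- Max (d ` I) > 0" using d I False by simp
      show "\<And>i. i \<in> I \<Longrightarrow> d i \<le> - (- Max (d ` I))" using I by simp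
    qed
  qed (use that[of 1] in auto)
  (* half of what diagonal dominance allows; + 1 covers the empty family *)
  define \<delta> where "\<delta> = a / (2 * (card I + 1))"
  have \<delta>: "\<delta> > 0" "\<delta> * card I < a"
    using a by (auto simp: \<delta>_def field_simps intro!: add_nonneg_pos)
  have "\<forall>\<^sub>F h in F. \<forall>i\<in>I. \<forall>j\<in>I. \<bar>B h (e h i) (e h j) - (if i = j then d i else 0)\<bar> < \<delta>"
    using lim[THEN tendstoD, OF _ _ \<delta>(1)] I by (auto simp: eventually_ball_finite_distrib dist_real_def)
  then have "\<forall>\<^sub>F h in F. \<forall>i\<in>I. \<forall>j\<in>I. \<bar>B h (e h i) (e h j) - (if i = j then d i else 0)\<bar> \<le> \<delta>"
    by (rule eventually_mono) (metis less_imp_le)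
  with V show ?thesis
  proof eventually_elim
    case (elim h)
    show ?case
    proof (rule neg_index_ge_family[OF I, where e = "e h"])
      fix c :: "'i \<Rightarrow> real" assume "\<exists>i\<in>I. c i \<noteq> 0"
      then show "B h (\<Sum>i\<in>I. c i *\<^sub>R e h i) (\<Sum>i\<in>I. c i *\<^sub>R e h i) < 0"
        unfolding bilinear_quadratic_sum[OF B]
        using elim(2) \<delta> a(2)
        by (intro gram_near_diagonal_neg[OF I, where \<delta> = \<delta> and d = d and a = a]) (blast | simp)+
    qed (use elim B in \<open>auto simp: bilinear_lzero\<close>)
  qed
qed

lemma bilinear_uminus: "bilinear B \<Longrightarrow> bilinear (\<lambda>x y. - (B x y :: real))"
  unfolding bilinear_def by (auto intro: linear_compose_neg)

text \<open>
  The device behind every index computation below. If vectors \<open>e h i\<close>, as many as the dimension,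
  have Gram matrices converging to a nondegenerate diagonal matrix, both indices are at least the
  numbers of its negative and positive entries, and these numbers already add up to the dimension.
  The vectors themselves need not converge, which permits rescaling vectors on which the form
  degenerates.
\<close>

theorem eventually_neg_index_eq:
  fixes B :: "'h \<Rightarrow> 'a::euclidean_space \<Rightarrow> 'a \<Rightarrow> real" and e :: "'h \<Rightarrow> 'i \<Rightarrow> 'a"
  assumes I: "finite I" and B: "\<And>h. bilinear (B h)"
    and V: "\<forall>\<^sub>F h in F. subspace (V h) \<and> dim (V h) = card I \<and> (\<forall>i\<in>I. e h i \<in> V h)"
    and lim: "\<And>i j. i \<in> I \<Longrightarrow> j \<in> I \<Longrightarrow> ((\<lambda>h. B h (e h i) (e h j)) \<longlongrightarrow> (if i = j then d i else 0)) F"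
    and d: "\<And>i. i \<in> I \<Longrightarrow> d i \<noteq> 0"
  shows "\<forall>\<^sub>F h in F. neg_index (V h) (\<lambda>z. B h z z) = card {i\<in>I. d i < 0} \<and>
                     pos_index (V h) (\<lambda>z. B h z z) = card {i\<in>I. d i > 0}"
proof -
  have "\<forall>\<^sub>F h in F. card {i\<in>I. d i < 0} \<le> neg_index (V h) (\<lambda>z. B h z z)"
    by (rule eventually_neg_index_ge[where e = e and d = d])
      (use I B lim in \<open>auto intro: eventually_mono[OF V]\<close>)
  moreover have "\<forall>\<^sub>F h in F. card {i\<in>I. d i > 0} \<le> neg_index (V h) (\<lambda>z. - B h z z)"
  proof (rule eventually_neg_index_ge[where e = e and d = "\<lambda>i. - d i" and B = "\<lambda>h x y. - B h x y"])
    fix i j assume "i \<in> {i\<in>I. d i > 0}" "j \<in> {i\<in>I. d i > 0}"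
    then have "((\<lambda>h. - B h (e h i) (e h j)) \<longlongrightarrow> - (if i = j then d i else 0)) F"
      by (intro tendsto_minus lim) auto
    then show "((\<lambda>h. - B h (e h i) (e h j)) \<longlongrightarrow> (if i = j then - d i else 0)) F"
      by (auto split: if_splits)
  qed (use I B bilinear_uminus in \<open>auto intro: eventually_mono[OF V]\<close>)
  ultimately show ?thesis using V
  proof eventually_elim
    case (elim h)
    have "card {i\<in>I. d i < 0} + card {i\<in>I. d i > 0} = card ({i\<in>I. d i < 0} \<union> {i\<in>I. d i > 0})"
      using I by (intro card_Un_disjoint[symmetric]) auto
    also have "{i\<in>I. d i < 0} \<union> {i\<in>I. d i > 0} = I" using d by force
    finally have "card {i\<in>I. d i < 0} + card {i\<in>I. d i > 0} = card I" .
    moreover have "neg_index (V h) (\<lambda>z. B h z z) + pos_index (V h) (\<lambda>z. B h z z) \<le> dim (V h)"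
      by (rule neg_index_add_pos_index_le_dim) (use elim B in \<open>auto simp: bilinear_lzero\<close>)
    ultimately show ?case using elim unfolding pos_index_def by linarith
  qed
qed

text \<open>
  Gram-Schmidt for a possibly degenerate form: split off a vector with \<open>B z z \<noteq> 0\<close> as long as there is one.
\<close>

lemma orthogonal_basis_exists:
  fixes V :: "'a::euclidean_space set"
  assumes B: "bilinear B" and "subspace V" and "\<And>z w. z \<in> V \<Longrightarrow> w \<in> V \<Longrightarrow> B z w = (B w z :: real)"
  shows "\<exists>C. finite C \<and> independent C \<and> span C = V \<and> (\<forall>b\<in>C. \<forall>b'\<in>C. b \<noteq> b' \<longrightarrow> B b b' = 0)"
  using assms(2,3)
proof (induction "dim V" arbitrary: V rule: less_induct)
  case less
  note add = bilinear_ladd[OF B] bilinear_radd[OF B] bilinear_lsub[OF B] bilinear_rsub[OF B]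
    and mul = bilinear_lmul[OF B] bilinear_rmul[OF B]
  show ?case
  proof (cases "\<forall>z\<in>V. B z z = 0")
    case True
    have z: "B z w = 0" if "z \<in> V" "w \<in> V" for z w
    proof -
      have "B (z + w) (z + w) = 0" using True less.prems that by (auto intro: subspace_add)
      then show ?thesis using True that less.prems(2)[of z w] by (simp add: add)
    qed
    obtain C where "C \<subseteq> V" "independent C" "V \<subseteq> span C" "card C = dim V" using basis_exists[of V] .
    then show ?thesis
      using z less.prems(1) span_minimal[of C V]
      by (intro exI[of _ C]) (auto simp: finiteI_independent subset_iff)
  next
    case False
    then obtain z where z: "z \<in> V" "B z z \<noteq> 0" by auto
    let ?V' = "{w \<in> V. B z w = 0}"
    have sub: "subspace ?V'"
      using less.prems(1) by (auto simp: subspace_def add mul bilinear_rzero[OF B])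
    have "?V' \<subset> V" using z by auto
    then have "dim ?V' < dim V"
      using sub less.prems(1) by (intro dim_psubset) (simp only: span_eq_iff[THEN iffD2])
    from less.hyps[OF this sub] less.prems obtain C where
      C: "finite C" "independent C" "span C = ?V'" "\<forall>b\<in>C. \<forall>b'\<in>C. b \<noteq> b' \<longrightarrow> B b b' = 0" by auto
    have zn: "z \<notin> span C" using z C by auto
    have CV: "C \<subseteq> ?V'" using C(3) span_superset by blast
    have sp: "span (insert z C) = V"
    proof
      show "span (insert z C) \<subseteq> V" using z CV less.prems(1) by (intro span_minimal) auto
      show "V \<subseteq> span (insert z C)"
      proof
        fix w assume w: "w \<in> V"
        have "w - (B z w / B z z) *\<^sub>R z \<in> ?V'"
          using z w less.prems(1) by (auto simp: add mul intro: subspace_diff subspace_scale)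
        then show "w \<in> span (insert z C)" unfolding C(3)[symmetric] span_breakdown_eq by blast
      qed
    qed
    have "B b b' = 0" if "b \<in> insert z C" "b' \<in> insert z C" "b \<noteq> b'" for b b'
      using that C(4) CV less.prems(2)[of b b'] z by auto
    then show ?thesis
      using C(1,2) zn sp independent_insertI[OF zn C(2)] by (intro exI[of _ "insert z C"]) simp
  qed
qed

lemma orthogonal_quadratic_sum:
  fixes B :: "'a::real_vector \<Rightarrow> 'a \<Rightarrow> real"
  assumes B: "bilinear B" and C: "finite C" "\<And>b b'. b \<in> C \<Longrightarrow> b' \<in> C \<Longrightarrow> b \<noteq> b' \<Longrightarrow> B b b' = 0"
  shows "B (\<Sum>b\<in>C. c b *\<^sub>R b) (\<Sum>b\<in>C. c b *\<^sub>R b) = (\<Sum>b\<in>C. (c b)\<^sup>2 * B b b)"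
proof -
  have "(\<Sum>b'\<in>C. c b * c b' * B b b') = (c b)\<^sup>2 * B b b" if "b \<in> C" for b
  proof -
    have "(\<Sum>b'\<in>C. c b * c b' * B b b') = (\<Sum>b'\<in>C. if b' = b then (c b)\<^sup>2 * B b b else 0)"
      using C(2) that by (intro sum.cong) (auto simp: power2_eq_square)
    also have "\<dots> = (c b)\<^sup>2 * B b b" using C(1) that by simp
    finally show ?thesis .
  qed
  then show ?thesis using bilinear_quadratic_sum[OF B, of c "\<lambda>b. b" C] by simp
qed

lemma diagonalises_orthogonal:
  fixes B :: "'a::euclidean_space \<Rightarrow> 'a \<Rightarrow> real"
  assumes B: "bilinear B" and C: "finite C" "independent C" "span C = V"
     "\<And>b b'. b \<in> C \<Longrightarrow> b' \<in> C \<Longrightarrow> b \<noteq> b' \<Longrightarrow> B b b' = 0"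
    and Q: "\<And>z. z \<in> V \<Longrightarrow> Q z = B z z"
  shows "diagonalises C V Q"
  unfolding diagonalises_def
proof (intro conjI allI)
  fix c :: "'a \<Rightarrow> real"
  have CV: "C \<subseteq> V" using C(3) span_superset by blast
  have "(\<Sum>b\<in>C. c b *\<^sub>R b) \<in> V" unfolding C(3)[symmetric] by (intro span_sum span_scale span_base)
  then show "Q (\<Sum>b\<in>C. c b *\<^sub>R b) = (\<Sum>b\<in>C. (c b)\<^sup>2 * Q b)"
    using orthogonal_quadratic_sum[OF B C(1,4), of c] Q CV by (auto intro!: sum.cong)
qed (use C in auto)

lemma neg_index_diagonalises:
  fixes V :: "'a::euclidean_space set"
  assumes "diagonalises C V Q"
  shows "neg_index V Q = card {b\<in>C. Q b < 0}"
proof (rule antisym)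
  have C: "finite C" "independent C" "span C = V"
    and Q: "\<And>c. Q (\<Sum>b\<in>C. c b *\<^sub>R b) = (\<Sum>b\<in>C. (c b)\<^sup>2 * Q b)"
    using assms by (auto simp: diagonalises_def)
  have CV: "C \<subseteq> V" and V: "subspace V" using C(3) span_superset subspace_span by auto
  have Q0: "Q 0 = 0" using Q[of "\<lambda>_. 0"] by simp
  have Qsub: "Q (\<Sum>b\<in>D. c b *\<^sub>R b) = (\<Sum>b\<in>D. (c b)\<^sup>2 * Q b)" if "D \<subseteq> C" for D c
  proof -
    have "(\<Sum>b\<in>D. c b *\<^sub>R b) = (\<Sum>b\<in>C. (if b \<in> D then c b else 0) *\<^sub>R b)"
      by (rule sum.mono_neutral_cong_left) (use that C in auto)
    moreover have "(\<Sum>b\<in>D. (c b)\<^sup>2 * Q b) = (\<Sum>b\<in>C. (if b \<in> D then c b else 0)\<^sup>2 * Q b)"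
      by (rule sum.mono_neutral_cong_left) (use that C in auto)
    ultimately show ?thesis using Q by simp
  qed
  show "card {b\<in>C. Q b < 0} \<le> neg_index V Q"
  proof (rule neg_index_ge_family[where e = "\<lambda>b. b"])
    fix c :: "'a \<Rightarrow> real" assume "\<exists>i\<in>{b \<in> C. Q b < 0}. c i \<noteq> 0"
    then obtain b0 where b0: "b0 \<in> C" "Q b0 < 0" "c b0 \<noteq> 0" by auto
    have "(\<Sum>b\<in>{b\<in>C. Q b < 0}. (c b)\<^sup>2 * Q b) < (\<Sum>b\<in>{b\<in>C. Q b < 0}. 0)"
      by (rule sum_strict_mono_ex1)
        (use b0 C in \<open>auto simp: mult_le_0_iff mult_less_0_iff intro!: bexI[of _ b0]\<close>)
    then show "Q (\<Sum>i\<in>{b\<in>C. Q b < 0}. c i *\<^sub>R i) < 0" using Qsub[of "{b\<in>C. Q b < 0}" c] by simp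
  qed (use C CV V Q0 in auto)
  let ?P = "{b\<in>C. \<not> Q b < 0}"
  have "neg_index V Q + dim (span ?P) \<le> dim V"
  proof (rule neg_index_add_nonneg_le)
    show "span ?P \<subseteq> V" using CV V by (intro span_minimal) auto
    fix z assume "z \<in> span ?P"
    then obtain u where "z = (\<Sum>v\<in>?P. u v *\<^sub>R v)" using span_finite[of ?P] C by auto
    then show "Q z \<ge> 0" using Qsub[of ?P u] by (auto intro!: sum_nonneg mult_nonneg_nonneg)
  qed (use V in auto)
  moreover have "dim (span ?P) = card ?P"
    using C independent_mono[of C ?P] by (simp add: dim_eq_card_independent)
  moreover have "dim V = card C" using C by (metis dim_eq_card_independent dim_span)
  moreover have "card C = card {b\<in>C. Q b < 0} + card ?P"
    using C(1) by (subst card_Un_disjoint[symmetric]) (auto intro: arg_cong[where f = card])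
  ultimately show "neg_index V Q \<le> card {b\<in>C. Q b < 0}" by linarith
qed

lemma pos_index_diagonalises:
  fixes V :: "'a::euclidean_space set"
  assumes "diagonalises C V Q"
  shows "pos_index V Q = card {b\<in>C. Q b > 0}"
proof -
  have "diagonalises C V (\<lambda>z. - Q z)"
    using assms by (auto simp: diagonalises_def sum_negf)
  from neg_index_diagonalises[OF this] show ?thesis by (simp add: pos_index_def)
qed

text \<open>
  Sylvester's law of inertia: every diagonalising basis counts the negative index, so the description
  by \<open>THE\<close> is meaningful.
\<close>

lemma neg_squares_eq:
  fixes V :: "'a::euclidean_space set"
  assumes "diagonalises C V Q"
  shows "neg_squares V Q = card {b\<in>C. Q b < 0}"
  unfolding neg_squares_def
proof (rule the_equality)
  show "\<exists>B. diagonalises B V Q \<and> card {b\<in>C. Q b < 0} = card {b\<in>B. Q b < 0}"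
    using assms by blast
  fix k assume "\<exists>B. diagonalises B V Q \<and> k = card {b\<in>B. Q b < 0}"
  then obtain B where "diagonalises B V Q" "k = card {b\<in>B. Q b < 0}" by blast
  then show "k = card {b\<in>C. Q b < 0}"
    using neg_index_diagonalises[of B V Q] neg_index_diagonalises[OF assms] by simp
qed

lemma pos_squares_eq:
  fixes V :: "'a::euclidean_space set"
  assumes "diagonalises C V Q"
  shows "pos_squares V Q = card {b\<in>C. Q b > 0}"
  unfolding pos_squares_def
proof (rule the_equality)
  show "\<exists>B. diagonalises B V Q \<and> card {b\<in>C. Q b > 0} = card {b\<in>B. Q b > 0}"
    using assms by blast
  fix k assume "\<exists>B. diagonalises B V Q \<and> k = card {b\<in>B. Q b > 0}"
  then obtain B where "diagonalises B V Q" "k = card {b\<in>B. Q b > 0}" by blast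
  then show "k = card {b\<in>C. Q b > 0}"
    using pos_index_diagonalises[of B V Q] pos_index_diagonalises[OF assms] by simp
qed

lemma nonneg_complement_exists:
  fixes V :: "'a::euclidean_space set"
  assumes B: "bilinear B" and V: "subspace V" and sym: "\<And>z w. z \<in> V \<Longrightarrow> w \<in> V \<Longrightarrow> B z w = (B w z :: real)"
  shows "\<exists>P. subspace P \<and> P \<subseteq> V \<and> (\<forall>z\<in>P. B z z \<ge> 0) \<and> neg_index V (\<lambda>z. B z z) + dim P = dim V"
proof -
  have "\<exists>C. finite C \<and> independent C \<and> span C = V \<and> (\<forall>b\<in>C. \<forall>b'\<in>C. b \<noteq> b' \<longrightarrow> B b b' = 0)"
    by (rule orthogonal_basis_exists[OF B V]) (rule sym)
  then obtain C where C: "finite C" "independent C" "span C = V" "\<forall>b\<in>C. \<forall>b'\<in>C. b \<noteq> b' \<longrightarrow> B b b' = 0"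
    by (elim exE conjE)
  let ?P = "{b\<in>C. \<not> B b b < 0}"
  have d: "diagonalises C V (\<lambda>z. B z z)"
    by (rule diagonalises_orthogonal[OF B C(1-3)]) (use C(4) in auto)
  have "dim (span ?P) = card ?P"
    using C independent_mono[of C ?P] by (simp add: dim_eq_card_independent)
  moreover have "dim V = card C" using C by (metis dim_eq_card_independent dim_span)
  moreover have "card C = card {b\<in>C. B b b < 0} + card ?P"
    using C(1) by (subst card_Un_disjoint[symmetric]) (auto intro: arg_cong[where f = card])
  ultimately have dd: "neg_index V (\<lambda>z. B z z) + dim (span ?P) = dim V"
    using neg_index_diagonalises[OF d] by simp
  show ?thesis
  proof (intro exI[of _ "span ?P"] conjI ballI subspace_span dd)
    show "span ?P \<subseteq> V" using C(3) span_superset by (intro span_minimal V) blast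
    fix z assume "z \<in> span ?P"
    then obtain u where "z = (\<Sum>v\<in>?P. u v *\<^sub>R v)" using span_finite[of ?P] C by auto
    moreover have "B (\<Sum>v\<in>?P. u v *\<^sub>R v) (\<Sum>v\<in>?P. u v *\<^sub>R v) = (\<Sum>v\<in>?P. (u v)\<^sup>2 * B v v)"
      by (rule orthogonal_quadratic_sum[OF B]) (use C in auto)
    ultimately show "B z z \<ge> 0" by (auto intro!: sum_nonneg mult_nonneg_nonneg)
  qed
qed

section \<open>Orthogonal projections onto convergent subspaces\<close>

lemma closest_point_subspace:
  fixes V :: "'a::euclidean_space set"
  assumes V: "subspace V"
  shows "closest_point V x \<in> V" and "v \<in> V \<Longrightarrow> (x - closest_point V x) \<bullet> v = 0"
proof -
  have ne: "closed V" "V \<noteq> {}" "convex V"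
    using V closed_subspace subspace_0 subspace_imp_convex by auto
  show c: "closest_point V x \<in> V" using ne closest_point_in_set by blast
  assume v: "v \<in> V"
  have "(x - closest_point V x) \<bullet> ((closest_point V x + s *\<^sub>R v) - closest_point V x) \<le> 0" for s
    by (rule closest_point_dot) (use ne V c v in \<open>auto intro: subspace_add subspace_scale\<close>)
  from this[of 1] this[of "-1"] show "(x - closest_point V x) \<bullet> v = 0" by simp
qed

lemma closest_point_subspace_unique:
  fixes V :: "'a::euclidean_space set"
  assumes V: "subspace V" and p: "p \<in> V" "\<And>v. v \<in> V \<Longrightarrow> (x - p) \<bullet> v = 0"
  shows "closest_point V x = p"
proof -
  let ?d = "p - closest_point V x"
  have "?d \<in> V" using V p closest_point_subspace(1) by (auto intro: subspace_diff)
  then have "(x - p) \<bullet> ?d = 0" "(x - closest_point V x) \<bullet> ?d = 0"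
    using p closest_point_subspace(2)[OF V] by auto
  then have "?d \<bullet> ?d = 0" by (simp add: inner_diff_left inner_diff_right)
  then show ?thesis by simp
qed

lemma closest_point_subspace_self: "subspace V \<Longrightarrow> v \<in> V \<Longrightarrow> closest_point V (v::'a::euclidean_space) = v"
  by (rule closest_point_subspace_unique) auto

lemma linear_closest_point:
  fixes V :: "'a::euclidean_space set"
  assumes V: "subspace V"
  shows "linear (closest_point V)"
proof (rule linearI)
  fix x y c
  show "closest_point V (x + y) = closest_point V x + closest_point V y"
    by (rule closest_point_subspace_unique[OF V])
      (use closest_point_subspace(2)[OF V, of _ x] closest_point_subspace(2)[OF V, of _ y] V
        closest_point_subspace(1)[OF V] in \<open>auto intro: subspace_add simp: inner_diff_left inner_add_left\<close>)
  show "closest_point V (c *\<^sub>R x) = c *\<^sub>R closest_point V x"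
    by (rule closest_point_subspace_unique[OF V])
      (use closest_point_subspace(2)[OF V, of _ x] V closest_point_subspace(1)[OF V] 
       in \<open>auto intro: subspace_scale simp flip: scaleR_diff_right\<close>)
qed

text \<open>
  Pointwise convergence of linear maps on a finite-dimensional space is convergence in operator norm.
\<close>

lemma linear_tendsto_uniform:
  fixes T :: "'t \<Rightarrow> 'a::euclidean_space \<Rightarrow> 'b::real_normed_vector"
  assumes lin: "\<forall>\<^sub>F t in F. linear (T t)" and T0: "linear T0"
    and lim: "\<And>b. b \<in> Basis \<Longrightarrow> ((\<lambda>t. T t b) \<longlongrightarrow> T0 b) F" and e: "e > 0"
  shows "\<forall>\<^sub>F t in F. \<forall>x. norm (T t x - T0 x) \<le> e * norm x"
proof -
  have "((\<lambda>t. \<Sum>b\<in>Basis. norm (T t b - T0 b)) \<longlongrightarrow> (\<Sum>b\<in>Basis. norm (T0 b - T0 b))) F"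
    by (intro tendsto_intros lim)
  then have "((\<lambda>t. \<Sum>b\<in>Basis. norm (T t b - T0 b)) \<longlongrightarrow> 0) F" by simp
  then have "\<forall>\<^sub>F t in F. (\<Sum>b\<in>Basis. norm (T t b - T0 b)) < e"
    using e by (rule order_tendstoD)
  with lin show ?thesis
  proof eventually_elim
    case (elim t)
    show ?case
    proof
      fix x :: 'a
      have L: "linear (\<lambda>x. T t x - T0 x)" using elim(1) T0 by (intro linear_compose_sub)
      have "T t x - T0 x = (\<Sum>b\<in>Basis. (x \<bullet> b) *\<^sub>R (T t b - T0 b))"
        using linear_sum[OF L, of "\<lambda>b. (x \<bullet> b) *\<^sub>R b" Basis] linear_cmul[OF L]
        by (simp add: euclidean_representation)
      also have "norm \<dots> \<le> (\<Sum>b\<in>Basis. norm x * norm (T t b - T0 b))"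
        by (intro sum_norm_le) (auto simp: Basis_le_norm mult_right_mono)
      also have "\<dots> = norm x * (\<Sum>b\<in>Basis. norm (T t b - T0 b))" by (simp add: sum_distrib_left)
      also have "\<dots> \<le> norm x * e" using elim(2) by (intro mult_left_mono) auto
      finally show "norm (T t x - T0 x) \<le> e * norm x" by (simp add: mult.commute)
    qed
  qed
qed

section \<open>Lagrangian subspaces and the charts of the Grassmannian\<close>

lemma symp_form_eq: "symp_form z w = inner (fst z) (snd w) - inner (snd z) (fst w)"
  by (cases z; cases w) (simp add: symp_form_def symp_J_def inner_minus_left)

lemma LagrD:
  assumes "V \<in> (Lagr :: 'm::finite symp set set)"
  shows "subspace V" "dim V = CARD('m)" "x \<in> V \<Longrightarrow> y \<in> V \<Longrightarrow> symp_form x y = 0"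
  using assms by (auto simp: Lagr_def)

text \<open>
  Convergence in the topology of the Grassmannian, along an arbitrary filter.
\<close>

definition lagr_tendsto :: "('t \<Rightarrow> 'm::finite symp set) \<Rightarrow> 'm symp set \<Rightarrow> 't filter \<Rightarrow> bool" where
  "lagr_tendsto H V F \<longleftrightarrow> (\<forall>\<^sub>F t in F. H t \<in> Lagr) \<and> V \<in> Lagr \<and>
     (\<forall>x. ((\<lambda>t. closest_point (H t) x) \<longlongrightarrow> closest_point V x) F)"

lemma lagr_tendstoD:
  assumes "lagr_tendsto H V F"
  shows "\<forall>\<^sub>F t in F. H t \<in> Lagr" "V \<in> Lagr" "((\<lambda>t. closest_point (H t) x) \<longlongrightarrow> closest_point V x) F"
    "v \<in> V \<Longrightarrow> ((\<lambda>t. closest_point (H t) v) \<longlongrightarrow> v) F"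
proof -
  show 1: "\<forall>\<^sub>F t in F. H t \<in> Lagr" "V \<in> Lagr" "((\<lambda>t. closest_point (H t) x) \<longlongrightarrow> closest_point V x) F" for x
    using assms by (simp_all add: lagr_tendsto_def del: split_paired_All)
  show "((\<lambda>t. closest_point (H t) v) \<longlongrightarrow> v) F" if "v \<in> V"
    using 1(3)[of v] closest_point_subspace_self[OF LagrD(1)[OF 1(2)] that] by simp
qed

text \<open>
  The distance to \<open>V\<close> is bounded below by \<open>c * norm z\<close> on the complementary subspace \<open>W\<close>, and the
  projections converge in operator norm; so transversality persists, with a uniform angle.
\<close>

lemma lagr_tendsto_disjoint:
  fixes V :: "'m::finite symp set"
  assumes H: "lagr_tendsto H V F" and W: "subspace W" "V \<inter> W = {0}"
  obtains c where "c > 0" "\<forall>\<^sub>F t in F. \<forall>z\<in>W. c * norm z \<le> norm (z - closest_point (H t) z)"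
proof -
  have V: "subspace V" using lagr_tendstoD(2)[OF H] LagrD by auto
  let ?f = "\<lambda>z. z - closest_point V z"
  have f: "bounded_linear ?f"
    by (intro linear_linear[THEN iffD2] linear_compose_sub linear_closest_point V linear_id[unfolded id_def])
  obtain c where c: "c > 0" "\<forall>x\<in>W. c * norm x \<le> norm (?f x)"
  proof -
    have "\<exists>e>0. \<forall>x\<in>W. e * norm x \<le> norm (?f x)"
    proof (rule injective_imp_isometric[OF closed_subspace[OF W(1)] W(1) f], intro ballI impI)
      fix x assume x: "x \<in> W" "?f x = 0"
      then have "x \<in> V" using closest_point_subspace(1)[OF V, of x] by simp
      then show "x = 0" using x W by auto
    qed
    then show ?thesis using that by (auto simp: mult.commute)
  qed
  have "\<forall>\<^sub>F t in F. \<forall>x. norm (closest_point (H t) x - closest_point V x) \<le> (c/2) * norm x"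
  proof (rule linear_tendsto_uniform)
    show "\<forall>\<^sub>F t in F. linear (closest_point (H t))"
      by (rule eventually_mono[OF lagr_tendstoD(1)[OF H]]) (rule linear_closest_point[OF LagrD(1)])
  qed (use lagr_tendstoD[OF H] linear_closest_point V c in auto)
  then have "\<forall>\<^sub>F t in F. \<forall>z\<in>W. (c/2) * norm z \<le> norm (z - closest_point (H t) z)"
  proof eventually_elim
    case (elim t)
    show ?case
    proof
      fix z assume z: "z \<in> W"
      have "c * norm z \<le> norm (?f z)" using c z by auto
      also have "\<dots> \<le> norm (z - closest_point (H t) z) + norm (closest_point (H t) z - closest_point V z)"
        using norm_triangle_ineq[of "z - closest_point (H t) z" "closest_point (H t) z - closest_point V z"] by simp
      also have "\<dots> \<le> norm (z - closest_point (H t) z) + (c/2) * norm z" using elim[rule_format, of z] by simp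
      finally show "(c/2) * norm z \<le> norm (z - closest_point (H t) z)" by simp
    qed
  qed
  with that[of "c/2"] c show ?thesis by simp
qed

text \<open>
  The boundary form of the Robin condition with parameter \<open>\<tau>\<close>. It is symmetric on Lagrangian planes; on
  \<open>{(A w, - w - \<tau> A w)}\<close> with symmetric \<open>A\<close> it is \<open>A w \<bullet> w\<close>.
\<close>

definition robin_form :: "real \<Rightarrow> 'm::finite symp \<Rightarrow> 'm symp \<Rightarrow> real" where
  "robin_form \<tau> z w = - inner (fst z) (snd w + \<tau> *\<^sub>R fst w)"

abbreviation robin_index :: "real \<Rightarrow> 'm::finite symp set \<Rightarrow> nat" where
  "robin_index \<tau> L \<equiv> neg_index L (\<lambda>z. robin_form \<tau> z z)"

text \<open>
  Transversality to the Lagrangian plane \<open>{(x, - \<tau> x)}\<close>.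
\<close>

definition chart :: "real \<Rightarrow> 'm::finite symp set \<Rightarrow> bool" where
  "chart \<tau> L \<longleftrightarrow> (\<forall>z\<in>L. snd z + \<tau> *\<^sub>R fst z = 0 \<longrightarrow> z = 0)"

text \<open>
  The product of the two linear expressions whose zero sets are \<open>{(x, - \<tau> x)}\<close> and \<open>{(x, - \<sigma> x)}\<close>; its index
  measures the change of the Robin index from \<open>\<tau>\<close> to \<open>\<sigma>\<close>.
\<close>

definition shift_form :: "real \<Rightarrow> real \<Rightarrow> 'm::finite symp \<Rightarrow> 'm symp \<Rightarrow> real" where
  "shift_form \<tau> \<sigma> z w = inner (snd z + \<tau> *\<^sub>R fst z) (snd w + \<sigma> *\<^sub>R fst w)"

lemma bilinear_robin_form: "bilinear (robin_form \<tau>)"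
  by (auto simp: bilinear_def robin_form_def inner_left_distrib inner_right_distrib algebra_simps intro!: linearI)

lemma bilinear_shift_form: "bilinear (shift_form \<tau> \<sigma>)"
  by (auto simp: bilinear_def shift_form_def inner_left_distrib inner_right_distrib algebra_simps intro!: linearI)

lemma robin_form_zero [simp]: "robin_form \<tau> 0 z = 0" "robin_form \<tau> z 0 = 0"
  by (simp_all add: robin_form_def)

lemma shift_form_zero [simp]: "shift_form \<tau> \<sigma> 0 z = 0"
  by (simp add: shift_form_def)

lemma robin_form_sym: "L \<in> Lagr \<Longrightarrow> z \<in> L \<Longrightarrow> w \<in> L \<Longrightarrow> robin_form \<tau> z w = robin_form \<tau> w z"
  using LagrD(3)[of L z w]
  by (simp add: robin_form_def symp_form_eq inner_right_distrib inner_commute)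

lemma shift_form_sym:
  assumes "L \<in> Lagr" "z \<in> L" "w \<in> L"
  shows "shift_form \<tau> \<sigma> z w = shift_form \<tau> \<sigma> w z"
proof -
  have e: "inner (fst z) (snd w) = inner (fst w) (snd z)"
    using LagrD(3)[OF assms] by (simp add: symp_form_eq inner_commute)
  show ?thesis
    using e by (simp add: shift_form_def inner_left_distrib inner_right_distrib inner_commute algebra_simps)
qed

text \<open>
  The map \<open>z \<mapsto> - snd z - \<tau> *\<^sub>R fst z\<close> is injective on a plane in the chart, hence bijective onto
  \<open>real^'m\<close> by dimension.
\<close>

lemma chart_param:
  fixes L :: "'m::finite symp set"
  assumes L: "L \<in> Lagr" and ch: "chart \<tau> L"
  shows "\<exists>g. linear g \<and> (\<forall>e. g e \<in> L) \<and> (\<forall>e. snd (g e) + \<tau> *\<^sub>R fst (g e) = - e) \<and>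
    (\<forall>z\<in>L. g (- snd z - \<tau> *\<^sub>R fst z) = z)"
proof -
  let ?f = "\<lambda>z::'m symp. - snd z - \<tau> *\<^sub>R fst z"
  have f: "linear ?f" by (auto intro!: linearI simp: algebra_simps)
  have inj: "inj_on ?f L"
  proof (rule inj_onI)
    fix z w assume zw: "z \<in> L" "w \<in> L" "?f z = ?f w"
    then have "z - w \<in> L" "snd (z - w) + \<tau> *\<^sub>R fst (z - w) = 0"
      using LagrD(1)[OF L] by (auto intro: subspace_diff simp: algebra_simps)
    then show "z = w" using ch by (auto simp: chart_def)
  qed
  obtain g where g: "g ` UNIV \<subseteq> L" "linear g" "\<forall>v\<in>L. g (?f v) = v"
    using linear_exists_left_inverse_on[OF f LagrD(1)[OF L] inj] by blast
  have "dim (?f ` L) = CARD('m)"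
    using dim_image_eq[OF f, of L] inj LagrD(1,2)[OF L] by (simp add: span_eq_iff[THEN iffD2])
  then have surj: "?f ` L = UNIV"
    using linear_subspace_image[OF f LagrD(1)[OF L]] subspace_dim_equal[of "?f ` L" UNIV]
    by (simp add: dim_UNIV)
  have "?f (g e) = e" for e
  proof -
    have "e \<in> ?f ` L" using surj by simp
    then obtain v where "v \<in> L" "e = ?f v" by (rule imageE)
    then show ?thesis using g(3) by simp
  qed
  then have fg: "?f (g e) = e" for e by simp
  have eq: "snd (g e) + \<tau> *\<^sub>R fst (g e) = - e" for e
    using arg_cong[OF fg[of e], of uminus] by (simp add: algebra_simps)
  show ?thesis
    by (intro exI[of _ g] conjI allI g(2,3) eq) (use g(1) in auto)
qed

text \<open>
  A change of the Robin parameter from \<open>\<tau>\<close> to \<open>\<sigma>\<close> adds the index of a second form on \<open>L\<close>.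
  On \<open>L \<times> L\<close> the form \<open>robin_form \<tau> \<oplus> shift_form \<tau> \<sigma>\<close> is, by completing the square, the pullback of
  \<open>robin_form \<sigma>\<close> under \<open>(a, b) \<mapsto> a - sqrt (\<sigma> - \<tau>) *\<^sub>R b\<close> plus the square of a vector that
  can be prescribed by the choice of \<open>b\<close>, since \<open>L\<close> is in the chart \<open>\<tau>\<close>. So the indices of the two
  sides agree.
\<close>

lemma robin_index_diff:
  fixes L :: "'m::finite symp set"
  assumes L: "L \<in> Lagr" and ch: "chart \<tau> L" and less: "\<tau> < \<sigma>"
  shows "robin_index \<sigma> L = robin_index \<tau> L + neg_index L (\<lambda>z. shift_form \<tau> \<sigma> z z)"
proof -
  note sub = LagrD(1)[OF L]
  define c where "c = \<sigma> - \<tau>"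
  define r where "r = sqrt c"
  have c: "c > 0" "r > 0" "r * r = c" "\<sigma> = \<tau> + c" using less by (auto simp: c_def r_def)
  (* completing the square *)
  have key: "robin_form \<tau> a a + shift_form \<tau> \<sigma> b b
     = (norm (- snd b - \<tau> *\<^sub>R fst b + r *\<^sub>R fst (a - r *\<^sub>R b)))\<^sup>2 + robin_form \<sigma> (a - r *\<^sub>R b) (a - r *\<^sub>R b)"
    if "a \<in> L" "b \<in> L" for a b
  proof -
    obtain ax ay bx "by" where ab: "a = (ax, ay)" "b = (bx, by)" by (cases a; cases b) auto
    have e: "inner bx ay = inner ax by"
      using LagrD(3)[OF L that] by (simp add: symp_form_eq ab inner_commute)
    have v: "- by - \<tau> *\<^sub>R bx + r *\<^sub>R (ax - r *\<^sub>R bx) = r *\<^sub>R ax - by - \<sigma> *\<^sub>R bx"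
      by (simp add: algebra_simps c)
    have 1: "robin_form \<tau> a a = - inner ax ay - \<tau> * inner ax ax"
      by (simp add: ab robin_form_def inner_right_distrib)
    have 2: "shift_form \<tau> \<sigma> b b = inner by by + (\<tau> + \<sigma>) * inner bx by + \<tau> * \<sigma> * inner bx bx"
      by (simp add: ab shift_form_def inner_right_distrib inner_left_distrib inner_commute[of "by" bx] ring_distribs)
    have 3: "(norm (r *\<^sub>R ax - by - \<sigma> *\<^sub>R bx))\<^sup>2 = (r * r) * inner ax ax + inner by by + \<sigma> * \<sigma> * inner bx bx
       - 2 * r * inner ax by - 2 * r * \<sigma> * inner ax bx + 2 * \<sigma> * inner bx by"
      by (simp add: power2_norm_eq_inner inner_diff_left inner_diff_right inner_commute[of "by" ax]
          inner_commute[of "by" bx] inner_commute[of bx ax] ring_distribs)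
    have 4: "robin_form \<sigma> (a - r *\<^sub>R b) (a - r *\<^sub>R b) = - inner ax ay + r * inner ax by - \<sigma> * inner ax ax
       + 2 * r * \<sigma> * inner ax bx + r * inner bx ay - (r * r) * inner bx by - (r * r) * \<sigma> * inner bx bx"
      by (simp add: ab robin_form_def inner_diff_left inner_diff_right inner_right_distrib
          inner_commute[of bx ax] ring_distribs)
    have "fst (a - r *\<^sub>R b) = ax - r *\<^sub>R bx" by (simp add: ab)
    show ?thesis
      unfolding 1 2 4 unfolding ab fst_conv snd_conv fst_diff fst_scaleR v 3
      unfolding c(3,4) e by (simp add: ring_distribs)
  qed
  (* negative subspaces for the two forms combine to one for the form with parameter \<sigma> *)
  have geq: "robin_index \<tau> L + neg_index L (\<lambda>z. shift_form \<tau> \<sigma> z z) \<le> robin_index \<sigma> L"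
  proof -
    obtain W1 where W1: "subspace W1" "W1 \<subseteq> L" "neg_def_on (\<lambda>z. robin_form \<tau> z z) W1" "dim W1 = robin_index \<tau> L"
      using neg_index_attained[OF sub] .
    obtain W2 where W2: "subspace W2" "W2 \<subseteq> L" "neg_def_on (\<lambda>z. shift_form \<tau> \<sigma> z z) W2"
        "dim W2 = neg_index L (\<lambda>z. shift_form \<tau> \<sigma> z z)"
      using neg_index_attained[OF sub] .
    let ?\<phi> = "\<lambda>p. fst p - r *\<^sub>R snd p :: 'm symp"
    have lin: "linear ?\<phi>" by (auto intro!: linearI simp: algebra_simps)
    have neg: "robin_form \<sigma> (?\<phi> p) (?\<phi> p) < 0" if p: "p \<in> W1 \<times> W2" "p \<noteq> 0" for p
    proof -
      obtain a b where ab: "p = (a, b)" "a \<in> W1" "b \<in> W2" using p by auto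
      have "robin_form \<tau> a a \<le> 0"
        using W1(3) ab by (cases "a = 0") (auto simp: neg_def_on_def less_imp_le)
      moreover have "shift_form \<tau> \<sigma> b b \<le> 0"
        using W2(3) ab by (cases "b = 0") (auto simp: neg_def_on_def less_imp_le)
      moreover have "robin_form \<tau> a a < 0 \<or> shift_form \<tau> \<sigma> b b < 0"
        using W1(3) W2(3) ab p(2) by (auto simp: neg_def_on_def zero_prod_def)
      moreover have "a \<in> L" "b \<in> L" using ab W1 W2 by auto
      ultimately show ?thesis using key[of a b]
          zero_le_power2[of "norm (- snd b - \<tau> *\<^sub>R fst b + r *\<^sub>R fst (a - r *\<^sub>R b))"]
        unfolding ab fst_conv snd_conv by linarith
    qed
    have S: "subspace (W1 \<times> W2)" using W1 W2 by (intro subspace_Times)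
    have inj: "inj_on ?\<phi> (W1 \<times> W2)"
    proof (rule linear_inj_on_iff_eq_0[OF lin S, THEN iffD2], intro ballI impI)
      fix p assume "p \<in> W1 \<times> W2" "?\<phi> p = 0"
      then show "p = 0" using neg[of p] by fastforce
    qed
    have "dim (?\<phi> ` (W1 \<times> W2)) \<le> robin_index \<sigma> L"
    proof (rule neg_index_ge)
      show "subspace (?\<phi> ` (W1 \<times> W2))" by (rule linear_subspace_image[OF lin S])
      show "?\<phi> ` (W1 \<times> W2) \<subseteq> L"
      proof
        fix z assume "z \<in> ?\<phi> ` (W1 \<times> W2)"
        then obtain a b where "z = a - r *\<^sub>R b" "a \<in> W1" "b \<in> W2" by force
        then show "z \<in> L" using subsetD[OF W1(2)] subsetD[OF W2(2)] sub by (simp add: subspace_diff subspace_scale)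
      qed
      show "neg_def_on (\<lambda>z. robin_form \<sigma> z z) (?\<phi> ` (W1 \<times> W2))"
        unfolding neg_def_on_def
      proof (intro ballI impI)
        fix z assume z: "z \<in> ?\<phi> ` (W1 \<times> W2)" "z \<noteq> 0"
        then obtain p where p: "p \<in> W1 \<times> W2" "z = ?\<phi> p" by blast
        have "p \<noteq> 0"
        proof
          assume "p = 0"
          then show False using p(2) z(2) by simp
        qed
        with neg p show "robin_form \<sigma> z z < 0" by simp
      qed
    qed
    moreover have "dim (?\<phi> ` (W1 \<times> W2)) = dim (W1 \<times> W2)"
      by (rule dim_image_eq[OF lin]) (simp only: span_eq_iff[THEN iffD2, OF S] inj)
    moreover have "dim (W1 \<times> W2) = dim W1 + dim W2" using W1 W2 by (intro dim_Times)
    ultimately show ?thesis using W1 W2 by simp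
  qed
  (* conversely, W lifts to L \<times> L so that the square in key vanishes *)
  have leq: "robin_index \<sigma> L \<le> robin_index \<tau> L + neg_index L (\<lambda>z. shift_form \<tau> \<sigma> z z)"
  proof -
    obtain W where W: "subspace W" "W \<subseteq> L" "neg_def_on (\<lambda>z. robin_form \<sigma> z z) W" "dim W = robin_index \<sigma> L"
      using neg_index_attained[OF sub] .
    have "\<exists>P. subspace P \<and> P \<subseteq> L \<and> (\<forall>z\<in>P. robin_form \<tau> z z \<ge> 0) \<and> robin_index \<tau> L + dim P = dim L"
      by (rule nonneg_complement_exists[OF bilinear_robin_form sub]) (rule robin_form_sym[OF L])
    then obtain P1 where P1: "subspace P1" "P1 \<subseteq> L" "\<forall>z\<in>P1. robin_form \<tau> z z \<ge> 0"
        "robin_index \<tau> L + dim P1 = dim L"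
      by (elim exE conjE)
    have "\<exists>P. subspace P \<and> P \<subseteq> L \<and> (\<forall>z\<in>P. shift_form \<tau> \<sigma> z z \<ge> 0) \<and>
        neg_index L (\<lambda>z. shift_form \<tau> \<sigma> z z) + dim P = dim L"
      by (rule nonneg_complement_exists[OF bilinear_shift_form sub]) (rule shift_form_sym[OF L])
    then obtain P2 where P2: "subspace P2" "P2 \<subseteq> L" "\<forall>z\<in>P2. shift_form \<tau> \<sigma> z z \<ge> 0"
        "neg_index L (\<lambda>z. shift_form \<tau> \<sigma> z z) + dim P2 = dim L"
      by (elim exE conjE)
    obtain g where g: "linear g" "\<forall>e. g e \<in> L" "\<forall>e. snd (g e) + \<tau> *\<^sub>R fst (g e) = - e"
      using chart_param[OF L ch] by (elim exE conjE)
    (* the choice that makes the squared vector in key equal to 0 *)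
    define b where "b z = g (- r *\<^sub>R fst z)" for z :: "'m symp"
    let ?\<psi> = "\<lambda>z. (z + r *\<^sub>R b z, b z)"
    have "linear (\<lambda>z::'m symp. - r *\<^sub>R fst z)" by (rule linearI) (simp_all add: scaleR_add_right)
    from linear_compose[OF this g(1)] have lb: "linear b" unfolding b_def o_def .
    have lin: "linear ?\<psi>"
    proof (rule linearI)
      fix x y k
      show "?\<psi> (x + y) = ?\<psi> x + ?\<psi> y" unfolding linear_add[OF lb] by (simp add: scaleR_add_right)
      show "?\<psi> (k *\<^sub>R x) = k *\<^sub>R ?\<psi> x" unfolding linear_cmul[OF lb] by (simp add: scaleR_add_right)
    qed
    have bL: "b z \<in> L" for z by (simp add: b_def g)
    have val: "robin_form \<tau> (z + r *\<^sub>R b z) (z + r *\<^sub>R b z) + shift_form \<tau> \<sigma> (b z) (b z) = robin_form \<sigma> z z"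
      if "z \<in> L" for z
    proof -
      have 0: "- snd (b z) - \<tau> *\<^sub>R fst (b z) + r *\<^sub>R fst z = 0"
      proof -
        have "snd (b z) + \<tau> *\<^sub>R fst (b z) = r *\<^sub>R fst z"
          using g(3)[rule_format, of "- r *\<^sub>R fst z"] by (simp add: b_def)
        moreover have "- snd (b z) - \<tau> *\<^sub>R fst (b z) = - (snd (b z) + \<tau> *\<^sub>R fst (b z))" by simp
        ultimately show ?thesis by (simp only: add.left_inverse)
      qed
      have "z + r *\<^sub>R b z \<in> L" using that bL sub by (intro subspace_add subspace_scale)
      moreover have "z + r *\<^sub>R b z - r *\<^sub>R b z = z" by simp
      ultimately show ?thesis
        using key[of "z + r *\<^sub>R b z" "b z"] bL[of z] by (simp only: 0) simp
    qed
    have inj: "inj_on ?\<psi> W"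
    proof (rule inj_onI)
      fix z w assume "?\<psi> z = ?\<psi> w" then show "z = w" by auto
    qed
    have "dim (?\<psi> ` W) + dim (P1 \<times> P2) \<le> dim (L \<times> L)"
    proof (rule dim_add_le_of_disjoint)
      show S: "subspace (?\<psi> ` W)" by (rule linear_subspace_image[OF lin W(1)])
      show S2: "subspace (P1 \<times> P2)" using P1 P2 by (intro subspace_Times)
      show "?\<psi> ` W \<subseteq> L \<times> L" using subsetD[OF W(2)] bL sub
        by (auto simp del: split_paired_All intro!: subspace_add subspace_scale)
      show "P1 \<times> P2 \<subseteq> L \<times> L" using P1 P2 by auto
      show "subspace (L \<times> L)" using sub by (intro subspace_Times)
      have zero: "p = 0" if "p \<in> ?\<psi> ` W" "p \<in> P1 \<times> P2" for p
      proof -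
        obtain z where z: "z \<in> W" "p = ?\<psi> z" using \<open>p \<in> ?\<psi> ` W\<close> by blast
        have "robin_form \<sigma> z z \<ge> 0"
          using val[of z] P1(3)[rule_format, of "fst p"] P2(3)[rule_format, of "snd p"] that(2) z subsetD[OF W(2) z(1)]
          by (simp add: mem_Times_iff)
        then have "z = 0" using W(3)[unfolded neg_def_on_def, rule_format, of z] z(1) by (metis not_less)
        then show "p = 0" using z(2) linear_0[OF lin] by (simp only:)
      qed
      show "?\<psi> ` W \<inter> (P1 \<times> P2) = {0}"
      proof (intro equalityI subsetI)
        fix p assume "p \<in> ?\<psi> ` W \<inter> (P1 \<times> P2)"
        then show "p \<in> {0}" using zero[of p] by (simp only: Int_iff singleton_iff)
      next
        fix p :: "'m symp \<times> 'm symp" assume "p \<in> {0}"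
        then show "p \<in> ?\<psi> ` W \<inter> (P1 \<times> P2)"
          using subspace_0[OF S] subspace_0[OF S2] by (simp only: Int_iff singleton_iff)
      qed
    qed
    moreover have "dim (?\<psi> ` W) = dim W"
      by (rule dim_image_eq[OF lin]) (simp only: span_eq_iff[THEN iffD2, OF W(1)] inj)
    moreover have "dim (P1 \<times> P2) = dim P1 + dim P2" using P1 P2 by (intro dim_Times)
    moreover have "dim (L \<times> L) = dim L + dim L" using sub by (intro dim_Times)
    ultimately show ?thesis using W P1 P2 by linarith
  qed
  from geq leq show ?thesis by simp
qed

lemma robin_index_le: "L \<in> Lagr \<Longrightarrow> robin_index \<tau> (L :: 'm::finite symp set) \<le> CARD('m)"
  using neg_index_add_pos_index_le_dim[of L "\<lambda>z. robin_form \<tau> z z"] LagrD[of L]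
  by (simp add: bilinear_lzero[OF bilinear_robin_form])

lemma robin_form_shift: "robin_form \<sigma> z z = robin_form \<tau> z z - (\<sigma> - \<tau>) * (norm (fst z))\<^sup>2"
  by (simp add: robin_form_def inner_right_distrib power2_norm_eq_inner algebra_simps)

lemma robin_index_mono:
  assumes "L \<in> Lagr" "\<tau> \<le> \<sigma>"
  shows "robin_index \<tau> L \<le> robin_index \<sigma> L"
proof -
  obtain W where W: "subspace W" "W \<subseteq> L" "neg_def_on (\<lambda>z. robin_form \<tau> z z) W" "dim W = robin_index \<tau> L"
    using neg_index_attained[OF LagrD(1)[OF assms(1)]] .
  have "neg_def_on (\<lambda>z. robin_form \<sigma> z z) W"
    unfolding neg_def_on_def
  proof (intro ballI impI)
    fix z assume "z \<in> W" "z \<noteq> 0"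
    then have "robin_form \<tau> z z < 0" using W(3) by (auto simp: neg_def_on_def)
    moreover have "(\<sigma> - \<tau>) * (norm (fst z))\<^sup>2 \<ge> 0" using assms by simp
    ultimately show "robin_form \<sigma> z z < 0" unfolding robin_form_shift[of \<sigma> z \<tau>] by linarith
  qed
  from neg_index_ge[OF W(1,2) this] W show ?thesis by simp
qed

text \<open>
  A vector \<open>(x, - \<tau> x)\<close> in \<open>L\<close> is in the radical of \<open>robin_form \<tau>\<close> on \<open>L\<close>, and it becomes negative as soon as
  the parameter increases.
\<close>

lemma robin_index_strict:
  fixes L :: "'m::finite symp set"
  assumes L: "L \<in> Lagr" and "\<tau> < \<sigma>" "\<not> chart \<tau> L"
  shows "robin_index \<tau> L < robin_index \<sigma> L"
proof -
  note sub = LagrD(1)[OF L]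
  note B = bilinear_robin_form
  obtain z where z: "z \<in> L" "snd z + \<tau> *\<^sub>R fst z = 0" "z \<noteq> 0" using assms by (auto simp: chart_def)
  have fz: "fst z \<noteq> 0" using z by (cases z) (auto simp: zero_prod_def)
  obtain W where W: "subspace W" "W \<subseteq> L" "neg_def_on (\<lambda>z. robin_form \<tau> z z) W" "dim W = robin_index \<tau> L"
    using neg_index_attained[OF sub] .
  have rz: "robin_form \<tau> v z = 0" for v using z by (simp add: robin_form_def)
  have rz': "robin_form \<tau> z v = 0" if "v \<in> L" for v using robin_form_sym[OF L z(1) that] rz by simp
  have "z \<notin> W" using W(3) rz[of z] z by (auto simp: neg_def_on_def)
  let ?U = "{x + y |x y. x \<in> W \<and> y \<in> span {z}}"
  have Wz: "W \<inter> span {z} = {0}"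
  proof -
    have "v = 0" if "v \<in> W" "v \<in> span {z}" for v
    proof -
      obtain k where "v = k *\<^sub>R z" using \<open>v \<in> span {z}\<close> by (auto simp: span_singleton)
      then have "robin_form \<tau> v v = 0" using rz by (simp add: bilinear_rmul[OF B])
      then show ?thesis using W(3) that by (auto simp: neg_def_on_def)
    qed
    then show ?thesis using subspace_0[OF W(1)] by (auto simp: span_zero)
  qed
  have "dim ?U + dim (W \<inter> span {z}) = dim W + dim (span {z})"
    by (rule dim_sums_Int[OF W(1) subspace_span])
  then have d: "dim ?U = dim W + 1" using Wz z by (simp add: dim_singleton)
  have "dim ?U \<le> robin_index \<sigma> L"
  proof (rule neg_index_ge)
    show "subspace ?U" by (rule subspace_sums[OF W(1) subspace_span])
    show "?U \<subseteq> L" proof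
      fix v assume "v \<in> ?U"
      then obtain x y where xy: "v = x + y" "x \<in> W" "y \<in> span {z}" by blast
      then obtain k where xk: "v = x + k *\<^sub>R z" by (auto simp: span_singleton)
      then show "v \<in> L" using subsetD[OF W(2) xy(2)] z(1) sub by (simp add: subspace_add subspace_scale)
    qed
    show "neg_def_on (\<lambda>z. robin_form \<sigma> z z) ?U"
      unfolding neg_def_on_def
    proof (intro ballI impI)
      fix v assume v: "v \<in> ?U" "v \<noteq> 0"
      then obtain x y where xy: "v = x + y" "x \<in> W" "y \<in> span {z}" by blast
      then obtain k where xk: "v = x + k *\<^sub>R z" by (auto simp: span_singleton)
      note xk = xk xy(2)
      have xL: "x \<in> L" using xk W by auto
      have eq: "robin_form \<tau> v v = robin_form \<tau> x x"
        using rz rz'[OF xL] unfolding xk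
        by (simp add: bilinear_ladd[OF B] bilinear_radd[OF B] bilinear_lmul[OF B] bilinear_rmul[OF B])
      have ge: "(\<sigma> - \<tau>) * (norm (fst v))\<^sup>2 \<ge> 0" using assms by simp
      show "robin_form \<sigma> v v < 0"
      proof (cases "x = 0")
        case True
        then have "fst v \<noteq> 0" using v xk fz by auto
        then have "(\<sigma> - \<tau>) * (norm (fst v))\<^sup>2 > 0" using assms by simp
        then show ?thesis unfolding robin_form_shift[of \<sigma> v \<tau>] eq
          using True by (simp add: bilinear_lzero[OF B])
      next
        case False
        then have "robin_form \<tau> x x < 0" using W(3) xk by (auto simp: neg_def_on_def)
        then show ?thesis unfolding robin_form_shift[of \<sigma> v \<tau>] eq using ge by linarith
      qed
    qed
  qed
  then show ?thesis using d W by simp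
qed

text \<open>
  Each excluded parameter makes the bounded monotone function \<open>\<tau> \<mapsto> robin_index \<tau> L\<close> jump.
\<close>

lemma finite_not_chart:
  fixes L :: "'m::finite symp set"
  assumes L: "L \<in> Lagr"
  shows "finite {\<tau>. \<not> chart \<tau> L}"
proof (rule finite_imageD)
  show "finite ((\<lambda>\<tau>. robin_index \<tau> L) ` {\<tau>. \<not> chart \<tau> L})"
    by (rule finite_subset[of _ "{..CARD('m)}"]) (use robin_index_le[OF L] in auto)
  show "inj_on (\<lambda>\<tau>. robin_index \<tau> L) {\<tau>. \<not> chart \<tau> L}"
  proof (rule inj_onI)
    fix \<tau> \<sigma> assume "\<tau> \<in> {\<tau>. \<not> chart \<tau> L}" "\<sigma> \<in> {\<tau>. \<not> chart \<tau> L}" "robin_index \<tau> L = robin_index \<sigma> L"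
    then show "\<tau> = \<sigma>"
      using robin_index_strict[OF L, of \<tau> \<sigma>] robin_index_strict[OF L, of \<sigma> \<tau>]
      by (cases \<tau> \<sigma> rule: linorder_cases) auto
  qed
qed

section \<open>A continuous angle on the Lagrangian Grassmannian\<close>

lemma orthogonal_null_vector:
  fixes B :: "'a::real_vector \<Rightarrow> 'a \<Rightarrow> real"
  assumes B: "bilinear B" and C: "\<And>b b'. b \<in> C \<Longrightarrow> b' \<in> C \<Longrightarrow> b \<noteq> b' \<Longrightarrow> B b b' = 0"
    and b: "b \<in> C" "B b b = 0" and w: "w \<in> span C"
  shows "B b w = 0"
proof -
  have "linear (B b)" using B by (simp add: bilinear_def)
  then show ?thesis
    by (rule linear_eq_0_on_span[OF _ _ w]) (metis C b)
qed

lemma chart_surj: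
  assumes "L \<in> Lagr" "chart \<tau> L"
  obtains z where "z \<in> L" "snd z + \<tau> *\<^sub>R fst z = e"
proof -
  obtain g where "\<forall>e. g e \<in> L" "\<forall>e. snd (g e) + \<tau> *\<^sub>R fst (g e) = - e"
    using chart_param[OF assms] by (elim exE conjE)
  then show ?thesis using that[of "g (- e)"] by simp
qed

lemma eventually_chart:
  fixes V :: "'a::finite symp set"
  assumes H: "lagr_tendsto H V F" and ch: "chart \<tau> V"
  shows "\<forall>\<^sub>F t in F. chart \<tau> (H t)"
proof -
  let ?W = "{z::'a symp. snd z + \<tau> *\<^sub>R fst z = 0}"
  note V = lagr_tendstoD(2)[OF H]
  have "linear (\<lambda>z::'a symp. snd z + \<tau> *\<^sub>R fst z)"
    by (rule linearI) (simp_all add: scaleR_add_right)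
  from linear_subspace_vimage[OF this subspace_single_0] have W: "subspace ?W" by (simp add: vimage_def)
  have VW: "V \<inter> ?W = {0}" using ch subspace_0[OF LagrD(1)[OF V]] by (auto simp: chart_def)
  obtain c where c: "c > 0" "\<forall>\<^sub>F t in F. \<forall>z\<in>?W. c * norm z \<le> norm (z - closest_point (H t) z)"
    by (rule lagr_tendsto_disjoint[OF H W VW])
  from c(2) lagr_tendstoD(1)[OF H] show ?thesis
  proof eventually_elim
    case (elim t)
    show ?case unfolding chart_def
    proof (intro ballI impI)
      fix z assume z: "z \<in> H t" "snd z + \<tau> *\<^sub>R fst z = 0"
      have "closest_point (H t) z = z" by (rule closest_point_subspace_self[OF LagrD(1)[OF elim(2)] z(1)])
      moreover have "c * norm z \<le> norm (z - closest_point (H t) z)" using elim(1) z(2) by blast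
      ultimately show "z = 0" using c(1) by (simp add: mult_le_0_iff)
    qed
  qed
qed

text \<open>
  Transversality to the planes of both parameters makes \<open>shift_form\<close> nondegenerate on \<open>V\<close>, and a
  nondegenerate form keeps its index under small perturbations of the space.
\<close>

lemma shift_index_locally_constant:
  fixes V :: "'m::finite symp set"
  assumes H: "lagr_tendsto H V F" and ch: "chart \<tau> V" "chart \<sigma> V"
  shows "\<forall>\<^sub>F t in F. neg_index (H t) (\<lambda>z. shift_form \<tau> \<sigma> z z) = neg_index V (\<lambda>z. shift_form \<tau> \<sigma> z z)"
proof -
  note V = lagr_tendstoD(2)[OF H]
  note B = bilinear_shift_form[of \<tau> \<sigma>]
  have "\<exists>C. finite C \<and> independent C \<and> span C = V \<and> (\<forall>b\<in>C. \<forall>b'\<in>C. b \<noteq> b' \<longrightarrow> shift_form \<tau> \<sigma> b b' = 0)"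
    by (rule orthogonal_basis_exists[OF B LagrD(1)[OF V]]) (rule shift_form_sym[OF V])
  then obtain C where C: "finite C" "independent C" "span C = V"
      "\<forall>b\<in>C. \<forall>b'\<in>C. b \<noteq> b' \<longrightarrow> shift_form \<tau> \<sigma> b b' = 0"
    by (elim exE conjE)
  have dg: "diagonalises C V (\<lambda>z. shift_form \<tau> \<sigma> z z)"
    by (rule diagonalises_orthogonal[OF B C(1-3)]) (use C(4) in auto)
  have CV: "b \<in> V" if "b \<in> C" for b using C(3) that span_base by blast
  have nz: "shift_form \<tau> \<sigma> b b \<noteq> 0" if b: "b \<in> C" for b
  proof
    assume 0: "shift_form \<tau> \<sigma> b b = 0"
    (* a radical vector pairs to 0 with everything, and snd w + \<sigma> *\<^sub>R fst w takes every value *)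
    obtain w where w: "w \<in> V" "snd w + \<sigma> *\<^sub>R fst w = snd b + \<tau> *\<^sub>R fst b"
      by (rule chart_surj[OF V ch(2)])
    have "shift_form \<tau> \<sigma> b w = 0"
      by (rule orthogonal_null_vector[OF B _ b 0]) (use C(3,4) w in auto)
    then have "snd b + \<tau> *\<^sub>R fst b = 0" unfolding shift_form_def w(2) by simp
    then have "b = 0" using ch(1) CV[OF b] unfolding chart_def by blast
    then show False using C(2) b dependent_zero by blast
  qed
  have "\<forall>\<^sub>F t in F. neg_index (H t) (\<lambda>z. shift_form \<tau> \<sigma> z z) = card {b\<in>C. shift_form \<tau> \<sigma> b b < 0} \<and>
      pos_index (H t) (\<lambda>z. shift_form \<tau> \<sigma> z z) = card {b\<in>C. shift_form \<tau> \<sigma> b b > 0}"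
  proof (rule eventually_neg_index_eq[where e = "\<lambda>t b. closest_point (H t) b" and B = "\<lambda>t. shift_form \<tau> \<sigma>"
        and d = "\<lambda>b. shift_form \<tau> \<sigma> b b" and I = C and V = H])
    have "card C = CARD('m)" using C(2,3) LagrD(2)[OF V] by (metis dim_eq_card_independent dim_span)
    then show "\<forall>\<^sub>F t in F. subspace (H t) \<and> dim (H t) = card C \<and> (\<forall>b\<in>C. closest_point (H t) b \<in> H t)"
      by (intro eventually_mono[OF lagr_tendstoD(1)[OF H]]) (simp add: LagrD closest_point_subspace(1))
    fix b b' assume b: "b \<in> C" "b' \<in> C"
    have "((\<lambda>t. shift_form \<tau> \<sigma> (closest_point (H t) b) (closest_point (H t) b')) \<longlongrightarrow> shift_form \<tau> \<sigma> b b') F"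
      unfolding shift_form_def by (intro tendsto_intros lagr_tendstoD(4)[OF H] CV b)
    then show "((\<lambda>t. shift_form \<tau> \<sigma> (closest_point (H t) b) (closest_point (H t) b')) \<longlongrightarrow>
        (if b = b' then shift_form \<tau> \<sigma> b b else 0)) F"
      using C(4) b by (cases "b = b'") auto
  qed (use C(1) B nz in auto)
  then show ?thesis
    by (rule eventually_mono) (simp add: neg_index_diagonalises[OF dg])
qed

lemma robin_index_diff_locally_constant:
  fixes V :: "'m::finite symp set"
  assumes H: "lagr_tendsto H V F" and ch: "chart \<tau> V" "chart \<sigma> V"
  shows "\<forall>\<^sub>F t in F. real (robin_index \<tau> (H t)) - real (robin_index \<sigma> (H t))
      = real (robin_index \<tau> V) - real (robin_index \<sigma> V)"
proof -
  have *: "\<forall>\<^sub>F t in F. real (robin_index \<tau> (H t)) - real (robin_index \<sigma> (H t))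
      = real (robin_index \<tau> V) - real (robin_index \<sigma> V)" if "\<tau> < \<sigma>" "chart \<tau> V" "chart \<sigma> V" for \<tau> \<sigma>
    using shift_index_locally_constant[OF H that(2,3)] lagr_tendstoD(1)[OF H] eventually_chart[OF H that(2)]
  proof eventually_elim
    case (elim t)
    then show ?case
      using robin_index_diff[OF elim(2,3) that(1)] robin_index_diff[OF lagr_tendstoD(2)[OF H] that(2,1)] by simp
  qed
  consider "\<tau> < \<sigma>" | "\<sigma> < \<tau>" | "\<tau> = \<sigma>" by linarith
  then show ?thesis
  proof cases
    case 2
    from *[OF 2 ch(2,1)] show ?thesis by (rule eventually_mono) simp
  qed (use *[of \<tau> \<sigma>] ch in auto)
qed

text \<open>
  Minus the Robin index averaged over the parameter, an angle in units of full turns.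
\<close>

definition robin_mean :: "'m::finite symp set \<Rightarrow> real" where
  "robin_mean L = - (LINT \<sigma>|restrict_space lborel {0..1}. real (robin_index \<sigma> L))"

text \<open>
  For each of the almost all parameters \<open>\<sigma>\<close> in which \<open>V\<close> is in the chart, \<open>robin_index \<tau> - robin_index \<sigma>\<close> is
  eventually constant along the sequence; dominated convergence does the rest.
\<close>

lemma robin_mean_add_index_tendsto:
  fixes V :: "'m::finite symp set"
  assumes H: "lagr_tendsto H V sequentially" and L: "\<And>n. H n \<in> Lagr" and ch: "chart \<tau> V"
  shows "(\<lambda>n. robin_mean (H n) + real (robin_index \<tau> (H n))) \<longlonglongrightarrow> robin_mean V + real (robin_index \<tau> V)"
proof -
  let ?M = "restrict_space lborel {0..1::real}"
  note V = lagr_tendstoD(2)[OF H]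
  have fin: "finite_measure ?M" by (rule finite_measureI) (simp add: space_restrict_space emeasure_restrict_space)
  have M1: "measure ?M (space ?M) = 1" by (simp add: space_restrict_space measure_restrict_space)
  have meas: "(\<lambda>\<sigma>. real (robin_index \<sigma> L)) \<in> borel_measurable ?M" if "L \<in> Lagr" for L :: "'m symp set"
  proof (rule measurable_restrict_space1)
    have "mono (\<lambda>\<sigma>. real (robin_index \<sigma> L))" using robin_index_mono[OF that] by (auto intro!: monoI)
    then show "(\<lambda>\<sigma>. real (robin_index \<sigma> L)) \<in> borel_measurable lborel"
      using borel_measurable_mono by simp
  qed
  have int: "integrable ?M (\<lambda>\<sigma>. real (robin_index \<sigma> L))" if "L \<in> Lagr" for L :: "'m symp set"
    by (rule finite_measure.integrable_const_bound[OF fin, of _ "real CARD('m)"])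
      (use robin_index_le[OF that] meas[OF that] in auto)
  have eq: "robin_mean L + real (robin_index \<tau> L) = (LINT \<sigma>|?M. real (robin_index \<tau> L) - real (robin_index \<sigma> L))"
    if "L \<in> Lagr" for L :: "'m symp set"
    using int[OF that] fin M1 by (simp add: robin_mean_def finite_measure.integrable_const)
  have "(\<lambda>n. LINT \<sigma>|?M. real (robin_index \<tau> (H n)) - real (robin_index \<sigma> (H n)))
      \<longlonglongrightarrow> (LINT \<sigma>|?M. real (robin_index \<tau> V) - real (robin_index \<sigma> V))"
  proof (rule integral_dominated_convergence[where w = "\<lambda>_. 2 * real CARD('m)"])
    show "integrable ?M (\<lambda>_. 2 * real CARD('m))" using fin by (simp add: finite_measure.integrable_const)
    (* only finitely many parameters are excluded *)
    have "AE \<sigma> in lborel. \<sigma> \<notin> {\<sigma>. \<not> chart \<sigma> V}"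
      by (intro AE_not_in finite_imp_null_set_lborel finite_not_chart V)
    then show "AE \<sigma> in ?M. (\<lambda>n. real (robin_index \<tau> (H n)) - real (robin_index \<sigma> (H n)))
        \<longlonglongrightarrow> real (robin_index \<tau> V) - real (robin_index \<sigma> V)"
      by (subst AE_restrict_space_iff)
        (auto elim!: eventually_mono intro!: tendsto_eventually robin_index_diff_locally_constant[OF H ch])
    fix n
    show "AE \<sigma> in ?M. norm (real (robin_index \<tau> (H n)) - real (robin_index \<sigma> (H n))) \<le> 2 * real CARD('m)"
    proof (rule AE_I2)
      fix \<sigma>
      show "norm (real (robin_index \<tau> (H n)) - real (robin_index \<sigma> (H n))) \<le> 2 * real CARD('m)"
        using robin_index_le[OF L[of n], of \<tau>] robin_index_le[OF L[of n], of \<sigma>] by simp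
    qed
  qed (use meas V L in \<open>auto intro!: borel_measurable_diff\<close>)
  then show ?thesis by (simp add: eq V L)
qed

lemma cont_family_tendsto:
  assumes "cont_family A H" "a \<in> A" "\<forall>n. x n \<in> A" "x \<longlonglongrightarrow> a"
  shows "lagr_tendsto (\<lambda>n. H (x n)) (H a) sequentially"
  unfolding lagr_tendsto_def
proof (intro conjI allI)
  fix z
  have "continuous_on A (\<lambda>t. closest_point (H t) z)" using assms unfolding cont_family_def by blast
  then show "(\<lambda>n. closest_point (H (x n)) z) \<longlonglongrightarrow> closest_point (H a) z"
    using continuous_on_tendsto_compose[OF _ assms(4,2)] assms(3) by (auto simp: eventually_sequentially)
qed (use assms in \<open>auto simp: cont_family_def\<close>)

lemma chart_exists:
  assumes "L \<in> (Lagr :: 'm::finite symp set set)"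
  obtains \<tau> where "chart \<tau> L"
proof -
  have "{\<tau>. \<not> chart \<tau> L} \<noteq> UNIV" using finite_not_chart[OF assms] infinite_UNIV_char_0 by metis
  then show ?thesis using that by auto
qed

text \<open>
  \<open>robin_mean\<close> itself jumps, but only by integers, because \<open>robin_mean + robin_index \<tau>\<close> is continuous in
  the chart \<open>\<tau>\<close> and the charts cover all Lagrangian planes. So \<open>exp (2 \<pi> i robin_mean)\<close> is continuous
  without zeros and has a logarithm on a contractible set.
\<close>

lemma robin_mean_lift:
  fixes A :: "'t::real_normed_vector set" and H :: "'t \<Rightarrow> 'm::finite symp set"
  assumes H: "cont_family A H" and A: "contractible A"
  obtains \<phi> where "continuous_on A \<phi>" "\<And>t. t \<in> A \<Longrightarrow> \<exists>k::int. \<phi> t = robin_mean (H t) + k"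
proof -
  let ?E = "\<lambda>t. exp (\<i> * complex_of_real (2 * pi * robin_mean (H t)))"
  have period: "exp (\<i> * complex_of_real (2 * pi * (x + real k))) = exp (\<i> * complex_of_real (2 * pi * x))" for x k
    unfolding exp_eq by (rule exI[of _ "int k"]) (simp add: algebra_simps)
  have "continuous_on A ?E"
    unfolding continuous_on_sequentially
  proof (intro allI ballI impI)
    fix x a assume a: "a \<in> A" and x: "(\<forall>n. x n \<in> A) \<and> x \<longlonglongrightarrow> a"
    have T: "lagr_tendsto (\<lambda>n. H (x n)) (H a) sequentially" using cont_family_tendsto[OF H a] x by blast
    obtain \<tau> where \<tau>: "chart \<tau> (H a)" using chart_exists[OF lagr_tendstoD(2)[OF T]] .
    have "(\<lambda>n. robin_mean (H (x n)) + real (robin_index \<tau> (H (x n)))) \<longlonglongrightarrow> robin_mean (H a) + real (robin_index \<tau> (H a))"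
      by (rule robin_mean_add_index_tendsto[OF T _ \<tau>]) (use H x in \<open>auto simp: cont_family_def\<close>)
    then have "(\<lambda>n. exp (\<i> * complex_of_real (2 * pi * (robin_mean (H (x n)) + real (robin_index \<tau> (H (x n)))))))
        \<longlonglongrightarrow> exp (\<i> * complex_of_real (2 * pi * (robin_mean (H a) + real (robin_index \<tau> (H a)))))"
      by (intro tendsto_exp tendsto_mult tendsto_of_real tendsto_const)
    then show "(?E \<circ> x) \<longlonglongrightarrow> ?E a" unfolding period o_def .
  qed
  then obtain g where g: "continuous_on A g" "\<And>t. t \<in> A \<Longrightarrow> ?E t = exp (g t)"
    using continuous_logarithm_on_contractible[OF _ A, of ?E] by auto
  show ?thesis
  proof (rule that[of "\<lambda>t. Im (g t) / (2 * pi)"])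
    show "continuous_on A (\<lambda>t. Im (g t) / (2 * pi))" by (intro continuous_intros g(1)) auto
    fix t assume t: "t \<in> A"
    obtain n :: int where "g t = \<i> * complex_of_real (2 * pi * robin_mean (H t)) + (of_int (2 * n) * pi) * \<i>"
      using g(2)[OF t] exp_eq by metis
    then have "Im (g t) = 2 * pi * robin_mean (H t) + 2 * of_int n * pi" by simp
    then have "Im (g t) / (2 * pi) = robin_mean (H t) + of_int n" by (simp add: field_simps)
    then show "\<exists>k::int. Im (g t) / (2 * pi) = robin_mean (H t) + k" by blast
  qed
qed

section \<open>Summation of jumps\<close>

text \<open>
  Bolzano's bisection principle glues the local information; in particular it yields that \<open>X\<close> has
  finitely many points in the interval, which makes the sum meaningful.
\<close>

lemma jump_sum:
  fixes D r l :: "real \<Rightarrow> int"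
  assumes ab: "a < b"
    and right: "\<And>t. t \<in> {a..b} \<Longrightarrow> \<forall>\<^sub>F x in at t within {t<..b}. D x - D t = r t \<and> x \<notin> X"
    and left: "\<And>t. t \<in> {a..b} \<Longrightarrow> \<forall>\<^sub>F x in at t within {a..<t}. D x - D t = l t \<and> x \<notin> X"
    and r: "\<And>t. t \<notin> X \<Longrightarrow> r t = 0" and l: "\<And>t. t \<notin> X \<Longrightarrow> l t = 0"
  shows "D b - D a = r a + (\<Sum>t\<in>{t\<in>{a<..<b}. t \<in> X}. r t - l t) - l b"
proof -
  (* the claim with its finiteness part, for all subintervals *)
  define P where "P x y \<longleftrightarrow> (a \<le> x \<and> x < y \<and> y \<le> b \<longrightarrow> finite {t\<in>{x<..<y}. t \<in> X} \<and>
      D y - D x = r x + (\<Sum>t\<in>{t\<in>{x<..<y}. t \<in> X}. r t - l t) - l y)" for x y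
  have "P a b"
  proof (rule Bolzano)
    show "a \<le> b" using ab by simp
    fix x y z assume xyz: "P x y" "P y z" "x \<le> y" "y \<le> z"
    show "P x z"
    proof (cases "x = y \<or> y = z")
      case False
      then have lt: "x < y" "y < z" using xyz by auto
      show ?thesis unfolding P_def
      proof (intro impI)
        assume "a \<le> x \<and> x < z \<and> z \<le> b"
        then have 1: "finite {t\<in>{x<..<y}. t \<in> X}" "D y - D x = r x + (\<Sum>t\<in>{t\<in>{x<..<y}. t \<in> X}. r t - l t) - l y"
          and 2: "finite {t\<in>{y<..<z}. t \<in> X}" "D z - D y = r y + (\<Sum>t\<in>{t\<in>{y<..<z}. t \<in> X}. r t - l t) - l z"
          using xyz lt by (auto simp: P_def)
        have un: "{t\<in>{x<..<z}. t \<in> X} = ({t\<in>{x<..<y}. t \<in> X} \<union> {t\<in>{y}. t \<in> X}) \<union> {t\<in>{y<..<z}. t \<in> X}"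
          using lt by auto
        have "(\<Sum>t\<in>{t\<in>{x<..<z}. t \<in> X}. r t - l t) = (\<Sum>t\<in>{t\<in>{x<..<y}. t \<in> X}. r t - l t)
           + (\<Sum>t\<in>{t\<in>{y}. t \<in> X}. r t - l t) + (\<Sum>t\<in>{t\<in>{y<..<z}. t \<in> X}. r t - l t)"
          unfolding un using 1(1) 2(1) lt by (subst sum.union_disjoint, auto, subst sum.union_disjoint, auto)
        moreover have "(\<Sum>t\<in>{t\<in>{y}. t \<in> X}. r t - l t) = r y - l y"
        proof (cases "y \<in> X")
          case True
          then have "{t\<in>{y}. t \<in> X} = {y}" by auto
          then show ?thesis by simp
        next
          case F: False
          then have "{t\<in>{y}. t \<in> X} = {}" by auto
          then show ?thesis using r[OF F] l[OF F] by simp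
        qed
        ultimately show "finite {t\<in>{x<..<z}. t \<in> X} \<and> D z - D x = r x + (\<Sum>t\<in>{t\<in>{x<..<z}. t \<in> X}. r t - l t) - l z"
          using 1 2 un by simp
      qed
    qed (use xyz in auto)
  next
    fix t assume t: "a \<le> t" "t \<le> b"
    obtain d1 where d1: "d1 > 0" "\<And>x. x \<in> {t<..b} \<Longrightarrow> dist x t < d1 \<Longrightarrow> D x - D t = r t \<and> x \<notin> X"
      using right[of t] t unfolding eventually_at by auto
    obtain d2 where d2: "d2 > 0" "\<And>x. x \<in> {a..<t} \<Longrightarrow> dist x t < d2 \<Longrightarrow> D x - D t = l t \<and> x \<notin> X"
      using left[of t] t unfolding eventually_at by auto
    show "\<exists>d>0. \<forall>x y. x \<le> t \<and> t \<le> y \<and> y - x < d \<longrightarrow> P x y"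
    proof (intro exI[of _ "min d1 d2"] conjI allI impI)
      fix x y assume xy: "x \<le> t \<and> t \<le> y \<and> y - x < min d1 d2"
      show "P x y" unfolding P_def
      proof (intro impI)
        assume h: "a \<le> x \<and> x < y \<and> y \<le> b"
        have R: "D s - D t = r t \<and> s \<notin> X" if "t < s" "s \<le> y" for s
          using d1(2)[of s] that xy h by (auto simp: dist_real_def)
        have L: "D s - D t = l t \<and> s \<notin> X" if "s < t" "x \<le> s" for s
          using d2(2)[of s] that xy h by (auto simp: dist_real_def)
        have sub: "{s\<in>{x<..<y}. s \<in> X} \<subseteq> {t}"
        proof
          fix s assume s: "s \<in> {s\<in>{x<..<y}. s \<in> X}"
          then show "s \<in> {t}" using R[of s] L[of s] by (cases s t rule: linorder_cases) auto
        qed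
        then have fin: "finite {s\<in>{x<..<y}. s \<in> X}" using finite_subset by blast
        consider "x = t" "t < y" | "x < t" "t = y" | "x < t" "t < y" using xy h by linarith
        then have "D y - D x = r x + (\<Sum>t\<in>{t\<in>{x<..<y}. t \<in> X}. r t - l t) - l y"
        proof cases
          case 1
          then have e: "{s\<in>{x<..<y}. s \<in> X} = {}" using sub by auto
          show ?thesis unfolding e using R[of y] l[of y] 1 by simp
        next
          case 2
          then have e: "{s\<in>{x<..<y}. s \<in> X} = {}" using sub by auto
          show ?thesis unfolding e using L[of x] r[of x] 2 by simp
        next
          case 3
          have "(\<Sum>t\<in>{t\<in>{x<..<y}. t \<in> X}. r t - l t) = r t - l t"
          proof (cases "t \<in> X")
            case True
            then have e: "{s\<in>{x<..<y}. s \<in> X} = {t}" using sub 3 by auto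
            show ?thesis unfolding e by simp
          next
            case False
            then have e: "{s\<in>{x<..<y}. s \<in> X} = {}" using sub by auto
            show ?thesis unfolding e using r[OF False] l[OF False] by simp
          qed
          then show ?thesis using R[of y] l[of y] L[of x] r[of x] 3 by simp
        qed
        with fin show "finite {s\<in>{x<..<y}. s \<in> X} \<and> D y - D x = r x + (\<Sum>t\<in>{t\<in>{x<..<y}. t \<in> X}. r t - l t) - l y"
          by simp
      qed
    qed (use d1 d2 in auto)
  qed
  then show ?thesis using ab by (simp add: P_def)
qed

section \<open>The crossing form and the jump of the index at a regular crossing\<close>

lemma has_vector_derivative_quotient:
  assumes "(f has_vector_derivative d) (at x within S)"
  shows "((\<lambda>y. (f y - f x) /\<^sub>R (y - x)) \<longlongrightarrow> d) (at x within S)"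
proof -
  have "((\<lambda>y. (1 / norm (y - x)) *\<^sub>R (f y - (f x + (y - x) *\<^sub>R d))) \<longlongrightarrow> 0) (at x within S)"
    using assms unfolding has_vector_derivative_def has_derivative_within by blast
  then have "((\<lambda>y. norm ((1 / norm (y - x)) *\<^sub>R (f y - (f x + (y - x) *\<^sub>R d)))) \<longlongrightarrow> 0) (at x within S)"
    by (rule tendsto_norm_zero)
  then have "((\<lambda>y. norm ((f y - f x) /\<^sub>R (y - x) - d)) \<longlongrightarrow> 0) (at x within S)"
  proof (rule Lim_transform_eventually)
    show "\<forall>\<^sub>F y in at x within S. norm ((1 / norm (y - x)) *\<^sub>R (f y - (f x + (y - x) *\<^sub>R d)))
        = norm ((f y - f x) /\<^sub>R (y - x) - d)"
      unfolding eventually_at_filter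
    proof (intro always_eventually allI impI)
      fix y assume y: "y \<noteq> x"
      have "(f y - f x) /\<^sub>R (y - x) - d = (1 / (y - x)) *\<^sub>R (f y - (f x + (y - x) *\<^sub>R d))"
        using y by (simp add: diff_diff_eq[symmetric] scaleR_diff_right divide_inverse)
      then show "norm ((1 / norm (y - x)) *\<^sub>R (f y - (f x + (y - x) *\<^sub>R d))) = norm ((f y - f x) /\<^sub>R (y - x) - d)"
        by simp
    qed
  qed
  then show ?thesis by (rule tendsto_norm_zero_cancel[THEN LIM_zero_cancel])
qed

lemma symp_form_add_left: "symp_form (x + y) z = symp_form x z + symp_form y z"
  and symp_form_add_right: "symp_form z (x + y) = symp_form z x + symp_form z y"
  and symp_form_diff_left: "symp_form (x - y) z = symp_form x z - symp_form y z"
  and symp_form_diff_right: "symp_form z (x - y) = symp_form z x - symp_form z y"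
  and symp_form_scale_left: "symp_form (c *\<^sub>R x) z = c * symp_form x z"
  and symp_form_scale_right: "symp_form z (c *\<^sub>R x) = c * symp_form z x"
  and symp_form_anti: "symp_form x z = - symp_form z x"
  by (simp_all add: symp_form_eq inner_left_distrib inner_right_distrib inner_diff_left inner_diff_right
      algebra_simps inner_commute)

lemma symp_form_zero: "symp_form x 0 = 0" "symp_form 0 x = 0"
  by (simp_all add: symp_form_eq)

lemma tendsto_symp_form:
  assumes "(f \<longlongrightarrow> x) F" "(g \<longlongrightarrow> y) F"
  shows "((\<lambda>t. symp_form (f t) (g t)) \<longlongrightarrow> symp_form x y) F"
  unfolding symp_form_eq by (intro tendsto_intros assms)

lemma subspace_Int_vertical: "V \<in> (Lagr :: 'm::finite symp set set) \<Longrightarrow> subspace (V \<inter> {0} \<times> UNIV)"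
  by (intro subspace_inter LagrD(1) subspace_Times subspace_single_0 subspace_UNIV)

text \<open>
  \<open>robin_form \<tau>\<close> on \<open>V\<close> has exactly the radical \<open>V \<inter> {0} \<times> UNIV\<close>. Lifts of a diagonalising basis of a complement
  keep their signs; the radical is taken care of by the curves \<open>\<kappa> t k\<close> divided by \<open>sqrt (\<rho> t)\<close>, which
  may diverge as long as their first components tend to \<open>0\<close>: the form only sees first components
  paired with something bounded, so the mixed terms disappear and \<open>m\<close> gives the remaining signs. The scale \<open>\<rho>\<close>
  is linear in the parameter at a regular crossing and quadratic in the degenerate case.
\<close>

theorem robin_index_perturb:
  fixes V :: "'m::finite symp set" and \<kappa> :: "'t \<Rightarrow> 'j \<Rightarrow> 'm symp"
  assumes V: "V \<in> Lagr" and ch: "chart \<tau> V" and L: "\<forall>\<^sub>F t in F. L t \<in> Lagr"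
    and lift: "\<And>b. b \<in> V \<Longrightarrow> \<exists>\<beta>. (\<beta> \<longlongrightarrow> b) F \<and> (\<forall>\<^sub>F t in F. \<beta> t \<in> L t)"
    and J: "finite J" "card J = dim (V \<inter> {0} \<times> UNIV)"
    and \<kappa>: "\<And>k. k \<in> J \<Longrightarrow> \<forall>\<^sub>F t in F. \<kappa> t k \<in> L t"
    and \<rho>: "\<forall>\<^sub>F t in F. \<rho> t > 0"
    and small: "\<And>k. k \<in> J \<Longrightarrow> ((\<lambda>t. fst (\<kappa> t k) /\<^sub>R sqrt (\<rho> t)) \<longlongrightarrow> 0) F"
    and form: "\<And>k k'. k \<in> J \<Longrightarrow> k' \<in> J \<Longrightarrow>
      ((\<lambda>t. robin_form \<tau> (\<kappa> t k) (\<kappa> t k') / \<rho> t) \<longlongrightarrow> (if k = k' then m k else 0)) F"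
    and m: "\<And>k. k \<in> J \<Longrightarrow> m k \<noteq> 0"
  shows "\<forall>\<^sub>F t in F. robin_index \<tau> (L t) = robin_index \<tau> V + card {k\<in>J. m k < 0} \<and> L t \<inter> {0} \<times> UNIV = {0}"
proof -
  let ?K = "V \<inter> {0} \<times> UNIV"
  note subV = LagrD(1)[OF V] and B = bilinear_robin_form[of \<tau>]
  have "\<exists>C. finite C \<and> independent C \<and> span C = V \<and> (\<forall>b\<in>C. \<forall>b'\<in>C. b \<noteq> b' \<longrightarrow> robin_form \<tau> b b' = 0)"
    by (rule orthogonal_basis_exists[OF B subV]) (rule robin_form_sym[OF V])
  then obtain C where C: "finite C" "independent C" "span C = V"
     "\<forall>b\<in>C. \<forall>b'\<in>C. b \<noteq> b' \<longrightarrow> robin_form \<tau> b b' = 0" by (elim exE conjE)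
  have CV: "b \<in> V" if "b \<in> C" for b using span_base[OF that] unfolding C(3) .
  have dg: "diagonalises C V (\<lambda>z. robin_form \<tau> z z)"
    by (rule diagonalises_orthogonal[OF B C(1-3)]) (use C(4) in auto)
  define C' where "C' = {b\<in>C. robin_form \<tau> b b \<noteq> 0}"
  have C': "finite C'" "\<And>b. b \<in> C' \<Longrightarrow> b \<in> V" using C(1) CV by (simp_all add: C'_def)
  have null: "b \<in> ?K" if b: "b \<in> C" "robin_form \<tau> b b = 0" for b
  proof -
    obtain w where w: "w \<in> V" "snd w + \<tau> *\<^sub>R fst w = fst b" by (rule chart_surj[OF V ch])
    have "robin_form \<tau> b w = 0" by (rule orthogonal_null_vector[OF B _ b]) (use C(3,4) w in auto)
    then have "fst b = 0" unfolding robin_form_def w(2) by simp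
    then show ?thesis using CV[OF b(1)] by (simp add: mem_Times_iff)
  qed
  have index_le: "neg_index U (\<lambda>z. robin_form \<tau> z z) + pos_index U (\<lambda>z. robin_form \<tau> z z) + dim (U \<inter> {0} \<times> UNIV) \<le> dim U"
    if U: "U \<in> Lagr" for U :: "'m symp set"
    by (rule neg_index_add_pos_index_le[OF LagrD(1)[OF U] B _ subspace_Int_vertical[OF U] Int_lower1])
      (rule robin_form_sym[OF U], assumption, assumption, simp add: robin_form_def mem_Times_iff)
  have cardC: "card C = CARD('m)" using C(2,3) LagrD(2)[OF V] by (metis dim_eq_card_independent dim_span)
  (* the null vectors of the orthogonal basis span the radical *)
  have cardI: "card C' + card J = CARD('m)"
  proof -
    have "card C = card C' + card (C - C')"
      using C(1) by (subst card_Un_disjoint[symmetric]) (auto simp: C'_def intro: arg_cong[where f = card])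
    moreover have "card (C - C') \<le> dim ?K"
    proof (rule independent_card_le_dim)
      show "C - C' \<subseteq> ?K"
      proof
        fix b assume "b \<in> C - C'"
        then have "b \<in> C" "robin_form \<tau> b b = 0" by (simp_all add: C'_def)
        then show "b \<in> ?K" by (rule null)
      qed
      show "independent (C - C')" by (rule independent_mono[OF C(2)]) blast
    qed
    moreover have "card C' + dim ?K \<le> CARD('m)"
    proof -
      have "card C' = card {b\<in>C. robin_form \<tau> b b < 0} + card {b\<in>C. robin_form \<tau> b b > 0}"
        using C(1) by (subst card_Un_disjoint[symmetric]) (auto simp: C'_def intro: arg_cong[where f = card])
      then show ?thesis
        using index_le[OF V] neg_index_diagonalises[OF dg] pos_index_diagonalises[OF dg] LagrD(2)[OF V] by simp
    qed
    ultimately show ?thesis using cardC J(2) by linarith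
  qed
  have "\<forall>b\<in>C'. \<exists>\<beta>. (\<beta> \<longlongrightarrow> b) F \<and> (\<forall>\<^sub>F t in F. \<beta> t \<in> L t)" using lift C'(2) by blast
  then obtain \<beta> where \<beta>: "\<And>b. b \<in> C' \<Longrightarrow> (\<beta> b \<longlongrightarrow> b) F" "\<And>b. b \<in> C' \<Longrightarrow> \<forall>\<^sub>F t in F. \<beta> b t \<in> L t"
    by metis
  let ?I = "C' <+> J"
  (* test vectors: lifts for the nondegenerate part, rescaled curves for the radical *)
  define e where "e t i = (case i of Inl b \<Rightarrow> \<beta> b t | Inr k \<Rightarrow> \<kappa> t k /\<^sub>R sqrt (\<rho> t))" for t and i :: "'m symp + 'j"
  define dd where "dd i = (case i of Inl b \<Rightarrow> robin_form \<tau> b b | Inr k \<Rightarrow> m k)" for i :: "'m symp + 'j"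
  have finI: "finite ?I" using C'(1) J(1) by simp
  have split: "card {i\<in>?I. P (dd i)} = card {b\<in>C'. P (robin_form \<tau> b b)} + card {k\<in>J. P (m k)}" for P
  proof -
    have "{i\<in>?I. P (dd i)} = {b\<in>C'. P (robin_form \<tau> b b)} <+> {k\<in>J. P (m k)}"
      by (auto simp: dd_def)
    then show ?thesis using C'(1) J(1) by (simp add: card_Plus)
  qed
  have ev: "\<forall>\<^sub>F t in F. neg_index (L t) (\<lambda>z. robin_form \<tau> z z) = card {i\<in>?I. dd i < 0} \<and>
      pos_index (L t) (\<lambda>z. robin_form \<tau> z z) = card {i\<in>?I. dd i > 0}"
  proof (rule eventually_neg_index_eq[where e = e and B = "\<lambda>t. robin_form \<tau>" and V = L, OF finI B])
    have 1: "\<forall>\<^sub>F t in F. \<forall>b\<in>C'. \<beta> b t \<in> L t" using \<beta>(2) C'(1) by (simp add: eventually_ball_finite)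
    have 2: "\<forall>\<^sub>F t in F. \<forall>k\<in>J. \<kappa> t k \<in> L t" using \<kappa> J(1) by (simp add: eventually_ball_finite)
    show "\<forall>\<^sub>F t in F. subspace (L t) \<and> dim (L t) = card ?I \<and> (\<forall>i\<in>?I. e t i \<in> L t)"
      using L 1 2
    proof eventually_elim
      case (elim t)
      have "e t i \<in> L t" if "i \<in> ?I" for i
        using that elim(2,3) subspace_scale[OF LagrD(1)[OF elim(1)]] unfolding e_def by (elim PlusE) simp_all
      then show ?case using LagrD(1,2)[OF elim(1)] C'(1) J(1) cardI by (simp add: card_Plus)
    qed
    show "dd i \<noteq> 0" if "i \<in> ?I" for i using that m by (auto simp: dd_def C'_def)
    have mixed: "((\<lambda>t. robin_form \<tau> (\<kappa> t k /\<^sub>R sqrt (\<rho> t)) (\<beta> b t)) \<longlongrightarrow> 0) F" if k: "k \<in> J" and b: "b \<in> C'" for k b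
    proof -
      have "((\<lambda>t. - inner (fst (\<kappa> t k) /\<^sub>R sqrt (\<rho> t)) (snd (\<beta> b t) + \<tau> *\<^sub>R fst (\<beta> b t))) \<longlongrightarrow> - inner 0 (snd b + \<tau> *\<^sub>R fst b)) F"
        by (intro tendsto_intros small[OF k] \<beta>(1)[OF b])
      then show ?thesis by (simp add: robin_form_def)
    qed
    fix i j assume "i \<in> ?I" "j \<in> ?I"
    then consider b b' where "i = Inl b" "j = Inl b'" "b \<in> C'" "b' \<in> C'"
      | b k where "i = Inl b" "j = Inr k" "b \<in> C'" "k \<in> J"
      | b k where "i = Inr k" "j = Inl b" "b \<in> C'" "k \<in> J"
      | k k' where "i = Inr k" "j = Inr k'" "k \<in> J" "k' \<in> J" by blast
    then show "((\<lambda>t. robin_form \<tau> (e t i) (e t j)) \<longlongrightarrow> (if i = j then dd i else 0)) F"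
    proof cases
      case 1
      have "((\<lambda>t. robin_form \<tau> (\<beta> b t) (\<beta> b' t)) \<longlongrightarrow> robin_form \<tau> b b') F"
        unfolding robin_form_def by (intro tendsto_intros \<beta>(1) 1)
      moreover have "robin_form \<tau> b b' = (if i = j then dd i else 0)"
        using C(4) 1 by (simp add: dd_def C'_def)
      ultimately show ?thesis using 1 by (simp add: e_def)
    next
      case 2
      have "\<forall>\<^sub>F t in F. robin_form \<tau> (\<kappa> t k /\<^sub>R sqrt (\<rho> t)) (\<beta> b t) = robin_form \<tau> (e t i) (e t j)"
        using L \<beta>(2)[OF 2(3)] \<kappa>[OF 2(4)]
      proof eventually_elim
        case (elim t)
        show ?case unfolding e_def 2(1,2) sum.case
          by (rule robin_form_sym[OF elim(1) subspace_scale[OF LagrD(1)[OF elim(1)] elim(3)] elim(2)])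
      qed
      from Lim_transform_eventually[OF mixed[OF 2(4,3)] this] show ?thesis using 2 by simp
    next
      case 3
      then show ?thesis using mixed[OF 3(4,3)] by (simp add: e_def)
    next
      case 4
      have "\<forall>\<^sub>F t in F. robin_form \<tau> (\<kappa> t k) (\<kappa> t k') / \<rho> t = robin_form \<tau> (e t i) (e t j)"
        using \<rho>
      proof eventually_elim
        case (elim t)
        have "inverse (sqrt (\<rho> t)) * inverse (sqrt (\<rho> t)) = inverse (\<rho> t)"
          using elim by (simp flip: inverse_mult_distrib)
        then show ?case unfolding e_def 4(1,2) sum.case bilinear_lmul[OF B] bilinear_rmul[OF B] real_scaleR_def
          by (simp add: divide_inverse mult.assoc[symmetric] mult.commute)
      qed
      moreover have "(if k = k' then m k else 0) = (if i = j then dd i else 0)" using 4 by (simp add: dd_def)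
      ultimately show ?thesis using Lim_transform_eventually[OF form[OF 4(3,4)]] by simp
    qed
  qed
  have neg: "card {b\<in>C'. robin_form \<tau> b b < 0} = robin_index \<tau> V"
    unfolding neg_index_diagonalises[OF dg] by (rule arg_cong[where f = card]) (auto simp: C'_def)
  have sum: "card {i\<in>?I. dd i < 0} + card {i\<in>?I. dd i > 0} = CARD('m)"
  proof -
    have "card {i\<in>?I. dd i < 0} + card {i\<in>?I. dd i > 0} = card ({i\<in>?I. dd i < 0} \<union> {i\<in>?I. dd i > 0})"
      using finI by (intro card_Un_disjoint[symmetric]) auto
    also have "{i\<in>?I. dd i < 0} \<union> {i\<in>?I. dd i > 0} = ?I"
      using m by (auto simp: dd_def C'_def) (metis linorder_neqE_linordered_idom)
    finally show ?thesis using cardI C'(1) J(1) by (simp add: card_Plus)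
  qed
  from ev L show ?thesis
  proof eventually_elim
    case (elim t)
    have "dim (L t \<inter> {0} \<times> UNIV) = 0" using index_le[OF elim(2)] elim(1) sum LagrD(2)[OF elim(2)] by linarith
    then have "L t \<inter> {0} \<times> UNIV = {0}"
      using subspace_0[OF subspace_Int_vertical[OF elim(2)]] unfolding dim_eq_0 by blast
    then show ?case using elim(1) split[of "\<lambda>x. x < 0"] neg by simp
  qed
qed

definition proj_deriv :: "(real \<Rightarrow> 'm::finite symp set) \<Rightarrow> real set \<Rightarrow> real \<Rightarrow> 'm symp \<Rightarrow> 'm symp" where
  "proj_deriv \<Gamma> I t0 x = vector_derivative (\<lambda>t. closest_point (\<Gamma> t) x) (at t0 within I)"

context
  fixes \<Gamma> :: "real \<Rightarrow> 'm::finite symp set" and a b t0 :: real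
  assumes path: "C1_path \<Gamma> a b" and ab: "a < b" and t0: "t0 \<in> {a..b}"
begin

lemma path_Lagr: "t \<in> {a..b} \<Longrightarrow> \<Gamma> t \<in> Lagr"
  using path by (simp add: C1_path_def)

lemma path_eventually_mem: "\<forall>\<^sub>F t in at t0 within {a..b}. t \<in> {a..b}"
  by (auto simp: eventually_at_filter)

lemma path_filter_nontrivial: "at t0 within {a..b} \<noteq> bot"
  using ab t0 by (simp add: trivial_limit_within islimpt_Icc)

lemma proj_has_deriv:
  "((\<lambda>t. closest_point (\<Gamma> t) x) has_vector_derivative proj_deriv \<Gamma> {a..b} t0 x) (at t0 within {a..b})"
proof -
  obtain d where "\<forall>t\<in>{a..b}. ((\<lambda>t. closest_point (\<Gamma> t) x) has_vector_derivative d t) (at t within {a..b})"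
    using path unfolding C1_path_def by blast
  then have "((\<lambda>t. closest_point (\<Gamma> t) x) has_vector_derivative d t0) (at t0 within {a..b})" using t0 by blast
  moreover from vector_derivative_within_closed_interval[OF ab t0 this]
  have "proj_deriv \<Gamma> {a..b} t0 x = d t0" unfolding proj_deriv_def .
  ultimately show ?thesis by simp
qed

lemma linear_proj_deriv: "linear (proj_deriv \<Gamma> {a..b} t0)"
proof (rule linearI)
  have P: "linear (closest_point (\<Gamma> t))" if "t \<in> {a..b}" for t
    using linear_closest_point[OF LagrD(1)[OF path_Lagr[OF that]]] .
  fix x y c
  have "((\<lambda>t. closest_point (\<Gamma> t) (x + y)) has_vector_derivative
      proj_deriv \<Gamma> {a..b} t0 x + proj_deriv \<Gamma> {a..b} t0 y) (at t0 within {a..b})"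
    by (rule has_vector_derivative_transform[OF t0 _ has_vector_derivative_add[OF proj_has_deriv proj_has_deriv]])
      (simp add: linear_add[OF P])
  from vector_derivative_within_closed_interval[OF ab t0 this]
  show "proj_deriv \<Gamma> {a..b} t0 (x + y) = proj_deriv \<Gamma> {a..b} t0 x + proj_deriv \<Gamma> {a..b} t0 y"
    by (simp add: proj_deriv_def)
  have "((\<lambda>t. closest_point (\<Gamma> t) (c *\<^sub>R x)) has_vector_derivative
      c *\<^sub>R proj_deriv \<Gamma> {a..b} t0 x) (at t0 within {a..b})"
    by (rule has_vector_derivative_transform[OF t0 _ bounded_linear.has_vector_derivative[OF bounded_linear_scaleR_right proj_has_deriv]])
      (simp add: linear_cmul[OF P])
  from vector_derivative_within_closed_interval[OF ab t0 this]
  show "proj_deriv \<Gamma> {a..b} t0 (c *\<^sub>R x) = c *\<^sub>R proj_deriv \<Gamma> {a..b} t0 x"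
    by (simp add: proj_deriv_def)
qed

lemma path_lagr_tendsto: "lagr_tendsto \<Gamma> (\<Gamma> t0) (at t0 within {a..b})"
  unfolding lagr_tendsto_def
proof (intro conjI allI)
  show "\<forall>\<^sub>F t in at t0 within {a..b}. \<Gamma> t \<in> Lagr"
    by (rule eventually_mono[OF path_eventually_mem path_Lagr])
  show "((\<lambda>t. closest_point (\<Gamma> t) x) \<longlongrightarrow> closest_point (\<Gamma> t0) x) (at t0 within {a..b})" for x
    using has_vector_derivative_continuous[OF proj_has_deriv[of x]] unfolding continuous_within .
qed (rule path_Lagr[OF t0])

lemma proj_self: "q \<in> \<Gamma> t0 \<Longrightarrow> closest_point (\<Gamma> t0) q = q"
  using closest_point_subspace_self[OF LagrD(1)[OF path_Lagr[OF t0]]] .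

lemma proj_quotient:
  assumes "q \<in> \<Gamma> t0"
  shows "((\<lambda>t. (closest_point (\<Gamma> t) q - q) /\<^sub>R (t - t0)) \<longlongrightarrow> proj_deriv \<Gamma> {a..b} t0 q) (at t0 within {a..b})"
  using has_vector_derivative_quotient[OF proj_has_deriv[of q]] proj_self[OF assms] by simp

text \<open>
  Differentiate \<open>symp_form (P\<^sub>t k) (P\<^sub>t k') = 0\<close>, where \<open>P\<^sub>t\<close> projects onto \<open>\<Gamma> t\<close>.
\<close>

lemma symp_proj_deriv_sym:
  assumes "k \<in> \<Gamma> t0" "k' \<in> \<Gamma> t0"
  shows "symp_form k' (proj_deriv \<Gamma> {a..b} t0 k) = symp_form k (proj_deriv \<Gamma> {a..b} t0 k')"
proof -
  let ?P = "\<lambda>t. closest_point (\<Gamma> t)" and ?d = "proj_deriv \<Gamma> {a..b} t0"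
  have "((\<lambda>t. symp_form ((?P t k - k) /\<^sub>R (t - t0)) (?P t k') + symp_form k ((?P t k' - k') /\<^sub>R (t - t0)))
      \<longlongrightarrow> symp_form (?d k) k' + symp_form k (?d k')) (at t0 within {a..b})"
    by (intro tendsto_add tendsto_symp_form proj_quotient lagr_tendstoD(4)[OF path_lagr_tendsto] assms tendsto_const)
  moreover have "\<forall>\<^sub>F t in at t0 within {a..b}.
      symp_form ((?P t k - k) /\<^sub>R (t - t0)) (?P t k') + symp_form k ((?P t k' - k') /\<^sub>R (t - t0)) = 0"
    using path_eventually_mem
  proof eventually_elim
    case (elim t)
    note L = path_Lagr[OF elim]
    have "symp_form (?P t k) (?P t k') = 0"
      by (intro LagrD(3)[OF L] closest_point_subspace(1) LagrD(1)[OF L])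
    moreover have "symp_form k k' = 0" using LagrD(3)[OF path_Lagr[OF t0] assms] .
    ultimately show ?case
      by (simp add: symp_form_scale_left symp_form_scale_right symp_form_diff_left symp_form_diff_right algebra_simps)
  qed
  ultimately have "((\<lambda>t. 0) \<longlongrightarrow> symp_form (?d k) k' + symp_form k (?d k')) (at t0 within {a..b})"
    by (rule Lim_transform_eventually)
  then have "symp_form (?d k) k' + symp_form k (?d k') = 0"
    by (rule tendsto_unique[OF path_filter_nontrivial _ tendsto_const])
  then show ?thesis using symp_form_anti[of "?d k" k'] by simp
qed

text \<open>
  The crossing form through the derivative of the orthogonal projections, in place of graph maps over a
  complement chosen by \<open>SOME\<close>. Since \<open>symp_form (P\<^sub>t q) (q + R\<^sub>t q) = 0\<close>, the values
  \<open>symp_form q (R\<^sub>t q)\<close> and \<open>symp_form q (P\<^sub>t q - q)\<close> differ by a product of two small terms.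
\<close>

lemma crossing_form_eq:
  assumes q: "q \<in> \<Gamma> t0"
  shows "crossing_form \<Gamma> {a..b} t0 q = symp_form q (proj_deriv \<Gamma> {a..b} t0 q)"
proof -
  let ?V = "\<Gamma> t0" and ?P = "\<lambda>t. closest_point (\<Gamma> t)" and ?F = "at t0 within {a..b}"
  define W where "W = (SOME W. is_complement ?V W)"
  note V = path_Lagr[OF t0] and subV = LagrD(1)[OF path_Lagr[OF t0]]
  (* some complement exists, so the chosen one is a complement *)
  have "is_complement ?V {y. \<forall>x\<in>?V. inner x y = 0}"
    unfolding is_complement_def
  proof (intro conjI allI)
    show "subspace {y. \<forall>x\<in>?V. inner x y = 0}"
      by (auto simp: subspace_def inner_right_distrib simp del: split_paired_All)
    show "?V \<inter> {y. \<forall>x\<in>?V. inner x y = 0} = {0}"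
    proof (intro equalityI subsetI)
      fix x assume "x \<in> ?V \<inter> {y. \<forall>x\<in>?V. inner x y = 0}"
      then have "inner x x = 0" by blast
      then show "x \<in> {0}" by simp
    qed (use subspace_0[OF subV] in simp)
    fix x
    have "x = ?P t0 x + (x - ?P t0 x)" by simp
    moreover have "x - ?P t0 x \<in> {y. \<forall>x\<in>?V. inner x y = 0}"
      using closest_point_subspace(2)[OF subV] by (simp add: inner_commute)
    ultimately show "\<exists>v\<in>?V. \<exists>w\<in>{y. \<forall>x\<in>?V. inner x y = 0}. x = v + w"
      using closest_point_subspace(1)[OF subV] by blast
  qed
  then have "is_complement ?V W" unfolding W_def by (rule someI)
  then have compl: "subspace W \<and> ?V \<inter> W = {0} \<and> (\<forall>x. \<exists>v\<in>?V. \<exists>w\<in>W. x = v + w)"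
    unfolding is_complement_def .
  note W = compl[THEN conjunct1] compl[THEN conjunct2, THEN conjunct1] compl[THEN conjunct2, THEN conjunct2, THEN spec]
  have dimW: "dim W = CARD('m)"
  proof -
    have "{x + y |x y. x \<in> ?V \<and> y \<in> W} = UNIV" using W(3) by blast
    then have "DIM('m symp) + dim (?V \<inter> W) = dim ?V + dim W"
      using dim_sums_Int[OF subV W(1)] by simp
    then show ?thesis using W(2) LagrD(2)[OF V] by simp
  qed
  obtain c where c: "c > 0" "\<forall>\<^sub>F t in ?F. \<forall>z\<in>W. c * norm z \<le> norm (z - ?P t z)"
    by (rule lagr_tendsto_disjoint[OF path_lagr_tendsto W(1,2)])
  let ?R = "\<lambda>t. graph_map \<Gamma> W t q"
  have R0: "?R t0 = 0"
    unfolding graph_map_def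
  proof (rule the_equality)
    show "0 \<in> W \<and> q + 0 \<in> ?V" using q subspace_0[OF W(1)] by simp
    fix w assume w: "w \<in> W \<and> q + w \<in> ?V"
    have "q + w - q \<in> ?V" by (rule subspace_diff[OF subV _ q]) (use w in simp)
    then show "w = 0" using w W(2) by auto
  qed
  have R: "\<forall>\<^sub>F t in ?F. ?R t \<in> W \<and> q + ?R t \<in> \<Gamma> t \<and> norm (?R t) \<le> norm (?P t q - q) / c"
    using c(2) path_eventually_mem
  proof eventually_elim
    case (elim t)
    note L = path_Lagr[OF elim(2)] and sub = LagrD(1)[OF path_Lagr[OF elim(2)]]
    have z: "z = 0" if "z \<in> \<Gamma> t" "z \<in> W" for z
    proof -
      have "c * norm z \<le> norm (z - ?P t z)" by (rule elim(1)[rule_format, OF that(2)])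
      then show "z = 0" using closest_point_subspace_self[OF sub that(1)] c(1) by (simp add: mult_le_0_iff)
    qed
    have int: "\<Gamma> t \<inter> W = {0}"
    proof (intro equalityI subsetI)
      fix x assume "x \<in> \<Gamma> t \<inter> W"
      then show "x \<in> {0}" using z[of x] by simp
    qed (use subspace_0[OF sub] subspace_0[OF W(1)] in simp)
    have "dim {x + y |x y. x \<in> \<Gamma> t \<and> y \<in> W} + dim (\<Gamma> t \<inter> W) = dim (\<Gamma> t) + dim W"
      by (rule dim_sums_Int[OF sub W(1)])
    then have "dim {x + y |x y. x \<in> \<Gamma> t \<and> y \<in> W} = DIM('m symp)"
      unfolding int using dimW LagrD(2)[OF L] by simp
    then have "span {x + y |x y. x \<in> \<Gamma> t \<and> y \<in> W} = UNIV" by (simp only: dim_eq_full)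
    then have "{x + y |x y. x \<in> \<Gamma> t \<and> y \<in> W} = UNIV"
      by (simp only: span_eq_iff[THEN iffD2, OF subspace_sums[OF sub W(1)]])
    then have "q \<in> {x + y |x y. x \<in> \<Gamma> t \<and> y \<in> W}" by simp
    then obtain v w where vw: "q = v + w" "v \<in> \<Gamma> t" "w \<in> W" by blast
    have "\<exists>!w. w \<in> W \<and> q + w \<in> \<Gamma> t"
    proof (rule ex1I[of _ "- w"])
      show "- w \<in> W \<and> q + - w \<in> \<Gamma> t" using vw subspace_neg[OF W(1)] by simp
      fix w' assume w': "w' \<in> W \<and> q + w' \<in> \<Gamma> t"
      have "w' + w \<in> W" using subspace_add[OF W(1)] w' vw(3) by simp
      moreover have "(q + w') - v \<in> \<Gamma> t" using subspace_diff[OF sub _ vw(2)] w' by simp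
      then have "w' + w \<in> \<Gamma> t" using vw(1) by (simp add: algebra_simps)
      ultimately have "w' + w = 0" by (intro z)
      then show "w' = - w" by (simp add: eq_neg_iff_add_eq_0)
    qed
    from theI'[OF this] have R: "?R t \<in> W" "q + ?R t \<in> \<Gamma> t" unfolding graph_map_def by auto
    have "?P t q + ?P t (?R t) = q + ?R t"
      using closest_point_subspace_self[OF sub R(2)] linear_add[OF linear_closest_point[OF sub]] by simp
    then have "?R t - ?P t (?R t) = ?P t q - q" by (simp add: algebra_simps)
    then have "c * norm (?R t) \<le> norm (?P t q - q)" using elim(1)[rule_format, OF R(1)] by simp
    then show ?case using R c(1) by (simp add: field_simps)
  qed
  have Rlim: "(?R \<longlongrightarrow> 0) ?F"
  proof (rule Lim_null_comparison)
    show "\<forall>\<^sub>F t in ?F. norm (?R t) \<le> norm (?P t q - q) / c" using R by (rule eventually_mono) simp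
    have "((\<lambda>t. norm (?P t q - q) / c) \<longlongrightarrow> norm (q - q) / c) ?F"
      by (intro tendsto_intros lagr_tendstoD(4)[OF path_lagr_tendsto] q) (use c in auto)
    then show "((\<lambda>t. norm (?P t q - q) / c) \<longlongrightarrow> 0) ?F" by simp
  qed
  have "((\<lambda>t. symp_form q ((?P t q - q) /\<^sub>R (t - t0)) - symp_form ((?P t q - q) /\<^sub>R (t - t0)) (?R t))
      \<longlongrightarrow> symp_form q (proj_deriv \<Gamma> {a..b} t0 q) - symp_form (proj_deriv \<Gamma> {a..b} t0 q) 0) ?F"
    by (intro tendsto_diff tendsto_symp_form tendsto_const proj_quotient q Rlim)
  then have "((\<lambda>t. (symp_form q (?R t) - symp_form q (?R t0)) / (t - t0))
      \<longlongrightarrow> symp_form q (proj_deriv \<Gamma> {a..b} t0 q) - symp_form (proj_deriv \<Gamma> {a..b} t0 q) 0) ?F"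
  proof (rule Lim_transform_eventually)
    show "\<forall>\<^sub>F t in ?F. symp_form q ((?P t q - q) /\<^sub>R (t - t0)) - symp_form ((?P t q - q) /\<^sub>R (t - t0)) (?R t)
        = (symp_form q (?R t) - symp_form q (?R t0)) / (t - t0)"
      using R path_eventually_mem
    proof eventually_elim
      case (elim t)
      note L = path_Lagr[OF elim(2)]
      have "symp_form (?P t q) (q + ?R t) = 0"
        by (rule LagrD(3)[OF L closest_point_subspace(1)[OF LagrD(1)[OF L]]]) (use elim in blast)
      then have "symp_form q (?R t) = symp_form q (?P t q - q) - symp_form (?P t q - q) (?R t)"
        using symp_form_anti[of "?P t q" q] symp_form_anti[of q q]
        by (simp add: symp_form_diff_left symp_form_diff_right symp_form_add_right)
      then show ?case unfolding R0 symp_form_scale_left symp_form_scale_right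
        by (simp add: symp_form_zero divide_inverse right_diff_distrib mult.commute)
    qed
  qed
  then have "((\<lambda>t. symp_form q (?R t)) has_real_derivative symp_form q (proj_deriv \<Gamma> {a..b} t0 q)) ?F"
    unfolding has_field_derivative_iff by (simp add: R0 symp_form_zero)
  then have "((\<lambda>t. symp_form q (?R t)) has_vector_derivative symp_form q (proj_deriv \<Gamma> {a..b} t0 q)) ?F"
    by (simp add: has_real_derivative_iff_has_vector_derivative)
  from vector_derivative_within_closed_interval[OF ab t0 this]
  show ?thesis unfolding crossing_form_def Let_def W_def .
qed

abbreviation vertical :: "'m symp set" where "vertical \<equiv> {0} \<times> UNIV"

abbreviation crossing_bilinear :: "'m symp \<Rightarrow> 'm symp \<Rightarrow> real" where
  "crossing_bilinear k k' \<equiv> symp_form k' (proj_deriv \<Gamma> {a..b} t0 k)"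

lemma bilinear_crossing: "bilinear crossing_bilinear"
  unfolding bilinear_def
  by (intro conjI allI linearI; simp only: linear_add[OF linear_proj_deriv] linear_cmul[OF linear_proj_deriv]
      symp_form_add_left symp_form_add_right symp_form_scale_left symp_form_scale_right real_scaleR_def)

text \<open>
  A crossing form that is diagonal in \<open>J\<close> is nondegenerate only if no diagonal entry vanishes; without a crossing, \<open>J\<close> is empty.
\<close>

lemma crossing_basis:
  assumes reg: "is_crossing \<Gamma> vertical t0 \<longrightarrow> regular_crossing \<Gamma> vertical {a..b} t0"
  shows "\<exists>J. finite J \<and> independent J \<and> span J = \<Gamma> t0 \<inter> vertical \<and>
     (\<forall>k\<in>J. \<forall>k'\<in>J. k \<noteq> k' \<longrightarrow> crossing_bilinear k k' = 0) \<and> (\<forall>k\<in>J. crossing_bilinear k k \<noteq> 0) \<and>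
     crossing_neg \<Gamma> vertical {a..b} t0 = int (card {k\<in>J. crossing_bilinear k k < 0}) \<and>
     crossing_pos \<Gamma> vertical {a..b} t0 = int (card {k\<in>J. crossing_bilinear k k > 0})"
proof -
  let ?K = "\<Gamma> t0 \<inter> vertical" and ?Q = "crossing_form \<Gamma> {a..b} t0"
  note B = bilinear_crossing
  have "\<exists>J. finite J \<and> independent J \<and> span J = ?K \<and>
     (\<forall>k\<in>J. \<forall>k'\<in>J. k \<noteq> k' \<longrightarrow> crossing_bilinear k k' = 0)"
    by (rule orthogonal_basis_exists[OF B subspace_Int_vertical[OF path_Lagr[OF t0]]])
      (elim IntE, rule symp_proj_deriv_sym)
  then obtain J where J: "finite J" "independent J" "span J = ?K"
     "\<forall>k\<in>J. \<forall>k'\<in>J. k \<noteq> k' \<longrightarrow> crossing_bilinear k k' = 0" by (elim exE conjE)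
  have Q: "?Q q = crossing_bilinear q q" if "q \<in> ?K" for q
    by (rule crossing_form_eq) (rule IntD1[OF that])
  have JK: "k \<in> ?K" if "k \<in> J" for k using span_base[OF that] unfolding J(3) .
  have dg: "diagonalises J ?K ?Q"
    by (rule diagonalises_orthogonal[OF B J(1-3) _ Q]) (use J(4) in auto)
  have nz: "crossing_bilinear k k \<noteq> 0" if k: "k \<in> J" for k
  proof
    assume 0: "crossing_bilinear k k = 0"
    have k0: "k \<noteq> 0" using J(2) k dependent_zero by blast
    then have "is_crossing \<Gamma> vertical t0" using JK[OF k] unfolding is_crossing_def by blast
    then have nd: "nondegenerate ?K ?Q" using reg by (simp add: regular_crossing_def)
    have "?Q (k + p) - ?Q k - ?Q p = 0" if p: "p \<in> ?K" for p
    proof -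
      have "k + p \<in> ?K" by (rule subspace_add[OF subspace_Int_vertical[OF path_Lagr[OF t0]] JK[OF k] p])
      moreover have "crossing_bilinear k p = 0"
        by (rule orthogonal_null_vector[OF B _ k 0]) (use J(3,4) p in auto)
      moreover have "crossing_bilinear p k = crossing_bilinear k p"
        by (rule symp_proj_deriv_sym[OF IntD1[OF p] IntD1[OF JK[OF k]]])
      ultimately show ?thesis
        unfolding Q[OF p] Q[OF JK[OF k]] by (simp only: Q bilinear_ladd[OF B] bilinear_radd[OF B])
    qed
    then show False using nd JK[OF k] k0 unfolding nondegenerate_def by blast
  qed
  have "crossing_neg \<Gamma> vertical {a..b} t0 = int (card {k\<in>J. crossing_bilinear k k < 0}) \<and>
     crossing_pos \<Gamma> vertical {a..b} t0 = int (card {k\<in>J. crossing_bilinear k k > 0})"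
  proof (cases "is_crossing \<Gamma> vertical t0")
    case True
    have "{k\<in>J. ?Q k < 0} = {k\<in>J. crossing_bilinear k k < 0}" "{k\<in>J. ?Q k > 0} = {k\<in>J. crossing_bilinear k k > 0}"
      using Q[OF JK] by (auto simp del: split_paired_All split_paired_Ex intro!: Collect_cong conj_cong)
    then show ?thesis
      using True neg_squares_eq[OF dg] pos_squares_eq[OF dg] by (simp add: crossing_neg_def crossing_pos_def)
  next
    case False
    then have "?K = {0}" by (simp add: is_crossing_def)
    then have "k = 0" if "k \<in> J" for k using JK[OF that] by simp
    moreover have "0 \<notin> J" using J(2) dependent_zero by blast
    ultimately have "J = {}" by blast
    then show ?thesis using False by (simp add: crossing_neg_def crossing_pos_def)
  qed
  note c = this[THEN conjunct1] this[THEN conjunct2]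
  have "\<forall>k\<in>J. crossing_bilinear k k \<noteq> 0" using nz by (rule ballI)
  with J c show ?thesis by (intro exI[of _ J] conjI)
qed

text \<open>
  The projections of the basis vectors \<open>k\<close> onto \<open>\<Gamma> t\<close> are the curves needed for the perturbation
  result, with scale \<open>\<bar>t - t0\<bar>\<close>. The sign \<open>s\<close> treats both sides of \<open>t0\<close> at once.
\<close>

lemma index_jump:
  assumes J: "finite J" "independent J" "span J = \<Gamma> t0 \<inter> vertical"
     "\<And>k k'. k \<in> J \<Longrightarrow> k' \<in> J \<Longrightarrow> k \<noteq> k' \<Longrightarrow> crossing_bilinear k k' = 0"
     "\<And>k. k \<in> J \<Longrightarrow> crossing_bilinear k k \<noteq> 0"
    and ch: "chart \<tau> (\<Gamma> t0)"
    and F: "F \<le> at t0 within {a..b}" and s: "s = 1 \<or> s = -1" "\<forall>\<^sub>F t in F. s * (t - t0) > 0"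
  shows "\<forall>\<^sub>F t in F. robin_index \<tau> (\<Gamma> t) = robin_index \<tau> (\<Gamma> t0) + card {k\<in>J. s * crossing_bilinear k k < 0}
      \<and> \<not> is_crossing \<Gamma> vertical t"
proof -
  let ?V = "\<Gamma> t0" and ?P = "\<lambda>t. closest_point (\<Gamma> t)" and ?d = "proj_deriv \<Gamma> {a..b} t0"
  let ?h = "\<lambda>t. s * (t - t0)"
  note V = path_Lagr[OF t0]
  have mem: "\<forall>\<^sub>F t in F. t \<in> {a..b}" using path_eventually_mem F by (rule filter_leD[rotated])
  have Plim: "((\<lambda>t. ?P t v) \<longlongrightarrow> v) F" if "v \<in> ?V" for v
    using lagr_tendstoD(4)[OF path_lagr_tendsto that] F tendsto_mono by blast
  have Pmem: "\<forall>\<^sub>F t in F. ?P t v \<in> \<Gamma> t" for v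
    using mem by (rule eventually_mono) (rule closest_point_subspace(1)[OF LagrD(1)[OF path_Lagr]])
  have JK: "k \<in> ?V \<inter> vertical" if "k \<in> J" for k using span_base[OF that] unfolding J(3) .
  have JV: "k \<in> ?V" "fst k = 0" if "k \<in> J" for k using JK[OF that] by (simp_all add: mem_Times_iff)
  have h0: "(?h \<longlongrightarrow> 0) F"
  proof -
    have "(?h \<longlongrightarrow> s * (t0 - t0)) (at t0 within {a..b})" by (intro tendsto_intros)
    then show ?thesis using tendsto_mono[OF F] by simp
  qed
  have sqlim: "((\<lambda>t. sqrt (?h t)) \<longlongrightarrow> 0) F" using tendsto_real_sqrt[OF h0] by simp
  have fq: "((\<lambda>t. fst (?P t k) /\<^sub>R ?h t) \<longlongrightarrow> s *\<^sub>R fst (?d k)) F" if k: "k \<in> J" for k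
  proof -
    have "((\<lambda>t. (?P t k - k) /\<^sub>R (t - t0)) \<longlongrightarrow> ?d k) F"
      using tendsto_mono[OF F proj_quotient[OF JV(1)[OF k]]] .
    then have "((\<lambda>t. s *\<^sub>R fst ((?P t k - k) /\<^sub>R (t - t0))) \<longlongrightarrow> s *\<^sub>R fst (?d k)) F" by (intro tendsto_intros)
    moreover have "s *\<^sub>R fst ((?P t k - k) /\<^sub>R (t - t0)) = fst (?P t k) /\<^sub>R ?h t" for t
      using JV(2)[OF k] s(1) by auto
    ultimately show ?thesis by simp
  qed
  have "\<forall>\<^sub>F t in F. robin_index \<tau> (\<Gamma> t) = robin_index \<tau> ?V + card {k\<in>J. s * crossing_bilinear k k < 0}
      \<and> \<Gamma> t \<inter> vertical = {0}"
  proof (rule robin_index_perturb[OF V ch _ _ J(1), where \<kappa> = ?P and \<rho> = ?h])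
    show "\<forall>\<^sub>F t in F. \<Gamma> t \<in> Lagr" using mem by (rule eventually_mono) (rule path_Lagr)
    show "\<exists>\<beta>. (\<beta> \<longlongrightarrow> v) F \<and> (\<forall>\<^sub>F t in F. \<beta> t \<in> \<Gamma> t)" if "v \<in> ?V" for v
      using Plim[OF that] Pmem[of v] by blast
    show "card J = dim (?V \<inter> vertical)" using J(2,3) by (metis dim_eq_card_independent dim_span)
    show "\<forall>\<^sub>F t in F. ?P t k \<in> \<Gamma> t" for k by (rule Pmem)
    show "s * crossing_bilinear k k \<noteq> 0" if "k \<in> J" for k using J(5)[OF that] s(1) by auto
    show "((\<lambda>t. fst (?P t k) /\<^sub>R sqrt (?h t)) \<longlongrightarrow> 0) F" if k: "k \<in> J" for k
    proof -
      have "((\<lambda>t. sqrt (?h t) *\<^sub>R (fst (?P t k) /\<^sub>R ?h t)) \<longlongrightarrow> 0 *\<^sub>R (s *\<^sub>R fst (?d k))) F"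
        by (intro tendsto_scaleR sqlim fq k)
      then have "((\<lambda>t. sqrt (?h t) *\<^sub>R (fst (?P t k) /\<^sub>R ?h t)) \<longlongrightarrow> 0) F" by simp
      then show ?thesis
      proof (rule Lim_transform_eventually)
        show "\<forall>\<^sub>F t in F. sqrt (?h t) *\<^sub>R (fst (?P t k) /\<^sub>R ?h t) = fst (?P t k) /\<^sub>R sqrt (?h t)"
          using s(2)
        proof eventually_elim
          case (elim t)
          then show ?case using sqrt_divide_self_eq[of "?h t"] by (simp add: divide_inverse)
        qed
      qed
    qed
    show "((\<lambda>t. robin_form \<tau> (?P t k) (?P t k') / ?h t) \<longlongrightarrow> (if k = k' then s * crossing_bilinear k k else 0)) F"
      if k: "k \<in> J" "k' \<in> J" for k k'
    proof -
      have "((\<lambda>t. - inner (fst (?P t k) /\<^sub>R ?h t) (snd (?P t k') + \<tau> *\<^sub>R fst (?P t k')))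
         \<longlongrightarrow> - inner (s *\<^sub>R fst (?d k)) (snd k' + \<tau> *\<^sub>R fst k')) F"
        by (intro tendsto_minus tendsto_inner fq k tendsto_add tendsto_scaleR tendsto_const
            tendsto_snd tendsto_fst Plim JV(1))
      moreover have "- inner (s *\<^sub>R fst (?d k)) (snd k' + \<tau> *\<^sub>R fst k') = s * crossing_bilinear k k'"
        using JV(2)[OF k(2)] by (simp add: symp_form_eq inner_commute)
      moreover have "s * crossing_bilinear k k' = (if k = k' then s * crossing_bilinear k k else 0)"
        using J(4)[OF k] by auto
      moreover have "- inner (fst (?P t k) /\<^sub>R ?h t) (snd (?P t k') + \<tau> *\<^sub>R fst (?P t k'))
          = robin_form \<tau> (?P t k) (?P t k') / ?h t" for t
        by (simp add: robin_form_def divide_inverse)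
      ultimately show ?thesis by simp
    qed
  qed (rule s(2))
  then show ?thesis by (simp add: is_crossing_def)
qed

end

section \<open>The Maslov index of a path inside one chart\<close>

lemma lagr_tendsto_compose:
  assumes H: "lagr_tendsto H V F" and g: "filterlim g F G"
  shows "lagr_tendsto (\<lambda>x. H (g x)) V G"
  unfolding lagr_tendsto_def
proof (intro conjI allI)
  show "\<forall>\<^sub>F x in G. H (g x) \<in> Lagr" by (rule eventually_compose_filterlim[OF lagr_tendstoD(1)[OF H] g])
  show "V \<in> Lagr" by (rule lagr_tendstoD(2)[OF H])
  show "((\<lambda>x. closest_point (H (g x)) z) \<longlongrightarrow> closest_point V z) G" for z
    by (rule filterlim_compose[OF lagr_tendstoD(3)[OF H] g])
qed

text \<open>
  \<open>\<phi> - robin_mean - robin_index \<tau>\<close> is continuous at \<open>t0\<close> and integer-valued.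
\<close>

lemma angle_index_locally_constant:
  assumes path: "C1_path \<Gamma> a b" "a < b" "t0 \<in> {a..b}" and ch: "chart \<tau> (\<Gamma> t0)"
    and \<phi>: "continuous_on {a..b} \<phi>" "\<And>t. t \<in> {a..b} \<Longrightarrow> \<phi> t = robin_mean (\<Gamma> t) + real_of_int (D t)"
  shows "\<forall>\<^sub>F t in at t0 within {a..b}. D t - D t0 = int (robin_index \<tau> (\<Gamma> t)) - int (robin_index \<tau> (\<Gamma> t0))"
proof -
  let ?F = "at t0 within {a..b}"
  let ?m = "\<lambda>t. robin_mean (\<Gamma> t) + real (robin_index \<tau> (\<Gamma> t))"
  have m: "(?m \<longlongrightarrow> ?m t0) ?F"
    unfolding tendsto_at_iff_sequentially
  proof (intro allI impI)
    fix X assume X: "\<forall>i. X i \<in> {a..b} - {t0}" "X \<longlonglongrightarrow> t0"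
    have "filterlim X ?F sequentially"
      using X by (auto simp: filterlim_at intro!: always_eventually)
    from lagr_tendsto_compose[OF path_lagr_tendsto[OF path] this]
    have T: "lagr_tendsto (\<lambda>i. \<Gamma> (X i)) (\<Gamma> t0) sequentially" .
    have L: "\<Gamma> (X i) \<in> Lagr" for i using path_Lagr[OF path, of "X i"] X(1) by blast
    show "(?m \<circ> X) \<longlonglongrightarrow> ?m t0"
      using robin_mean_add_index_tendsto[OF T L ch] by (simp add: o_def)
  qed
  have "(\<phi> \<longlongrightarrow> \<phi> t0) ?F" using \<phi>(1) path(3) by (simp add: continuous_on_def)
  from tendsto_diff[OF this m]
  have "((\<lambda>t. \<phi> t - ?m t) \<longlongrightarrow> \<phi> t0 - ?m t0) ?F" .
  then have "\<forall>\<^sub>F t in ?F. dist (\<phi> t - ?m t) (\<phi> t0 - ?m t0) < 1" by (rule tendstoD) simp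
  with path_eventually_mem[OF path] show ?thesis
  proof eventually_elim
    case (elim t)
    have "\<phi> t - ?m t - (\<phi> t0 - ?m t0)
      = real_of_int ((D t - D t0) - (int (robin_index \<tau> (\<Gamma> t)) - int (robin_index \<tau> (\<Gamma> t0))))"
      using \<phi>(2)[OF elim(1)] \<phi>(2)[OF path(3)] by simp
    then have "\<bar>real_of_int ((D t - D t0) - (int (robin_index \<tau> (\<Gamma> t)) - int (robin_index \<tau> (\<Gamma> t0))))\<bar> < 1"
      using elim(2) unfolding dist_real_def by simp
    then show ?case by linarith
  qed
qed

text \<open>
  The integer \<open>D\<close> separating the continuous angle from \<open>robin_mean\<close> moves exactly like \<open>robin_index \<tau>\<close>
  near any point of the path, in any chart; its jumps there are the signature terms of the Maslov index.
\<close>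

lemma Mas_regular_angle:
  fixes \<Gamma> :: "real \<Rightarrow> 'm::finite symp set"
  assumes reg: "regular_path \<Gamma> vertical a b" and ab: "a < b"
    and \<phi>: "continuous_on {a..b} \<phi>" "\<And>t. t \<in> {a..b} \<Longrightarrow> \<phi> t = robin_mean (\<Gamma> t) + real_of_int (D t)"
  shows "Mas_regular \<Gamma> vertical a b = D a - D b"
proof -
  have path: "C1_path \<Gamma> a b" using reg by (simp add: regular_path_def)
  let ?r = "crossing_neg \<Gamma> vertical {a..b}" and ?l = "crossing_pos \<Gamma> vertical {a..b}"
  let ?X = "{t. is_crossing \<Gamma> vertical t}"
  have jump: "(\<forall>\<^sub>F x in at t within {t<..b}. D x - D t = ?r t \<and> x \<notin> ?X) \<and>
      (\<forall>\<^sub>F x in at t within {a..<t}. D x - D t = ?l t \<and> x \<notin> ?X)" if t: "t \<in> {a..b}" for t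
  proof -
    note p = path ab t
    obtain \<tau> where ch: "chart \<tau> (\<Gamma> t)" by (rule chart_exists[OF path_Lagr[OF p t]])
    have "is_crossing \<Gamma> vertical t \<longrightarrow> regular_crossing \<Gamma> vertical {a..b} t"
      using reg t by (simp add: regular_path_def)
    from crossing_basis[OF p this] obtain J where
      J: "finite J" "independent J" "span J = \<Gamma> t \<inter> vertical"
         "\<forall>k\<in>J. \<forall>k'\<in>J. k \<noteq> k' \<longrightarrow> symp_form k' (proj_deriv \<Gamma> {a..b} t k) = 0"
         "\<forall>k\<in>J. symp_form k (proj_deriv \<Gamma> {a..b} t k) \<noteq> 0"
      and neg: "?r t = int (card {k\<in>J. symp_form k (proj_deriv \<Gamma> {a..b} t k) < 0})"
      and pos: "?l t = int (card {k\<in>J. symp_form k (proj_deriv \<Gamma> {a..b} t k) > 0})"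
      by (elim exE conjE)
    note orth = J(4)[rule_format] and nz = J(5)[rule_format]
    note c = angle_index_locally_constant[OF p ch \<phi>]
    have 1: "at t within {t<..b} \<le> at t within {a..b}" and 2: "at t within {a..<t} \<le> at t within {a..b}"
      using t by (auto intro!: at_le)
    have "\<forall>\<^sub>F x in at t within {t<..b}. robin_index \<tau> (\<Gamma> x) = robin_index \<tau> (\<Gamma> t)
        + card {k\<in>J. 1 * symp_form k (proj_deriv \<Gamma> {a..b} t k) < 0} \<and> \<not> is_crossing \<Gamma> vertical x"
    proof (rule index_jump[OF p J(1-3) orth nz ch 1])
      show "\<forall>\<^sub>F x in at t within {t<..b}. 0 < 1 * (x - t)" by (auto simp: eventually_at_filter)
    qed simp_all
    moreover have "\<forall>\<^sub>F x in at t within {t<..b}. D x - D t = int (robin_index \<tau> (\<Gamma> x)) - int (robin_index \<tau> (\<Gamma> t))"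
      by (rule filter_leD[OF 1 c])
    ultimately have R: "\<forall>\<^sub>F x in at t within {t<..b}. D x - D t = ?r t \<and> x \<notin> ?X"
      by eventually_elim (simp add: neg)
    have "\<forall>\<^sub>F x in at t within {a..<t}. robin_index \<tau> (\<Gamma> x) = robin_index \<tau> (\<Gamma> t)
        + card {k\<in>J. -1 * symp_form k (proj_deriv \<Gamma> {a..b} t k) < 0} \<and> \<not> is_crossing \<Gamma> vertical x"
    proof (rule index_jump[OF p J(1-3) orth nz ch 2])
      show "\<forall>\<^sub>F x in at t within {a..<t}. 0 < -1 * (x - t)" by (auto simp: eventually_at_filter)
    qed simp_all
    moreover have "\<forall>\<^sub>F x in at t within {a..<t}. D x - D t = int (robin_index \<tau> (\<Gamma> x)) - int (robin_index \<tau> (\<Gamma> t))"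
      by (rule filter_leD[OF 2 c])
    ultimately have "\<forall>\<^sub>F x in at t within {a..<t}. D x - D t = ?l t \<and> x \<notin> ?X"
      by eventually_elim (simp add: pos)
    with R show ?thesis by blast
  qed
  have "D b - D a = ?r a + (\<Sum>t\<in>{t\<in>{a<..<b}. t \<in> ?X}. ?r t - ?l t) - ?l b"
    by (rule jump_sum[OF ab conjunct1[OF jump] conjunct2[OF jump]]) (simp_all add: crossing_neg_def crossing_pos_def)
  moreover have "(\<Sum>t\<in>{t\<in>{a<..<b}. t \<in> ?X}. ?r t - ?l t) = - (\<Sum>t\<in>{t\<in>{a<..<b}. is_crossing \<Gamma> vertical t}. ?l t - ?r t)"
    by (simp add: sum_negf[symmetric])
  ultimately show ?thesis unfolding Mas_regular_def by simp
qed

lemma robin_mean_add_index_continuous: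
  fixes H :: "'t::{first_countable_topology, t2_space} \<Rightarrow> 'm::finite symp set"
  assumes H: "cont_family A H" and ch: "\<And>t. t \<in> A \<Longrightarrow> chart \<tau> (H t)"
  shows "continuous_on A (\<lambda>t. robin_mean (H t) + real (robin_index \<tau> (H t)))"
  unfolding continuous_on_sequentially
proof (intro allI ballI impI)
  fix x a assume a: "a \<in> A" and x: "(\<forall>n. x n \<in> A) \<and> x \<longlonglongrightarrow> a"
  have T: "lagr_tendsto (\<lambda>n. H (x n)) (H a) sequentially" using cont_family_tendsto[OF H a] x by blast
  have "H (x n) \<in> Lagr" for n using H x by (simp add: cont_family_def)
  from robin_mean_add_index_tendsto[OF T this ch[OF a]]
  show "((\<lambda>t. robin_mean (H t) + real (robin_index \<tau> (H t))) \<circ> x) \<longlonglongrightarrow> robin_mean (H a) + real (robin_index \<tau> (H a))"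
    by (simp add: o_def)
qed

lemma continuous_int_valued_constant:
  fixes f :: "'t::topological_space \<Rightarrow> real"
  assumes "connected S" "continuous_on S f" and int: "\<And>x. x \<in> S \<Longrightarrow> f x \<in> \<int>" and xy: "x \<in> S" "y \<in> S"
  shows "f x = f y"
proof -
  have "f constant_on S"
  proof (rule continuous_discrete_range_constant[OF assms(1,2)])
    fix x assume x: "x \<in> S"
    show "\<exists>e>0. \<forall>y. y \<in> S \<and> f y \<noteq> f x \<longrightarrow> e \<le> norm (f y - f x)"
    proof (intro exI[of _ 1] conjI allI impI)
      fix y assume y: "y \<in> S \<and> f y \<noteq> f x"
      then have "f y - f x \<in> \<int>" "f y - f x \<noteq> 0" using int x by auto
      then show "1 \<le> norm (f y - f x)" using Ints_nonzero_abs_ge1[of "f y - f x"] by simp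
    qed simp
  qed
  then show ?thesis using xy by (auto simp: constant_on_def)
qed

text \<open>
  Lift the angle over the homotopy square. Along the two sides with fixed end points the lift is
  constant, so its drop along \<open>\<Gamma>\<close> is that along \<open>\<Lambda>\<close>, where a single chart applies.
\<close>

lemma Mas_regular_of_chart_path:
  fixes \<Lambda> \<Gamma> :: "real \<Rightarrow> 'm::finite symp set"
  assumes reg: "regular_path \<Gamma> vertical a b" and ab: "a < b"
    and hom: "homotopic_fixed_ends a b \<Lambda> \<Gamma>" and ch: "\<And>t. t \<in> {a..b} \<Longrightarrow> chart \<tau> (\<Lambda> t)"
  shows "Mas_regular \<Gamma> vertical a b = int (robin_index \<tau> (\<Lambda> a)) - int (robin_index \<tau> (\<Lambda> b))"
proof -
  let ?S = "{0..1::real} \<times> {a..b}"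
  obtain H :: "real \<times> real \<Rightarrow> 'm symp set" where H: "cont_family ?S H"
    "\<And>t. t \<in> {a..b} \<Longrightarrow> H (0, t) = \<Lambda> t" "\<And>t. t \<in> {a..b} \<Longrightarrow> H (1, t) = \<Gamma> t"
    "\<And>\<sigma>. \<sigma> \<in> {0..1} \<Longrightarrow> H (\<sigma>, a) = \<Lambda> a" "\<And>\<sigma>. \<sigma> \<in> {0..1} \<Longrightarrow> H (\<sigma>, b) = \<Lambda> b"
    using hom unfolding homotopic_fixed_ends_def by blast
  have "contractible ?S" by (intro convex_imp_contractible convex_Times convex_real_interval)
  then obtain \<phi> where \<phi>: "continuous_on ?S \<phi>" "\<And>t. t \<in> ?S \<Longrightarrow> \<exists>k::int. \<phi> t = robin_mean (H t) + k"
    using robin_mean_lift[OF H(1)] by blast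
  (* an integer already; the floor only gives it the integer type *)
  define D where "D t = \<lfloor>\<phi> (1, t) - robin_mean (\<Gamma> t)\<rfloor>" for t
  have slice1: "continuous_on {a..b} (\<lambda>t. \<phi> (\<sigma>, t))" if "\<sigma> \<in> {0..1}" for \<sigma>
    by (rule continuous_on_compose2[OF \<phi>(1)]) (use that in \<open>auto intro!: continuous_intros\<close>)
  have slice2: "continuous_on {0..1} (\<lambda>\<sigma>. \<phi> (\<sigma>, t))" if "t \<in> {a..b}" for t
    by (rule continuous_on_compose2[OF \<phi>(1)]) (use that in \<open>auto intro!: continuous_intros\<close>)
  have "\<phi> (1, t) = robin_mean (\<Gamma> t) + real_of_int (D t)" if t: "t \<in> {a..b}" for t
    using \<phi>(2)[of "(1, t)"] t H(3)[OF t] by (auto simp: D_def)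
  from Mas_regular_angle[OF reg ab slice1 this]
  have 1: "real_of_int (Mas_regular \<Gamma> vertical a b) = real_of_int (D a - D b)" by simp
  have Dab: "real_of_int (D t) = \<phi> (1, t) - robin_mean (\<Lambda> t)" if "t = a \<or> t = b" for t
    using \<phi>(2)[of "(1, t)"] that ab H(3)[of t] H(4)[of 1] H(5)[of 1] by (auto simp: D_def)
  have int: "\<phi> (\<sigma>, t) - robin_mean (\<Lambda> t) \<in> \<int>" if "\<sigma> \<in> {0..1}" "t = a \<or> t = b" for \<sigma> t
    using \<phi>(2)[of "(\<sigma>, t)"] that ab H(4)[of \<sigma>] H(5)[of \<sigma>] by auto
  have "\<phi> (1, t) - robin_mean (\<Lambda> t) = \<phi> (0, t) - robin_mean (\<Lambda> t)" if t: "t = a \<or> t = b" for t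
  proof (rule continuous_int_valued_constant[where S = "{0..1::real}" and f = "\<lambda>\<sigma>. \<phi> (\<sigma>, t) - robin_mean (\<Lambda> t)"])
    show "continuous_on {0..1} (\<lambda>\<sigma>. \<phi> (\<sigma>, t) - robin_mean (\<Lambda> t))"
      by (intro continuous_on_diff slice2 continuous_on_const) (use t ab in auto)
  qed (use int[OF _ t] in auto)
  then have 2: "real_of_int (D a) - real_of_int (D b) = (\<phi> (0, a) - robin_mean (\<Lambda> a)) - (\<phi> (0, b) - robin_mean (\<Lambda> b))"
    using Dab by simp
  have L: "cont_family {a..b} \<Lambda>"
    unfolding cont_family_def
  proof (intro conjI ballI allI)
    fix t assume t: "t \<in> {a..b}"
    then have "H (0, t) \<in> Lagr" using H(1) by (simp add: cont_family_def)
    then show "\<Lambda> t \<in> Lagr" using H(2)[OF t] by simp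
  next
    fix x
    have "continuous_on ?S (\<lambda>t. closest_point (H t) x)" using H(1) unfolding cont_family_def by blast
    then have "continuous_on {a..b} (\<lambda>t. closest_point (H (0, t)) x)"
      by (rule continuous_on_compose2) (auto intro!: continuous_intros)
    then show "continuous_on {a..b} (\<lambda>t. closest_point (\<Lambda> t) x)"
      by (rule continuous_on_eq) (simp add: H(2))
  qed
  let ?f = "\<lambda>t. \<phi> (0, t) - (robin_mean (\<Lambda> t) + real (robin_index \<tau> (\<Lambda> t)))"
  have "?f a = ?f b"
  proof (rule continuous_int_valued_constant[where S = "{a..b}" and f = ?f])
    show "continuous_on {a..b} ?f"
      by (intro continuous_on_diff slice1 robin_mean_add_index_continuous[OF L ch]) auto
    fix t assume t: "t \<in> {a..b}"
    obtain k :: int where "\<phi> (0, t) = robin_mean (\<Lambda> t) + k" using \<phi>(2)[of "(0, t)"] t H(2)[OF t] by auto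
    then have "?f t = of_int (k - int (robin_index \<tau> (\<Lambda> t)))" by simp
    then show "?f t \<in> \<int>" by (metis Ints_of_int)
  qed (use ab in auto)
  then have "real_of_int (Mas_regular \<Gamma> vertical a b)
      = real_of_int (int (robin_index \<tau> (\<Lambda> a)) - int (robin_index \<tau> (\<Lambda> b)))"
    using 1 2 by simp
  then show ?thesis by (simp only: of_int_eq_iff)
qed

section \<open>Regular representatives inside a chart\<close>

text \<open>
  Orthogonality of \<open>x - p\<close> and \<open>x - q\<close> to the respective ranges turns \<open>norm (p - q)\<^sup>2\<close> into two terms that contain
  \<open>T t - T0\<close>; injectivity of \<open>T0\<close> bounds the coordinates of \<open>p\<close> and \<open>q\<close>.
\<close>

lemma closest_point_range_tendsto:
  fixes T :: "'t \<Rightarrow> 'a::euclidean_space \<Rightarrow> 'b::euclidean_space"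
  assumes lin: "\<forall>\<^sub>F t in F. linear (T t)" and T0: "linear T0" "inj T0"
    and lim: "\<And>w. ((\<lambda>t. T t w) \<longlongrightarrow> T0 w) F"
  shows "((\<lambda>t. closest_point (range (T t)) x) \<longlongrightarrow> closest_point (range T0) x) F"
proof (rule tendstoI)
  fix \<epsilon> :: real assume \<epsilon>: "\<epsilon> > 0"
  obtain k where k: "k > 0" "\<And>w. k * norm w \<le> norm (T0 w)"
    using linear_inj_bounded_below_pos[OF T0] by (metis mult.commute)
  (* small enough to keep T t injective and to bring the final bound below \<epsilon>; + 4 avoids a zero denominator *)
  define \<eta> where "\<eta> = min (k / 2) (\<epsilon>\<^sup>2 * k / (4 * (norm x)\<^sup>2 + 4))"
  have N: "4 * (norm x)\<^sup>2 + 4 > 0" using zero_le_power2[of "norm x"] by linarith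
  have \<eta>: "\<eta> > 0" "\<eta> \<le> k / 2" "\<eta> * (4 * (norm x)\<^sup>2 + 4) \<le> \<epsilon>\<^sup>2 * k"
  proof -
    show "\<eta> > 0" using k \<epsilon> N by (simp add: \<eta>_def)
    show "\<eta> \<le> k / 2" unfolding \<eta>_def by (rule min.cobounded1)
    have "\<eta> \<le> \<epsilon>\<^sup>2 * k / (4 * (norm x)\<^sup>2 + 4)" unfolding \<eta>_def by (rule min.cobounded2)
    then show "\<eta> * (4 * (norm x)\<^sup>2 + 4) \<le> \<epsilon>\<^sup>2 * k" using N by (simp add: pos_le_divide_eq)
  qed
  have "\<forall>\<^sub>F t in F. \<forall>w. norm (T t w - T0 w) \<le> \<eta> * norm w"
    by (rule linear_tendsto_uniform[OF lin T0(1) lim \<eta>(1)])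
  with lin show "\<forall>\<^sub>F t in F. dist (closest_point (range (T t)) x) (closest_point (range T0) x) < \<epsilon>"
  proof eventually_elim
    case (elim t)
    have S: "subspace (range (T t))" "subspace (range T0)"
      using linear_subspace_image[OF elim(1) subspace_UNIV] linear_subspace_image[OF T0(1) subspace_UNIV] .
    let ?p = "closest_point (range (T t)) x" and ?q = "closest_point (range T0) x"
    obtain c where c: "?p = T t c" using closest_point_subspace(1)[OF S(1), of x] by blast
    obtain d where d: "?q = T0 d" using closest_point_subspace(1)[OF S(2), of x] by blast
    have px: "(x - ?p) \<bullet> T t w = 0" and qx: "(x - ?q) \<bullet> T0 w = 0" for w
      using closest_point_subspace(2)[OF S(1)] closest_point_subspace(2)[OF S(2)] by auto
    have le: "norm y \<le> norm x \<and> norm (x - y) \<le> norm x" if "(x - y) \<bullet> y = 0" for y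
    proof -
      have "(norm x)\<^sup>2 = (norm (x - y))\<^sup>2 + (norm y)\<^sup>2"
        using that unfolding power2_norm_eq_inner by (simp add: inner_diff_left inner_diff_right inner_commute)
      then have "(norm y)\<^sup>2 \<le> (norm x)\<^sup>2" "(norm (x - y))\<^sup>2 \<le> (norm x)\<^sup>2" by simp_all
      then show ?thesis by (simp add: power2_le_iff_abs_le)
    qed
    have pn: "norm ?p \<le> norm x" "norm (x - ?p) \<le> norm x" using le[of ?p] px[of c] c by simp_all
    have qn: "norm ?q \<le> norm x" "norm (x - ?q) \<le> norm x" using le[of ?q] qx[of d] d by simp_all
    have cb: "k / 2 * norm c \<le> norm x"
    proof -
      have "k * norm c \<le> norm (T0 c)" by (rule k(2))
      also have "\<dots> \<le> norm (T t c) + norm (T t c - T0 c)" using norm_triangle_sub[of "T0 c" "T t c"] by (simp add: norm_minus_commute)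
      also have "\<dots> \<le> norm x + \<eta> * norm c" using elim(2)[rule_format, of c] pn c by simp
      also have "\<dots> \<le> norm x + k / 2 * norm c" using mult_right_mono[OF \<eta>(2) norm_ge_zero[of c]] by simp
      finally show ?thesis by simp
    qed
    have db: "k * norm d \<le> norm x" using k(2)[of d] qn d by simp
    (* the four orthogonality relations *)
    have "(norm (?p - ?q))\<^sup>2 = (T t d - T0 d) \<bullet> (?p - x) + (T t c - T0 c) \<bullet> (x - ?q)"
      using px[of c] px[of d] qx[of c] qx[of d] c d unfolding power2_norm_eq_inner
      by (simp add: inner_diff_left inner_diff_right inner_commute algebra_simps)
    also have "\<dots> \<le> norm (T t d - T0 d) * norm (?p - x) + norm (T t c - T0 c) * norm (x - ?q)"
      by (intro add_mono norm_cauchy_schwarz)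
    also have "\<dots> \<le> (\<eta> * norm d) * norm x + (\<eta> * norm c) * norm x"
      using elim(2) pn qn \<eta>(1) by (intro add_mono mult_mono) (simp_all add: norm_minus_commute)
    finally have "(norm (?p - ?q))\<^sup>2 \<le> \<eta> * norm x * (norm d + norm c)" by (simp add: algebra_simps)
    then have "k * (norm (?p - ?q))\<^sup>2 \<le> k * (\<eta> * norm x * (norm d + norm c))"
      by (rule mult_left_mono) (use k in simp)
    also have "\<dots> = \<eta> * norm x * (k * norm d + k * norm c)" by (simp add: algebra_simps)
    also have "\<dots> \<le> \<eta> * norm x * (3 * norm x)"
    proof (rule mult_left_mono)
      show "k * norm d + k * norm c \<le> 3 * norm x" using cb db by simp
      show "0 \<le> \<eta> * norm x" using \<eta>(1) by simp
    qed
    also have "\<dots> = \<eta> * (3 * (norm x)\<^sup>2)" by (simp add: power2_eq_square)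
    also have "\<dots> < \<eta> * (4 * (norm x)\<^sup>2 + 4)"
    proof (rule mult_strict_left_mono[OF _ \<eta>(1)])
      show "3 * (norm x)\<^sup>2 < 4 * (norm x)\<^sup>2 + 4" using zero_le_power2[of "norm x"] by linarith
    qed
    also have "\<dots> \<le> k * \<epsilon>\<^sup>2" using \<eta>(3) by (simp add: mult.commute)
    finally have "(norm (?p - ?q))\<^sup>2 < \<epsilon>\<^sup>2" using k(1) by simp
    then show ?case using \<epsilon> by (simp add: dist_norm power2_less_imp_less)
  qed
qed

lemma cont_family_range:
  fixes T :: "'t::topological_space \<Rightarrow> 'a::euclidean_space \<Rightarrow> 'm::finite symp"
  assumes lin: "\<And>t. t \<in> A \<Longrightarrow> linear (T t)" "\<And>t. t \<in> A \<Longrightarrow> inj (T t)"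
    and cont: "\<And>w. continuous_on A (\<lambda>t. T t w)"
    and L: "\<And>t. t \<in> A \<Longrightarrow> range (T t) \<in> Lagr"
  shows "cont_family A (\<lambda>t. range (T t))"
  unfolding cont_family_def
proof (intro conjI ballI allI)
  fix x
  show "continuous_on A (\<lambda>t. closest_point (range (T t)) x)"
    unfolding continuous_on_def
  proof (intro ballI closest_point_range_tendsto)
    fix t assume t: "t \<in> A"
    show "\<forall>\<^sub>F t in at t within A. linear (T t)" using lin(1) by (auto simp: eventually_at_filter)
    show "linear (T t)" "inj (T t)" using lin t by auto
    show "((\<lambda>t. T t w) \<longlongrightarrow> T t w) (at t within A)" for w using cont[of w] t by (simp add: continuous_on_def)
  qed
qed (rule L)

text \<open>
  A plane in the chart is parametrised by \<open>w = - y - \<tau> x\<close>.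
\<close>

definition chart_map :: "real \<Rightarrow> (real^'m \<Rightarrow> real^'m) \<Rightarrow> real^'m \<Rightarrow> 'm::finite symp" where
  "chart_map \<tau> A w = (A w, - w - \<tau> *\<^sub>R A w)"

definition self_adjoint :: "('a::euclidean_space \<Rightarrow> 'a) \<Rightarrow> bool" where
  "self_adjoint A \<longleftrightarrow> linear A \<and> (\<forall>v w. inner (A v) w = inner v (A w))"

lemma linear_chart_map: "linear A \<Longrightarrow> linear (chart_map \<tau> A)"
  by (rule linearI) (simp_all add: chart_map_def linear_add linear_cmul algebra_simps)

lemma chart_map_recover: "- snd (chart_map \<tau> A w) - \<tau> *\<^sub>R fst (chart_map \<tau> A w) = w"
  by (simp add: chart_map_def)

lemma inj_chart_map: "inj (chart_map \<tau> A)"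
  by (metis chart_map_recover injI)

lemma chart_map_Lagr:
  assumes "self_adjoint A"
  shows "range (chart_map \<tau> A) \<in> (Lagr :: 'm::finite symp set set)"
  unfolding Lagr_def
proof (intro CollectI conjI ballI)
  have A: "linear A" "\<And>v w. inner (A v) w = inner v (A w)" using assms by (auto simp: self_adjoint_def)
  note lin = linear_chart_map[OF A(1), of \<tau>]
  show "subspace (range (chart_map \<tau> A))" by (rule linear_subspace_image[OF lin subspace_UNIV])
  have "dim (range (chart_map \<tau> A)) = dim (UNIV :: (real^'m) set)"
    by (rule dim_image_eq[OF lin]) (simp add: inj_chart_map)
  then show "dim (range (chart_map \<tau> A)) = CARD('m)" by simp
  fix x y assume "x \<in> range (chart_map \<tau> A)" "y \<in> range (chart_map \<tau> A)"
  then obtain v w where "x = chart_map \<tau> A v" "y = chart_map \<tau> A w" by blast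
  moreover have "inner (A v) (A w) = inner (A w) (A v)" by (rule inner_commute)
  moreover have "inner (A v) w = inner v (A w)" by (rule A(2))
  ultimately show "symp_form x y = 0"
    by (simp add: symp_form_eq chart_map_def inner_diff_left inner_diff_right inner_minus_left)
qed

lemma chart_map_exists:
  fixes L :: "'m::finite symp set"
  assumes L: "L \<in> Lagr" and ch: "chart \<tau> L"
  shows "\<exists>A. self_adjoint A \<and> L = range (chart_map \<tau> A)"
proof -
  obtain g where g: "linear g" "\<forall>e. g e \<in> L" "\<forall>e. snd (g e) + \<tau> *\<^sub>R fst (g e) = - e"
     "\<forall>z\<in>L. g (- snd z - \<tau> *\<^sub>R fst z) = z"
    using chart_param[OF L ch] by (elim exE conjE)
  have e: "g w = chart_map \<tau> (\<lambda>w. fst (g w)) w" for w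
  proof -
    have "snd (g w) = - w - \<tau> *\<^sub>R fst (g w)"
      using g(3)[rule_format, of w] by (simp only: eq_diff_eq)
    then show ?thesis by (simp add: chart_map_def prod_eq_iff)
  qed
  have "linear (\<lambda>w. fst (g w))"
    using linear_compose[OF g(1) linear_fst] by (simp add: o_def)
  moreover have "inner (fst (g v)) w = inner v (fst (g w))" for v w
    using robin_form_sym[OF L g(2)[rule_format, of v] g(2)[rule_format, of w], of \<tau>] g(3)
    by (simp add: robin_form_def inner_commute)
  moreover have "L = range g"
  proof (intro equalityI subsetI)
    fix z assume "z \<in> L"
    then have "z = g (- snd z - \<tau> *\<^sub>R fst z)" using g(4) by simp
    then show "z \<in> range g" by (rule range_eqI)
  qed (use g(2) in blast)
  moreover have "range g = range (chart_map \<tau> (\<lambda>w. fst (g w)))" by (rule image_cong[OF refl]) (rule e)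
  ultimately show ?thesis by (intro exI[of _ "\<lambda>w. fst (g w)"]) (simp add: self_adjoint_def)
qed

text \<open>
  Write \<open>P\<^sub>t\<close> for the projection onto \<open>H t\<close>. It maps the point over \<open>w\<close> at \<open>t0\<close> to a point over some \<open>v\<close> close to \<open>w\<close>, and
  the maps \<open>A t\<close> are uniformly bounded near \<open>t0\<close> by uniform transversality.
\<close>

lemma chart_map_continuous:
  fixes H :: "'t::topological_space \<Rightarrow> 'm::finite symp set"
  assumes H: "cont_family S H" and A: "\<And>t. t \<in> S \<Longrightarrow> self_adjoint (A t)"
    "\<And>t. t \<in> S \<Longrightarrow> H t = range (chart_map \<tau> (A t))"
  shows "continuous_on S (\<lambda>t. A t w)"
  unfolding continuous_on_def
proof
  fix t0 assume t0: "t0 \<in> S"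
  let ?F = "at t0 within S" and ?P = "\<lambda>t. closest_point (H t)"
  let ?W = "{z::'m symp. snd z + \<tau> *\<^sub>R fst z = 0}"
  have mem: "\<forall>\<^sub>F t in ?F. t \<in> S" by (auto simp: eventually_at_filter)
  have L: "H t \<in> Lagr" if "t \<in> S" for t using H that by (simp add: cont_family_def)
  have T: "lagr_tendsto H (H t0) ?F"
    unfolding lagr_tendsto_def
  proof (intro conjI allI)
    show "\<forall>\<^sub>F t in ?F. H t \<in> Lagr" by (rule eventually_mono[OF mem L])
    fix x
    have "continuous_on S (\<lambda>t. closest_point (H t) x)" using H unfolding cont_family_def by blast
    then show "((\<lambda>t. ?P t x) \<longlongrightarrow> ?P t0 x) ?F" using t0 unfolding continuous_on_def by blast
  qed (rule L[OF t0])
  have "linear (\<lambda>z::'m symp. snd z + \<tau> *\<^sub>R fst z)"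
    by (rule linearI) (simp_all add: scaleR_add_right)
  from linear_subspace_vimage[OF this subspace_single_0] have W: "subspace ?W" by (simp add: vimage_def)
  have HW: "H t0 \<inter> ?W = {0}"
  proof (intro equalityI subsetI)
    fix z assume z: "z \<in> H t0 \<inter> ?W"
    then obtain v where v: "z = chart_map \<tau> (A t0) v" using A(2)[OF t0] by blast
    then have "v = 0" using z chart_map_recover[of \<tau> "A t0" v] by (simp add: chart_map_def)
    then show "z \<in> {0}" using v linear_0[OF linear_chart_map[of "A t0" \<tau>]] A(1)[OF t0] by (simp add: self_adjoint_def)
  qed (use subspace_0[OF W] subspace_0[OF LagrD(1)[OF L[OF t0]]] in simp)
  obtain c where c: "c > 0" "\<forall>\<^sub>F t in ?F. \<forall>z\<in>?W. c * norm z \<le> norm (z - ?P t z)"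
    by (rule lagr_tendsto_disjoint[OF T W HW])
  let ?z = "chart_map \<tau> (A t0) w"
  have zH: "?z \<in> H t0" using A(2)[OF t0] by blast
  let ?v = "\<lambda>t. - snd (?P t ?z) - \<tau> *\<^sub>R fst (?P t ?z)"
  have Pz: "((\<lambda>t. ?P t ?z) \<longlongrightarrow> ?z) ?F" by (rule lagr_tendstoD(4)[OF T zH])
  have "((\<lambda>t. norm (fst (?P t ?z) - fst ?z) + norm (w - ?v t) / c)
      \<longlongrightarrow> norm (fst ?z - fst ?z) + norm (w - (- snd ?z - \<tau> *\<^sub>R fst ?z)) / c) ?F"
    by (intro tendsto_intros Pz) (use c in auto)
  then have lim: "((\<lambda>t. norm (fst (?P t ?z) - fst ?z) + norm (w - ?v t) / c) \<longlongrightarrow> 0) ?F"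
    unfolding chart_map_recover by simp
  have "\<forall>\<^sub>F t in ?F. norm (A t w - A t0 w) \<le> norm (fst (?P t ?z) - fst ?z) + norm (w - ?v t) / c"
    using mem c(2)
  proof eventually_elim
    case (elim t)
    have lin: "linear (A t)" using A(1)[OF elim(1)] by (simp add: self_adjoint_def)
    have bd: "norm (A t e) \<le> norm e / c" for e
    proof -
      (* a vector of the complement at distance at most norm e from the plane *)
      let ?m = "(A t e, - \<tau> *\<^sub>R A t e)"
      have ne: "closed (H t)" using L[OF elim(1)] LagrD(1) closed_subspace by blast
      have "c * norm (A t e) \<le> c * norm ?m" using c(1) norm_fst_le[of "A t e"] by (intro mult_left_mono) auto
      also have "\<dots> \<le> norm (?m - ?P t ?m)" using elim(2) by simp
      also have "\<dots> \<le> dist ?m (chart_map \<tau> (A t) e)"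
        using closest_point_le[OF ne, of "chart_map \<tau> (A t) e" ?m] A(2)[OF elim(1)] by (simp add: dist_norm)
      also have "\<dots> = norm e" by (simp add: dist_norm chart_map_def norm_Pair)
      finally show ?thesis using c(1) by (simp add: field_simps)
    qed
    obtain v where v: "?P t ?z = chart_map \<tau> (A t) v"
      using closest_point_subspace(1)[OF LagrD(1)[OF L[OF elim(1)]], of ?z] A(2)[OF elim(1)] by auto
    then have vv: "?v t = v" using chart_map_recover[of \<tau> "A t" v] by simp
    have "A t w - A t0 w = (fst (?P t ?z) - fst ?z) + A t (w - v)"
      unfolding linear_diff[OF lin] v by (simp add: chart_map_def)
    then have "norm (A t w - A t0 w) \<le> norm (fst (?P t ?z) - fst ?z) + norm (A t (w - v))"
      by (metis norm_triangle_ineq)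
    also have "\<dots> \<le> norm (fst (?P t ?z) - fst ?z) + norm (w - v) / c" using bd by simp
    finally show ?case unfolding vv .
  qed
  from Lim_null_comparison[OF this lim] show "((\<lambda>t. A t w) \<longlongrightarrow> A t0 w) ?F"
    by (rule LIM_zero_cancel)
qed

lemma C1_differentiable_on_inner:
  assumes "f C1_differentiable_on S" "g C1_differentiable_on S"
  shows "(\<lambda>t. inner (f t) (g t)) C1_differentiable_on S"
proof -
  obtain D E where D: "\<forall>x\<in>S. (f has_vector_derivative D x) (at x)" "continuous_on S D"
    and E: "\<forall>x\<in>S. (g has_vector_derivative E x) (at x)" "continuous_on S E"
    using assms unfolding C1_differentiable_on_def by blast
  have cont: "continuous_on S f" "continuous_on S g"
    using D(1) E(1) by (auto intro!: continuous_at_imp_continuous_on has_vector_derivative_continuous)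
  show ?thesis unfolding C1_differentiable_on_def
    using bounded_bilinear.has_vector_derivative[OF bounded_bilinear_inner, of f _ _ UNIV g] D E cont
    by (intro exI[of _ "\<lambda>x. inner (f x) (E x) + inner (D x) (g x)"]) (auto intro!: continuous_intros)
qed

lemma C1_differentiable_on_sum:
  assumes "\<And>i. i \<in> I \<Longrightarrow> f i C1_differentiable_on S"
  shows "(\<lambda>t. \<Sum>i\<in>I. f i t) C1_differentiable_on S"
  using assms by (induction I rule: infinite_finite_induct) auto

lemma C1_differentiable_on_prod:
  fixes f :: "'i \<Rightarrow> real \<Rightarrow> real"
  assumes "\<And>i. i \<in> I \<Longrightarrow> f i C1_differentiable_on S"
  shows "(\<lambda>t. \<Prod>i\<in>I. f i t) C1_differentiable_on S"
  using assms by (induction I rule: infinite_finite_induct) auto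

lemma C1_differentiable_on_inverse:
  fixes f :: "real \<Rightarrow> real"
  assumes "f C1_differentiable_on S" "\<And>t. t \<in> S \<Longrightarrow> f t \<noteq> 0"
  shows "(\<lambda>t. inverse (f t)) C1_differentiable_on S"
proof -
  obtain D where D: "\<forall>x\<in>S. (f has_vector_derivative D x) (at x)" "continuous_on S D"
    using assms unfolding C1_differentiable_on_def by blast
  have cont: "continuous_on S f"
    using D(1) by (auto intro!: continuous_at_imp_continuous_on has_vector_derivative_continuous)
  have "((\<lambda>t. inverse (f t)) has_vector_derivative - (inverse (f x) * D x * inverse (f x))) (at x)" if "x \<in> S" for x
    using D(1) that assms(2)[OF that] unfolding has_real_derivative_iff_has_vector_derivative[symmetric]
    by (auto intro!: DERIV_inverse')
  then show ?thesis unfolding C1_differentiable_on_def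
    using D(2) cont assms(2)
    by (intro exI[of _ "\<lambda>x. - (inverse (f x) * D x * inverse (f x))"]) (auto intro!: continuous_intros)
qed

lemma C1_differentiable_on_det:
  fixes M :: "real \<Rightarrow> real^'n^'n"
  assumes "\<And>i j. (\<lambda>t. (M t $ i) $ j) C1_differentiable_on S"
  shows "(\<lambda>t. Determinants.det (M t)) C1_differentiable_on S"
  unfolding Determinants.det_def
  by (intro C1_differentiable_on_sum C1_differentiable_on_mult C1_differentiable_on_const C1_differentiable_on_prod assms)

text \<open>
  Cramer's rule applied to the normal equations writes the projection as a rational expression in the Gram matrix.
\<close>

lemma C1_closest_point_range:
  fixes T :: "real \<Rightarrow> real^'n \<Rightarrow> 'b::euclidean_space"
  assumes lin: "\<And>t. linear (T t)" "\<And>t. inj (T t)" and C1: "\<And>w. (\<lambda>t. T t w) C1_differentiable_on UNIV"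
  shows "(\<lambda>t. closest_point (range (T t)) x) C1_differentiable_on UNIV"
proof -
  let ?e = "\<lambda>i::'n. axis i (1::real)"
  (* normal equations G c = R with the Gram matrix G; M k has its k-th column replaced by R *)
  define G :: "real \<Rightarrow> real^'n^'n" where "G t = (\<chi> i j. inner (T t (?e i)) (T t (?e j)))" for t
  define R :: "real \<Rightarrow> real^'n" where "R t = (\<chi> i. inner x (T t (?e i)))" for t
  define M :: "'n \<Rightarrow> real \<Rightarrow> real^'n^'n" where "M k t = (\<chi> i j. if j = k then R t $ i else (G t $ i) $ j)" for k t
  define c :: "real \<Rightarrow> real^'n" where "c t = (\<chi> k. Determinants.det (M k t) / Determinants.det (G t))" for t
  have T: "T t w = (\<Sum>i\<in>UNIV. w $ i *\<^sub>R T t (?e i))" for t w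
  proof -
    have "w = (\<Sum>i\<in>UNIV. w $ i *\<^sub>R ?e i)" using basis_expansion[of w] by (simp add: scalar_mult_eq_scaleR)
    then have "T t w = T t (\<Sum>i\<in>UNIV. w $ i *\<^sub>R ?e i)" by simp
    also have "\<dots> = (\<Sum>i\<in>UNIV. w $ i *\<^sub>R T t (?e i))" by (simp add: linear_sum[OF lin(1)] linear_cmul[OF lin(1)])
    finally show ?thesis .
  qed
  have Gw: "(G t *v w) $ i = inner (T t (?e i)) (T t w)" for t w i
    unfolding T[of t w] by (simp add: matrix_vector_mult_def G_def inner_sum_right mult.commute)
  have nz: "Determinants.det (G t) \<noteq> 0" for t
  proof -
    have "w = 0" if "G t *v w = 0" for w
    proof -
      have "inner (T t w) (T t w) = (\<Sum>i\<in>UNIV. w $ i * inner (T t (?e i)) (T t w))"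
        by (subst T) (simp add: inner_sum_left)
      also have "\<dots> = 0" using that Gw[of t w] by simp
      finally have "T t w = T t 0" using linear_0[OF lin(1)] by simp
      then show "w = 0" using lin(2)[of t] by (simp add: inj_def)
    qed
    then show ?thesis
      using matrix_left_invertible_ker[of "G t"] invertible_left_inverse[of "G t"] invertible_det_nz[of "G t"] by blast
  qed
  have cp: "closest_point (range (T t)) x = (\<Sum>i\<in>UNIV. c t $ i *\<^sub>R T t (?e i))" for t
    unfolding T[symmetric]
  proof (rule closest_point_subspace_unique)
    show "subspace (range (T t))" by (rule linear_subspace_image[OF lin(1) subspace_UNIV])
    have Gc: "G t *v c t = R t" using cramer[OF nz, of t "c t" "R t"] by (simp add: c_def M_def)
    have orth: "inner (x - T t (c t)) (T t (?e i)) = 0" for i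
    proof -
      have "inner (T t (?e i)) (T t (c t)) = inner x (T t (?e i))" using Gw[of t "c t" i] Gc by (simp add: R_def)
      then show ?thesis by (simp add: inner_diff_left inner_commute[of "T t (c t)"])
    qed
    then show "inner (x - T t (c t)) v = 0" if "v \<in> range (T t)" for v
    proof -
      obtain w where w: "v = T t w" using \<open>v \<in> range (T t)\<close> by blast
      show ?thesis unfolding w T[of t w]
        by (simp add: inner_sum_right orth)
    qed
  qed simp
  have G1: "(\<lambda>t. (G t $ i) $ j) C1_differentiable_on UNIV" for i j
    by (simp add: G_def C1_differentiable_on_inner C1)
  have R1: "(\<lambda>t. R t $ i) C1_differentiable_on UNIV" for i
    by (simp add: R_def C1_differentiable_on_inner C1)
  have "(\<lambda>t. Determinants.det (M k t)) C1_differentiable_on UNIV" for k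
  proof (rule C1_differentiable_on_det)
    show "(\<lambda>t. (M k t $ i) $ j) C1_differentiable_on UNIV" for i j
      by (cases "j = k") (simp_all add: M_def G1 R1)
  qed
  moreover have "(\<lambda>t. Determinants.det (G t)) C1_differentiable_on UNIV"
    by (rule C1_differentiable_on_det) (rule G1)
  ultimately have "(\<lambda>t. c t $ k) C1_differentiable_on UNIV" for k
    unfolding c_def using nz by (simp add: divide_inverse C1_differentiable_on_inverse C1_differentiable_on_mult)
  then show ?thesis unfolding cp by (intro C1_differentiable_on_sum C1_differentiable_on_scaleR C1)
qed

text \<open>
  Any differentiable curve in the Lagrangian planes may replace the projected one in the crossing form.
\<close>

lemma proj_deriv_curve:
  fixes \<Gamma> :: "real \<Rightarrow> 'm::finite symp set"
  assumes path: "C1_path \<Gamma> a b" "a < b" "t0 \<in> {a..b}"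
    and z: "\<And>t. t \<in> {a..b} \<Longrightarrow> z t \<in> \<Gamma> t" "(z has_vector_derivative z') (at t0 within {a..b})"
  shows "symp_form (z t0) (proj_deriv \<Gamma> {a..b} t0 (z t0)) = symp_form (z t0) z'"
proof -
  let ?P = "\<lambda>t. closest_point (\<Gamma> t)" and ?d = "proj_deriv \<Gamma> {a..b} t0" and ?F = "at t0 within {a..b}" and ?k = "z t0"
  have k: "?k \<in> \<Gamma> t0" by (rule z(1)[OF path(3)])
  have zl: "(z \<longlongrightarrow> ?k) ?F" using has_vector_derivative_continuous[OF z(2)] unfolding continuous_within .
  have "((\<lambda>t. symp_form ((?P t ?k - ?k) /\<^sub>R (t - t0)) (z t) + symp_form ?k ((z t - ?k) /\<^sub>R (t - t0)))
      \<longlongrightarrow> symp_form (?d ?k) ?k + symp_form ?k z') ?F"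
    by (intro tendsto_add tendsto_symp_form proj_quotient[OF path k] zl tendsto_const has_vector_derivative_quotient z(2))
  moreover have "\<forall>\<^sub>F t in ?F.
      symp_form ((?P t ?k - ?k) /\<^sub>R (t - t0)) (z t) + symp_form ?k ((z t - ?k) /\<^sub>R (t - t0)) = 0"
    using path_eventually_mem[OF path]
  proof eventually_elim
    case (elim t)
    note L = path_Lagr[OF path elim]
    have "symp_form (?P t ?k) (z t) = 0"
      by (intro LagrD(3)[OF L] closest_point_subspace(1) LagrD(1)[OF L] z(1) elim)
    moreover have "symp_form ?k ?k = 0" using LagrD(3)[OF path_Lagr[OF path path(3)] k k] .
    ultimately show ?case
      by (simp add: symp_form_scale_left symp_form_scale_right symp_form_diff_left symp_form_diff_right algebra_simps)
  qed
  ultimately have "((\<lambda>t. 0) \<longlongrightarrow> symp_form (?d ?k) ?k + symp_form ?k z') ?F"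
    by (rule Lim_transform_eventually)
  then have "symp_form (?d ?k) ?k + symp_form ?k z' = 0"
    by (rule tendsto_unique[OF path_filter_nontrivial[OF path] _ tendsto_const])
  then show ?thesis using symp_form_anti[of "?d ?k" ?k] by simp
qed

text \<open>
  At \<open>u\<close> away from \<open>1/2\<close> the derivative of \<open>C = (1 - u) A + u B + c u (1 - u)\<close> is definite, because the last term
  dominates; near \<open>1/2\<close> the matrix \<open>C\<close> itself is positive definite and there is no crossing.
\<close>

lemma regular_path_between:
  fixes A B :: "real^'m \<Rightarrow> real^'m::finite" and a b \<tau> :: real
  assumes A: "self_adjoint A" and B: "self_adjoint B" and ab: "a < b"
  shows "\<exists>C. (\<forall>t. self_adjoint (C t)) \<and> C a = A \<and> C b = B \<and> (\<forall>w. continuous_on UNIV (\<lambda>t. C t w)) \<and>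
    regular_path (\<lambda>t. range (chart_map \<tau> (C t))) vertical a b"
proof -
  have lA: "linear A" and lB: "linear B" using A B by (auto simp: self_adjoint_def)
  obtain K1 where K1: "K1 > 0" "\<And>w. norm (A w) \<le> K1 * norm w" using linear_bounded_pos[OF lA] by blast
  obtain K2 where K2: "K2 > 0" "\<And>w. norm (B w) \<le> K2 * norm w" using linear_bounded_pos[OF lB] by blast
  define K where "K = K1 + K2"
  have K: "K > 0" "\<bar>inner w (A w)\<bar> \<le> K * (norm w)\<^sup>2" "\<bar>inner w (B w)\<bar> \<le> K * (norm w)\<^sup>2" for w
  proof -
    show "K > 0" using K1 K2 by (simp add: K_def)
    have *: "\<bar>inner w v\<bar> \<le> K * (norm w)\<^sup>2" if "norm v \<le> K' * norm w" "K' \<le> K" for v K'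
    proof -
      have "\<bar>inner w v\<bar> \<le> norm w * norm v" by (rule Cauchy_Schwarz_ineq2)
      also have "\<dots> \<le> norm w * (K' * norm w)" using that(1) by (intro mult_left_mono) auto
      also have "\<dots> = K' * (norm w)\<^sup>2" by (simp add: power2_eq_square)
      also have "\<dots> \<le> K * (norm w)\<^sup>2" using that(2) by (intro mult_right_mono) auto
      finally show ?thesis .
    qed
    show "\<bar>inner w (A w)\<bar> \<le> K * (norm w)\<^sup>2" by (rule *[OF K1(2)]) (use K2 in \<open>simp add: K_def\<close>)
    show "\<bar>inner w (B w)\<bar> \<le> K * (norm w)\<^sup>2" by (rule *[OF K2(2)]) (use K1 in \<open>simp add: K_def\<close>)
  qed
  (* c = 16 K: the correction dominates the derivative of C where |u - 1/2| \<ge> 1/4 and makes C positive in between *)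
  define c where "c = 16 * K"
  define U where "U t = (t - a) / (b - a)" for t
  define C where "C t w = (1 - U t) *\<^sub>R A w + U t *\<^sub>R B w + (c * (U t * (1 - U t))) *\<^sub>R w" for t w
  have CA: "C a = A" and CB: "C b = B" using ab by (auto simp: C_def U_def)
  have C: "self_adjoint (C t)" for t
    unfolding self_adjoint_def
  proof (intro conjI allI)
    show "linear (C t)"
      by (rule linearI) (simp_all add: C_def linear_add[OF lA] linear_add[OF lB] linear_cmul[OF lA] linear_cmul[OF lB] algebra_simps)
    show "inner (C t v) w = inner v (C t w)" for v w
      using A B by (simp add: C_def self_adjoint_def inner_left_distrib inner_right_distrib)
  qed
  have lC: "linear (C t)" for t using C by (simp add: self_adjoint_def)
  have U1: "U C1_differentiable_on UNIV"
    unfolding U_def by (simp add: divide_inverse C1_differentiable_on_mult)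
  have C1w: "(\<lambda>t. C t w) C1_differentiable_on UNIV" for w
    unfolding C_def by (intro C1_differentiable_on_add C1_differentiable_on_scaleR C1_differentiable_on_diff
        C1_differentiable_on_mult C1_differentiable_on_const U1)
  have C1T: "(\<lambda>t. chart_map \<tau> (C t) w) C1_differentiable_on UNIV" for w
  proof -
    obtain D where D: "\<forall>x\<in>UNIV. ((\<lambda>t. C t w) has_vector_derivative D x) (at x)" "continuous_on UNIV D"
      using C1w[of w] unfolding C1_differentiable_on_def by blast
    have "((\<lambda>t. chart_map \<tau> (C t) w) has_vector_derivative (D x, 0 - \<tau> *\<^sub>R D x)) (at x)" for x
      unfolding chart_map_def
      by (intro has_vector_derivative_Pair has_vector_derivative_diff has_vector_derivative_const
          bounded_linear.has_vector_derivative[OF bounded_linear_scaleR_right] D(1)[rule_format] UNIV_I)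
    moreover have "continuous_on UNIV (\<lambda>x. (D x, 0 - \<tau> *\<^sub>R D x))" by (intro continuous_intros D(2))
    ultimately show ?thesis unfolding C1_differentiable_on_def
      by (intro exI[of _ "\<lambda>x. (D x, 0 - \<tau> *\<^sub>R D x)"] conjI ballI)
  qed
  let ?\<Gamma> = "\<lambda>t. range (chart_map \<tau> (C t))"
  have path: "C1_path ?\<Gamma> a b"
    unfolding C1_path_def
  proof (intro conjI ballI allI)
    show "?\<Gamma> t \<in> Lagr" for t by (rule chart_map_Lagr[OF C])
    fix x
    have "(\<lambda>t. closest_point (?\<Gamma> t) x) C1_differentiable_on UNIV"
      by (rule C1_closest_point_range[OF linear_chart_map[OF lC] inj_chart_map C1T])
    then obtain D where D: "\<And>t. ((\<lambda>t. closest_point (?\<Gamma> t) x) has_vector_derivative D t) (at t)" "continuous_on UNIV D"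
      unfolding C1_differentiable_on_def by blast
    show "\<exists>d. (\<forall>t\<in>{a..b}. ((\<lambda>t. closest_point (?\<Gamma> t) x) has_vector_derivative d t) (at t within {a..b})) \<and>
        continuous_on {a..b} d"
      using has_vector_derivative_at_within[OF D(1)] continuous_on_subset[OF D(2)] by blast
  qed
  have "regular_crossing ?\<Gamma> vertical {a..b} t"
    if t: "t \<in> {a..b}" and cr: "is_crossing ?\<Gamma> vertical t" for t
    unfolding regular_crossing_def
  proof (intro conjI cr)
    let ?u = "U t" and ?Q = "crossing_form ?\<Gamma> {a..b} t"
    have u: "0 \<le> ?u" "?u \<le> 1" using t ab by (auto simp: U_def divide_simps)
    have Q: "?Q q = inner w (B w - A w + (c * (1 - 2 * ?u)) *\<^sub>R w) / (b - a)" "C t w = 0"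
      if q: "q \<in> ?\<Gamma> t \<inter> vertical" "q = chart_map \<tau> (C t) w" for q w
    proof -
      show C0: "C t w = 0" using q by (auto simp: chart_map_def)
      have dU: "(U has_real_derivative 1 / (b - a)) (at t within {a..b})"
        unfolding U_def using ab by (auto intro!: derivative_eq_intros)
      have dC: "((\<lambda>s. C s w) has_vector_derivative (1 / (b - a)) *\<^sub>R (B w - A w + (c * (1 - 2 * ?u)) *\<^sub>R w)) (at t within {a..b})"
        unfolding C_def
        by (auto intro!: derivative_eq_intros dU simp: algebra_simps add_divide_distrib diff_divide_distrib)
      let ?C' = "(1 / (b - a)) *\<^sub>R (B w - A w + (c * (1 - 2 * ?u)) *\<^sub>R w)"
      have dz: "((\<lambda>s. chart_map \<tau> (C s) w) has_vector_derivative (?C', 0 - \<tau> *\<^sub>R ?C')) (at t within {a..b})"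
        unfolding chart_map_def
        by (intro has_vector_derivative_Pair has_vector_derivative_diff has_vector_derivative_const
            bounded_linear.has_vector_derivative[OF bounded_linear_scaleR_right] dC)
      have "?Q q = symp_form q (proj_deriv ?\<Gamma> {a..b} t q)"
        by (rule crossing_form_eq[OF path ab t]) (use q in blast)
      also have "\<dots> = symp_form q (?C', 0 - \<tau> *\<^sub>R ?C')"
        unfolding q(2) by (rule proj_deriv_curve[OF path ab t _ dz]) blast
      also have "\<dots> = inner w ?C'"
        unfolding q(2) chart_map_def C0 by (simp add: symp_form_eq)
      finally show "?Q q = inner w (B w - A w + (c * (1 - 2 * ?u)) *\<^sub>R w) / (b - a)" by simp
    qed
    have def: "?Q q \<noteq> 0" if q: "q \<in> ?\<Gamma> t \<inter> vertical" "q \<noteq> 0" for q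
    proof -
      obtain w where w: "q = chart_map \<tau> (C t) w" using q(1) by blast
      note Qw = Q[OF q(1) w]
      have w0: "w \<noteq> 0" using q(2) w linear_0[OF linear_chart_map[OF lC]] by auto
      then have n: "(norm w)\<^sup>2 > 0" by simp
      let ?N = "(norm w)\<^sup>2"
      have e: "inner w (B w - A w + (c * (1 - 2 * ?u)) *\<^sub>R w) = inner w (B w) - inner w (A w) + c * (1 - 2 * ?u) * ?N"
        by (simp add: inner_diff_right inner_right_distrib power2_norm_eq_inner)
      have bA: "- (K * ?N) \<le> inner w (A w)" "inner w (A w) \<le> K * ?N" using K(2)[of w] by (simp_all add: abs_le_iff)
      have bB: "- (K * ?N) \<le> inner w (B w)" "inner w (B w) \<le> K * ?N" using K(3)[of w] by (simp_all add: abs_le_iff)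
      have cN: "c * (1 - 2 * ?u) * ?N = 16 * (1 - 2 * ?u) * (K * ?N)" by (simp add: c_def)
      have KN: "K * ?N > 0" using K(1) n by simp
      consider "?u < 1/4" | "?u > 3/4" | "1/4 \<le> ?u" "?u \<le> 3/4" by linarith
      then have "inner w (B w - A w + (c * (1 - 2 * ?u)) *\<^sub>R w) \<noteq> 0"
      proof cases
        case 1
        then have "16 * (1 - 2 * ?u) * (K * ?N) \<ge> 8 * (K * ?N)" using KN by (intro mult_right_mono) auto
        then have "inner w (B w) - inner w (A w) + c * (1 - 2 * ?u) * ?N > 0"
          unfolding cN using bA bB KN by linarith
        then show ?thesis unfolding e by simp
      next
        case 2
        then have "16 * (1 - 2 * ?u) * (K * ?N) \<le> - 8 * (K * ?N)" using KN by (intro mult_right_mono) auto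
        then have "inner w (B w) - inner w (A w) + c * (1 - 2 * ?u) * ?N < 0"
          unfolding cN using bA bB KN by linarith
        then show ?thesis unfolding e by simp
      next
        case 3
        have "0 = inner w (C t w)" using Qw(2) by simp
        also have "\<dots> = (1 - ?u) * inner w (A w) + ?u * inner w (B w) + 16 * (?u * (1 - ?u)) * (K * ?N)"
          unfolding C_def c_def by (simp add: inner_right_distrib power2_norm_eq_inner)
        finally have "0 = (1 - ?u) * inner w (A w) + ?u * inner w (B w) + 16 * (?u * (1 - ?u)) * (K * ?N)" .
        moreover have "(1 - ?u) * - (K * ?N) \<le> (1 - ?u) * inner w (A w)" using u bA by (intro mult_left_mono) auto
        moreover have "?u * - (K * ?N) \<le> ?u * inner w (B w)" using u bB by (intro mult_left_mono) auto
        moreover have "(?u - 1/4) * (3/4 - ?u) \<ge> 0" using 3 by simp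
        then have "3 \<le> 16 * (?u * (1 - ?u))" by (simp add: algebra_simps)
        then have "3 * (K * ?N) \<le> 16 * (?u * (1 - ?u)) * (K * ?N)" using KN by (intro mult_right_mono) auto
        ultimately have False using KN by (simp add: algebra_simps)
        then show ?thesis ..
      qed
      then show ?thesis unfolding Qw(1) using ab by simp
    qed
    have two: "?Q (q + q) = 4 * ?Q q" if "q \<in> ?\<Gamma> t" for q
    proof -
      have qq: "q + q \<in> ?\<Gamma> t" by (rule subspace_add[OF LagrD(1)[OF chart_map_Lagr[OF C]] that that])
      let ?d = "proj_deriv ?\<Gamma> {a..b} t"
      have "?Q (q + q) = symp_form (q + q) (?d (q + q))" by (rule crossing_form_eq[OF path ab t qq])
      also have "\<dots> = 4 * symp_form q (?d q)"
        unfolding linear_add[OF linear_proj_deriv[OF path ab t]] symp_form_add_left symp_form_add_right by simp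
      also have "\<dots> = 4 * ?Q q" by (simp only: crossing_form_eq[OF path ab t that])
      finally show ?thesis .
    qed
    show "nondegenerate (?\<Gamma> t \<inter> vertical) ?Q"
      unfolding nondegenerate_def
    proof (intro ballI impI)
      fix q assume q: "q \<in> ?\<Gamma> t \<inter> vertical" "\<forall>p\<in>?\<Gamma> t \<inter> vertical. ?Q (q + p) - ?Q q - ?Q p = 0"
      have "?Q (q + q) - ?Q q - ?Q q = 0" by (rule q(2)[rule_format, OF q(1)])
      then have "?Q q = 0" unfolding two[OF IntD1[OF q(1)]] by simp
      then show "q = 0" by (rule contrapos_pp) (rule def[OF q(1)])
    qed
  qed
  then have "regular_path ?\<Gamma> vertical a b" using path by (simp add: regular_path_def)
  moreover have "continuous_on UNIV (\<lambda>t. C t w)" for w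
  proof -
    obtain D where D: "\<forall>x\<in>UNIV. ((\<lambda>t. C t w) has_vector_derivative D x) (at x)"
      using C1w[of w] unfolding C1_differentiable_on_def by blast
    show ?thesis
      by (intro continuous_at_imp_continuous_on ballI) (rule has_vector_derivative_continuous[OF D[rule_format]], simp)
  qed
  ultimately show ?thesis using C CA CB by (intro exI[of _ C] conjI allI)
qed

text \<open>
  Both the representative and the homotopy to it are built inside the chart, where Lagrangian planes are symmetric
  matrices and convex combinations make sense.
\<close>

theorem Mas_chart_path:
  fixes \<Lambda> :: "real \<Rightarrow> 'm::finite symp set"
  assumes L: "cont_family {a..b} \<Lambda>" and ab: "a < b" and ch: "\<And>t. t \<in> {a..b} \<Longrightarrow> chart \<tau> (\<Lambda> t)"
  shows "Mas \<Lambda> vertical a b = int (robin_index \<tau> (\<Lambda> a)) - int (robin_index \<tau> (\<Lambda> b))"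
proof -
  have "\<forall>t\<in>{a..b}. \<exists>A. self_adjoint A \<and> \<Lambda> t = range (chart_map \<tau> A)"
    using chart_map_exists ch L unfolding cont_family_def by blast
  then obtain A where A: "\<And>t. t \<in> {a..b} \<Longrightarrow> self_adjoint (A t)"
      "\<And>t. t \<in> {a..b} \<Longrightarrow> \<Lambda> t = range (chart_map \<tau> (A t))" by metis
  have cA: "continuous_on {a..b} (\<lambda>t. A t w)" for w by (rule chart_map_continuous[OF L A])
  have "\<exists>C. (\<forall>t. self_adjoint (C t)) \<and> C a = A a \<and> C b = A b \<and> (\<forall>w. continuous_on UNIV (\<lambda>t. C t w)) \<and>
    regular_path (\<lambda>t. range (chart_map \<tau> (C t))) vertical a b"
    by (rule regular_path_between[OF A(1) A(1) ab]) (use ab in auto)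
  then obtain C where C: "\<forall>t. self_adjoint (C t)" "C a = A a" "C b = A b" "\<forall>w. continuous_on UNIV (\<lambda>t. C t w)"
      "regular_path (\<lambda>t. range (chart_map \<tau> (C t))) vertical a b" by (elim exE conjE)
  let ?\<Gamma> = "\<lambda>t. range (chart_map \<tau> (C t))"
  define M where "M p w = (1 - fst p) *\<^sub>R A (snd p) w + fst p *\<^sub>R C (snd p) w" for p :: "real \<times> real" and w
  let ?S = "{0..1::real} \<times> {a..b}"
  have sM: "self_adjoint (M p)" if "p \<in> ?S" for p
  proof -
    have 1: "self_adjoint (A (snd p))" "self_adjoint (C (snd p))" using A(1) C(1) that by auto
    then have l: "linear (A (snd p))" "linear (C (snd p))" by (auto simp: self_adjoint_def)
    show ?thesis unfolding self_adjoint_def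
    proof (intro conjI allI)
      show "linear (M p)"
        by (rule linearI) (simp_all add: M_def linear_add[OF l(1)] linear_add[OF l(2)] linear_cmul[OF l(1)] linear_cmul[OF l(2)] algebra_simps)
      show "inner (M p v) w = inner v (M p w)" for v w
        using 1 by (simp add: M_def self_adjoint_def inner_left_distrib inner_right_distrib)
    qed
  qed
  have cM: "continuous_on ?S (\<lambda>p. M p w)" for w
  proof -
    have "continuous_on ?S (\<lambda>p. A (snd p) w)"
      by (rule continuous_on_compose2[OF cA]) (auto intro!: continuous_intros)
    moreover have "continuous_on ?S (\<lambda>p. C (snd p) w)"
      by (rule continuous_on_compose2[OF C(4)[rule_format]]) (auto intro!: continuous_intros)
    ultimately show ?thesis unfolding M_def by (intro continuous_intros)
  qed
  have hom: "homotopic_fixed_ends a b \<Lambda> ?\<Gamma>"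
    unfolding homotopic_fixed_ends_def
  proof (intro exI[of _ "\<lambda>p. range (chart_map \<tau> (M p))"] conjI ballI)
    show "cont_family ?S (\<lambda>p. range (chart_map \<tau> (M p)))"
    proof (rule cont_family_range)
      show "linear (chart_map \<tau> (M p))" if "p \<in> ?S" for p
        using sM[OF that] by (intro linear_chart_map) (simp add: self_adjoint_def)
      show "continuous_on ?S (\<lambda>p. chart_map \<tau> (M p) w)" for w
        unfolding chart_map_def by (intro continuous_intros cM)
      show "range (chart_map \<tau> (M p)) \<in> Lagr" if "p \<in> ?S" for p
        by (rule chart_map_Lagr[OF sM[OF that]])
    qed (rule inj_chart_map)
    show "range (chart_map \<tau> (M (0, t))) = \<Lambda> t" if "t \<in> {a..b}" for t
      using A(2)[OF that] by (simp add: M_def[abs_def])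
    show "range (chart_map \<tau> (M (1, t))) = ?\<Gamma> t" if "t \<in> {a..b}" for t
      by (simp add: M_def[abs_def])
    show "range (chart_map \<tau> (M (\<sigma>, a))) = \<Lambda> a" for \<sigma>
      using A(2)[of a] ab by (simp add: M_def[abs_def] C(2) algebra_simps)
    show "range (chart_map \<tau> (M (\<sigma>, b))) = \<Lambda> b" for \<sigma>
      using A(2)[of b] ab by (simp add: M_def[abs_def] C(3) algebra_simps)
  qed
  note val = Mas_regular_of_chart_path[OF _ ab _ ch]
  show ?thesis unfolding Mas_def
  proof (rule the_equality)
    show "\<exists>\<Gamma>. regular_path \<Gamma> vertical a b \<and> homotopic_fixed_ends a b \<Lambda> \<Gamma> \<and>
        int (robin_index \<tau> (\<Lambda> a)) - int (robin_index \<tau> (\<Lambda> b)) = Mas_regular \<Gamma> vertical a b"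
      using C(5) hom val[OF C(5) hom] by (intro exI[of _ ?\<Gamma>]) simp
    fix k assume "\<exists>\<Gamma>. regular_path \<Gamma> vertical a b \<and> homotopic_fixed_ends a b \<Lambda> \<Gamma> \<and> k = Mas_regular \<Gamma> vertical a b"
    then obtain \<Gamma> where "regular_path \<Gamma> vertical a b" "homotopic_fixed_ends a b \<Lambda> \<Gamma>" "k = Mas_regular \<Gamma> vertical a b"
      by blast
    then show "k = int (robin_index \<tau> (\<Lambda> a)) - int (robin_index \<tau> (\<Lambda> b))" using val by simp
  qed
qed

section \<open>Differentiation of indefinite integrals\<close>

text \<open>
  Lebesgue differentiation for the gauge integral. Where the difference quotient fails by at least
  \<open>1 / (n + 1)\<close>, there are arbitrarily short bad intervals; Vitali's theorem selects
  disjoint ones covering almost all such points, and Henstock's lemma bounds their total length.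
\<close>

lemma indefinite_integral_derivative_ae:
  fixes f :: "real \<Rightarrow> real"
  assumes f: "f integrable_on {a..b}"
  shows "negligible {x\<in>{a..b}. \<not> ((\<lambda>u. integral {a..u} f) has_real_derivative f x) (at x within {a..b})}"
proof -
  let ?F = "\<lambda>u. integral {a..u} f"
  (* (x, y) violates the difference quotient estimate with 1 / (n + 1) *)
  define bad where "bad n x y \<longleftrightarrow> y \<in> {a..b} \<and> y \<noteq> x \<and>
    \<bar>y - x\<bar> < real (Suc n) * \<bar>?F y - ?F x - f x * (y - x)\<bar>" for n x y
  define E where "E n = {x\<in>{a..b}. \<forall>d>0. \<exists>y. bad n x y \<and> \<bar>y - x\<bar> < d}" for n
  have F_diff: "?F v - ?F u = integral {u..v} f" if "a \<le> u" "u \<le> v" "v \<le> b" for u v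
  proof -
    have "f integrable_on {a..v}" using f by (rule integrable_on_subinterval) (use that in auto)
    from Henstock_Kurzweil_Integration.integral_combine[OF that(1,2) this] show ?thesis by linarith
  qed
  have "negligible (E n)" for n
    unfolding negligible_outer_le
  proof (intro allI impI)
    fix e :: real assume e: "e > 0"
    define e' where "e' = e / real (Suc n)"
    have e': "e' > 0" using e by (simp add: e'_def)
    obtain \<gamma> where \<gamma>: "gauge \<gamma>" "\<And>p. \<lbrakk>p tagged_partial_division_of (cbox a b); \<gamma> fine p\<rbrakk> \<Longrightarrow>
             (\<Sum>(x,k)\<in>p. norm(measure lborel k *\<^sub>R f x - integral k f)) < e'"
      using Henstock_lemma[of f a b e'] f e' by auto
    define I where "I i = {min (fst i) (snd i)..max (fst i) (snd i)}" for i :: "real \<times> real"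
    (* pairs index the candidate intervals, so that every interval remembers its tag *)
    define K where "K = {i. fst i \<in> E n \<and> bad n (fst i) (snd i) \<and> I i \<subseteq> \<gamma> (fst i)}"
    let ?c = "\<lambda>i::real \<times> real. (fst i + snd i) / 2" and ?r = "\<lambda>i::real \<times> real. \<bar>snd i - fst i\<bar> / 2"
    have cb: "cball (?c i) (?r i) = I i" for i :: "real \<times> real"
      by (auto simp: I_def cball_eq_atLeastAtMost min_def max_def abs_if field_simps)
    have rpos: "0 < ?r i" if "i \<in> K" for i using that by (auto simp: K_def bad_def)
    have cover: "\<exists>i. i \<in> K \<and> x \<in> cball (?c i) (?r i) \<and> ?r i < d" if x: "x \<in> E n" and d: "0 < d" for x d
    proof -
      have "open (\<gamma> x)" "x \<in> \<gamma> x" using \<gamma>(1) by (auto simp: gauge_def)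
      then obtain \<delta> where \<delta>: "\<delta> > 0" "ball x \<delta> \<subseteq> \<gamma> x" using open_contains_ball by blast
      obtain y where y: "bad n x y" "\<bar>y - x\<bar> < min \<delta> (2 * d)"
      proof -
        have "0 < min \<delta> (2 * d)" using \<delta>(1) d by simp
        then have "\<exists>y. bad n x y \<and> \<bar>y - x\<bar> < min \<delta> (2 * d)" using x unfolding E_def by blast
        then show ?thesis using that by blast
      qed
      have "I (x, y) \<subseteq> ball x \<delta>" using y(2) by (auto simp: I_def dist_real_def)
      then have "(x, y) \<in> K" using x y \<delta>(2) by (auto simp: K_def)
      moreover have "x \<in> I (x, y)" by (auto simp: I_def)
      ultimately show ?thesis using y(2) unfolding cb by (intro exI[of _ "(x, y)"]) auto
    qed
    obtain C where C: "countable C" "C \<subseteq> K" "pairwise (\<lambda>i j. disjnt (cball (?c i) (?r i)) (cball (?c j) (?r j))) C"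
       "negligible (E n - (\<Union>i\<in>C. cball (?c i) (?r i)))"
      by (rule Vitali_covering_theorem_cballs[of K ?r "E n" ?c, OF rpos cover])
    have fin: "measure lebesgue (\<Union>i\<in>C'. I i) \<le> e" if C': "C' \<subseteq> C" "finite C'" for C'
    proof -
      let ?g = "\<lambda>i. (fst i, I i)"
      have C'K: "i \<in> K" if "i \<in> C'" for i using C'(1) C(2) that by blast
      have ne: "fst i \<in> I i" for i by (auto simp: I_def)
      have disj: "I i \<inter> I j = {}" if "i \<in> C'" "j \<in> C'" "i \<noteq> j" for i j
        using C(3) C'(1) that unfolding pairwise_def cb disjnt_def by blast
      have inj: "inj_on ?g C'"
      proof (rule inj_onI, rule ccontr)
        fix i j assume ij: "i \<in> C'" "j \<in> C'" "?g i = ?g j" "i \<noteq> j"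
        have "fst i \<in> I i \<inter> I j" using ij(3) ne[of i] by simp
        then show False using disj[OF ij(1,2,4)] by simp
      qed
      have inab: "fst i \<in> {a..b}" "snd i \<in> {a..b}" if "i \<in> K" for i
        using that by (auto simp: K_def E_def bad_def)
      have tag: "(?g ` C') tagged_partial_division_of (cbox a b)"
        unfolding tagged_partial_division_of_def
      proof (intro conjI allI impI)
        show "finite (?g ` C')" using C'(2) by simp
        fix x k assume "(x, k) \<in> ?g ` C'"
        then obtain i where i: "i \<in> C'" "x = fst i" "k = I i" by auto
        show "x \<in> k" using i ne by simp
        show "k \<subseteq> cbox a b" using inab[OF C'K[OF i(1)]] i by (auto simp: I_def)
        show "\<exists>a b. k = cbox a b" using i(3) by (auto simp: I_def)
      next
        fix x1 k1 x2 k2 assume h: "(x1, k1) \<in> ?g ` C' \<and> (x2, k2) \<in> ?g ` C' \<and> (x1, k1) \<noteq> (x2, k2)"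
        then obtain i j where ij: "i \<in> C'" "k1 = I i" "j \<in> C'" "k2 = I j" "i \<noteq> j" by auto
        show "interior k1 \<inter> interior k2 = {}"
          using disj[OF ij(1,3,5)] ij interior_subset[of k1] interior_subset[of k2] by blast
      qed
      have fine: "\<gamma> fine (?g ` C')" using C'K by (auto simp: fine_def K_def)
      have each: "measure lebesgue (I i) \<le> real (Suc n) * norm (measure lborel (I i) *\<^sub>R f (fst i) - integral (I i) f)" if i: "i \<in> C'" for i
      proof -
        have b: "bad n (fst i) (snd i)" using C'K[OF i] by (simp add: K_def)
        note ab = inab[OF C'K[OF i]]
        have m: "measure lebesgue (I i) = \<bar>snd i - fst i\<bar>" by (auto simp: I_def)
        have c: "measure lborel (I i) = \<bar>snd i - fst i\<bar>" by (auto simp: I_def)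
        have "norm (measure lborel (I i) *\<^sub>R f (fst i) - integral (I i) f)
            = \<bar>?F (snd i) - ?F (fst i) - f (fst i) * (snd i - fst i)\<bar>"
        proof (cases "fst i \<le> snd i")
          case True
          then have "integral (I i) f = ?F (snd i) - ?F (fst i)" using F_diff[of "fst i" "snd i"] ab by (simp add: I_def)
          then show ?thesis using True c by (simp add: abs_minus_commute mult.commute)
        next
          case False
          then have int: "integral (I i) f = ?F (fst i) - ?F (snd i)"
            using F_diff[of "snd i" "fst i"] ab by (simp add: I_def)
          have m': "measure lborel (I i) = fst i - snd i" using False c by simp
          have "measure lborel (I i) *\<^sub>R f (fst i) - integral (I i) f
              = ?F (snd i) - ?F (fst i) - f (fst i) * (snd i - fst i)"
            unfolding int m' by (simp add: algebra_simps)
          then show ?thesis by (simp only: real_norm_def)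
        qed
        then show ?thesis using b m by (simp add: bad_def)
      qed
      have "measure lebesgue (\<Union>i\<in>C'. I i) \<le> (\<Sum>i\<in>C'. measure lebesgue (I i))"
        by (rule measure_UNION_le[OF C'(2)]) (auto simp: I_def)
      also have "\<dots> \<le> (\<Sum>i\<in>C'. real (Suc n) * norm (measure lborel (I i) *\<^sub>R f (fst i) - integral (I i) f))"
        by (rule sum_mono) (rule each)
      also have "\<dots> = real (Suc n) * (\<Sum>(x,k)\<in>?g ` C'. norm (measure lborel k *\<^sub>R f x - integral k f))"
        by (simp add: sum.reindex[OF inj] sum_distrib_left)
      also have "\<dots> \<le> real (Suc n) * e'" using \<gamma>(2)[OF tag fine] by (intro mult_left_mono) auto
      also have "\<dots> = e" by (simp add: e'_def)
      finally show ?thesis .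
    qed
    have lm: "I i \<in> lmeasurable" for i by (simp add: I_def)
    have U: "(\<Union>i\<in>C. I i) \<in> lmeasurable" "measure lebesgue (\<Union>i\<in>C. I i) \<le> e"
      using fmeasurable_UN_bound[OF C(1) lm fin] measure_UN_bound[OF C(1) lm fin] by simp_all
    let ?N = "E n - (\<Union>i\<in>C. I i)"
    have N: "negligible ?N" using C(4) unfolding cb .
    show "\<exists>T. E n \<subseteq> T \<and> T \<in> lmeasurable \<and> measure lebesgue T \<le> e"
    proof (intro exI[of _ "?N \<union> (\<Union>i\<in>C. I i)"] conjI)
      show "?N \<union> (\<Union>i\<in>C. I i) \<in> lmeasurable" using U(1) N negligible_imp_measurable by blast
      show "measure lebesgue (?N \<union> (\<Union>i\<in>C. I i)) \<le> e"
        using measure_Un_le[of ?N lebesgue "\<Union>i\<in>C. I i"] U N negligible_imp_measure0[OF N] negligible_imp_measurable[OF N]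
        by (simp add: fmeasurableD)
    qed auto
  qed
  then have "negligible (\<Union>n. E n)" by (intro negligible_countable_Union) auto
  moreover have "{x\<in>{a..b}. \<not> (?F has_real_derivative f x) (at x within {a..b})} \<subseteq> (\<Union>n. E n)"
  proof
    fix x assume "x \<in> {x\<in>{a..b}. \<not> (?F has_real_derivative f x) (at x within {a..b})}"
    then have x: "x \<in> {a..b}" "\<not> ((\<lambda>y. (?F y - ?F x) / (y - x)) \<longlongrightarrow> f x) (at x within {a..b})"
      by (auto simp: has_field_derivative_iff)
    then obtain \<epsilon> where \<epsilon>: "\<epsilon> > 0" "\<forall>d>0. \<exists>y\<in>{a..b}. y \<noteq> x \<and> dist y x < d \<and> \<not> dist ((?F y - ?F x) / (y - x)) (f x) < \<epsilon>"
      unfolding tendsto_iff eventually_at by blast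
    obtain n where n: "inverse (real (Suc n)) < \<epsilon>" using reals_Archimedean[OF \<epsilon>(1)] by blast
    have "\<exists>y. bad n x y \<and> \<bar>y - x\<bar> < d" if "d > 0" for d
    proof -
      obtain y where y: "y \<in> {a..b}" "y \<noteq> x" "dist y x < d" "\<not> dist ((?F y - ?F x) / (y - x)) (f x) < \<epsilon>"
        using \<epsilon>(2) \<open>d > 0\<close> by blast
      have "(?F y - ?F x) / (y - x) - f x = (?F y - ?F x - f x * (y - x)) / (y - x)"
        using y(2) by (simp add: field_simps)
      then have "\<epsilon> \<le> \<bar>?F y - ?F x - f x * (y - x)\<bar> / \<bar>y - x\<bar>" using y(4) by (simp add: dist_real_def)
      then have "inverse (real (Suc n)) < \<bar>?F y - ?F x - f x * (y - x)\<bar> / \<bar>y - x\<bar>" using n by linarith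
      then have "\<bar>y - x\<bar> < real (Suc n) * \<bar>?F y - ?F x - f x * (y - x)\<bar>"
        using y(2) by (simp add: field_simps del: of_nat_Suc)
      then show ?thesis using y by (auto simp: bad_def dist_real_def)
    qed
    then show "x \<in> (\<Union>n. E n)" using x(1) by (auto simp: E_def)
  qed
  ultimately show ?thesis by (rule negligible_subset)
qed

section \<open>The Sobolev space and classical solutions\<close>

lemma Dx_eqI:
  assumes "0 < l" "x \<in> {0..l}" "(u has_real_derivative d) (at x within {0..l})"
  shows "Dx l u x = d"
  unfolding Dx_def
  by (rule vector_derivative_within_closed_interval[OF assms(1,2)])
    (use assms(3) in \<open>simp add: has_real_derivative_iff_has_vector_derivative\<close>)

lemma has_real_derivative_cong:
  assumes "(f has_real_derivative d) (at x within S)" "x \<in> S" "\<And>y. y \<in> S \<Longrightarrow> g y = f y"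
  shows "(g has_real_derivative d) (at x within S)"
  by (rule has_field_derivative_transform_within[OF assms(1), of 1]) (use assms in auto)

lemma H2_derivative:
  assumes l: "0 < l" and u: "u \<in> H2 l"
  shows "\<exists>p w. w integrable_on {0..l} \<and> continuous_on {0..l} p \<and>
    (\<forall>x\<in>{0..l}. p x = p 0 + integral {0..x} w) \<and>
    (\<forall>x\<in>{0..l}. (u has_real_derivative p x) (at x within {0..l}))"
proof -
  obtain p w where w: "w \<in> borel_measurable (lebesgue_on {0..l})" "integrable (lebesgue_on {0..l}) (\<lambda>x. (w x)\<^sup>2)"
    and p: "\<And>x. x \<in> {0..l} \<Longrightarrow> p x = p 0 + (LINT t|lebesgue_on {0..x}. w t)"
    and u': "\<And>x. x \<in> {0..l} \<Longrightarrow> u x = u 0 + (LINT t|lebesgue_on {0..x}. p t)"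
    using u unfolding H2_def by blast
  have intw: "integrable (lebesgue_on {0..l}) w"
  proof (rule Bochner_Integration.integrable_bound[of _ "\<lambda>x. 1 + (w x)\<^sup>2"])
    have "integrable (lebesgue_on {0..l}) (\<lambda>x. 1::real)"
      by (intro finite_measure.integrable_const finite_measure_lebesgue_on) simp
    then show "integrable (lebesgue_on {0..l}) (\<lambda>x. 1 + (w x)\<^sup>2)" using w(2) by (rule Bochner_Integration.integrable_add)
    (* square integrable functions on a bounded interval are integrable *)
    have "norm (w x) \<le> norm (1 + (w x)\<^sup>2)" for x
    proof -
      have "0 \<le> (\<bar>w x\<bar> - 1)\<^sup>2" by simp
      then have "2 * \<bar>w x\<bar> \<le> 1 + (w x)\<^sup>2" by (simp add: power2_eq_square algebra_simps)
      then show ?thesis by simp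
    qed
    then show "AE x in lebesgue_on {0..l}. norm (w x) \<le> norm (1 + (w x)\<^sup>2)" by simp
  qed (rule w(1))
  have won: "w integrable_on {0..l}" using integrable_on_lebesgue_on[OF intw] by simp
  have eqI: "(LINT t|lebesgue_on {0..x}. f t) = integral {0..x} f"
    if "integrable (lebesgue_on {0..l}) f" "x \<in> {0..l}" for x and f :: "real \<Rightarrow> real"
  proof (rule lebesgue_integral_eq_integral)
    show "integrable (lebesgue_on {0..x}) f"
      by (rule integrable_subinterval[OF that(1)]) (use that(2) in auto)
  qed simp
  have p': "p x = p 0 + integral {0..x} w" if "x \<in> {0..l}" for x
    using p[OF that] eqI[OF intw that] by simp
  have cp: "continuous_on {0..l} p"
  proof (rule continuous_on_eq[of _ "\<lambda>x. p 0 + integral {0..x} w"])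
    show "continuous_on {0..l} (\<lambda>x. p 0 + integral {0..x} w)"
      by (intro continuous_intros indefinite_integral_continuous_1 won)
  qed (simp add: p' [symmetric])
  have intp: "integrable (lebesgue_on {0..l}) p"
    by (rule continuous_imp_integrable_real[OF cp])
  have u'': "u x = u 0 + integral {0..x} p" if "x \<in> {0..l}" for x
    using u'[OF that] eqI[OF intp that] by simp
  have "(u has_real_derivative p x) (at x within {0..l})" if x: "x \<in> {0..l}" for x
  proof -
    have "((\<lambda>x. u 0 + integral {0..x} p) has_real_derivative 0 + p x) (at x within {0..l})"
      by (intro DERIV_add DERIV_const integral_has_real_derivative cp x)
    then have "((\<lambda>x. u 0 + integral {0..x} p) has_real_derivative p x) (at x within {0..l})" by simp
    then show ?thesis by (rule has_real_derivative_cong[OF _ x u''])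
  qed
  with won cp p' show ?thesis by (intro exI[of _ p] exI[of _ w] conjI ballI)
qed

lemma H2_continuous:
  assumes "0 < l" "u \<in> H2 l"
  shows "continuous_on {0..l} u"
proof -
  obtain p where u': "\<forall>x\<in>{0..l}. (u has_real_derivative p x) (at x within {0..l})"
    using H2_derivative[OF assms] by (elim exE conjE)
  show ?thesis by (rule DERIV_continuous_on[OF u'[rule_format]])
qed

text \<open>
  By Lebesgue differentiation the square integrable function behind \<open>u\<close> equals the pointwise second derivative, hence \<open>c\<close>,
  almost everywhere; so the first derivative is the primitive of \<open>c\<close>.
\<close>

lemma H2_classical:
  assumes l: "0 < l" and u: "u \<in> H2 l" and c: "continuous_on {0..l} c"
    and ae: "AE x in lebesgue_on {0..l}. Dx l (Dx l u) x = c x"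
  shows "\<exists>p. (\<forall>x\<in>{0..l}. (u has_real_derivative p x) (at x within {0..l})) \<and>
    (\<forall>x\<in>{0..l}. (p has_real_derivative c x) (at x within {0..l}))"
proof -
  obtain p w where w: "w integrable_on {0..l}" and cp: "continuous_on {0..l} p"
    and p_all: "\<forall>x\<in>{0..l}. p x = p 0 + integral {0..x} w"
    and u_all: "\<forall>x\<in>{0..l}. (u has_real_derivative p x) (at x within {0..l})"
    using H2_derivative[OF l u] by (elim exE conjE)
  note p = p_all[rule_format] and u' = u_all[rule_format]
  have D: "Dx l u x = p x" if "x \<in> {0..l}" for x by (rule Dx_eqI[OF l that u'[OF that]])
  let ?B = "{x\<in>{0..l}. \<not> ((\<lambda>u. integral {0..u} w) has_real_derivative w x) (at x within {0..l})}"
  have B: "negligible ?B" by (rule indefinite_integral_derivative_ae[OF w])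
  have DD: "Dx l (Dx l u) x = w x" if x: "x \<in> {0..l} - ?B" for x
  proof (rule Dx_eqI[OF l])
    have "((\<lambda>u. integral {0..u} w) has_real_derivative w x) (at x within {0..l})" using x by blast
    then have "((\<lambda>x. p 0 + integral {0..x} w) has_real_derivative 0 + w x) (at x within {0..l})"
      by (intro DERIV_add DERIV_const)
    then have "((\<lambda>x. p 0 + integral {0..x} w) has_real_derivative w x) (at x within {0..l})" by simp
    then show "(Dx l u has_real_derivative w x) (at x within {0..l})"
    proof (rule has_real_derivative_cong)
      show "Dx l u y = p 0 + integral {0..y} w" if "y \<in> {0..l}" for y
        using D[OF that] p[OF that] by simp
    qed (use x in auto)
  qed (use x in auto)
  obtain N where N: "negligible N" "{x\<in>{0..l}. Dx l (Dx l u) x \<noteq> c x} \<subseteq> N"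
  proof -
    have "{0..l} \<inter> space lebesgue \<in> sets lebesgue" by simp
    from iffD1[OF AE_restrict_space_iff[OF this] ae]
    obtain N where N: "N \<in> null_sets lebesgue"
        "{x\<in>space lebesgue. \<not> (x \<in> {0..l} \<longrightarrow> Dx l (Dx l u) x = c x)} \<subseteq> N"
      unfolding eventually_ae_filter by (elim bexE)
    then have "{x\<in>{0..l}. Dx l (Dx l u) x \<noteq> c x} \<subseteq> N" by (simp add: subset_iff)
    with N(1) show ?thesis using that[of N] by (simp only: negligible_iff_null_sets)
  qed
  have wc: "w x = c x" if "x \<in> {0..l} - (?B \<union> N)" for x
  proof -
    have x: "x \<in> {0..l} - ?B" "x \<in> {0..l}" "x \<notin> N" using that by simp_all
    have "Dx l (Dx l u) x = c x"
    proof (rule ccontr)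
      assume "Dx l (Dx l u) x \<noteq> c x"
      with x(2) have "x \<in> {x\<in>{0..l}. Dx l (Dx l u) x \<noteq> c x}" by simp
      from subsetD[OF N(2) this] x(3) show False by contradiction
    qed
    then show ?thesis unfolding DD[OF x(1)] .
  qed
  have p': "p x = p 0 + integral {0..x} c" if x: "x \<in> {0..l}" for x
  proof -
    have "integral {0..x} w = integral {0..x} c"
    proof (rule integral_spike)
      show "negligible (?B \<union> N)" by (rule negligible_Un[OF B N(1)])
      show "c y = w y" if "y \<in> {0..x} - (?B \<union> N)" for y
      proof -
        have "y \<in> {0..l}" using DiffD1[OF that] x by simp
        moreover have "y \<notin> ?B \<union> N" using that unfolding Diff_iff by (rule conjunct2)
        ultimately have "w y = c y" by (intro wc DiffI)
        then show ?thesis by (rule sym)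
      qed
    qed
    with p[OF x] show ?thesis by (simp only:)
  qed
  have "(p has_real_derivative c x) (at x within {0..l})" if x: "x \<in> {0..l}" for x
  proof -
    have "((\<lambda>x. p 0 + integral {0..x} c) has_real_derivative 0 + c x) (at x within {0..l})"
      by (intro DERIV_add DERIV_const integral_has_real_derivative c x)
    then have "((\<lambda>x. p 0 + integral {0..x} c) has_real_derivative c x) (at x within {0..l})" by simp
    then show ?thesis by (rule has_real_derivative_cong[OF _ x p'])
  qed
  with u' show ?thesis by (intro exI[of _ p] conjI ballI)
qed

lemma classical_H2:
  assumes l: "0 < l" and u: "\<And>x. x \<in> {0..l} \<Longrightarrow> (u has_real_derivative p x) (at x within {0..l})"
    and p: "\<And>x. x \<in> {0..l} \<Longrightarrow> (p has_real_derivative c x) (at x within {0..l})"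
    and c: "continuous_on {0..l} c" and out: "\<And>x. x \<notin> {0..l} \<Longrightarrow> u x = 0"
  shows "u \<in> H2 l" and "x \<in> {0..l} \<Longrightarrow> Dx l u x = p x" and "x \<in> {0..l} \<Longrightarrow> Dx l (Dx l u) x = c x"
proof -
  show D: "Dx l u x = p x" if "x \<in> {0..l}" for x by (rule Dx_eqI[OF l that u[OF that]])
  show "Dx l (Dx l u) x = c x" if x: "x \<in> {0..l}"
    by (rule Dx_eqI[OF l x has_real_derivative_cong[OF p[OF x] x D]])
  have cp: "continuous_on {0..l} p" by (rule DERIV_continuous_on[OF p])
  have int: "f x = f 0 + (LINT t|lebesgue_on {0..x}. f' t)"
    if f: "\<And>x. x \<in> {0..l} \<Longrightarrow> (f has_real_derivative f' x) (at x within {0..l})" "continuous_on {0..l} f'"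
      and x: "x \<in> {0..l}" for f f' x
  proof -
    have "(f' has_integral f x - f 0) {0..x}"
    proof (rule fundamental_theorem_of_calculus)
      fix y assume y: "y \<in> {0..x}"
      have "(f has_vector_derivative f' y) (at y within {0..l})"
        using f(1)[of y] x y by (simp add: has_real_derivative_iff_has_vector_derivative)
      then show "(f has_vector_derivative f' y) (at y within {0..x})"
        by (rule has_vector_derivative_within_subset) (use x in auto)
    qed (use x in auto)
    moreover have "integrable (lebesgue_on {0..x}) f'"
      by (rule continuous_imp_integrable_real) (rule continuous_on_subset[OF f(2)], use x in auto)
    then have "(LINT t|lebesgue_on {0..x}. f' t) = integral {0..x} f'"
      by (intro lebesgue_integral_eq_integral) auto
    ultimately show ?thesis by (simp add: integral_unique)
  qed
  have "integrable (lebesgue_on {0..l}) (\<lambda>x. (c x)\<^sup>2)"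
    by (rule continuous_imp_integrable_real) (intro continuous_intros c)
  moreover have "c \<in> borel_measurable (lebesgue_on {0..l})"
    by (rule continuous_imp_measurable_on_sets_lebesgue[OF c]) simp
  ultimately show "u \<in> H2 l"
    unfolding H2_def
    by (intro CollectI conjI allI impI exI[of _ p] exI[of _ c] ballI out int[OF p c] int[OF u cp])
qed

section \<open>Linear differential equations\<close>

text \<open>
  The function \<open>norm (Z x)\<^sup>2 * exp (- (2 * M + 1) * x) - e\<^sup>2 * x\<close> is decreasing, by
  \<open>2 * e * norm (Z x) \<le> e\<^sup>2 + norm (Z x)\<^sup>2\<close>. The case \<open>Z 0 = 0\<close>, \<open>e = 0\<close> gives
  uniqueness, and \<open>Z 0 = 0\<close> an estimate of \<open>Z\<close> that is linear in the perturbation \<open>e\<close>.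
\<close>

lemma gronwall:
  fixes Z :: "real \<Rightarrow> 'a::real_inner"
  assumes Z: "\<And>x. x \<in> {0..l} \<Longrightarrow> (Z has_vector_derivative Z' x) (at x within {0..l})"
    and bd: "\<And>x. x \<in> {0..l} \<Longrightarrow> norm (Z' x) \<le> M * norm (Z x) + e"
    and M: "0 \<le> M" and e: "0 \<le> e" and x: "x \<in> {0..l}"
  shows "(norm (Z x))\<^sup>2 \<le> ((norm (Z 0))\<^sup>2 + e\<^sup>2 * l) * exp ((2 * M + 1) * l)"
proof -
  let ?k = "2 * M + 1"
  (* 2 * e * norm Z \<le> e\<^sup>2 + (norm Z)\<^sup>2 explains the summand 1 in the rate *)
  define \<psi> where "\<psi> y = inner (Z y) (Z y) * exp (- ?k * y) - e\<^sup>2 * y" for y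
  define \<psi>' where "\<psi>' y = (inner (Z y) (Z' y) + inner (Z' y) (Z y)) * exp (- ?k * y) + exp (- ?k * y) * (- ?k) * inner (Z y) (Z y) - e\<^sup>2" for y
  have d: "(\<psi> has_real_derivative \<psi>' y) (at y within {0..l})" if y: "y \<in> {0..l}" for y
  proof -
    have 1: "((\<lambda>y. inner (Z y) (Z y)) has_real_derivative inner (Z y) (Z' y) + inner (Z' y) (Z y)) (at y within {0..l})"
      unfolding has_real_derivative_iff_has_vector_derivative
      by (rule bounded_bilinear.has_vector_derivative[OF bounded_bilinear_inner Z[OF y] Z[OF y]])
    have 2: "((\<lambda>y. exp (- ?k * y)) has_real_derivative exp (- ?k * y) * (- ?k)) (at y within {0..l})"
      by (auto intro!: derivative_eq_intros)
    have 3: "((\<lambda>y. e\<^sup>2 * y) has_real_derivative e\<^sup>2) (at y within {0..l})" by (auto intro!: derivative_eq_intros)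
    show ?thesis unfolding \<psi>_def[abs_def] \<psi>'_def by (rule DERIV_diff[OF DERIV_mult[OF 1 2] 3])
  qed
  have neg: "\<psi>' y \<le> 0" if y: "y \<in> {0..l}" for y
  proof -
    let ?n = "norm (Z y)"
    have "inner (Z y) (Z' y) \<le> ?n * norm (Z' y)" by (rule norm_cauchy_schwarz)
    also have "\<dots> \<le> ?n * (M * ?n + e)" by (intro mult_left_mono bd y) simp
    finally have "inner (Z y) (Z' y) + inner (Z' y) (Z y) \<le> 2 * M * ?n\<^sup>2 + 2 * e * ?n"
      by (simp add: inner_commute power2_eq_square algebra_simps)
    moreover have "2 * e * ?n \<le> e\<^sup>2 + ?n\<^sup>2"
      using zero_le_power2[of "e - ?n"] by (simp add: power2_diff)
    ultimately have "inner (Z y) (Z' y) + inner (Z' y) (Z y) - ?k * ?n\<^sup>2 \<le> e\<^sup>2" by (simp add: algebra_simps)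
    then have "(inner (Z y) (Z' y) + inner (Z' y) (Z y) - ?k * ?n\<^sup>2) * exp (- ?k * y) \<le> e\<^sup>2 * exp (- ?k * y)"
      by (rule mult_right_mono) simp
    also have "\<dots> \<le> e\<^sup>2 * 1"
    proof (rule mult_left_mono)
      have "0 \<le> ?k * y" using M y by (intro mult_nonneg_nonneg) auto
      then show "exp (- ?k * y) \<le> 1" by (simp only: exp_le_one_iff mult_minus_left neg_le_0_iff_le)
    qed simp
    finally show ?thesis unfolding \<psi>'_def power2_norm_eq_inner by (simp add: algebra_simps)
  qed
  have "\<psi> x \<le> \<psi> 0"
  proof (cases "x = 0")
    case False
    then have x0: "0 < x" using x by simp
    have "\<exists>y\<in>{0<..<x}. \<psi> x - \<psi> 0 = (\<lambda>t. \<psi>' y * t) (x - 0)"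
    proof (rule mvt_simple[OF x0])
      fix y assume y: "0 \<le> y" "y \<le> x"
      have "(\<psi> has_real_derivative \<psi>' y) (at y within {0..x})"
        by (rule has_field_derivative_subset[OF d]) (use x y in auto)
      then show "(\<psi> has_derivative (\<lambda>t. \<psi>' y * t)) (at y within {0..x})"
        by (simp add: has_field_derivative_def)
    qed
    then obtain y where y: "y \<in> {0<..<x}" "\<psi> x - \<psi> 0 = \<psi>' y * x" by auto
    then have "\<psi>' y * x \<le> 0" using neg[of y] x by (intro mult_nonpos_nonneg) auto
    then show ?thesis using y by simp
  qed simp
  then have "(norm (Z x))\<^sup>2 * exp (- ?k * x) \<le> (norm (Z 0))\<^sup>2 + e\<^sup>2 * x"
    by (simp add: \<psi>_def power2_norm_eq_inner)
  then have "(norm (Z x))\<^sup>2 * exp (- ?k * x) * exp (?k * x) \<le> ((norm (Z 0))\<^sup>2 + e\<^sup>2 * x) * exp (?k * x)"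
    by (rule mult_right_mono) simp
  moreover have "exp (- ?k * x) * exp (?k * x) = 1" by (simp add: algebra_simps flip: exp_add)
  ultimately have "(norm (Z x))\<^sup>2 \<le> ((norm (Z 0))\<^sup>2 + e\<^sup>2 * x) * exp (?k * x)"
    by (simp only: mult.assoc mult_1_right)
  also have "\<dots> \<le> ((norm (Z 0))\<^sup>2 + e\<^sup>2 * l) * exp (?k * l)"
    using x M by (intro mult_mono add_mono mult_left_mono) (auto intro!: add_nonneg_nonneg)
  finally show ?thesis .
qed

text \<open>
  Picard iteration. With the weight \<open>exp (2 * M * x)\<close> one integration step halves the norm, so that the series of
  iterates converges geometrically on the whole interval.
\<close>

lemma linear_ode_exists:
  fixes B :: "real \<Rightarrow> 'a::euclidean_space \<Rightarrow> 'a"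
  assumes l: "0 \<le> l" and lin: "\<And>x. linear (B x)"
    and bd: "\<And>x z. x \<in> {0..l} \<Longrightarrow> norm (B x z) \<le> M * norm z" and M: "M > 0"
    and cont: "\<And>Y. continuous_on {0..l} Y \<Longrightarrow> continuous_on {0..l} (\<lambda>x. B x (Y x))"
  shows "\<exists>Y. Y 0 = c \<and> (\<forall>x\<in>{0..l}. (Y has_vector_derivative B x (Y x)) (at x within {0..l}))"
proof -
  define D where "D n = ((\<lambda>Y x. integral {0..x} (\<lambda>t. B t (Y t))) ^^ n) (\<lambda>_. c)" for n
  have D0: "D 0 x = c" for x by (simp add: D_def)
  have DS: "D (Suc n) x = integral {0..x} (\<lambda>t. B t (D n t))" for n x by (simp add: D_def)
  have cD: "continuous_on {0..l} (D n)" for n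
  proof (induction n)
    case 0
    have "D 0 = (\<lambda>_. c)" by (simp add: D_def)
    then show ?case by simp
  next
    case (Suc n)
    have "D (Suc n) = (\<lambda>x. integral {0..x} (\<lambda>t. B t (D n t)))" using DS by blast
    then show ?case
      using indefinite_integral_continuous_1[OF integrable_continuous_interval[OF cont[OF Suc]]] by simp
  qed
  have int: "(\<lambda>t. B t (Y t)) integrable_on {0..x}" if "continuous_on {0..l} Y" "x \<in> {0..l}" for Y x
    by (rule integrable_continuous_interval, rule continuous_on_subset[OF cont[OF that(1)]]) (use that(2) in auto)
  have bound: "norm (D n x) \<le> norm c * (1/2)^n * exp (2 * M * x)" if "x \<in> {0..l}" for n x
    using that
  proof (induction n arbitrary: x)
    case 0
    have "norm c * 1 \<le> norm c * exp (2 * M * x)" using 0 M by (intro mult_left_mono) auto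
    then show ?case by (simp add: D0)
  next
    case (Suc n)
    let ?K = "norm c * (1/2)^n"
    have FTC: "((\<lambda>t. M * (?K * exp (2 * M * t))) has_integral ?K / 2 * exp (2 * M * x) - ?K / 2 * exp (2 * M * 0)) {0..x}"
    proof (rule fundamental_theorem_of_calculus)
      show "((\<lambda>t. ?K / 2 * exp (2 * M * t)) has_vector_derivative M * (?K * exp (2 * M * y))) (at y within {0..x})" for y
        unfolding has_real_derivative_iff_has_vector_derivative[symmetric]
        by (auto intro!: derivative_eq_intros)
    qed (use Suc.prems in simp)
    have "norm (integral {0..x} (\<lambda>t. B t (D n t))) \<le> integral {0..x} (\<lambda>t. M * (?K * exp (2 * M * t)))"
    proof (rule integral_norm_bound_integral[OF int[OF cD Suc.prems]])
      show "(\<lambda>t. M * (?K * exp (2 * M * t))) integrable_on {0..x}" using FTC by blast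
      fix t assume t: "t \<in> {0..x}"
      then have tl: "t \<in> {0..l}" using Suc.prems by auto
      have "norm (B t (D n t)) \<le> M * norm (D n t)" by (rule bd[OF tl])
      also have "\<dots> \<le> M * (?K * exp (2 * M * t))" using M by (intro mult_left_mono Suc.IH tl) auto
      finally show "norm (B t (D n t)) \<le> M * (?K * exp (2 * M * t))" .
    qed
    also have "\<dots> = ?K / 2 * exp (2 * M * x) - ?K / 2 * exp (2 * M * 0)" using FTC by (rule integral_unique)
    also have "\<dots> \<le> ?K / 2 * exp (2 * M * x)" by simp
    finally show ?case by (simp add: DS)
  qed
  let ?S = "\<lambda>N x. \<Sum>n<N. D n x"
  define Y where "Y x = (\<Sum>n. D n x)" for x
  have ul: "uniform_limit {0..l} ?S Y sequentially"
    unfolding Y_def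
  proof (rule Weierstrass_m_test)
    show "summable (\<lambda>n. norm c * exp (2 * M * l) * (1/2)^n)" by (intro summable_mult summable_geometric) simp
    fix n x assume x: "x \<in> {0..l}"
    have "norm (D n x) \<le> norm c * (1/2)^n * exp (2 * M * x)" by (rule bound[OF x])
    also have "\<dots> \<le> norm c * (1/2)^n * exp (2 * M * l)" using x M by (intro mult_left_mono) auto
    finally show "norm (D n x) \<le> norm c * exp (2 * M * l) * (1/2)^n" by (simp add: mult_ac)
  qed
  have cS: "continuous_on {0..l} (?S N)" for N by (intro continuous_on_sum cD)
  have cY: "continuous_on {0..l} Y"
    by (rule uniform_limit_theorem[OF _ ul]) (use cS in auto)
  have ulB: "uniform_limit {0..l} (\<lambda>N t. B t (?S N t)) (\<lambda>t. B t (Y t)) sequentially"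
  proof (rule uniform_limitI)
    fix \<epsilon> :: real assume \<epsilon>: "\<epsilon> > 0"
    have "\<forall>\<^sub>F N in sequentially. \<forall>t\<in>{0..l}. dist (?S N t) (Y t) < \<epsilon> / M"
      by (rule uniform_limitD[OF ul]) (use \<epsilon> M in simp)
    then show "\<forall>\<^sub>F N in sequentially. \<forall>t\<in>{0..l}. dist (B t (?S N t)) (B t (Y t)) < \<epsilon>"
    proof eventually_elim
      case (elim N)
      show ?case
      proof
        fix t assume t: "t \<in> {0..l}"
        have "dist (B t (?S N t)) (B t (Y t)) \<le> M * norm (?S N t - Y t)"
          unfolding dist_norm linear_diff[OF lin, symmetric] by (rule bd[OF t])
        also have "\<dots> < M * (\<epsilon> / M)"
          using elim t M by (intro mult_strict_left_mono) (auto simp: dist_norm)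
        finally show "dist (B t (?S N t)) (B t (Y t)) < \<epsilon>" using M by simp
      qed
    qed
  qed
  have step: "?S (Suc N) x = c + integral {0..x} (\<lambda>t. B t (?S N t))" if x: "x \<in> {0..l}" for N x
  proof -
    have "?S (Suc N) x = D 0 x + (\<Sum>n<N. D (Suc n) x)" by (rule sum.lessThan_Suc_shift)
    also have "(\<Sum>n<N. D (Suc n) x) = integral {0..x} (\<lambda>t. \<Sum>n<N. B t (D n t))"
      unfolding DS by (rule integral_sum[symmetric]) (use int[OF cD x] in auto)
    finally show ?thesis by (simp add: D0 linear_sum[OF lin])
  qed
  have fixpoint: "Y x = c + integral {0..x} (\<lambda>t. B t (Y t))" if x: "x \<in> {0..l}" for x
  proof -
    have ulx: "uniform_limit (cbox 0 x) (\<lambda>N t. B t (?S N t)) (\<lambda>t. B t (Y t)) sequentially"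
      by (rule uniform_limit_on_subset[OF ulB]) (use x in auto)
    have "continuous_on (cbox 0 x) (\<lambda>t. B t (?S N t))" for N
      by (rule continuous_on_subset[OF cont[OF cS]]) (use x in auto)
    then obtain I J where IJ: "\<And>N. ((\<lambda>t. B t (?S N t)) has_integral I N) (cbox 0 x)"
        "((\<lambda>t. B t (Y t)) has_integral J) (cbox 0 x)" "(I \<longlongrightarrow> J) sequentially"
      using uniform_limit_integral_cbox[OF ulx] by auto
    have "I N = integral {0..x} (\<lambda>t. B t (?S N t))" for N using integral_unique[OF IJ(1)[of N]] by simp
    then have "I = (\<lambda>N. integral {0..x} (\<lambda>t. B t (?S N t)))" by (rule ext)
    with tendsto_add[OF tendsto_const[of c] IJ(3)]
    have "(\<lambda>N. ?S (Suc N) x) \<longlonglongrightarrow> c + J" unfolding step[OF x] by (simp only:)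
    moreover have "(\<lambda>N. ?S (Suc N) x) \<longlonglongrightarrow> Y x"
      using tendsto_uniform_limitI[OF ul x] by (rule LIMSEQ_Suc)
    ultimately have "Y x = c + J" by (rule LIMSEQ_unique[rotated])
    then show ?thesis using IJ(2) by (simp add: integral_unique)
  qed
  have "(Y has_vector_derivative B x (Y x)) (at x within {0..l})" if x: "x \<in> {0..l}" for x
  proof -
    have "((\<lambda>x. c + integral {0..x} (\<lambda>t. B t (Y t))) has_vector_derivative 0 + B x (Y x)) (at x within {0..l})"
      by (intro has_vector_derivative_add has_vector_derivative_const integral_has_vector_derivative cont cY x)
    then have "((\<lambda>x. c + integral {0..x} (\<lambda>t. B t (Y t))) has_vector_derivative B x (Y x)) (at x within {0..l})" by simp
    from has_vector_derivative_transform[OF x _ this] show ?thesis using fixpoint by blast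
  qed
  moreover have "Y 0 = c" using fixpoint[of 0] l by simp
  ultimately show ?thesis by blast
qed

section \<open>The first-order system of the eigenvalue equation\<close>

text \<open>
  States are \<open>((u, v), (u', v'))\<close>.
\<close>

type_synonym state = "(real \<times> real) \<times> (real \<times> real)"

definition field :: "(real \<Rightarrow> real) \<Rightarrow> (real \<Rightarrow> real) \<Rightarrow> real \<Rightarrow> real \<Rightarrow> state \<Rightarrow> state" where
  "field g h \<mu> x z = (snd z, (- g x * fst (fst z) - \<mu> * snd (fst z), - h x * snd (fst z) + \<mu> * fst (fst z)))"

text \<open>
  The derivative of \<open>field\<close> with respect to the spectral parameter.
\<close>

definition twist :: "state \<Rightarrow> state" where
  "twist z = (0, (- snd (fst z), fst (fst z)))"

lemma field_twist: "field g h \<mu> x z = field g h 0 x z + \<mu> *\<^sub>R twist z"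
  by (simp add: field_def twist_def)

lemma linear_field: "linear (field g h \<mu> x)"
  by (rule linearI) (simp_all add: field_def prod_eq_iff algebra_simps)

lemma norm_twist_le: "norm (twist z) \<le> 2 * norm z"
proof -
  have "norm (twist z) \<le> \<bar>snd (fst z)\<bar> + \<bar>fst (fst z)\<bar>"
    using norm_Pair_le[of "- snd (fst z)" "fst (fst z)"] by (simp add: twist_def norm_Pair)
  also have "\<dots> \<le> norm (fst z) + norm (fst z)"
    using norm_fst_le[of "fst (fst z)" "snd (fst z)"] norm_snd_le[of "snd (fst z)" "fst (fst z)"] by simp
  also have "\<dots> \<le> 2 * norm z" using norm_fst_le[of "fst z" "snd z"] by simp
  finally show ?thesis .
qed

lemma norm_field_le:
  assumes "\<bar>g x\<bar> \<le> G" "\<bar>h x\<bar> \<le> G"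
  shows "norm (field g h \<mu> x z) \<le> (1 + 2 * G + 2 * \<bar>\<mu>\<bar>) * norm z"
proof -
  have a: "\<bar>fst (fst z)\<bar> \<le> norm z" "\<bar>snd (fst z)\<bar> \<le> norm z" "norm (snd z) \<le> norm z"
    using norm_fst_le[of "fst (fst z)" "snd (fst z)"] norm_snd_le[of "snd (fst z)" "fst (fst z)"]
      norm_fst_le[of "fst z" "snd z"] norm_snd_le[of "snd z" "fst z"] by simp_all
  have 0: "norm (field g h 0 x z) \<le> (1 + 2 * G) * norm z"
  proof -
    have "norm (field g h 0 x z) \<le> norm (snd z) + (\<bar>g x\<bar> * \<bar>fst (fst z)\<bar> + \<bar>h x\<bar> * \<bar>snd (fst z)\<bar>)"
      using norm_Pair_le[of "snd z" "(- g x * fst (fst z), - h x * snd (fst z))"]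
        norm_Pair_le[of "- g x * fst (fst z)" "- h x * snd (fst z)"]
      by (simp add: field_def abs_mult)
    also have "\<dots> \<le> norm z + (G * norm z + G * norm z)"
      using assms a by (intro add_mono mult_mono) auto
    finally show ?thesis by (simp add: algebra_simps)
  qed
  have "norm (field g h \<mu> x z) \<le> norm (field g h 0 x z) + \<bar>\<mu>\<bar> * norm (twist z)"
    unfolding field_twist[of g h \<mu>] by (rule norm_triangle_le) simp
  also have "\<dots> \<le> (1 + 2 * G) * norm z + \<bar>\<mu>\<bar> * (2 * norm z)"
    by (intro add_mono 0 mult_left_mono norm_twist_le) simp
  finally show ?thesis by (simp add: algebra_simps)
qed

locale nls_system =
  fixes l :: real and g h :: "real \<Rightarrow> real"
  assumes l: "0 < l" and cg: "continuous_on {0..l} g" and ch: "continuous_on {0..l} h"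
begin

lemma coefficient_bound: "\<exists>G\<ge>0. \<forall>x\<in>{0..l}. \<bar>g x\<bar> \<le> G \<and> \<bar>h x\<bar> \<le> G"
proof -
  have "bounded (g ` {0..l})" "bounded (h ` {0..l})"
    using cg ch by (auto intro!: compact_imp_bounded compact_continuous_image)
  then obtain a b where "\<forall>x\<in>{0..l}. \<bar>g x\<bar> \<le> a" "\<forall>x\<in>{0..l}. \<bar>h x\<bar> \<le> b" by (auto simp: bounded_iff)
  then show ?thesis by (intro exI[of _ "max 0 (max a b)"]) (auto simp: max_def)
qed

definition G :: real where "G = (SOME G. 0 \<le> G \<and> (\<forall>x\<in>{0..l}. \<bar>g x\<bar> \<le> G \<and> \<bar>h x\<bar> \<le> G))"

lemma G: "0 \<le> G" "x \<in> {0..l} \<Longrightarrow> \<bar>g x\<bar> \<le> G" "x \<in> {0..l} \<Longrightarrow> \<bar>h x\<bar> \<le> G"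
  using someI_ex[OF coefficient_bound] unfolding G_def[symmetric] by auto

definition rate :: "real \<Rightarrow> real" where "rate \<mu> = 1 + 2 * G + 2 * \<bar>\<mu>\<bar>"

lemma rate_pos: "rate \<mu> > 0" using G(1) by (simp add: rate_def)

lemma field_bound: "x \<in> {0..l} \<Longrightarrow> norm (field g h \<mu> x z) \<le> rate \<mu> * norm z"
  unfolding rate_def by (rule norm_field_le) (rule G, assumption)+

lemma field_cont:
  assumes "continuous_on {0..l} Y"
  shows "continuous_on {0..l} (\<lambda>x. field g h \<mu> x (Y x))"
  unfolding field_def by (intro continuous_intros assms cg ch)

definition sol :: "real \<Rightarrow> state \<Rightarrow> real \<Rightarrow> state" where
  "sol \<mu> c = (SOME Y. Y 0 = c \<and> (\<forall>x\<in>{0..l}. (Y has_vector_derivative field g h \<mu> x (Y x)) (at x within {0..l})))"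

lemma sol: "sol \<mu> c 0 = c" "x \<in> {0..l} \<Longrightarrow> (sol \<mu> c has_vector_derivative field g h \<mu> x (sol \<mu> c x)) (at x within {0..l})"
proof -
  have "\<exists>Y. Y 0 = c \<and> (\<forall>x\<in>{0..l}. (Y has_vector_derivative field g h \<mu> x (Y x)) (at x within {0..l}))"
    by (rule linear_ode_exists[OF _ linear_field field_bound rate_pos field_cont]) (use l in auto)
  from someI_ex[OF this] show "sol \<mu> c 0 = c"
    "x \<in> {0..l} \<Longrightarrow> (sol \<mu> c has_vector_derivative field g h \<mu> x (sol \<mu> c x)) (at x within {0..l})"
    unfolding sol_def[symmetric] by auto
qed

lemma sol_perturbed:
  assumes Z: "\<And>x. x \<in> {0..l} \<Longrightarrow> (Z has_vector_derivative field g h \<mu> x (Z x) + E x) (at x within {0..l})"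
    and E: "\<And>x. x \<in> {0..l} \<Longrightarrow> norm (E x) \<le> e" and x: "x \<in> {0..l}"
  shows "(norm (Z x))\<^sup>2 \<le> ((norm (Z 0))\<^sup>2 + e\<^sup>2 * l) * exp ((2 * rate \<mu> + 1) * l)"
proof (rule gronwall[OF Z _ _ _ x])
  show "norm (field g h \<mu> x (Z x) + E x) \<le> rate \<mu> * norm (Z x) + e" if "x \<in> {0..l}" for x
    using norm_triangle_ineq[of "field g h \<mu> x (Z x)" "E x"] field_bound[OF that, of \<mu> "Z x"] E[OF that] by linarith
  show "0 \<le> rate \<mu>" using rate_pos[of \<mu>] by simp
  show "0 \<le> e" using E[OF x] norm_ge_zero[of "E x"] by linarith
qed

lemma sol_scaled:
  assumes s: "0 < s" "s \<le> 1" and y: "y \<in> {0..l}"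
  shows "((\<lambda>x. sol \<mu> c (s * x)) has_vector_derivative s *\<^sub>R field g h \<mu> (s * y) (sol \<mu> c (s * y))) (at y within {0..l})"
proof -
  have sx: "s * y \<in> {0..l}" if "y \<in> {0..l}" for y
    using s that mult_left_le_one_le[of y s] by auto
  have 1: "((\<lambda>x. s * x) has_vector_derivative s) (at y within {0..l})"
    unfolding has_real_derivative_iff_has_vector_derivative[symmetric] by (auto intro!: derivative_eq_intros)
  have 2: "(sol \<mu> c has_vector_derivative field g h \<mu> (s * y) (sol \<mu> c (s * y))) (at (s * y) within (\<lambda>x. s * x) ` {0..l})"
    by (rule has_vector_derivative_within_subset[OF sol(2)[OF sx[OF y]]]) (use sx in auto)
  show ?thesis using vector_diff_chain_within[OF 1 2] by (simp add: o_def)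
qed

text \<open>
  The equation on \<open>[0,l]\<close> with coefficients \<open>g (s x)\<close> is the restriction of the unscaled one to \<open>[0, s l]\<close>.
\<close>

lemma sol_scaled_unique:
  assumes s: "0 < s" "s \<le> 1"
    and Z: "\<And>x. x \<in> {0..l} \<Longrightarrow> (Z has_vector_derivative s *\<^sub>R field g h \<mu> (s * x) (Z x)) (at x within {0..l})"
    and x: "x \<in> {0..l}"
  shows "Z x = sol \<mu> (Z 0) (s * x)"
proof -
  let ?W = "\<lambda>x. Z x - sol \<mu> (Z 0) (s * x)"
  have sx: "s * y \<in> {0..l}" if "y \<in> {0..l}" for y
    using s that mult_left_le_one_le[of y s] by auto
  have dW: "(?W has_vector_derivative s *\<^sub>R field g h \<mu> (s * y) (?W y)) (at y within {0..l})" if y: "y \<in> {0..l}" for y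
    using has_vector_derivative_diff[OF Z[OF y] sol_scaled[OF s y]]
    by (simp only: linear_diff[OF linear_field] scaleR_diff_right)
  have "(norm (?W x))\<^sup>2 \<le> ((norm (?W 0))\<^sup>2 + 0\<^sup>2 * l) * exp ((2 * rate \<mu> + 1) * l)"
  proof (rule gronwall[OF dW _ _ _ x])
    fix y assume y: "y \<in> {0..l}"
    have "norm (s *\<^sub>R field g h \<mu> (s * y) (?W y)) \<le> 1 * (rate \<mu> * norm (?W y))"
      unfolding norm_scaleR using s field_bound[OF sx[OF y], of \<mu> "?W y"] by (intro mult_mono) auto
    then show "norm (s *\<^sub>R field g h \<mu> (s * y) (?W y)) \<le> rate \<mu> * norm (?W y) + 0" by simp
  qed (use rate_pos[of \<mu>] in auto)
  then show ?thesis by (simp add: sol(1))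
qed

lemma sol_unique:
  assumes "\<And>x. x \<in> {0..l} \<Longrightarrow> (Z has_vector_derivative field g h \<mu> x (Z x)) (at x within {0..l})" "x \<in> {0..l}"
  shows "Z x = sol \<mu> (Z 0) x"
  using sol_scaled_unique[of 1 Z \<mu> x] assms by simp

lemma linear_sol:
  assumes x: "x \<in> {0..l}"
  shows "linear (\<lambda>c. sol \<mu> c x)"
proof (rule linearI)
  fix c d :: state and k :: real
  have "sol \<mu> c y + sol \<mu> d y = sol \<mu> (sol \<mu> c 0 + sol \<mu> d 0) y" if "y \<in> {0..l}" for y
    by (rule sol_unique[OF _ that])
      (simp only: linear_add[OF linear_field], intro has_vector_derivative_add sol(2))
  from this[OF x] show "sol \<mu> (c + d) x = sol \<mu> c x + sol \<mu> d x" by (simp add: sol(1))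
  have "k *\<^sub>R sol \<mu> c y = sol \<mu> (k *\<^sub>R sol \<mu> c 0) y" if "y \<in> {0..l}" for y
    by (rule sol_unique[OF _ that])
      (simp only: linear_cmul[OF linear_field], intro bounded_linear.has_vector_derivative[OF bounded_linear_scaleR_right] sol(2))
  from this[OF x] show "sol \<mu> (k *\<^sub>R c) x = k *\<^sub>R sol \<mu> c x" by (simp add: sol(1))
qed

lemma sol_cont: "continuous_on {0..l} (sol \<mu> c)"
  using sol(2) by (intro continuous_on_vector_derivative)

lemma sol_bounded: "\<exists>K. \<forall>x\<in>{0..l}. norm (sol \<mu> c x) \<le> K"
  using compact_imp_bounded[OF compact_continuous_image[OF sol_cont[of \<mu> c] compact_Icc]]
  by (auto simp: bounded_iff)

lemma rate_mono: "\<bar>\<mu>\<bar> \<le> \<bar>\<nu>\<bar> \<Longrightarrow> rate \<mu> \<le> rate \<nu>" by (simp add: rate_def)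

text \<open>
  The difference of two solutions solves the system with inhomogeneity \<open>(\<mu> - \<nu>) *\<^sub>R twist (sol \<nu> c x)\<close>.
\<close>

lemma sol_param_tendsto:
  assumes x: "x \<in> {0..l}"
  shows "((\<lambda>\<mu>. sol \<mu> c x) \<longlongrightarrow> sol \<nu> c x) (at \<nu> within A)"
proof -
  obtain K where K: "\<And>x. x \<in> {0..l} \<Longrightarrow> norm (sol \<nu> c x) \<le> K" using sol_bounded by blast
  have K0: "0 \<le> K" using K[OF x] norm_ge_zero[of "sol \<nu> c x"] by linarith
  let ?C = "l * exp ((2 * rate (\<bar>\<nu>\<bar> + 1) + 1) * l)"
  have bd: "(norm (sol \<mu> c x - sol \<nu> c x))\<^sup>2 \<le> (\<bar>\<mu> - \<nu>\<bar> * (2 * K))\<^sup>2 * ?C" if \<mu>: "\<bar>\<mu> - \<nu>\<bar> \<le> 1" for \<mu>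
  proof -
    let ?Z = "\<lambda>x. sol \<mu> c x - sol \<nu> c x" and ?E = "\<lambda>x. (\<mu> - \<nu>) *\<^sub>R twist (sol \<nu> c x)"
    have "(norm (?Z x))\<^sup>2 \<le> ((norm (?Z 0))\<^sup>2 + (\<bar>\<mu> - \<nu>\<bar> * (2 * K))\<^sup>2 * l) * exp ((2 * rate \<mu> + 1) * l)"
    proof (rule sol_perturbed[where E = ?E, OF _ _ x])
      fix y assume y: "y \<in> {0..l}"
      have "field g h \<mu> y (sol \<mu> c y) - field g h \<nu> y (sol \<nu> c y) = field g h \<mu> y (?Z y) + ?E y"
        unfolding linear_diff[OF linear_field] field_twist[of g h \<mu> y "sol \<nu> c y"] field_twist[of g h \<nu> y "sol \<nu> c y"]
        by (simp add: algebra_simps)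
      then show "(?Z has_vector_derivative field g h \<mu> y (?Z y) + ?E y) (at y within {0..l})"
        using has_vector_derivative_diff[OF sol(2)[OF y, of \<mu> c] sol(2)[OF y, of \<nu> c]] by simp
      have "norm (?E y) \<le> \<bar>\<mu> - \<nu>\<bar> * (2 * norm (sol \<nu> c y))"
        unfolding norm_scaleR real_norm_def by (intro mult_left_mono norm_twist_le) simp
      also have "\<dots> \<le> \<bar>\<mu> - \<nu>\<bar> * (2 * K)" using K[OF y] by (intro mult_left_mono) auto
      finally show "norm (?E y) \<le> \<bar>\<mu> - \<nu>\<bar> * (2 * K)" .
    qed
    also have "\<dots> = (\<bar>\<mu> - \<nu>\<bar> * (2 * K))\<^sup>2 * (l * exp ((2 * rate \<mu> + 1) * l))" by (simp add: sol(1))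
    also have "\<dots> \<le> (\<bar>\<mu> - \<nu>\<bar> * (2 * K))\<^sup>2 * ?C"
    proof -
      have "rate \<mu> \<le> rate (\<bar>\<nu>\<bar> + 1)" by (rule rate_mono) (use \<mu> in auto)
      then have "(2 * rate \<mu> + 1) * l \<le> (2 * rate (\<bar>\<nu>\<bar> + 1) + 1) * l" using l by (intro mult_right_mono) auto
      then show ?thesis using l by (intro mult_left_mono) auto
    qed
    finally show ?thesis .
  qed
  have "((\<lambda>\<mu>. (norm (sol \<mu> c x - sol \<nu> c x))\<^sup>2) \<longlongrightarrow> 0) (at \<nu> within A)"
  proof (rule Lim_null_comparison)
    show "\<forall>\<^sub>F \<mu> in at \<nu> within A. norm ((norm (sol \<mu> c x - sol \<nu> c x))\<^sup>2) \<le> (\<bar>\<mu> - \<nu>\<bar> * (2 * K))\<^sup>2 * ?C"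
      unfolding eventually_at using bd by (intro exI[of _ 1]) (auto simp: dist_real_def)
    have "((\<lambda>\<mu>. (\<bar>\<mu> - \<nu>\<bar> * (2 * K))\<^sup>2 * ?C) \<longlongrightarrow> (\<bar>\<nu> - \<nu>\<bar> * (2 * K))\<^sup>2 * ?C) (at \<nu> within A)"
      by (intro tendsto_intros)
    then show "((\<lambda>\<mu>. (\<bar>\<mu> - \<nu>\<bar> * (2 * K))\<^sup>2 * ?C) \<longlongrightarrow> 0) (at \<nu> within A)" by simp
  qed
  from tendsto_real_sqrt[OF this] have "((\<lambda>\<mu>. norm (sol \<mu> c x - sol \<nu> c x)) \<longlongrightarrow> 0) (at \<nu> within A)"
    by simp
  then show ?thesis by (rule tendsto_norm_zero_cancel[THEN LIM_zero_cancel])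
qed

end

section \<open>Boundary traces\<close>

lemma vector_4:
  "vec_nth (vector [a, b, c, d] :: real^4) 1 = a" "vec_nth (vector [a, b, c, d] :: real^4) 2 = b"
  "vec_nth (vector [a, b, c, d] :: real^4) 3 = c" "vec_nth (vector [a, b, c, d] :: real^4) 4 = d"
  by (simp_all add: vector_def)

lemma vector_4_algebra:
  "(vector [a, b, c, d] :: real^4) = vector [a', b', c', d'] \<longleftrightarrow> a = a' \<and> b = b' \<and> c = c' \<and> d = d'"
  "(vector [a, b, c, d] :: real^4) = 0 \<longleftrightarrow> a = 0 \<and> b = 0 \<and> c = 0 \<and> d = 0"
  "(vector [a, b, c, d] :: real^4) + vector [a', b', c', d'] = vector [a + a', b + b', c + c', d + d']"
  "r *\<^sub>R (vector [a, b, c, d] :: real^4) = vector [r * a, r * b, r * c, r * d]"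
  by (simp_all add: Finite_Cartesian_Product.vec_eq_iff forall_4 vector_4)

text \<open>
  The trace of a solution of the first order system in terms of its initial data \<open>c\<close> and end data \<open>d\<close>.
\<close>

definition trace :: "state \<Rightarrow> state \<Rightarrow> 4 symp" where
  "trace c d = (vector [fst (fst c), snd (fst c), fst (fst d), snd (fst d)],
                vector [- fst (snd c), snd (snd c), fst (snd d), - snd (snd d)])"

text \<open>
  The boundary term of Green's formula. The second components count negatively, as in the trace.
\<close>

definition pairing :: "state \<Rightarrow> state \<Rightarrow> real" where
  "pairing z w = fst (fst z) * fst (snd w) - snd (fst z) * snd (snd w)"

definition wronskian :: "state \<Rightarrow> state \<Rightarrow> real" where
  "wronskian z w = pairing z w - pairing w z"

text \<open>
  The integrand of \<open>\<langle>z, S w\<rangle>\<close>.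
\<close>

definition cross :: "state \<Rightarrow> state \<Rightarrow> real" where
  "cross z w = fst (fst z) * snd (fst w) + snd (fst z) * fst (fst w)"

lemma inner_trace: "inner (fst (trace c d)) (snd (trace c' d')) = pairing d d' - pairing c c'"
  by (simp add: trace_def inner_vec_def sum_4 vector_4 pairing_def)

lemma inner_trace_pos: "inner (fst (trace c d)) (fst (trace c' d')) = inner (fst c) (fst c') + inner (fst d) (fst d')"
  by (simp add: trace_def inner_vec_def sum_4 vector_4 inner_prod_def)

lemma norm_fst_trace: "fst c = 0 \<Longrightarrow> norm (fst (trace c d)) = norm (fst d)"
  by (simp add: norm_eq_sqrt_inner inner_trace_pos)

lemma robin_form_trace: "robin_form \<tau> (trace c d) (trace c' d')
    = - (pairing d d' - pairing c c') - \<tau> * (inner (fst c) (fst c') + inner (fst d) (fst d'))"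
  by (simp add: robin_form_def inner_right_distrib inner_trace inner_trace_pos)

lemma symp_form_trace: "symp_form (trace c d) (trace c' d') = wronskian d d' - wronskian c c'"
  by (simp add: symp_form_eq inner_trace inner_commute[of "snd (trace c d)"] wronskian_def)

lemma trace_eqI: "fst z = vector [a1, a2, a3, a4] \<Longrightarrow> snd z = vector [- b1, b2, b3, - b4] \<Longrightarrow>
    z = trace ((a1, a2), (b1, b2)) ((a3, a4), (b3, b4))"
  by (simp add: trace_def prod_eq_iff)

lemma linear_trace: "linear (\<lambda>p. trace (fst p) (snd p))"
  by (rule linearI) (simp_all add: trace_def vector_4_algebra)

lemma tendsto_trace:
  assumes "(f \<longlongrightarrow> c) F" "(k \<longlongrightarrow> d) F"
  shows "((\<lambda>t. trace (f t) (k t)) \<longlongrightarrow> trace c d) F"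
proof -
  have "bounded_linear (\<lambda>p. trace (fst p) (snd p))" using linear_trace by (simp add: linear_linear)
  from bounded_linear.tendsto[OF this tendsto_Pair[OF assms]] show ?thesis by simp
qed

lemma trace_inject: "trace c d = trace c' d' \<Longrightarrow> c = c'"
  by (simp add: trace_def vector_4_algebra prod_eq_iff)

lemma fst_trace_eq_0: "fst (trace c d) = 0 \<longleftrightarrow> fst c = 0 \<and> fst d = 0"
  by (auto simp: trace_def vector_4_algebra prod_eq_iff)

lemma abs_components_le:
  "\<bar>fst (fst (z::state))\<bar> \<le> norm (fst z)" "\<bar>snd (fst z)\<bar> \<le> norm (fst z)" "\<bar>fst (snd z)\<bar> \<le> norm z" "\<bar>snd (snd z)\<bar> \<le> norm z"
  "norm (fst z) \<le> norm z"
proof -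
  show "norm (fst z) \<le> norm z" using norm_fst_le[of "fst z" "snd z"] by simp
  have s: "norm (snd z) \<le> norm z" using norm_snd_le[of "snd z" "fst z"] by simp
  show "\<bar>fst (fst z)\<bar> \<le> norm (fst z)" using norm_fst_le[of "fst (fst z)" "snd (fst z)"] by simp
  show "\<bar>snd (fst z)\<bar> \<le> norm (fst z)" using norm_snd_le[of "snd (fst z)" "fst (fst z)"] by simp
  show "\<bar>fst (snd z)\<bar> \<le> norm z" using norm_fst_le[of "fst (snd z)" "snd (snd z)"] s by simp
  show "\<bar>snd (snd z)\<bar> \<le> norm z" using norm_snd_le[of "snd (snd z)" "fst (snd z)"] s by simp
qed

lemma abs_pairing_le: "\<bar>pairing z w\<bar> \<le> 2 * (norm (fst z) * norm w)"
proof -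
  have "\<bar>pairing z w\<bar> \<le> \<bar>fst (fst z)\<bar> * \<bar>fst (snd w)\<bar> + \<bar>snd (fst z)\<bar> * \<bar>snd (snd w)\<bar>"
    unfolding pairing_def abs_mult[symmetric] by (rule abs_triangle_ineq4)
  also have "\<dots> \<le> norm (fst z) * norm w + norm (fst z) * norm w"
    by (intro add_mono mult_mono abs_components_le) auto
  finally show ?thesis by (simp add: mult.commute)
qed

lemma abs_cross_le: "\<bar>cross z w\<bar> \<le> 2 * (norm z * norm w)"
proof -
  have "\<bar>cross z w\<bar> \<le> \<bar>fst (fst z)\<bar> * \<bar>snd (fst w)\<bar> + \<bar>snd (fst z)\<bar> * \<bar>fst (fst w)\<bar>"
    unfolding cross_def abs_mult[symmetric] by (rule abs_triangle_ineq)
  also have "\<dots> \<le> norm z * norm w + norm z * norm w"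
    by (intro add_mono mult_mono order_trans[OF abs_components_le(1) abs_components_le(5)]
        order_trans[OF abs_components_le(2) abs_components_le(5)]) auto
  finally show ?thesis by (simp add: mult.commute)
qed

lemma pairing_add_right: "pairing v (z + w) = pairing v z + pairing v w"
  and pairing_twist: "pairing z (c *\<^sub>R twist w) = - (c * cross w z)"
  by (simp_all add: cross_def pairing_def twist_def algebra_simps)

lemma pairing_zero_left: "fst z = 0 \<Longrightarrow> pairing z w = 0"
  by (simp add: pairing_def)

lemma state_derivs:
  fixes Z :: "real \<Rightarrow> state"
  assumes "(Z has_vector_derivative Z') (at x within S)"
  shows "((\<lambda>x. fst (fst (Z x))) has_real_derivative fst (fst Z')) (at x within S)"
    "((\<lambda>x. snd (fst (Z x))) has_real_derivative snd (fst Z')) (at x within S)"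
    "((\<lambda>x. fst (snd (Z x))) has_real_derivative fst (snd Z')) (at x within S)"
    "((\<lambda>x. snd (snd (Z x))) has_real_derivative snd (snd Z')) (at x within S)"
proof -
  have 1: "((\<lambda>x. fst (Z x)) has_vector_derivative fst Z') (at x within S)"
    by (rule bounded_linear.has_vector_derivative[OF bounded_linear_fst assms])
  have 2: "((\<lambda>x. snd (Z x)) has_vector_derivative snd Z') (at x within S)"
    by (rule bounded_linear.has_vector_derivative[OF bounded_linear_snd assms])
  show "((\<lambda>x. fst (fst (Z x))) has_real_derivative fst (fst Z')) (at x within S)"
    "((\<lambda>x. snd (fst (Z x))) has_real_derivative snd (fst Z')) (at x within S)"
    "((\<lambda>x. fst (snd (Z x))) has_real_derivative fst (snd Z')) (at x within S)"
    "((\<lambda>x. snd (snd (Z x))) has_real_derivative snd (snd Z')) (at x within S)"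
    unfolding has_real_derivative_iff_has_vector_derivative
    by (rule bounded_linear.has_vector_derivative[OF bounded_linear_fst 1]
        bounded_linear.has_vector_derivative[OF bounded_linear_snd 1]
        bounded_linear.has_vector_derivative[OF bounded_linear_fst 2]
        bounded_linear.has_vector_derivative[OF bounded_linear_snd 2])+
qed

lemma state_derivI:
  assumes "(u has_real_derivative u') (at x within S)" "(v has_real_derivative v') (at x within S)"
    "(p has_real_derivative p') (at x within S)" "(q has_real_derivative q') (at x within S)"
  shows "((\<lambda>x. ((u x, v x), (p x, q x))) has_vector_derivative ((u', v'), (p', q'))) (at x within S)"
  using assms unfolding has_real_derivative_iff_has_vector_derivative by (intro has_vector_derivative_Pair)

text \<open>
  Green's formula in differential form: the parts that come from the potentials cancel.
\<close>

lemma wronskian_deriv: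
  assumes Z: "(Z has_vector_derivative field g h 0 x (Z x) + A) (at x within S)" "fst A = 0"
    and W: "(W has_vector_derivative field g h 0 x (W x) + B) (at x within S)" "fst B = 0"
  shows "((\<lambda>x. wronskian (Z x) (W x)) has_real_derivative pairing (Z x) B - pairing (W x) A) (at x within S)"
  unfolding wronskian_def pairing_def
  by (rule derivative_eq_intros state_derivs[OF Z(1)] state_derivs[OF W(1)] refl)+
    (use Z(2) W(2) in \<open>simp add: field_def algebra_simps\<close>)

context nls_system
begin

text \<open>
  The flow preserves the Wronskian, which is exactly the pullback of the symplectic form under traces.
\<close>

lemma solution_range_Lagr:
  assumes y: "y \<in> {0..l}"
  shows "range (\<lambda>c. trace c (sol \<mu> c y)) \<in> Lagr"
    and "linear (\<lambda>c. trace c (sol \<mu> c y))" and "inj (\<lambda>c. trace c (sol \<mu> c y))"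
proof -
  have "linear (\<lambda>c. (c, sol \<mu> c y))"
    by (rule linearI)
      (simp_all add: linear_add[OF linear_sol[OF y]] linear_cmul[OF linear_sol[OF y]])
  from linear_compose[OF this linear_trace]
  show lin: "linear (\<lambda>c. trace c (sol \<mu> c y))" by (simp add: o_def)
  show inj: "inj (\<lambda>c. trace c (sol \<mu> c y))" by (rule injI) (rule trace_inject)
  have const: "wronskian (sol \<mu> c y) (sol \<mu> d y) = wronskian c d" for c d
  proof -
    have "((\<lambda>x. wronskian (sol \<mu> c x) (sol \<mu> d x)) has_real_derivative 0) (at x within {0..l})" if x: "x \<in> {0..l}" for x
    proof -
      have "((\<lambda>x. wronskian (sol \<mu> c x) (sol \<mu> d x)) has_real_derivative
          pairing (sol \<mu> c x) (\<mu> *\<^sub>R twist (sol \<mu> d x)) - pairing (sol \<mu> d x) (\<mu> *\<^sub>R twist (sol \<mu> c x))) (at x within {0..l})"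
        by (rule wronskian_deriv[OF sol(2)[OF x, of \<mu> c, unfolded field_twist[of g h \<mu>]] _
            sol(2)[OF x, of \<mu> d, unfolded field_twist[of g h \<mu>]]]) (simp_all add: twist_def)
      then show ?thesis by (simp add: pairing_twist cross_def algebra_simps)
    qed
    then obtain k where k: "\<And>x. x \<in> {0..l} \<Longrightarrow> wronskian (sol \<mu> c x) (sol \<mu> d x) = k"
      using has_field_derivative_zero_constant[of "{0..l}" "\<lambda>x. wronskian (sol \<mu> c x) (sol \<mu> d x)"] by auto
    show ?thesis using k[OF y] k[of 0] l by (simp add: sol(1))
  qed
  show "range (\<lambda>c. trace c (sol \<mu> c y)) \<in> Lagr"
    unfolding Lagr_def
  proof (intro CollectI conjI ballI)
    show "subspace (range (\<lambda>c. trace c (sol \<mu> c y)))" by (rule linear_subspace_image[OF lin subspace_UNIV])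
    have "dim (range (\<lambda>c. trace c (sol \<mu> c y))) = dim (UNIV :: state set)"
      by (rule dim_image_eq[OF lin]) (use inj in simp)
    then show "dim (range (\<lambda>c. trace c (sol \<mu> c y))) = CARD(4)" by simp
    fix z w assume "z \<in> range (\<lambda>c. trace c (sol \<mu> c y))" "w \<in> range (\<lambda>c. trace c (sol \<mu> c y))"
    then show "symp_form z w = 0" by (auto simp: symp_form_trace const)
  qed
qed

text \<open>
  An \<open>H\<^sup>2\<close> solution has a continuous second derivative and is therefore classical; scaling turns it into a
  solution on \<open>[0, s l]\<close>. The factor \<open>1/s\<close> in the trace is the one that the chain rule produces.
\<close>

theorem Lam_eq:
  assumes s: "0 < s" "s \<le> 1"
  shows "Lam l g h \<mu> s = range (\<lambda>c. trace c (sol \<mu> c (s * l)))"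
proof -
  have cont: "continuous_on {0..l} (\<lambda>x. f (s * x))" if "continuous_on {0..l} f" for f :: "real \<Rightarrow> real"
  proof (rule continuous_on_compose2[OF that])
    show "continuous_on {0..l} (\<lambda>x. s * x)" by (intro continuous_intros)
    have "s * x \<in> {0..l}" if "x \<in> {0..l}" for x
      using that s mult_left_le_one_le[of x s] by (simp add: order_trans[of "s * x" x l])
    then show "(\<lambda>x. s * x) ` {0..l} \<subseteq> {0..l}" by blast
  qed
  note cgs = cont[OF cg] and chs = cont[OF ch]
  show ?thesis
  proof (intro equalityI subsetI)
    fix z assume "z \<in> Lam l g h \<mu> s"
    then obtain u v where uv: "u \<in> H2 l" "v \<in> H2 l" "z = Tr l s (u, v)"
      "L2_eq2 l (N_op l g h s (u, v)) (pscale (s\<^sup>2 * \<mu>) (u, v))"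
      unfolding Lam_def K_space_def by auto
    note eq = uv(4)[unfolded L2_eq2_def L2_eq_def, THEN conjunct1]
      uv(4)[unfolded L2_eq2_def L2_eq_def, THEN conjunct2]
    have cuv: "continuous_on {0..l} u" "continuous_on {0..l} v" using H2_continuous[OF l] uv by auto
    have cu: "continuous_on {0..l} (\<lambda>x. - s\<^sup>2 * g (s * x) * u x - s\<^sup>2 * \<mu> * v x)"
      and cv: "continuous_on {0..l} (\<lambda>x. - s\<^sup>2 * h (s * x) * v x + s\<^sup>2 * \<mu> * u x)"
      by (intro continuous_intros cgs chs cuv)+
    have "AE x in lebesgue_on {0..l}. Dx l (Dx l u) x = - s\<^sup>2 * g (s * x) * u x - s\<^sup>2 * \<mu> * v x"
      by (rule eventually_mono[OF eq(2)]) (simp add: L_op_def pscale_def rscale_def N_op_def)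
    from H2_classical[OF l uv(1) _ this, OF cu] obtain p where
      p: "\<forall>x\<in>{0..l}. (u has_real_derivative p x) (at x within {0..l})"
        "\<forall>x\<in>{0..l}. (p has_real_derivative - s\<^sup>2 * g (s * x) * u x - s\<^sup>2 * \<mu> * v x) (at x within {0..l})"
      by (elim exE conjE)
    have "AE x in lebesgue_on {0..l}. Dx l (Dx l v) x = - s\<^sup>2 * h (s * x) * v x + s\<^sup>2 * \<mu> * u x"
      by (rule eventually_mono[OF eq(1)]) (simp add: L_op_def pscale_def rscale_def N_op_def)
    from H2_classical[OF l uv(2) _ this, OF cv] obtain q where
      q: "\<forall>x\<in>{0..l}. (v has_real_derivative q x) (at x within {0..l})"
        "\<forall>x\<in>{0..l}. (q has_real_derivative - s\<^sup>2 * h (s * x) * v x + s\<^sup>2 * \<mu> * u x) (at x within {0..l})"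
      by (elim exE conjE)
    (* derivatives with respect to s * x *)
    define Z where "Z x = ((u x, v x), (p x / s, q x / s))" for x
    have "Z x = sol \<mu> (Z 0) (s * x)" if "x \<in> {0..l}" for x
    proof (rule sol_scaled_unique[OF s _ that])
      fix y assume y: "y \<in> {0..l}"
      have "(Z has_vector_derivative ((p y, q y), ((- s\<^sup>2 * g (s * y) * u y - s\<^sup>2 * \<mu> * v y) / s,
          (- s\<^sup>2 * h (s * y) * v y + s\<^sup>2 * \<mu> * u y) / s))) (at y within {0..l})"
        unfolding Z_def[abs_def] by (intro state_derivI DERIV_cdivide p(1)[rule_format] p(2)[rule_format] q(1)[rule_format] q(2)[rule_format] y)
      moreover have "((p y, q y), ((- s\<^sup>2 * g (s * y) * u y - s\<^sup>2 * \<mu> * v y) / s,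
          (- s\<^sup>2 * h (s * y) * v y + s\<^sup>2 * \<mu> * u y) / s)) = s *\<^sub>R field g h \<mu> (s * y) (Z y)"
        using s by (simp add: field_def Z_def power2_eq_square field_simps)
      ultimately show "(Z has_vector_derivative s *\<^sub>R field g h \<mu> (s * y) (Z y)) (at y within {0..l})" by simp
    qed
    from this[of l] have Zl: "Z l = sol \<mu> (Z 0) (s * l)" using l by simp
    have D: "Dx l u x = p x" "Dx l v x = q x" if "x \<in> {0..l}" for x
      using Dx_eqI[OF l that] p(1) q(1) that by auto
    have "z = trace (Z 0) (Z l)"
      unfolding uv(3) Z_def by (rule trace_eqI) (use D[of 0] D[of l] l in \<open>simp_all add: Tr_def Let_def\<close>)
    then show "z \<in> range (\<lambda>c. trace c (sol \<mu> c (s * l)))" unfolding Zl by blast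
  next
    fix z assume "z \<in> range (\<lambda>c. trace c (sol \<mu> c (s * l)))"
    then obtain c where z: "z = trace c (sol \<mu> c (s * l))" by blast
    let ?Y = "\<lambda>x. sol \<mu> c (s * x)"
    define u where "u x = (if x \<in> {0..l} then fst (fst (?Y x)) else 0)" for x
    define v where "v x = (if x \<in> {0..l} then snd (fst (?Y x)) else 0)" for x
    define p where "p x = s * fst (snd (?Y x))" for x
    define q where "q x = s * snd (snd (?Y x))" for x
    define cu where "cu x = - s\<^sup>2 * g (s * x) * u x - s\<^sup>2 * \<mu> * v x" for x
    define cv where "cv x = - s\<^sup>2 * h (s * x) * v x + s\<^sup>2 * \<mu> * u x" for x
    note d = state_derivs[OF sol_scaled[OF s]]
    have u': "(u has_real_derivative p x) (at x within {0..l})" if x: "x \<in> {0..l}" for x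
      by (rule has_real_derivative_cong[OF d(1)[OF x, of \<mu> c, THEN DERIV_cong] x]) (simp_all add: u_def p_def field_def)
    have v': "(v has_real_derivative q x) (at x within {0..l})" if x: "x \<in> {0..l}" for x
      by (rule has_real_derivative_cong[OF d(2)[OF x, of \<mu> c, THEN DERIV_cong] x]) (simp_all add: v_def q_def field_def)
    have p': "(p has_real_derivative cu x) (at x within {0..l})" if x: "x \<in> {0..l}" for x
      unfolding p_def[abs_def]
      by (rule DERIV_cong[OF DERIV_cmult[OF d(3)[OF x, of \<mu> c]]])
        (use x in \<open>simp add: cu_def u_def v_def field_def power2_eq_square algebra_simps\<close>)
    have q': "(q has_real_derivative cv x) (at x within {0..l})" if x: "x \<in> {0..l}" for x
      unfolding q_def[abs_def]
      by (rule DERIV_cong[OF DERIV_cmult[OF d(4)[OF x, of \<mu> c]]])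
        (use x in \<open>simp add: cv_def u_def v_def field_def power2_eq_square algebra_simps\<close>)
    have cuv: "continuous_on {0..l} u" "continuous_on {0..l} v"
      by (rule DERIV_continuous_on[OF u'], assumption) (rule DERIV_continuous_on[OF v'], assumption)
    have cu: "continuous_on {0..l} cu" and cv: "continuous_on {0..l} cv"
      unfolding cu_def[abs_def] cv_def[abs_def]
      by (intro continuous_intros cgs chs cuv)+
    note cH = classical_H2[OF l u' p' cu] classical_H2[OF l v' q' cv]
    have out: "u x = 0" "v x = 0" if "x \<notin> {0..l}" for x using that unfolding u_def v_def by (simp_all only: if_False)
    have H: "u \<in> H2 l" "v \<in> H2 l" by (rule cH(1) cH(4), assumption+, rule out, assumption)+
    have Du: "Dx l u x = p x" "Dx l v x = q x" "Dx l (Dx l u) x = cu x" "Dx l (Dx l v) x = cv x" if "x \<in> {0..l}" for x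
      using cH(2)[OF _ _ _ that] cH(3)[OF _ _ _ that] cH(5)[OF _ _ _ that] cH(6)[OF _ _ _ that] out by blast+
    have "L2_eq2 l (N_op l g h s (u, v)) (pscale (s\<^sup>2 * \<mu>) (u, v))"
      unfolding L2_eq2_def L2_eq_def
    proof (intro conjI AE_I2)
      fix x assume "x \<in> space (lebesgue_on {0..l})"
      then have x: "x \<in> {0..l}" by simp
      show "fst (N_op l g h s (u, v)) x = fst (pscale (s\<^sup>2 * \<mu>) (u, v)) x"
        using Du(4)[OF x] by (simp add: N_op_def L_op_def pscale_def rscale_def cv_def)
      show "snd (N_op l g h s (u, v)) x = snd (pscale (s\<^sup>2 * \<mu>) (u, v)) x"
        using Du(3)[OF x] by (simp add: N_op_def L_op_def pscale_def rscale_def cu_def)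
    qed
    then have "(u, v) \<in> K_space l g h \<mu> s" using H by (simp add: K_space_def)
    moreover have "Tr l s (u, v) = trace c (sol \<mu> c (s * l))"
    proof -
      have "Tr l s (u, v) = trace ((u 0, v 0), (p 0 / s, q 0 / s)) ((u l, v l), (p l / s, q l / s))"
        by (rule trace_eqI) (use Du[of 0] Du[of l] l in \<open>simp_all add: Tr_def Let_def\<close>)
      also have "\<dots> = trace c (sol \<mu> c (s * l))"
        using s l by (simp add: u_def v_def p_def q_def sol(1))
      finally show ?thesis .
    qed
    ultimately show "z \<in> Lam l g h \<mu> s" unfolding z Lam_def by (metis image_eqI)
  qed
qed

end

section \<open>The index on the two sides of the corner\<close>

text \<open>
  Data at the corner: \<open>c i\<close> are the initial data of a basis of the kernel, and the generalised
  eigenvectors \<open>K i\<close> solve the system with inhomogeneity \<open>twist (k i)\<close>, where \<open>k i\<close> is the kernel solution.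
\<close>

locale kernel_data = nls_system +
  fixes N :: nat and c :: "nat \<Rightarrow> state" and K :: "nat \<Rightarrow> real \<Rightarrow> state"
  assumes c0: "i < N \<Longrightarrow> fst (c i) = 0"
    and cl: "i < N \<Longrightarrow> fst (sol 0 (c i) l) = 0"
    and K': "i < N \<Longrightarrow> x \<in> {0..l} \<Longrightarrow>
      (K i has_vector_derivative field g h 0 x (K i x) + twist (sol 0 (c i) x)) (at x within {0..l})"
    and K0: "i < N \<Longrightarrow> fst (K i 0) = 0" and Kl: "i < N \<Longrightarrow> fst (K i l) = 0"
    and dimN: "dim (range (\<lambda>c. trace c (sol 0 c l)) \<inter> vertical) = N"
begin

abbreviation k :: "nat \<Rightarrow> real \<Rightarrow> state" where "k i \<equiv> sol 0 (c i)"

text \<open>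
  The solution at parameter \<open>\<mu>\<close> whose initial data are those of the first order approximation \<open>k i + \<mu> K i\<close>.
\<close>

definition F :: "nat \<Rightarrow> real \<Rightarrow> real \<Rightarrow> state" where "F i \<mu> = sol \<mu> (c i + \<mu> *\<^sub>R K i 0)"

text \<open>
  The matrix of the second order crossing form is \<open>- 2\<close> times this one.
\<close>

definition second_form :: "nat \<Rightarrow> nat \<Rightarrow> real" where
  "second_form i j = integral {0..l} (\<lambda>x. cross (K i x) (k j x))"

definition remainder :: "nat \<Rightarrow> real \<Rightarrow> real \<Rightarrow> state" where
  "remainder i \<mu> x = F i \<mu> x - k i x - \<mu> *\<^sub>R K i x"

lemma K_cont: "i < N \<Longrightarrow> continuous_on {0..l} (K i)"
  by (rule continuous_on_vector_derivative) (rule K')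

lemma K_bounded: "i < N \<Longrightarrow> \<exists>B. \<forall>x\<in>{0..l}. norm (K i x) \<le> B"
  using compact_imp_bounded[OF compact_continuous_image[OF K_cont compact_Icc]]
  by (auto simp: bounded_iff)

lemma cross_cont:
  assumes "continuous_on A Z" "continuous_on A W"
  shows "continuous_on A (\<lambda>x. cross (Z x) (W x))"
  unfolding cross_def by (intro continuous_intros assms)

text \<open>
  The remainder starts at \<open>0\<close> and solves the system with inhomogeneity \<open>\<mu>\<^sup>2 *\<^sub>R twist (K i x)\<close>.
\<close>

lemma remainder_bound:
  assumes i: "i < N"
  shows "\<exists>C\<ge>0. \<forall>\<mu> x. \<bar>\<mu>\<bar> \<le> 1 \<longrightarrow> x \<in> {0..l} \<longrightarrow> norm (remainder i \<mu> x) \<le> C * \<mu>\<^sup>2"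
proof -
  obtain B where B: "\<forall>x\<in>{0..l}. norm (K i x) \<le> B" using K_bounded[OF i] by (elim exE)
  have "norm (K i 0) \<le> B" using B l by simp
  then have B0: "0 \<le> B" using norm_ge_zero[of "K i 0"] by linarith
  let ?q = "l * exp ((2 * rate 1 + 1) * l)"
  show ?thesis
  proof (intro exI[of _ "2 * B * sqrt ?q"] conjI allI impI)
    show "0 \<le> 2 * B * sqrt ?q" using B0 l by simp
    fix \<mu> x :: real assume \<mu>: "\<bar>\<mu>\<bar> \<le> 1" and x: "x \<in> {0..l}"
    let ?E = "\<lambda>x. \<mu>\<^sup>2 *\<^sub>R twist (K i x)"
    have "(norm (remainder i \<mu> x))\<^sup>2 \<le> ((norm (remainder i \<mu> 0))\<^sup>2 + (\<mu>\<^sup>2 * (2 * B))\<^sup>2 * l) * exp ((2 * rate \<mu> + 1) * l)"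
    proof (rule sol_perturbed[where E = ?E, OF _ _ x])
      fix y assume y: "y \<in> {0..l}"
      have "field g h \<mu> y (F i \<mu> y) - field g h 0 y (k i y) - \<mu> *\<^sub>R (field g h 0 y (K i y) + twist (k i y))
          = field g h \<mu> y (remainder i \<mu> y) + ?E y"
        unfolding remainder_def linear_diff[OF linear_field] linear_cmul[OF linear_field]
          field_twist[of g h \<mu> y "k i y"] field_twist[of g h \<mu> y "K i y"]
        by (simp add: algebra_simps power2_eq_square)
      moreover have "(remainder i \<mu> has_vector_derivative
          field g h \<mu> y (F i \<mu> y) - field g h 0 y (k i y) - \<mu> *\<^sub>R (field g h 0 y (K i y) + twist (k i y))) (at y within {0..l})"
        unfolding remainder_def[abs_def] F_def
        by (intro has_vector_derivative_diff sol(2)[OF y]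
            bounded_linear.has_vector_derivative[OF bounded_linear_scaleR_right] K'[OF i y])
      ultimately show "(remainder i \<mu> has_vector_derivative field g h \<mu> y (remainder i \<mu> y) + ?E y) (at y within {0..l})"
        by simp
      have "norm (twist (K i y)) \<le> 2 * B" using norm_twist_le[of "K i y"] B[rule_format, OF y] by simp
      then show "norm (?E y) \<le> \<mu>\<^sup>2 * (2 * B)" unfolding norm_scaleR by (simp add: mult_left_mono)
    qed
    also have "remainder i \<mu> 0 = 0" by (simp add: remainder_def F_def sol(1))
    also have "((norm (0::state))\<^sup>2 + (\<mu>\<^sup>2 * (2 * B))\<^sup>2 * l) * exp ((2 * rate \<mu> + 1) * l)
        = (\<mu>\<^sup>2 * (2 * B))\<^sup>2 * (l * exp ((2 * rate \<mu> + 1) * l))" by simp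
    also have "\<dots> \<le> (\<mu>\<^sup>2 * (2 * B))\<^sup>2 * ?q"
    proof -
      have "rate \<mu> \<le> rate 1" by (rule rate_mono) (use \<mu> in auto)
      then have "(2 * rate \<mu> + 1) * l \<le> (2 * rate 1 + 1) * l" using l by (intro mult_right_mono) auto
      then show ?thesis using l by (intro mult_left_mono) auto
    qed
    also have "\<dots> = (2 * B * sqrt ?q * \<mu>\<^sup>2)\<^sup>2" using l by (simp add: power_mult_distrib)
    finally show "norm (remainder i \<mu> x) \<le> 2 * B * sqrt ?q * \<mu>\<^sup>2"
      by (rule power2_le_imp_le) (use B0 l in simp)
  qed
qed

text \<open>
  The solvability condition for \<open>K i\<close>, that is, the vanishing of the first order crossing form: Green's formula for \<open>K i\<close> and \<open>k j\<close> has no boundary terms.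
\<close>

lemma cross_kernel_integral:
  assumes i: "i < N" and j: "j < N"
  shows "integral {0..l} (\<lambda>x. cross (k i x) (k j x)) = 0"
proof -
  have "((\<lambda>x. cross (k i x) (k j x)) has_integral wronskian (K i l) (k j l) - wronskian (K i 0) (k j 0)) {0..l}"
  proof (rule fundamental_theorem_of_calculus)
    fix x assume x: "x \<in> {0..l}"
    have "((\<lambda>x. wronskian (K i x) (k j x)) has_real_derivative pairing (K i x) 0 - pairing (k j x) (twist (k i x))) (at x within {0..l})"
      by (rule wronskian_deriv[where g = g and h = h]) (use K'[OF i x] sol(2)[OF x, of 0 "c j"] in \<open>simp_all add: twist_def\<close>)
    moreover have "pairing (K i x) 0 - pairing (k j x) (twist (k i x)) = cross (k i x) (k j x)"
      by (simp add: pairing_def cross_def twist_def algebra_simps)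
    ultimately show "((\<lambda>x. wronskian (K i x) (k j x)) has_vector_derivative cross (k i x) (k j x)) (at x within {0..l})"
      by (simp add: has_real_derivative_iff_has_vector_derivative)
  qed (use l in simp)
  moreover have "wronskian (K i l) (k j l) - wronskian (K i 0) (k j 0) = 0"
    using K0[OF i] Kl[OF i] c0[OF j] cl[OF j] by (simp add: wronskian_def pairing_zero_left sol(1))
  ultimately show ?thesis by (simp add: integral_unique)
qed

text \<open>
  Green's formula for \<open>F i \<mu>\<close> and \<open>k j\<close>, whose only boundary term is at \<open>l\<close>.
\<close>

lemma pairing_kernel:
  assumes i: "i < N" and j: "j < N"
  shows "pairing (F i \<mu> l) (k j l) = \<mu> * (\<mu> * second_form i j + integral {0..l} (\<lambda>x. cross (remainder i \<mu> x) (k j x)))"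
proof -
  have cF: "continuous_on {0..l} (F i \<mu>)" unfolding F_def by (rule sol_cont)
  have cr: "continuous_on {0..l} (remainder i \<mu>)"
    unfolding remainder_def[abs_def] by (intro continuous_intros cF sol_cont K_cont i)
  note int = integrable_continuous_interval[OF cross_cont]
  have "((\<lambda>x. \<mu> * cross (F i \<mu> x) (k j x)) has_integral wronskian (F i \<mu> l) (k j l) - wronskian (F i \<mu> 0) (k j 0)) {0..l}"
  proof (rule fundamental_theorem_of_calculus)
    fix x assume x: "x \<in> {0..l}"
    have "((\<lambda>x. wronskian (F i \<mu> x) (k j x)) has_real_derivative pairing (F i \<mu> x) 0 - pairing (k j x) (\<mu> *\<^sub>R twist (F i \<mu> x))) (at x within {0..l})"
      by (rule wronskian_deriv[where g = g and h = h])
        (use sol(2)[OF x, of \<mu> "c i + \<mu> *\<^sub>R K i 0"] sol(2)[OF x, of 0 "c j"] in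
          \<open>simp_all add: twist_def F_def field_twist[of g h \<mu>]\<close>)
    then show "((\<lambda>x. wronskian (F i \<mu> x) (k j x)) has_vector_derivative \<mu> * cross (F i \<mu> x) (k j x)) (at x within {0..l})"
      unfolding pairing_twist by (simp add: has_real_derivative_iff_has_vector_derivative pairing_def)
  qed (use l in simp)
  moreover have "wronskian (F i \<mu> l) (k j l) - wronskian (F i \<mu> 0) (k j 0) = pairing (F i \<mu> l) (k j l)"
    using K0[OF i] c0[OF i] c0[OF j] cl[OF j] by (simp add: wronskian_def pairing_zero_left sol(1) F_def)
  ultimately have "pairing (F i \<mu> l) (k j l) = integral {0..l} (\<lambda>x. \<mu> * cross (F i \<mu> x) (k j x))"
    by (simp only: integral_unique)
  also have "\<dots> = \<mu> * integral {0..l} (\<lambda>x. cross (F i \<mu> x) (k j x))" by simp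
  also have "(\<lambda>x. cross (F i \<mu> x) (k j x)) =
      (\<lambda>x. cross (k i x) (k j x) + \<mu> * cross (K i x) (k j x) + cross (remainder i \<mu> x) (k j x))"
    by (rule ext) (simp add: remainder_def cross_def algebra_simps)
  also have "integral {0..l} \<dots> = integral {0..l} (\<lambda>x. cross (k i x) (k j x)) + \<mu> * second_form i j
      + integral {0..l} (\<lambda>x. cross (remainder i \<mu> x) (k j x))"
    unfolding second_form_def
    by (subst integral_add integral_mult_right; (intro integrable_add integrable_on_mult_right int sol_cont K_cont[OF i] cr)?)+ simp
  finally show ?thesis by (simp add: cross_kernel_integral[OF i j])
qed

abbreviation \<kappa> :: "real \<Rightarrow> nat \<Rightarrow> 4 symp" where
  "\<kappa> \<mu> i \<equiv> trace (c i + \<mu> *\<^sub>R K i 0) (F i \<mu> l)"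

lemma fst_F_l: "i < N \<Longrightarrow> fst (F i \<mu> l) = fst (remainder i \<mu> l)"
  by (simp add: remainder_def cl Kl)

text \<open>
  At \<open>l\<close> the first components of \<open>F i \<mu>\<close> are \<open>O(\<mu>\<^sup>2)\<close>, so replacing \<open>F j \<mu>\<close> by \<open>k j\<close> in the pairing and
  dropping the \<open>\<tau>\<close>-term costs only \<open>O(\<mu>\<^sup>3)\<close>.
\<close>

lemma robin_form_expansion:
  assumes i: "i < N" and j: "j < N"
  shows "\<exists>D. \<forall>\<mu>. \<bar>\<mu>\<bar> \<le> 1 \<longrightarrow> \<bar>robin_form \<tau> (\<kappa> \<mu> i) (\<kappa> \<mu> j) + \<mu>\<^sup>2 * second_form i j\<bar> \<le> D * \<bar>\<mu>\<bar> ^ 3"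
proof -
  obtain Ci where Ci: "0 \<le> Ci" "\<forall>\<mu> x. \<bar>\<mu>\<bar> \<le> 1 \<longrightarrow> x \<in> {0..l} \<longrightarrow> norm (remainder i \<mu> x) \<le> Ci * \<mu>\<^sup>2"
    using remainder_bound[OF i] by (elim exE conjE)
  obtain Cj where Cj: "0 \<le> Cj" "\<forall>\<mu> x. \<bar>\<mu>\<bar> \<le> 1 \<longrightarrow> x \<in> {0..l} \<longrightarrow> norm (remainder j \<mu> x) \<le> Cj * \<mu>\<^sup>2"
    using remainder_bound[OF j] by (elim exE conjE)
  obtain B where B: "\<forall>x\<in>{0..l}. norm (sol 0 (c j) x) \<le> B" using sol_bounded[of 0 "c j"] by (elim exE)
  have l0: "l \<in> {0..l}" using l by simp
  let ?R = "\<lambda>\<mu>. integral {0..l} (\<lambda>x. cross (remainder i \<mu> x) (k j x))"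
  let ?n = "norm (K j l)"
  show ?thesis
  proof (intro exI[of _ "l * (2 * (Ci * B)) + 2 * (Ci * (?n + Cj)) + \<bar>\<tau>\<bar> * (Ci * Cj)"] allI impI)
    fix \<mu> :: real assume \<mu>: "\<bar>\<mu>\<bar> \<le> 1"
    note ri = Ci(2)[rule_format, OF \<mu>] and rj = Cj(2)[rule_format, OF \<mu>]
    have cube: "\<bar>\<mu>\<bar> ^ 3 = \<bar>\<mu>\<bar> * \<mu>\<^sup>2" by (simp add: power3_eq_cube power2_eq_square)
    have sq: "\<mu>\<^sup>2 \<le> \<bar>\<mu>\<bar>" using \<mu> mult_left_le[of "\<bar>\<mu>\<bar>" "\<bar>\<mu>\<bar>"] by (simp add: power2_eq_square)
    have fi: "norm (fst (F i \<mu> l)) \<le> Ci * \<mu>\<^sup>2" and fj: "norm (fst (F j \<mu> l)) \<le> Cj * \<mu>\<^sup>2"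
      unfolding fst_F_l[OF i] fst_F_l[OF j]
      by (rule order_trans[OF abs_components_le(5) ri[OF l0]] order_trans[OF abs_components_le(5) rj[OF l0]])+
    have "robin_form \<tau> (\<kappa> \<mu> i) (\<kappa> \<mu> j) = - pairing (F i \<mu> l) (F j \<mu> l) - \<tau> * inner (fst (F i \<mu> l)) (fst (F j \<mu> l))"
      unfolding robin_form_trace using c0[OF i] K0[OF i] by (simp add: pairing_zero_left)
    also have "pairing (F i \<mu> l) (F j \<mu> l) = pairing (F i \<mu> l) (k j l) + pairing (F i \<mu> l) (F j \<mu> l - k j l)"
      by (simp add: pairing_add_right[symmetric])
    also have "pairing (F i \<mu> l) (k j l) = \<mu>\<^sup>2 * second_form i j + \<mu> * ?R \<mu>"
      unfolding pairing_kernel[OF i j] by (simp add: algebra_simps power2_eq_square)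
    finally have eq: "robin_form \<tau> (\<kappa> \<mu> i) (\<kappa> \<mu> j) + \<mu>\<^sup>2 * second_form i j
        = - (\<mu> * ?R \<mu>) - pairing (F i \<mu> l) (F j \<mu> l - k j l) - \<tau> * inner (fst (F i \<mu> l)) (fst (F j \<mu> l))"
      by simp
    have "norm (?R \<mu>) \<le> (2 * (Ci * \<mu>\<^sup>2 * B)) * (l - 0)"
    proof (rule integral_bound)
      show "continuous_on {0..l} (\<lambda>x. cross (remainder i \<mu> x) (k j x))"
        unfolding remainder_def F_def by (intro cross_cont continuous_intros sol_cont K_cont i)
      fix x assume x: "x \<in> {0..l}"
      have "norm (remainder i \<mu> x) * norm (k j x) \<le> (Ci * \<mu>\<^sup>2) * B"
        by (rule mult_mono[OF ri[OF x] B[rule_format, OF x]]) (use Ci(1) in auto)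
      then show "norm (cross (remainder i \<mu> x) (k j x)) \<le> 2 * (Ci * \<mu>\<^sup>2 * B)"
        using abs_cross_le[of "remainder i \<mu> x" "k j x"] by simp
    qed (use l in simp)
    then have "\<bar>\<mu>\<bar> * norm (?R \<mu>) \<le> \<bar>\<mu>\<bar> * ((2 * (Ci * \<mu>\<^sup>2 * B)) * (l - 0))" by (rule mult_left_mono) simp
    then have 1: "\<bar>\<mu> * ?R \<mu>\<bar> \<le> l * (2 * (Ci * B)) * \<bar>\<mu>\<bar> ^ 3" by (simp add: abs_mult cube mult_ac)
    have "norm (F j \<mu> l - k j l) \<le> \<bar>\<mu>\<bar> * ?n + Cj * \<mu>\<^sup>2"
      using norm_triangle_ineq[of "\<mu> *\<^sub>R K j l" "remainder j \<mu> l"] rj[OF l0] by (simp add: remainder_def)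
    also have "\<dots> \<le> \<bar>\<mu>\<bar> * (?n + Cj)"
      using mult_left_mono[OF sq Cj(1)] by (simp add: algebra_simps)
    finally have "norm (fst (F i \<mu> l)) * norm (F j \<mu> l - k j l) \<le> (Ci * \<mu>\<^sup>2) * (\<bar>\<mu>\<bar> * (?n + Cj))"
      by (intro mult_mono fi) (use Ci(1) in auto)
    also have "\<dots> = Ci * (?n + Cj) * \<bar>\<mu>\<bar> ^ 3" by (simp add: cube mult_ac)
    finally have 2: "\<bar>pairing (F i \<mu> l) (F j \<mu> l - k j l)\<bar> \<le> 2 * (Ci * (?n + Cj)) * \<bar>\<mu>\<bar> ^ 3"
      using abs_pairing_le[of "F i \<mu> l" "F j \<mu> l - k j l"] by linarith
    have "\<bar>inner (fst (F i \<mu> l)) (fst (F j \<mu> l))\<bar> \<le> (Ci * \<mu>\<^sup>2) * (Cj * \<mu>\<^sup>2)"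
      by (rule order_trans[OF Cauchy_Schwarz_ineq2 mult_mono[OF fi fj]]) (use Ci(1) in auto)
    also have "\<dots> \<le> (Ci * \<mu>\<^sup>2) * (Cj * \<bar>\<mu>\<bar>)"
      by (intro mult_left_mono sq) (use Ci(1) Cj(1) in auto)
    finally have "\<bar>\<tau>\<bar> * \<bar>inner (fst (F i \<mu> l)) (fst (F j \<mu> l))\<bar> \<le> \<bar>\<tau>\<bar> * ((Ci * \<mu>\<^sup>2) * (Cj * \<bar>\<mu>\<bar>))"
      by (rule mult_left_mono) simp
    then have 3: "\<bar>\<tau> * inner (fst (F i \<mu> l)) (fst (F j \<mu> l))\<bar> \<le> \<bar>\<tau>\<bar> * (Ci * Cj) * \<bar>\<mu>\<bar> ^ 3"
      by (simp add: abs_mult cube mult_ac)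
    show "\<bar>robin_form \<tau> (\<kappa> \<mu> i) (\<kappa> \<mu> j) + \<mu>\<^sup>2 * second_form i j\<bar>
        \<le> (l * (2 * (Ci * B)) + 2 * (Ci * (?n + Cj)) + \<bar>\<tau>\<bar> * (Ci * Cj)) * \<bar>\<mu>\<bar> ^ 3"
      unfolding eq distrib_right using 1 2 3 by linarith
  qed
qed

text \<open>
  Perturbation result with scale \<open>\<mu>\<^sup>2\<close>.
\<close>

theorem index_eigenvalue_direction:
  assumes ch: "chart \<tau> (range (\<lambda>c. trace c (sol 0 c l)))"
    and off: "\<And>i j. i < N \<Longrightarrow> j < N \<Longrightarrow> i \<noteq> j \<Longrightarrow> second_form i j = 0"
    and diag: "\<And>i. i < N \<Longrightarrow> second_form i i \<noteq> 0"
  shows "\<forall>\<^sub>F \<mu> in at_right 0. robin_index \<tau> (range (\<lambda>c. trace c (sol \<mu> c l))) =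
    robin_index \<tau> (range (\<lambda>c. trace c (sol 0 c l))) + card {i\<in>{..<N}. - second_form i i < 0}"
proof -
  have l0: "l \<in> {0..l}" using l by simp
  have small1: "\<forall>\<^sub>F \<mu> in at_right (0::real). \<bar>\<mu>\<bar> \<le> 1 \<and> 0 < \<mu>"
  proof -
    have "\<forall>\<^sub>F \<mu> in at_right (0::real). \<mu> \<in> {0<..<1}" by (rule eventually_at_right_real) simp
    then show ?thesis by eventually_elim auto
  qed
  have id0: "((\<lambda>\<mu>. \<bar>\<mu>\<bar>) \<longlongrightarrow> 0) (at_right (0::real))"
    by (rule tendsto_rabs_zero) (rule tendsto_ident_at)
  have "\<forall>\<^sub>F \<mu> in at_right 0. robin_index \<tau> (range (\<lambda>c. trace c (sol \<mu> c l))) =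
    robin_index \<tau> (range (\<lambda>c. trace c (sol 0 c l))) + card {i\<in>{..<N}. - second_form i i < 0}
     \<and> range (\<lambda>c. trace c (sol \<mu> c l)) \<inter> {0} \<times> UNIV = {0}"
  proof (rule robin_index_perturb[where \<kappa> = \<kappa> and \<rho> = "\<lambda>\<mu>. \<mu>\<^sup>2", OF solution_range_Lagr(1)[OF l0] ch])
    show "\<forall>\<^sub>F \<mu> in at_right 0. range (\<lambda>c. trace c (sol \<mu> c l)) \<in> Lagr"
      by (simp add: solution_range_Lagr(1)[OF l0])
    show "\<exists>\<beta>. (\<beta> \<longlongrightarrow> b) (at_right 0) \<and> (\<forall>\<^sub>F \<mu> in at_right 0. \<beta> \<mu> \<in> range (\<lambda>c. trace c (sol \<mu> c l)))"
      if "b \<in> range (\<lambda>c. trace c (sol 0 c l))" for b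
    proof -
      from that obtain d where b: "b = trace d (sol 0 d l)" by (rule imageE)
      have "((\<lambda>\<mu>. trace d (sol \<mu> d l)) \<longlongrightarrow> b) (at_right 0)"
        unfolding b by (intro tendsto_trace tendsto_const sol_param_tendsto l0)
      then show ?thesis by (intro exI[of _ "\<lambda>\<mu>. trace d (sol \<mu> d l)"]) simp
    qed
    show "finite {..<N}" "card {..<N} = dim (range (\<lambda>c. trace c (sol 0 c l)) \<inter> {0} \<times> UNIV)"
      using dimN by simp_all
    show "\<forall>\<^sub>F \<mu> in at_right 0. \<kappa> \<mu> i \<in> range (\<lambda>c. trace c (sol \<mu> c l))" for i
      unfolding F_def by (intro always_eventually allI rangeI)
    show "\<forall>\<^sub>F \<mu> in at_right 0. 0 < (\<mu>::real)\<^sup>2" using small1 by eventually_elim simp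
    show "- second_form i i \<noteq> 0" if "i \<in> {..<N}" for i using diag that by simp
    show "((\<lambda>\<mu>. fst (\<kappa> \<mu> i) /\<^sub>R sqrt (\<mu>\<^sup>2)) \<longlongrightarrow> 0) (at_right 0)" if "i \<in> {..<N}" for i
    proof -
      have i: "i < N" using that by simp
      obtain C where C: "0 \<le> C" "\<forall>\<mu> x. \<bar>\<mu>\<bar> \<le> 1 \<longrightarrow> x \<in> {0..l} \<longrightarrow> norm (remainder i \<mu> x) \<le> C * \<mu>\<^sup>2"
        using remainder_bound[OF i] by (elim exE conjE)
      show ?thesis
      proof (rule Lim_null_comparison)
        show "\<forall>\<^sub>F \<mu> in at_right 0. norm (fst (\<kappa> \<mu> i) /\<^sub>R sqrt (\<mu>\<^sup>2)) \<le> C * \<bar>\<mu>\<bar>"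
          using small1
        proof eventually_elim
          case (elim \<mu>)
          have "norm (fst (\<kappa> \<mu> i)) \<le> C * \<mu>\<^sup>2"
            using order_trans[OF abs_components_le(5) C(2)[rule_format, OF conjunct1[OF elim] l0]] c0[OF i] K0[OF i]
            by (simp add: norm_fst_trace fst_F_l[OF i])
          then have "norm (fst (\<kappa> \<mu> i)) / \<mu> \<le> C * \<mu>\<^sup>2 / \<mu>" using elim by (intro divide_right_mono) auto
          then show ?case using elim by (simp add: divide_inverse power2_eq_square mult_ac)
        qed
        show "((\<lambda>\<mu>. C * \<bar>\<mu>\<bar>) \<longlongrightarrow> 0) (at_right 0)" using tendsto_mult_right_zero[OF id0] .
      qed
    qed
    show "((\<lambda>\<mu>. robin_form \<tau> (\<kappa> \<mu> i) (\<kappa> \<mu> j) / \<mu>\<^sup>2) \<longlongrightarrow> (if i = j then - second_form i i else 0)) (at_right 0)"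
      if "i \<in> {..<N}" "j \<in> {..<N}" for i j
    proof -
      have i: "i < N" and j: "j < N" using that by simp_all
      obtain D where D: "\<forall>\<mu>. \<bar>\<mu>\<bar> \<le> 1 \<longrightarrow> \<bar>robin_form \<tau> (\<kappa> \<mu> i) (\<kappa> \<mu> j) + \<mu>\<^sup>2 * second_form i j\<bar> \<le> D * \<bar>\<mu>\<bar> ^ 3"
        using robin_form_expansion[OF i j, of \<tau>] by (elim exE)
      have e: "(if i = j then - second_form i i else 0) = - second_form i j" using off[OF i j] by simp
      show ?thesis unfolding e
      proof (rule LIM_zero_cancel, rule Lim_null_comparison)
        show "\<forall>\<^sub>F \<mu> in at_right 0. norm (robin_form \<tau> (\<kappa> \<mu> i) (\<kappa> \<mu> j) / \<mu>\<^sup>2 - - second_form i j) \<le> D * \<bar>\<mu>\<bar>"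
          using small1
        proof eventually_elim
          case (elim \<mu>)
          have q: "robin_form \<tau> (\<kappa> \<mu> i) (\<kappa> \<mu> j) / \<mu>\<^sup>2 - - second_form i j
              = (robin_form \<tau> (\<kappa> \<mu> i) (\<kappa> \<mu> j) + \<mu>\<^sup>2 * second_form i j) / \<mu>\<^sup>2"
            unfolding add_divide_distrib using elim by simp
          have "norm (robin_form \<tau> (\<kappa> \<mu> i) (\<kappa> \<mu> j) / \<mu>\<^sup>2 - - second_form i j)
              = \<bar>robin_form \<tau> (\<kappa> \<mu> i) (\<kappa> \<mu> j) + \<mu>\<^sup>2 * second_form i j\<bar> / \<mu>\<^sup>2"
            unfolding q real_norm_def abs_divide abs_power2 ..
          also have "\<dots> \<le> D * \<bar>\<mu>\<bar> ^ 3 / \<mu>\<^sup>2" by (rule divide_right_mono[OF D[rule_format, OF conjunct1[OF elim]]]) simp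
          also have "\<dots> = D * \<bar>\<mu>\<bar>" using elim by (simp add: power3_eq_cube power2_eq_square)
          finally show ?case .
        qed
        show "((\<lambda>\<mu>. D * \<bar>\<mu>\<bar>) \<longlongrightarrow> 0) (at_right 0)" using tendsto_mult_right_zero[OF id0] .
      qed
    qed
  qed
  then show ?thesis by (rule eventually_mono) simp
qed

lemma scaled_endpoint:
  "((\<lambda>s. sol \<mu> d (s * l)) has_vector_derivative l *\<^sub>R field g h \<mu> l (sol \<mu> d l)) (at_left 1)"
proof -
  have im: "(\<lambda>s. s * l) ` {0..1} \<subseteq> {0..l}"
    using l by (auto intro: mult_left_le_one_le)
  have "((\<lambda>s. s * l) has_vector_derivative l) (at 1 within {0..1})"
    by (auto intro!: derivative_eq_intros simp: has_real_derivative_iff_has_vector_derivative[symmetric])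
  moreover have "(sol \<mu> d has_vector_derivative field g h \<mu> l (sol \<mu> d l)) (at (1 * l) within (\<lambda>s. s * l) ` {0..1})"
    using has_vector_derivative_within_subset[OF sol(2)[of l \<mu> d] im] l by simp
  ultimately have "(sol \<mu> d \<circ> (\<lambda>s. s * l) has_vector_derivative l *\<^sub>R field g h \<mu> l (sol \<mu> d l)) (at 1 within {0..1})"
    by (rule vector_diff_chain_within)
  then show ?thesis by (simp add: o_def at_within_Icc_at_left)
qed

lemma scaled_endpoint_tendsto: "((\<lambda>s. sol \<mu> d (s * l)) \<longlongrightarrow> sol \<mu> d l) (at_left 1)"
  using has_vector_derivative_continuous[OF scaled_endpoint[of \<mu> d]] by (simp add: continuous_within)

text \<open>
  The first components of \<open>k i\<close> vanish at \<open>l\<close>.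
\<close>

lemma kernel_quotient:
  assumes i: "i < N"
  shows "((\<lambda>s. fst (k i (s * l)) /\<^sub>R (1 - s)) \<longlongrightarrow> - (l *\<^sub>R snd (k i l))) (at_left 1)"
proof -
  have "((\<lambda>s. fst (k i (s * l))) has_vector_derivative l *\<^sub>R snd (k i l)) (at_left 1)"
    using bounded_linear.has_vector_derivative[OF bounded_linear_fst scaled_endpoint[of 0 "c i"]]
    by (simp add: field_def)
  then have "((\<lambda>s. (fst (k i (s * l)) - fst (k i (1 * l))) /\<^sub>R (s - 1)) \<longlongrightarrow> l *\<^sub>R snd (k i l)) (at_left 1)"
    by (rule has_vector_derivative_quotient)
  from tendsto_minus[OF this] show ?thesis
    by (rule Lim_transform_eventually)
      (simp add: cl[OF i] scaleR_minus_left[symmetric] inverse_minus_eq[symmetric] del: scaleR_minus_left inverse_minus_eq)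
qed

text \<open>
  The pairing of the derivatives at \<open>l\<close>, \<open>u\<^sub>i' u\<^sub>j' - v\<^sub>i' v\<^sub>j'\<close>.
\<close>

definition slope_form :: "nat \<Rightarrow> nat \<Rightarrow> real" where
  "slope_form i j = pairing (snd (k i l), 0) (k j l)"

text \<open>
  Perturbation result with scale \<open>1 - s\<close>: close to the end point the values of the kernel functions are
  \<open>- (1 - s) * l\<close> times their slopes at \<open>l\<close>.
\<close>

theorem index_scaling_direction:
  assumes ch: "chart \<tau> (range (\<lambda>c. trace c (sol 0 c l)))"
    and off: "\<And>i j. i < N \<Longrightarrow> j < N \<Longrightarrow> i \<noteq> j \<Longrightarrow> slope_form i j = 0"
    and diag: "\<And>i. i < N \<Longrightarrow> slope_form i i \<noteq> 0"
  shows "\<forall>\<^sub>F s in at_left 1. robin_index \<tau> (range (\<lambda>c. trace c (sol 0 c (s * l)))) =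
    robin_index \<tau> (range (\<lambda>c. trace c (sol 0 c l))) + card {i\<in>{..<N}. l * slope_form i i < 0}"
proof -
  let ?\<kappa> = "\<lambda>s i. trace (c i) (k i (s * l))"
  let ?q = "\<lambda>s i. fst (k i (s * l)) /\<^sub>R (1 - s)"
  have l0: "l \<in> {0..l}" using l by simp
  have near: "\<forall>\<^sub>F s in at_left (1::real). s \<in> {0<..<1}" by (rule eventually_at_left_real) simp
  have sl: "s * l \<in> {0..l}" if "s \<in> {0<..<1}" for s using that l by (auto intro: mult_left_le_one_le)
  have sq0: "((\<lambda>s. sqrt (1 - s)) \<longlongrightarrow> 0) (at_left 1)"
    using tendsto_real_sqrt[OF tendsto_diff[OF tendsto_const[of 1] tendsto_ident_at[of 1 "{..<1}"]]] by simp
  have "\<forall>\<^sub>F s in at_left 1. robin_index \<tau> (range (\<lambda>c. trace c (sol 0 c (s * l)))) =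
    robin_index \<tau> (range (\<lambda>c. trace c (sol 0 c l))) + card {i\<in>{..<N}. l * slope_form i i < 0}
     \<and> range (\<lambda>c. trace c (sol 0 c (s * l))) \<inter> {0} \<times> UNIV = {0}"
  proof (rule robin_index_perturb[where \<kappa> = ?\<kappa> and \<rho> = "\<lambda>s. 1 - s", OF solution_range_Lagr(1)[OF l0] ch])
    show "\<forall>\<^sub>F s in at_left 1. range (\<lambda>c. trace c (sol 0 c (s * l))) \<in> Lagr"
      using near by eventually_elim (rule solution_range_Lagr(1), rule sl)
    show "\<exists>\<beta>. (\<beta> \<longlongrightarrow> b) (at_left 1) \<and> (\<forall>\<^sub>F s in at_left 1. \<beta> s \<in> range (\<lambda>c. trace c (sol 0 c (s * l))))"
      if "b \<in> range (\<lambda>c. trace c (sol 0 c l))" for b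
    proof -
      from that obtain d where b: "b = trace d (sol 0 d l)" by (rule imageE)
      have "((\<lambda>s. trace d (sol 0 d (s * l))) \<longlongrightarrow> b) (at_left 1)"
        unfolding b by (intro tendsto_trace tendsto_const scaled_endpoint_tendsto)
      then show ?thesis by (intro exI[of _ "\<lambda>s. trace d (sol 0 d (s * l))"]) simp
    qed
    show "finite {..<N}" "card {..<N} = dim (range (\<lambda>c. trace c (sol 0 c l)) \<inter> {0} \<times> UNIV)"
      using dimN by simp_all
    show "\<forall>\<^sub>F s in at_left 1. ?\<kappa> s i \<in> range (\<lambda>c. trace c (sol 0 c (s * l)))" for i
      by (intro always_eventually allI rangeI)
    show "\<forall>\<^sub>F s in at_left 1. 0 < 1 - (s::real)" using near by eventually_elim simp
    show "l * slope_form i i \<noteq> 0" if "i \<in> {..<N}" for i using diag that l by simp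
    show "((\<lambda>s. fst (?\<kappa> s i) /\<^sub>R sqrt (1 - s)) \<longlongrightarrow> 0) (at_left 1)" if "i \<in> {..<N}" for i
    proof (rule tendsto_norm_zero_cancel)
      have i: "i < N" using that by simp
      have "((\<lambda>s. sqrt (1 - s) * norm (?q s i)) \<longlongrightarrow> 0 * norm (- (l *\<^sub>R snd (k i l)))) (at_left 1)"
        by (intro tendsto_mult sq0 tendsto_norm kernel_quotient i)
      then have "((\<lambda>s. sqrt (1 - s) * norm (?q s i)) \<longlongrightarrow> 0) (at_left 1)" by simp
      then show "((\<lambda>s. norm (fst (?\<kappa> s i) /\<^sub>R sqrt (1 - s))) \<longlongrightarrow> 0) (at_left 1)"
      proof (rule Lim_transform_eventually)
        show "\<forall>\<^sub>F s in at_left 1. sqrt (1 - s) * norm (?q s i) = norm (fst (?\<kappa> s i) /\<^sub>R sqrt (1 - s))"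
          using near
        proof eventually_elim
          case (elim s)
          have "sqrt (1 - s) * inverse (1 - s) = inverse (sqrt (1 - s))"
            using sqrt_divide_self_eq[of "1 - s"] elim by (simp add: divide_inverse)
          then show ?case using elim c0[OF i] by (simp add: norm_fst_trace mult.assoc[symmetric])
        qed
      qed
    qed
    show "((\<lambda>s. robin_form \<tau> (?\<kappa> s i) (?\<kappa> s j) / (1 - s)) \<longlongrightarrow> (if i = j then l * slope_form i i else 0)) (at_left 1)"
      if "i \<in> {..<N}" "j \<in> {..<N}" for i j
    proof -
      have i: "i < N" and j: "j < N" using that by simp_all
      have e: "(if i = j then l * slope_form i i else 0) = l * slope_form i j" using off[OF i j] by simp
      let ?f = "\<lambda>s. - pairing (?q s i, 0) (k j (s * l)) - \<tau> * inner (?q s i) (fst (k j (s * l)))"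
      have "(?f \<longlongrightarrow> - pairing (- (l *\<^sub>R snd (k i l)), 0) (k j l) - \<tau> * inner (- (l *\<^sub>R snd (k i l))) (fst (k j l))) (at_left 1)"
        unfolding pairing_def fst_conv snd_conv
        by (intro tendsto_intros kernel_quotient scaled_endpoint_tendsto i)
      also have "- pairing (- (l *\<^sub>R snd (k i l)), 0) (k j l) - \<tau> * inner (- (l *\<^sub>R snd (k i l))) (fst (k j l)) = l * slope_form i j"
        using cl[OF j] by (simp add: slope_form_def pairing_def algebra_simps)
      finally show ?thesis unfolding e
      proof (rule Lim_transform_eventually)
        show "\<forall>\<^sub>F s in at_left 1. ?f s = robin_form \<tau> (?\<kappa> s i) (?\<kappa> s j) / (1 - s)"
          using near
        proof eventually_elim
          case (elim s)
          then show ?case unfolding robin_form_trace using c0[OF i]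
            by (simp add: pairing_zero_left) (simp add: pairing_def divide_inverse algebra_simps)
        qed
      qed
    qed
  qed
  then show ?thesis by (rule eventually_mono) simp
qed

text \<open>
  One chart at the corner serves both paths when \<open>\<epsilon>\<close> is small. The index at the corner cancels,
  since the first path ends and the second path begins there.
\<close>

theorem Mas_sum:
  assumes slope: "\<And>i j. i < N \<Longrightarrow> j < N \<Longrightarrow> i \<noteq> j \<Longrightarrow> slope_form i j = 0" "\<And>i. i < N \<Longrightarrow> slope_form i i \<noteq> 0"
    and second: "\<And>i j. i < N \<Longrightarrow> j < N \<Longrightarrow> i \<noteq> j \<Longrightarrow> second_form i j = 0" "\<And>i. i < N \<Longrightarrow> second_form i i \<noteq> 0"
  shows "\<forall>\<^sub>F \<epsilon> in at_right 0. Mas (\<lambda>s. Lam l g h 0 s) vertical (1 - \<epsilon>) 1 + Mas (\<lambda>\<mu>. Lam l g h \<mu> 1) vertical 0 \<epsilon>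
    = int (card {i\<in>{..<N}. l * slope_form i i < 0}) - int (card {i\<in>{..<N}. - second_form i i < 0})"
proof -
  let ?T = "\<lambda>\<mu> s c. trace c (sol \<mu> c (s * l))"
  let ?V = "range (?T 0 1)"
  let ?a = "card {i\<in>{..<N}. l * slope_form i i < 0}" and ?b = "card {i\<in>{..<N}. - second_form i i < 0}"
  have sl: "s * l \<in> {0..l}" if "0 < s" "s \<le> 1" for s using that l by (auto intro: mult_left_le_one_le)
  have VL: "?V \<in> Lagr" by (rule solution_range_Lagr(1)) (use l in simp)
  obtain \<tau> where \<tau>: "chart \<tau> ?V" using chart_exists[OF VL] .
  note T = solution_range_Lagr[OF sl]
  have near: "\<forall>\<^sub>F s in at_left (1::real). s \<in> {0<..<1}" by (rule eventually_at_left_real) simp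
  have "lagr_tendsto (\<lambda>s. range (?T 0 s)) ?V (at_left 1)"
    unfolding lagr_tendsto_def
  proof (intro conjI allI VL closest_point_range_tendsto)
    show "\<forall>\<^sub>F s in at_left 1. range (?T 0 s) \<in> Lagr" using near by eventually_elim (rule T(1), auto)
    show "\<forall>\<^sub>F s in at_left 1. linear (?T 0 s)" using near by eventually_elim (rule T(2), auto)
    show "linear (?T 0 1)" "inj (?T 0 1)" by (rule T; simp)+
    show "((\<lambda>s. ?T 0 s w) \<longlongrightarrow> ?T 0 1 w) (at_left 1)" for w
      unfolding mult_1 by (intro tendsto_trace tendsto_const scaled_endpoint_tendsto)
  qed
  from eventually_conj[OF eventually_chart[OF this \<tau>] index_scaling_direction[OF \<tau>[unfolded mult_1] slope]]
  have "\<exists>b<1. \<forall>s>b. s < 1 \<longrightarrow> chart \<tau> (range (?T 0 s)) \<and> robin_index \<tau> (range (?T 0 s)) = robin_index \<tau> ?V + ?a"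
    unfolding eventually_at_left_field mult_1 .
  then obtain b where b: "b < 1" "\<And>s. b < s \<Longrightarrow> s < 1 \<Longrightarrow> chart \<tau> (range (?T 0 s))"
    "\<And>s. b < s \<Longrightarrow> s < 1 \<Longrightarrow> robin_index \<tau> (range (?T 0 s)) = robin_index \<tau> ?V + ?a" by blast
  have "lagr_tendsto (\<lambda>\<mu>. range (?T \<mu> 1)) ?V (at_right 0)"
    unfolding lagr_tendsto_def
  proof (intro conjI allI VL closest_point_range_tendsto)
    show "\<forall>\<^sub>F \<mu> in at_right 0. range (?T \<mu> 1) \<in> Lagr" by (intro always_eventually allI T(1)) auto
    show "\<forall>\<^sub>F \<mu> in at_right 0. linear (?T \<mu> 1)" by (intro always_eventually allI T(2)) auto
    show "linear (?T 0 1)" "inj (?T 0 1)" by (rule T; simp)+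
    show "((\<lambda>\<mu>. ?T \<mu> 1 w) \<longlongrightarrow> ?T 0 1 w) (at_right 0)" for w
      by (intro tendsto_trace tendsto_const sol_param_tendsto sl) auto
  qed
  from eventually_conj[OF eventually_chart[OF this \<tau>] index_eigenvalue_direction[OF \<tau>[unfolded mult_1] second]]
  have "\<exists>b>0. \<forall>\<mu>>0. \<mu> < b \<longrightarrow> chart \<tau> (range (?T \<mu> 1)) \<and> robin_index \<tau> (range (?T \<mu> 1)) = robin_index \<tau> ?V + ?b"
    unfolding eventually_at_right_field mult_1 .
  then obtain d where d: "d > 0" "\<And>\<mu>. 0 < \<mu> \<Longrightarrow> \<mu> < d \<Longrightarrow> chart \<tau> (range (?T \<mu> 1))"
    "\<And>\<mu>. 0 < \<mu> \<Longrightarrow> \<mu> < d \<Longrightarrow> robin_index \<tau> (range (?T \<mu> 1)) = robin_index \<tau> ?V + ?b" by blast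
  have cong: "cont_family A (\<lambda>t. Lam l g h (\<mu> t) (s t))"
    if "cont_family A (\<lambda>t. range (?T (\<mu> t) (s t)))" "\<And>t. t \<in> A \<Longrightarrow> 0 < s t \<and> s t \<le> 1" for A :: "real set" and \<mu> s
  proof -
    have e: "Lam l g h (\<mu> t) (s t) = range (?T (\<mu> t) (s t))" if "t \<in> A" for t
      using Lam_eq \<open>\<And>t. t \<in> A \<Longrightarrow> 0 < s t \<and> s t \<le> 1\<close>[OF that] by blast
    show ?thesis using that(1) unfolding cont_family_def
      by (simp add: e cong: continuous_on_cong)
  qed
  have "\<forall>\<^sub>F \<epsilon> in at_right 0. \<epsilon> \<in> {0<..<min (min (1 - b) d) 1}"
    by (rule eventually_at_right_real) (use b(1) d(1) in simp)
  then show ?thesis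
  proof eventually_elim
    case (elim \<epsilon>)
    then have \<epsilon>: "0 < \<epsilon>" "\<epsilon> < 1 - b" "\<epsilon> < d" "\<epsilon> < 1" by simp_all
    have "Mas (\<lambda>s. Lam l g h 0 s) vertical (1 - \<epsilon>) 1
        = int (robin_index \<tau> (Lam l g h 0 (1 - \<epsilon>))) - int (robin_index \<tau> (Lam l g h 0 1))"
    proof (rule Mas_chart_path)
      have "cont_family {1 - \<epsilon>..1} (\<lambda>s. range (?T 0 s))"
      proof (rule cont_family_range)
        show "linear (?T 0 s)" "inj (?T 0 s)" "range (?T 0 s) \<in> Lagr" if "s \<in> {1 - \<epsilon>..1}" for s
          by (rule T; use that \<epsilon> in simp)+
        fix w
        have "continuous_on {1 - \<epsilon>..1} (\<lambda>s. sol 0 w (s * l))"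
        proof (rule continuous_on_compose2[OF sol_cont])
          show "continuous_on {1 - \<epsilon>..1} (\<lambda>s. s * l)" by (intro continuous_intros)
          have "s * l \<in> {0..l}" if "s \<in> {1 - \<epsilon>..1}" for s by (rule sl) (use that \<epsilon> in simp_all)
          then show "(\<lambda>s. s * l) ` {1 - \<epsilon>..1} \<subseteq> {0..l}" by blast
        qed
        then show "continuous_on {1 - \<epsilon>..1} (\<lambda>s. ?T 0 s w)"
          unfolding continuous_on_def by (intro ballI tendsto_trace tendsto_const) blast
      qed
      from cong[OF this] show "cont_family {1 - \<epsilon>..1} (\<lambda>s. Lam l g h 0 s)" using \<epsilon> by simp
      show "1 - \<epsilon> < 1" using \<epsilon> by simp
      show "chart \<tau> (Lam l g h 0 s)" if "s \<in> {1 - \<epsilon>..1}" for s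
        using that \<epsilon> b(2)[of s] \<tau> Lam_eq[of s 0] by (cases "s = 1") auto
    qed
    also have "\<dots> = int ?a"
      using b(3)[of "1 - \<epsilon>"] Lam_eq[of "1 - \<epsilon>" 0] Lam_eq[of 1 0] \<epsilon> by simp
    finally have 1: "Mas (\<lambda>s. Lam l g h 0 s) vertical (1 - \<epsilon>) 1 = int ?a" .
    have "Mas (\<lambda>\<mu>. Lam l g h \<mu> 1) vertical 0 \<epsilon>
        = int (robin_index \<tau> (Lam l g h 0 1)) - int (robin_index \<tau> (Lam l g h \<epsilon> 1))"
    proof (rule Mas_chart_path)
      have "cont_family {0..\<epsilon>} (\<lambda>\<mu>. range (?T \<mu> 1))"
      proof (rule cont_family_range)
        show "linear (?T \<mu> 1)" "inj (?T \<mu> 1)" "range (?T \<mu> 1) \<in> Lagr" for \<mu> by (rule T; simp)+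
        show "continuous_on {0..\<epsilon>} (\<lambda>\<mu>. ?T \<mu> 1 w)" for w
          unfolding continuous_on_def by (intro ballI tendsto_trace tendsto_const sol_param_tendsto sl) auto
      qed
      from cong[OF this] show "cont_family {0..\<epsilon>} (\<lambda>\<mu>. Lam l g h \<mu> 1)" by simp
      show "0 < \<epsilon>" by fact
      show "chart \<tau> (Lam l g h \<mu> 1)" if "\<mu> \<in> {0..\<epsilon>}" for \<mu>
        using that \<epsilon> d(2)[of \<mu>] \<tau> Lam_eq[of 1 \<mu>] by (cases "\<mu> = 0") auto
    qed
    also have "\<dots> = - int ?b"
      using d(3)[of \<epsilon>] Lam_eq[of 1 \<epsilon>] Lam_eq[of 1 0] \<epsilon> by simp
    finally have 2: "Mas (\<lambda>\<mu>. Lam l g h \<mu> 1) vertical 0 \<epsilon> = - int ?b" .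
    show ?case unfolding 1 2 by simp
  qed
qed

end

section \<open>Boundary value problems in classical form\<close>

text \<open>
  Every solution with \<open>w 0 = 0\<close> is a multiple of the one with slope \<open>1\<close>. The scalar equation is embedded into the
  system with both potentials equal to \<open>V\<close>.
\<close>

lemma shooting:
  assumes l: "0 < l" and V: "continuous_on {0..l} V"
  shows "\<exists>\<phi> \<psi>. \<phi> 0 = 0 \<and> \<psi> 0 = 1 \<and>
    (\<forall>x\<in>{0..l}. (\<phi> has_real_derivative \<psi> x) (at x within {0..l})) \<and>
    (\<forall>x\<in>{0..l}. (\<psi> has_real_derivative - V x * \<phi> x) (at x within {0..l})) \<and>
    (\<forall>w q. w 0 = 0 \<longrightarrow> (\<forall>x\<in>{0..l}. (w has_real_derivative q x) (at x within {0..l})) \<longrightarrow>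
      (\<forall>x\<in>{0..l}. (q has_real_derivative - V x * w x) (at x within {0..l})) \<longrightarrow>
      (\<forall>x\<in>{0..l}. w x = q 0 * \<phi> x \<and> q x = q 0 * \<psi> x))"
proof -
  interpret nls_system l V V by unfold_locales (use assms in auto)
  let ?e = "((0, 0), (1, 0)) :: state"
  note d = state_derivs[OF sol(2)[of _ 0 ?e]]
  show ?thesis
  proof (rule exI[of _ "\<lambda>x. fst (fst (sol 0 ?e x))"], rule exI[of _ "\<lambda>x. fst (snd (sol 0 ?e x))"],
      intro conjI ballI allI impI)
    show "fst (fst (sol 0 ?e 0)) = 0" "fst (snd (sol 0 ?e 0)) = 1" by (simp_all add: sol(1))
    fix x assume x: "x \<in> {0..l}"
    show "((\<lambda>x. fst (fst (sol 0 ?e x))) has_real_derivative fst (snd (sol 0 ?e x))) (at x within {0..l})"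
      using d(1)[OF x] by (simp add: field_def)
    show "((\<lambda>x. fst (snd (sol 0 ?e x))) has_real_derivative - V x * fst (fst (sol 0 ?e x))) (at x within {0..l})"
      using d(3)[OF x] by (simp add: field_def)
  next
    fix w q :: "real \<Rightarrow> real" and x
    assume w0: "w 0 = 0" and w: "\<forall>x\<in>{0..l}. (w has_real_derivative q x) (at x within {0..l})"
      and q: "\<forall>x\<in>{0..l}. (q has_real_derivative - V x * w x) (at x within {0..l})" and x: "x \<in> {0..l}"
    let ?Z = "\<lambda>x. ((w x, 0), (q x, 0)) :: state"
    have "?Z x = sol 0 (?Z 0) x"
    proof (rule sol_unique[OF _ x])
      fix y assume y: "y \<in> {0..l}"
      have "(?Z has_vector_derivative ((q y, 0), (- V y * w y, 0))) (at y within {0..l})"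
        by (intro state_derivI w[rule_format] q[rule_format] y DERIV_const)
      then show "(?Z has_vector_derivative field V V 0 y (?Z y)) (at y within {0..l})" by (simp add: field_def)
    qed
    also have "?Z 0 = q 0 *\<^sub>R ?e" using w0 by simp
    also have "sol 0 (q 0 *\<^sub>R ?e) x = q 0 *\<^sub>R sol 0 ?e x" by (rule linear_cmul[OF linear_sol[OF x]])
    finally have Z: "?Z x = q 0 *\<^sub>R sol 0 ?e x" .
    show "w x = q 0 * fst (fst (sol 0 ?e x))" using arg_cong[OF Z, of "\<lambda>z. fst (fst z)"] by simp
    show "q x = q 0 * fst (snd (sol 0 ?e x))" using arg_cong[OF Z, of "\<lambda>z. fst (snd z)"] by simp
  qed
qed

text \<open>
  All derivatives may be taken to be the pointwise ones, and the equation then holds at every point, not only almost everywhere.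
\<close>

lemma bvp_classical:
  assumes l: "0 < l" and V: "continuous_on {0..l} V" and f: "continuous_on {0..l} f"
    and w: "w \<in> H2_0 l" and eq: "AE x in lebesgue_on {0..l}. L_op l V 1 w x = f x" and x: "x \<in> {0..l}"
  shows "(w has_real_derivative Dx l w x) (at x within {0..l})"
    and "(Dx l w has_real_derivative - V x * w x - f x) (at x within {0..l})"
    and "L_op l V 1 w x = f x"
proof -
  have H: "w \<in> H2 l" using w by (simp add: H2_0_def)
  have c: "continuous_on {0..l} (\<lambda>x. - V x * w x - f x)"
    by (intro continuous_intros V f H2_continuous[OF l H])
  have "AE x in lebesgue_on {0..l}. Dx l (Dx l w) x = - V x * w x - f x"
    by (rule eventually_mono[OF eq]) (simp add: L_op_def)
  from H2_classical[OF l H c this] obtain p where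
    p: "\<forall>x\<in>{0..l}. (w has_real_derivative p x) (at x within {0..l})"
      "\<forall>x\<in>{0..l}. (p has_real_derivative - V x * w x - f x) (at x within {0..l})" by (elim exE conjE)
  have D: "Dx l w y = p y" if "y \<in> {0..l}" for y by (rule Dx_eqI[OF l that p(1)[rule_format, OF that]])
  show "(w has_real_derivative Dx l w x) (at x within {0..l})" using p(1) x D by simp
  show D2: "(Dx l w has_real_derivative - V x * w x - f x) (at x within {0..l})"
    by (rule has_real_derivative_cong[OF p(2)[rule_format, OF x] x D])
  show "L_op l V 1 w x = f x" using Dx_eqI[OF l x D2] by (simp add: L_op_def)
qed

lemma dim_real_le_1: "dim (A :: real set) \<le> 1"
  using dim_subset_UNIV[of A] by simp

lemma subspace_multiples_zero: "subspace {a :: real. a * r = 0}"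
  by (auto simp: subspace_def algebra_simps)

lemma L2_inner_eq_integral:
  assumes "continuous_on {0..l} f" "continuous_on {0..l} g"
  shows "L2_inner l f g = integral {0..l} (\<lambda>x. f x * g x)"
  unfolding L2_inner_def
proof (rule lebesgue_integral_eq_integral)
  have "continuous_on {0..l} (\<lambda>x. f x * g x)" by (intro continuous_intros assms)
  then show "integrable (lebesgue_on {0..l}) (\<lambda>x. f x * g x)"
    by (rule continuous_imp_integrable_real)
qed simp

text \<open>
  The characteristic polynomial is \<open>1\<close> or \<open>X - A\<^sub>0\<^sub>0\<close>.
\<close>

lemma n_neg_upper_triangular:
  assumes A: "A \<in> carrier_mat m m" "upper_triangular A" and m: "m \<le> 1"
  shows "n_neg A = card {i\<in>{..<m}. A $$ (i, i) < 0}"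
proof (cases "m = 0")
  case True
  have "char_poly A = 1" using char_poly_upper_triangular[OF A] A True by (simp add: diag_mat_def)
  then show ?thesis using True by (simp add: n_neg_def)
next
  case False
  with m have m1: "m = 1" by simp
  have "char_poly A = [:- (A $$ (0, 0)), 1:]" using char_poly_upper_triangular[OF A] A m1 by (simp add: diag_mat_def)
  moreover have "{i\<in>{..<m}. A $$ (i, i) < 0} = (if A $$ (0, 0) < 0 then {0} else {})" using m1 by auto
  ultimately show ?thesis by (simp add: n_neg_def)
qed

lemma continuous_on_C2:
  assumes "C2_on l f"
  shows "continuous_on {0..l} f"
  using assms unfolding C2_on_def by (metis DERIV_continuous_on)

section \<open>The kernels of the three operators\<close>

text \<open>
  Kernel functions vanish outside \<open>[0,l]\<close> by convention.
\<close>

definition profile :: "real \<Rightarrow> (real \<Rightarrow> real) \<Rightarrow> real \<Rightarrow> real" where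
  "profile l \<phi> x = (if x \<in> {0..l} then \<phi> x else 0)"

text \<open>
  The scalar solution \<open>\<phi>\<close> with \<open>\<phi>(0) = 0\<close> and unit slope, and its derivative \<open>\<psi>\<close>.
\<close>

locale shooting_data =
  fixes l :: real and V \<phi> \<psi> :: "real \<Rightarrow> real"
  assumes l: "0 < l" and cV: "continuous_on {0..l} V" and init: "\<phi> 0 = 0" "\<psi> 0 = 1"
    and \<phi>': "x \<in> {0..l} \<Longrightarrow> (\<phi> has_real_derivative \<psi> x) (at x within {0..l})"
    and \<psi>': "x \<in> {0..l} \<Longrightarrow> (\<psi> has_real_derivative - V x * \<phi> x) (at x within {0..l})"
    and unique: "w 0 = 0 \<Longrightarrow> (\<And>x. x \<in> {0..l} \<Longrightarrow> (w has_real_derivative q x) (at x within {0..l})) \<Longrightarrow>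
      (\<And>x. x \<in> {0..l} \<Longrightarrow> (q has_real_derivative - V x * w x) (at x within {0..l})) \<Longrightarrow>
      x \<in> {0..l} \<Longrightarrow> w x = q 0 * \<phi> x"
begin

definition slopes :: "real set" where "slopes = {a. a * \<phi> l = 0}"

lemma scaled_derivs:
  assumes "x \<in> {0..l}"
  shows "(rscale a (profile l \<phi>) has_real_derivative a * \<psi> x) (at x within {0..l})"
    and "((\<lambda>x. a * \<psi> x) has_real_derivative - V x * rscale a (profile l \<phi>) x) (at x within {0..l})"
proof -
  show "(rscale a (profile l \<phi>) has_real_derivative a * \<psi> x) (at x within {0..l})"
    by (rule has_real_derivative_cong[OF DERIV_cmult[OF \<phi>'[OF assms], of a] assms])
      (simp add: rscale_def profile_def)
  show "((\<lambda>x. a * \<psi> x) has_real_derivative - V x * rscale a (profile l \<phi>) x) (at x within {0..l})"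
    by (rule DERIV_cong[OF DERIV_cmult[OF \<psi>'[OF assms]]]) (use assms in \<open>simp add: rscale_def profile_def\<close>)
qed

lemma Dx_scaled: "x \<in> {0..l} \<Longrightarrow> Dx l (rscale a (profile l \<phi>)) x = a * \<psi> x"
  by (rule Dx_eqI[OF l _ scaled_derivs(1)])

lemma rscale_profile_inject: "rscale a (profile l \<phi>) = rscale b (profile l \<phi>) \<Longrightarrow> a = b"
proof -
  assume "rscale a (profile l \<phi>) = rscale b (profile l \<phi>)"
  then have "Dx l (rscale a (profile l \<phi>)) 0 = Dx l (rscale b (profile l \<phi>)) 0" by (rule arg_cong)
  then show "a = b" using l init by (simp add: Dx_scaled)
qed

text \<open>
  The shooting slopes \<open>a\<close> with \<open>a * \<phi> l = 0\<close> parametrise the kernel, which is thus at most one-dimensional.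
\<close>

lemma ker_L_eq: "ker_L l V = (\<lambda>a. rscale a (profile l \<phi>)) ` slopes"
proof (intro equalityI subsetI)
  fix w assume "w \<in> ker_L l V"
  then have w: "w \<in> H2_0 l" "AE x in lebesgue_on {0..l}. L_op l V 1 w x = 0"
    by (simp_all add: ker_L_def L2_eq_def)
  have w0: "w 0 = 0" "w l = 0" "\<And>x. x \<notin> {0..l} \<Longrightarrow> w x = 0" using w(1) by (simp_all add: H2_0_def H2_def)
  have u: "w x = Dx l w 0 * \<phi> x" if "x \<in> {0..l}" for x
    by (rule unique[where w = w and q = "Dx l w", OF w0(1) _ _ that]) (use bvp_classical[OF l cV continuous_on_const w] in simp_all)
  have "w = rscale (Dx l w 0) (profile l \<phi>)"
    using u w0(3) by (auto simp: rscale_def profile_def fun_eq_iff simp del: atLeastAtMost_iff)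
  moreover have "Dx l w 0 \<in> slopes" using u[of l] l w0(2) by (simp add: slopes_def)
  ultimately show "w \<in> (\<lambda>a. rscale a (profile l \<phi>)) ` slopes" by blast
next
  fix w assume "w \<in> (\<lambda>a. rscale a (profile l \<phi>)) ` slopes"
  then obtain a where a: "w = rscale a (profile l \<phi>)" "a * \<phi> l = 0" by (auto simp: slopes_def)
  note d = scaled_derivs[where a = a, folded a(1)]
  have c: "continuous_on {0..l} (\<lambda>x. - V x * w x)"
    by (intro continuous_intros cV DERIV_continuous_on[OF d(1)])
  have out: "x \<notin> {0..l} \<Longrightarrow> w x = 0" for x unfolding a by (simp only: rscale_def profile_def if_False mult_zero_right)
  note cH = classical_H2[OF l d(1) d(2) c out]
  have "w \<in> H2_0 l" using cH(1) a l init by (simp add: H2_0_def rscale_def profile_def)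
  moreover have "AE x in lebesgue_on {0..l}. L_op l V 1 w x = (0 :: rfun) x"
    by (rule AE_I2) (use cH(3) in \<open>simp add: L_op_def\<close>)
  ultimately show "w \<in> ker_L l V" by (simp add: ker_L_def L2_eq_def)
qed

end

lemma shooting_data_exists:
  assumes l: "0 < l" and V: "continuous_on {0..l} V"
  shows "\<exists>\<phi> \<psi>. shooting_data l V \<phi> \<psi>"
proof -
  obtain \<phi> \<psi> where P: "\<phi> 0 = 0" "\<psi> 0 = 1"
    "\<forall>x\<in>{0..l}. (\<phi> has_real_derivative \<psi> x) (at x within {0..l})"
    "\<forall>x\<in>{0..l}. (\<psi> has_real_derivative - V x * \<phi> x) (at x within {0..l})"
    "\<forall>w q. w 0 = 0 \<longrightarrow> (\<forall>x\<in>{0..l}. (w has_real_derivative q x) (at x within {0..l})) \<longrightarrow>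
      (\<forall>x\<in>{0..l}. (q has_real_derivative - V x * w x) (at x within {0..l})) \<longrightarrow>
      (\<forall>x\<in>{0..l}. w x = q 0 * \<phi> x \<and> q x = q 0 * \<psi> x)"
    using shooting[OF l V] by (elim exE conjE)
  have "shooting_data l V \<phi> \<psi>"
  proof
    show "w x = q 0 * \<phi> x" if "w 0 = 0" "\<And>x. x \<in> {0..l} \<Longrightarrow> (w has_real_derivative q x) (at x within {0..l})"
      "\<And>x. x \<in> {0..l} \<Longrightarrow> (q has_real_derivative - V x * w x) (at x within {0..l})" "x \<in> {0..l}" for w q x
      using P(5)[rule_format, of w q x] that by blast
  qed (use l V P in simp_all)
  then show ?thesis by blast
qed

locale kernel_profiles = nls_system l g h + G: shooting_data l g \<phi> \<psi> + H: shooting_data l h \<alpha> \<beta>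
  for l g h \<phi> \<psi> \<alpha> \<beta>
begin

text \<open>
  At spectral parameter \<open>0\<close> the system decouples.
\<close>

lemma sol_kernel:
  assumes x: "x \<in> {0..l}"
  shows "sol 0 ((0, 0), (a, b)) x = ((a * \<phi> x, b * \<alpha> x), (a * \<psi> x, b * \<beta> x))"
proof -
  let ?Z = "\<lambda>x. ((a * \<phi> x, b * \<alpha> x), (a * \<psi> x, b * \<beta> x))"
  have "?Z x = sol 0 (?Z 0) x"
  proof (rule sol_unique[OF _ x])
    fix y assume y: "y \<in> {0..l}"
    have "(?Z has_vector_derivative ((a * \<psi> y, b * \<beta> y), (a * (- g y * \<phi> y), b * (- h y * \<alpha> y)))) (at y within {0..l})"
      by (intro state_derivI DERIV_cmult G.\<phi>' G.\<psi>' H.\<phi>' H.\<psi>' y)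
    then show "(?Z has_vector_derivative field g h 0 y (?Z y)) (at y within {0..l})"
      by (simp add: field_def mult_ac)
  qed
  then show ?thesis by (simp add: G.init H.init)
qed

definition ker_map :: "real \<times> real \<Rightarrow> rfun \<times> rfun" where
  "ker_map ab = (rscale (fst ab) (profile l \<phi>), rscale (snd ab) (profile l \<alpha>))"

lemma ker_N_eq: "ker_N l g h = ker_map ` (G.slopes \<times> H.slopes)"
proof -
  have "ker_N l g h = ker_L l g \<times> ker_L l h"
    by (auto simp: ker_N_def ker_L_def dom_N_def L2_eq2_def L2_eq_def N_op_def)
  then show ?thesis unfolding G.ker_L_eq H.ker_L_eq by (auto simp: ker_map_def image_iff)
qed

lemma ker_map_linear: "Vector_Spaces.linear scaleR pscale ker_map"
  by unfold_locales (auto simp: ker_map_def pscale_def rscale_def fun_eq_iff algebra_simps)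

lemma inj_ker_map: "inj ker_map"
proof (rule injI)
  fix a b assume e: "ker_map a = ker_map b"
  have "fst a = fst b" by (rule G.rscale_profile_inject) (use arg_cong[OF e, of fst] in \<open>simp only: ker_map_def fst_conv\<close>)
  moreover have "snd a = snd b" by (rule H.rscale_profile_inject) (use arg_cong[OF e, of snd] in \<open>simp only: ker_map_def snd_conv\<close>)
  ultimately show "a = b" by (rule prod_eqI)
qed

text \<open>
  All four spaces are injective linear images of \<open>G.slopes\<close>, \<open>H.slopes\<close> or their product. This bridges the
  function spaces, in which \<open>dim\<close> is taken with respect to \<open>rscale\<close> and \<open>pscale\<close>, and the traces.
\<close>

lemma kernel_dims:
  "rfun_vs.dim (ker_L l g) = dim G.slopes" "rfun_vs.dim (ker_L l h) = dim H.slopes"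
  "pair_vs.dim (ker_N l g h) = dim G.slopes + dim H.slopes"
  "dim (range (\<lambda>c. trace c (sol 0 c l)) \<inter> vertical) = dim G.slopes + dim H.slopes"
proof -
  interpret R: finite_dimensional_vector_space_pair_1 "scaleR :: real \<Rightarrow> real \<Rightarrow> real" Basis rscale
    by unfold_locales
  interpret P: finite_dimensional_vector_space_pair_1 "scaleR :: real \<Rightarrow> real \<times> real \<Rightarrow> real \<times> real" Basis pscale
    by unfold_locales
  have sub: "subspace G.slopes" "subspace H.slopes"
    unfolding G.slopes_def H.slopes_def by (rule subspace_multiples_zero)+
  have "Vector_Spaces.linear scaleR rscale (\<lambda>a. rscale a f)" for f :: rfun
    by unfold_locales (auto simp: rscale_def fun_eq_iff algebra_simps)
  note lin = this
  show "rfun_vs.dim (ker_L l g) = dim G.slopes"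
    unfolding G.ker_L_eq
    by (rule R.dim_image_eq[OF lin, folded dim_raw_def], rule inj_onI) (rule G.rscale_profile_inject)
  show "rfun_vs.dim (ker_L l h) = dim H.slopes"
    unfolding H.ker_L_eq
    by (rule R.dim_image_eq[OF lin, folded dim_raw_def], rule inj_onI) (rule H.rscale_profile_inject)
  show "pair_vs.dim (ker_N l g h) = dim G.slopes + dim H.slopes"
    unfolding ker_N_eq dim_Times[OF sub, symmetric]
    by (rule P.dim_image_eq[OF ker_map_linear, folded dim_raw_def], rule inj_on_subset[OF inj_ker_map]) simp
  have l0: "l \<in> {0..l}" using l by simp
  (* initial data with u(0) = v(0) = 0 *)
  let ?E = "\<lambda>ab. ((0, 0), ab) :: state"
  let ?T = "\<lambda>ab. trace (?E ab) (sol 0 (?E ab) l)"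
  have linE: "linear ?E" by (rule linearI) simp_all
  have linT: "linear ?T"
    using linear_compose[OF linE solution_range_Lagr(2)[OF l0, of 0]] by (simp add: o_def)
  have injT: "inj ?T" by (rule injI) (drule trace_inject, simp)
  have "range (\<lambda>c. trace c (sol 0 c l)) \<inter> vertical = ?T ` (G.slopes \<times> H.slopes)"
  proof (intro equalityI subsetI)
    fix z assume z: "z \<in> range (\<lambda>c. trace c (sol 0 c l)) \<inter> vertical"
    then obtain c where c: "z = trace c (sol 0 c l)" by blast
    have "fst z = 0" using z by (simp add: mem_Times_iff)
    then have f: "fst c = 0" "fst (sol 0 c l) = 0" unfolding c fst_trace_eq_0 by simp_all
    have E: "c = ?E (fst (snd c), snd (snd c))" using f(1) by (simp add: prod_eq_iff)
    have "sol 0 c l = ((fst (snd c) * \<phi> l, snd (snd c) * \<alpha> l), (fst (snd c) * \<psi> l, snd (snd c) * \<beta> l))"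
      using sol_kernel[OF l0, of "fst (snd c)" "snd (snd c)"] E by simp
    then have "(fst (snd c), snd (snd c)) \<in> G.slopes \<times> H.slopes"
      using f(2) by (simp add: G.slopes_def H.slopes_def prod_eq_iff mem_Times_iff)
    moreover have "z = ?T (fst (snd c), snd (snd c))" unfolding c E[symmetric] ..
    ultimately show "z \<in> ?T ` (G.slopes \<times> H.slopes)" by (rule rev_image_eqI)
  next
    fix z assume "z \<in> ?T ` (G.slopes \<times> H.slopes)"
    then obtain a b where ab: "a \<in> G.slopes" "b \<in> H.slopes" "z = ?T (a, b)" by auto
    have "fst z = 0" unfolding ab(3) fst_trace_eq_0 sol_kernel[OF l0]
      using ab(1,2) by (simp add: G.slopes_def H.slopes_def zero_prod_def)
    then have "z \<in> vertical" by (simp add: mem_Times_iff)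
    then show "z \<in> range (\<lambda>c. trace c (sol 0 c l)) \<inter> vertical" using ab(3) by blast
  qed
  then show "dim (range (\<lambda>c. trace c (sol 0 c l)) \<inter> vertical) = dim G.slopes + dim H.slopes"
    using dim_image_eq[OF linT, of "G.slopes \<times> H.slopes"] injT dim_Times[OF sub]
    by (simp add: inj_on_subset)
qed

text \<open>
  Backward uniqueness from the Lagrangian property: data \<open>c\<close> with vanishing end data have Wronskian \<open>0\<close> with everything.
\<close>

lemma zero_end_data_imp_zero:
  assumes "fst (sol 0 c l) = 0" "snd (sol 0 c l) = 0" "fst c = 0"
  shows "c = 0"
proof -
  have l0: "l \<in> {0..l}" using l by simp
  have z: "sol 0 c l = 0" using assms by (simp add: prod_eq_iff)
  have "wronskian c d = 0" for d
    using LagrD(3)[OF solution_range_Lagr(1)[OF l0, of 0] rangeI[of "\<lambda>c. trace c (sol 0 c l)" c]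
        rangeI[of "\<lambda>c. trace c (sol 0 c l)" d]]
    by (simp add: symp_form_trace z wronskian_def pairing_def)
  (* these two choices read off the two slopes *)
  from this[of "((1, 0), (0, 0))"] this[of "((0, 1), (0, 0))"] show ?thesis
    using assms(3) by (simp add: wronskian_def pairing_def prod_eq_iff)
qed

end

theorem proposition5p10:
  fixes l :: real and g h :: "real \<Rightarrow> real"
    and zp zm n :: nat
    and u v uh vh :: "nat \<Rightarrow> real \<Rightarrow> real"
  assumes "0 < l" and "C2_on l g" and "C2_on l h"
    and "zp = rfun_vs.dim (ker_L l g)"
    and "zm = rfun_vs.dim (ker_L l h)"
    and "n = pair_vs.dim (ker_N l g h)"
    and "is_crossing (\<lambda>\<mu>. Lam l g h \<mu> 1) Dirichlet 0"
    and "\<not> regular_crossing (\<lambda>\<mu>. Lam l g h \<mu> 1) Dirichlet UNIV 0"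
    and "\<forall>q \<in> Lam l g h 0 1 \<inter> Dirichlet. first_form l g h q = 0"
    and "adapted_basis l g h zp n u v"
    and "generalised_eigenvectors l g h zp n u v uh vh"
    and "n \<le> 2"
    and "Determinant.det (M2_mat l zp n u v uh vh) \<noteq> 0"
  shows "\<forall>\<^sub>F \<epsilon> in at_right 0.
           Mas (\<lambda>s. Lam l g h 0 s) Dirichlet (1 - \<epsilon>) 1
             + Mas (\<lambda>\<mu>. Lam l g h \<mu> 1) Dirichlet 0 \<epsilon>
           = int (n_neg (Dplus_mat l g zp zm uh)) - int (n_neg (Dminus_mat l h zp vh))"
proof -
  note l = assms(1) and adapted = assms(10) and gen = assms(11)
  have cg: "continuous_on {0..l} g" and ch: "continuous_on {0..l} h"
    by (rule continuous_on_C2[OF assms(2)] continuous_on_C2[OF assms(3)])+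
  obtain \<phi> \<psi> where Gd: "shooting_data l g \<phi> \<psi>" using shooting_data_exists[OF l cg] by (elim exE)
  obtain \<alpha> \<beta> where Hd: "shooting_data l h \<alpha> \<beta>" using shooting_data_exists[OF l ch] by (elim exE)
  interpret kernel_profiles l g h \<phi> \<psi> \<alpha> \<beta>
    by (intro kernel_profiles.intro nls_system.intro l cg ch Gd Hd)
  have l0: "0 \<in> {0..l}" "l \<in> {0..l}" using l by simp_all
  have zp: "zp = dim G.slopes" and zm: "zm = dim H.slopes" and n: "n = zp + zm"
    using assms(4-6) kernel_dims by simp_all
  have zp1: "zp \<le> 1" and zm1: "zm \<le> 1" unfolding zp zm by (rule dim_real_le_1)+
  have uker: "u i \<in> ker_L l g" if "i < zp" for i using adapted that by (simp add: adapted_basis_def)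
  have vker: "v i \<in> ker_L l h" if "zp \<le> i" "i < n" for i using adapted that by (simp add: adapted_basis_def)
  have nz: "ker_vec zp u v i \<noteq> 0" if "i < n" for i
  proof
    assume "ker_vec zp u v i = 0"
    then have "0 \<in> ker_vec zp u v ` {..<n}" using that by (metis imageI lessThan_iff)
    from pair_vs.dependent_zero[OF this] show False using adapted by (simp add: adapted_basis_def)
  qed
  have "\<exists>a. a \<noteq> 0 \<and> (if i < zp then u i = rscale a (profile l \<phi>) \<and> a * \<phi> l = 0
      else v i = rscale a (profile l \<alpha>) \<and> a * \<alpha> l = 0)" if i: "i < n" for i
  proof (cases "i < zp")
    case True
    obtain a where a: "u i = rscale a (profile l \<phi>)" "a * \<phi> l = 0"
      using uker[OF True] unfolding G.ker_L_eq G.slopes_def by blast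
    have "a \<noteq> 0" using nz[OF i] True a(1) by (auto simp: ker_vec_def rscale_def zero_prod_def zero_fun_def)
    with a True show ?thesis by (intro exI[of _ a]) simp
  next
    case False
    obtain a where a: "v i = rscale a (profile l \<alpha>)" "a * \<alpha> l = 0"
      using vker[of i] False i unfolding H.ker_L_eq H.slopes_def by (auto simp: not_less)
    have "a \<noteq> 0" using nz[OF i] False a(1) by (auto simp: ker_vec_def rscale_def zero_prod_def zero_fun_def)
    with a False show ?thesis by (intro exI[of _ a]) simp
  qed
  then have "\<exists>a. \<forall>i<n. a i \<noteq> 0 \<and> (if i < zp then u i = rscale (a i) (profile l \<phi>) \<and> a i * \<phi> l = 0
      else v i = rscale (a i) (profile l \<alpha>) \<and> a i * \<alpha> l = 0)"
    by (intro choice) blast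
  then obtain a where a: "\<forall>i<n. a i \<noteq> 0 \<and> (if i < zp then u i = rscale (a i) (profile l \<phi>) \<and> a i * \<phi> l = 0
      else v i = rscale (a i) (profile l \<alpha>) \<and> a i * \<alpha> l = 0)" by (elim exE)
  have a0: "a i \<noteq> 0" if "i < n" for i using a that by simp
  have au: "u i = rscale (a i) (profile l \<phi>)" "a i * \<phi> l = 0" if "i < zp" for i using a[rule_format, of i] that n by auto
  have av: "v i = rscale (a i) (profile l \<alpha>)" "a i * \<alpha> l = 0" if "zp \<le> i" "i < n" for i
    using a[rule_format, of i] that by auto
  define c :: "nat \<Rightarrow> state" where "c i = (if i < zp then ((0, 0), (a i, 0)) else ((0, 0), (0, a i)))" for i
  define K :: "nat \<Rightarrow> real \<Rightarrow> state" where
    "K i x = (if i < zp then ((0, vh i x), (0, Dx l (vh i) x)) else ((uh i x, 0), (Dx l (uh i) x, 0)))" for i x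
  have ku: "sol 0 (c i) x = ((u i x, 0), (a i * \<psi> x, 0))" if "i < zp" "x \<in> {0..l}" for i x
    using sol_kernel[OF that(2), of "a i" 0] that by (simp add: c_def au(1) rscale_def profile_def)
  have kv: "sol 0 (c i) x = ((0, v i x), (0, a i * \<beta> x))" if "zp \<le> i" "i < n" "x \<in> {0..l}" for i x
    using sol_kernel[OF that(3), of 0 "a i"] that by (simp add: c_def av(1)[OF that(1,2)] rscale_def profile_def)
  have cu: "continuous_on {0..l} (u i)" if "i < zp" for i
    using H2_continuous[OF l] uker[OF that] by (simp add: ker_L_def H2_0_def)
  have cv: "continuous_on {0..l} (v i)" if "zp \<le> i" "i < n" for i
    using H2_continuous[OF l] vker[OF that] by (simp add: ker_L_def H2_0_def)
  have geq: "gen_vec zp uh vh i \<in> dom_N l" "L2_eq2 l (N_op l g h 1 (gen_vec zp uh vh i)) (ker_vec zp u v i)" if "i < n" for i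
    using gen that by (simp_all add: generalised_eigenvectors_def)
  have vh: "vh i \<in> H2_0 l" and vh_eq: "AE x in lebesgue_on {0..l}. L_op l h 1 (vh i) x = - u i x" if i: "i < zp" for i
  proof -
    show "vh i \<in> H2_0 l" using geq(1)[of i] i n by (simp add: gen_vec_def dom_N_def)
    have "AE x in lebesgue_on {0..l}. (- L_op l h 1 (vh i)) x = u i x"
      using geq(2)[of i] i n by (simp add: gen_vec_def ker_vec_def L2_eq2_def L2_eq_def N_op_def)
    then show "AE x in lebesgue_on {0..l}. L_op l h 1 (vh i) x = - u i x"
      by (rule eventually_mono) simp
  qed
  have uh: "uh i \<in> H2_0 l" and uh_eq: "AE x in lebesgue_on {0..l}. L_op l g 1 (uh i) x = v i x" if i: "zp \<le> i" "i < n" for i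
    using geq[of i] i by (simp_all add: gen_vec_def dom_N_def ker_vec_def L2_eq2_def L2_eq_def N_op_def)
  have cvh: "continuous_on {0..l} (vh i)" if "i < zp" for i
    using H2_continuous[OF l] vh[OF that] by (simp add: H2_0_def)
  have cuh: "continuous_on {0..l} (uh i)" if "zp \<le> i" "i < n" for i
    using H2_continuous[OF l] uh[OF that] by (simp add: H2_0_def)
  interpret KD: kernel_data l g h n c K
  proof unfold_locales
    show "fst (c i) = 0" for i by (simp add: c_def zero_prod_def)
    show "fst (sol 0 (c i) l) = 0" if i: "i < n" for i
    proof (cases "i < zp")
      case True
      then show ?thesis using ku[OF True l0(2)] au[OF True] l by (simp add: zero_prod_def rscale_def profile_def)
    next
      case False
      then show ?thesis using kv[of i l] av[of i] i l by (simp add: zero_prod_def rscale_def profile_def not_less)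
    qed
    show "fst (K i 0) = 0" "fst (K i l) = 0" if i: "i < n" for i
      using i vh[of i] uh[of i] by (auto simp: K_def zero_prod_def H2_0_def not_less)
    show "dim (range (\<lambda>c. trace c (sol 0 c l)) \<inter> vertical) = n" using kernel_dims(4) n zp zm by simp
    show "(K i has_vector_derivative field g h 0 x (K i x) + twist (sol 0 (c i) x)) (at x within {0..l})"
      if i: "i < n" and x: "x \<in> {0..l}" for i x
    proof (cases "i < zp")
      case True
      have "continuous_on {0..l} (\<lambda>x. - u i x)" by (intro continuous_intros cu True)
      note d = bvp_classical[OF l ch this vh[OF True] vh_eq[OF True] x]
      have "((\<lambda>x. ((0, vh i x), (0, Dx l (vh i) x)) :: state) has_vector_derivative
          ((0, Dx l (vh i) x), (0, - h x * vh i x - - u i x))) (at x within {0..l})"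
        by (intro state_derivI d DERIV_const)
      then show ?thesis unfolding ku[OF True x] using True
        by (simp add: K_def[abs_def] field_def twist_def)
    next
      case False
      then have i': "zp \<le> i" "i < n" using i by simp_all
      note d = bvp_classical[OF l cg cv[OF i'] uh[OF i'] uh_eq[OF i'] x]
      have "((\<lambda>x. ((uh i x, 0), (Dx l (uh i) x, 0)) :: state) has_vector_derivative
          ((Dx l (uh i) x, 0), (- g x * uh i x - v i x, 0))) (at x within {0..l})"
        by (intro state_derivI d DERIV_const)
      then show ?thesis unfolding kv[OF i' x] using False
        by (simp add: K_def[abs_def] field_def twist_def)
    qed
  qed
  (* both kernels are at most one-dimensional: distinct indices have distinct types *)
  have mixed: "i < zp \<and> zp \<le> j \<or> zp \<le> i \<and> j < zp" if "i < n" "j < n" "i \<noteq> j" for i j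
    using that zp1 zm1 n by linarith
  have second_u: "KD.second_form i i = L2_inner l (vh i) (u i)" if i: "i < zp" for i
    unfolding KD.second_form_def L2_inner_eq_integral[OF cvh[OF i] cu[OF i]]
    by (rule integral_cong) (use i in \<open>simp add: ku K_def cross_def del: atLeastAtMost_iff\<close>)
  have second_v: "KD.second_form i i = L2_inner l (uh i) (v i)" if i: "zp \<le> i" "i < n" for i
    unfolding KD.second_form_def L2_inner_eq_integral[OF cuh[OF i] cv[OF i]]
    by (rule integral_cong) (use i in \<open>simp add: kv K_def cross_def del: atLeastAtMost_iff\<close>)
  have second_off: "KD.second_form i j = 0" if ij: "i < n" "j < n" "i \<noteq> j" for i j
  proof -
    have "cross (K i x) (sol 0 (c j) x) = 0" if x: "x \<in> {0..l}" for x
      using mixed[OF ij] ku[of j x] kv[of j x] ij x by (auto simp: K_def cross_def)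
    then have "KD.second_form i j = integral {0..l} (\<lambda>x. 0)"
      unfolding KD.second_form_def by (intro integral_cong) simp
    then show ?thesis by simp
  qed
  let ?M = "M2_mat l zp n u v uh vh"
  have zero: "L2_inner l 0 f = 0" "L2_inner l f 0 = 0" for f by (simp_all add: L2_inner_def)
  have M_diag: "?M $$ (i, i) = - 2 * KD.second_form i i" if i: "i < n" for i
    using i second_u[of i] second_v[of i]
    by (cases "i < zp") (simp_all add: M2_mat_def gen_vec_def ker_vec_def S_op_def L2_inner2_def zero)
  have M_off: "?M $$ (i, j) = 0" if ij: "i < n" "j < n" "i \<noteq> j" for i j
    using mixed[OF ij] ij(1,2) by (auto simp: M2_mat_def gen_vec_def ker_vec_def S_op_def L2_inner2_def zero)
  have second_nz: "KD.second_form i i \<noteq> 0" if i: "i < n" for i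
  proof
    assume "KD.second_form i i = 0"
    then have "?M $$ (i, i) = 0" using M_diag[OF i] by simp
    moreover have cM: "?M \<in> carrier_mat n n" by (simp add: M2_mat_def)
    ultimately have "0 \<in> set (diag_mat ?M)" using i by (auto simp: diag_mat_def image_iff intro!: bexI[of _ i])
    moreover have "upper_triangular ?M" using M_off cM by (auto simp: upper_triangular_def)
    ultimately have "Determinant.det ?M = 0"
      using det_upper_triangular[OF _ cM] by (simp add: prod_list_zero_iff)
    with assms(13) show False by contradiction
  qed
  have slope_u: "KD.slope_form i i = (a i * \<psi> l)\<^sup>2" if "i < zp" for i
    using ku[OF that l0(2)] by (simp add: KD.slope_form_def pairing_def power2_eq_square)
  have slope_v: "KD.slope_form i i = - (a i * \<beta> l)\<^sup>2" if "zp \<le> i" "i < n" for i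
    using kv[OF that l0(2)] by (simp add: KD.slope_form_def pairing_def power2_eq_square)
  have slope_off: "KD.slope_form i j = 0" if ij: "i < n" "j < n" "i \<noteq> j" for i j
    using mixed[OF ij] ij ku[OF _ l0(2)] kv[OF _ _ l0(2)] by (auto simp: KD.slope_form_def pairing_def)
  have slope_nz: "KD.slope_form i i \<noteq> 0" if i: "i < n" for i
  proof
    assume s: "KD.slope_form i i = 0"
    have "snd (sol 0 (c i) l) = 0"
    proof (cases "i < zp")
      case True
      then show ?thesis using s slope_u[OF True] ku[OF True l0(2)] by (simp add: zero_prod_def)
    next
      case False
      then show ?thesis using s slope_v[of i] kv[of i l] i l by (simp add: zero_prod_def not_less)
    qed
    from zero_end_data_imp_zero[OF KD.cl[OF i] this KD.c0[OF i]] a0[OF i] show False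
      by (auto simp: c_def zero_prod_def split: if_splits)
  qed
  (* the slope form is positive for i < zp and negative for i \<ge> zp *)
  have slopes: "card {i\<in>{..<n}. l * KD.slope_form i i < 0} = zm"
  proof -
    have "l * KD.slope_form i i < 0 \<longleftrightarrow> zp \<le> i" if i: "i < n" for i
    proof (cases "i < zp")
      case True
      then show ?thesis using slope_u[OF True] l by (simp add: not_less)
    next
      case False
      then have "KD.slope_form i i < 0" using slope_v[of i] slope_nz[OF i] i by (simp add: not_less)
      then show ?thesis using False l by (simp add: mult_pos_neg)
    qed
    then have "{i\<in>{..<n}. l * KD.slope_form i i < 0} = {zp..<n}" by auto
    then show ?thesis using n by simp
  qed
  have Dm: "n_neg (Dminus_mat l h zp vh) = card {i\<in>{..<zp}. 0 < KD.second_form i i}"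
  proof -
    let ?A = "Dminus_mat l h zp vh"
    have e: "?A $$ (i, i) = - KD.second_form i i" if i: "i < zp" for i
    proof -
      have "L2_inner l (vh i) (L_op l h 1 (vh i)) = L2_inner l (vh i) (\<lambda>x. - u i x)"
        unfolding L2_inner_def
      proof (rule Bochner_Integration.integral_cong[OF refl])
        have c: "continuous_on {0..l} (\<lambda>x. - u i x)" by (intro continuous_intros cu i)
        fix x assume "x \<in> space (lebesgue_on {0..l})"
        then have "x \<in> {0..l}" by simp
        from bvp_classical(3)[OF l ch c vh[OF i] vh_eq[OF i] this]
        show "vh i x * L_op l h 1 (vh i) x = vh i x * - u i x" by simp
      qed
      also have "\<dots> = - L2_inner l (vh i) (u i)" by (simp add: L2_inner_def)
      finally show ?thesis using i second_u[OF i] by (simp add: Dminus_mat_def)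
    qed
    have "n_neg ?A = card {i\<in>{..<zp}. ?A $$ (i, i) < 0}"
      by (rule n_neg_upper_triangular) (use zp1 in \<open>auto simp: Dminus_mat_def upper_triangular_def\<close>)
    also have "{i\<in>{..<zp}. ?A $$ (i, i) < 0} = {i\<in>{..<zp}. 0 < KD.second_form i i}" using e by auto
    finally show ?thesis .
  qed
  have Dp: "n_neg (Dplus_mat l g zp zm uh) = card {i\<in>{zp..<n}. KD.second_form i i < 0}"
  proof -
    let ?A = "Dplus_mat l g zp zm uh"
    have e: "?A $$ (i, i) = KD.second_form (zp + i) (zp + i)" if i: "i < zm" for i
    proof -
      have "L2_inner l (uh (zp + i)) (L_op l g 1 (uh (zp + i))) = L2_inner l (uh (zp + i)) (v (zp + i))"
        unfolding L2_inner_def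
      proof (rule Bochner_Integration.integral_cong[OF refl])
        have i': "zp \<le> zp + i" "zp + i < n" using i n by simp_all
        fix x assume "x \<in> space (lebesgue_on {0..l})"
        then have "x \<in> {0..l}" by simp
        from bvp_classical(3)[OF l cg cv[OF i'] uh[OF i'] uh_eq[OF i'] this]
        show "uh (zp + i) x * L_op l g 1 (uh (zp + i)) x = uh (zp + i) x * v (zp + i) x" by simp
      qed
      then show ?thesis using i n second_v[of "zp + i"] by (simp add: Dplus_mat_def)
    qed
    have "n_neg ?A = card {i\<in>{..<zm}. ?A $$ (i, i) < 0}"
      by (rule n_neg_upper_triangular) (use zm1 in \<open>auto simp: Dplus_mat_def upper_triangular_def\<close>)
    also have "\<dots> = card ((\<lambda>i. zp + i) ` {i\<in>{..<zm}. ?A $$ (i, i) < 0})"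
      by (rule card_image[symmetric]) (simp add: inj_on_def)
    also have "(\<lambda>i. zp + i) ` {i\<in>{..<zm}. ?A $$ (i, i) < 0} = {i\<in>{zp..<n}. KD.second_form i i < 0}"
    proof (intro equalityI subsetI)
      fix i assume "i \<in> {i\<in>{zp..<n}. KD.second_form i i < 0}"
      then show "i \<in> (\<lambda>i. zp + i) ` {i\<in>{..<zm}. ?A $$ (i, i) < 0}"
        using e[of "i - zp"] n by (intro image_eqI[of _ _ "i - zp"]) auto
    qed (use e n in auto)
    finally show ?thesis .
  qed
  have "card {i\<in>{..<n}. - KD.second_form i i < 0}
      = card ({i\<in>{..<zp}. 0 < KD.second_form i i} \<union> {i\<in>{zp..<n}. 0 < KD.second_form i i})"
    by (rule arg_cong[of _ _ card]) (use n in auto)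
  also have "\<dots> = card {i\<in>{..<zp}. 0 < KD.second_form i i} + card {i\<in>{zp..<n}. 0 < KD.second_form i i}"
    by (rule card_Un_disjoint) auto
  finally have 1: "card {i\<in>{..<n}. - KD.second_form i i < 0} = n_neg (Dminus_mat l h zp vh) + card {i\<in>{zp..<n}. 0 < KD.second_form i i}"
    using Dm by simp
  have "zm = card {zp..<n}" using n by simp
  also have "{zp..<n} = {i\<in>{zp..<n}. KD.second_form i i < 0} \<union> {i\<in>{zp..<n}. 0 < KD.second_form i i}"
    using second_nz by (auto simp: not_less less_le)
  also have "card \<dots> = card {i\<in>{zp..<n}. KD.second_form i i < 0} + card {i\<in>{zp..<n}. 0 < KD.second_form i i}"
    by (rule card_Un_disjoint) auto
  finally have 2: "zm = n_neg (Dplus_mat l g zp zm uh) + card {i\<in>{zp..<n}. 0 < KD.second_form i i}"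
    using Dp by simp
  show ?thesis unfolding Dirichlet_def
    using KD.Mas_sum[OF slope_off slope_nz second_off second_nz]
  proof (rule eventually_mono)
    fix \<epsilon> :: real
    assume "Mas (\<lambda>s. Lam l g h 0 s) vertical (1 - \<epsilon>) 1 + Mas (\<lambda>\<mu>. Lam l g h \<mu> 1) vertical 0 \<epsilon>
      = int (card {i\<in>{..<n}. l * KD.slope_form i i < 0}) - int (card {i\<in>{..<n}. - KD.second_form i i < 0})"
    then show "Mas (\<lambda>s. Lam l g h 0 s) vertical (1 - \<epsilon>) 1 + Mas (\<lambda>\<mu>. Lam l g h \<mu> 1) vertical 0 \<epsilon>
      = int (n_neg (Dplus_mat l g zp zm uh)) - int (n_neg (Dminus_mat l h zp vh))"
      unfolding slopes 1 using 2 by linarith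
  qed
qed

end
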